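(* Let $L$ and $f$ be as in the context and assume (F-1$'$), (F-2$'$), (F-3) and (F-4a) hold. Suppose that $u\equiv0$ is the only classical solution of the Cauchy problem (1.1) with initial data $g=0$. Then every solution $W$ of the stationary equation (1.3) satisfies $W(x)\le c_0$ for all $x\in\mathbb{R}^n$, where $c_0$ is the largest root of $G(u)=0$, with $G$ as in (F-4a). In particular, if $G(u)<0$ for all $u>0$, then (1.3) has no nontrivial solutions.
   Context: Let $L=\sum_{i,j=1}^n a_{ij}(x)\frac{\partial^2}{\partial x_i\partial x_j}+\sum_{i=1}^n b_i(x)\frac{\partial}{\partial x_i}$ with $a_{ij},b_i\in C^{\alpha}(\mathbb{R}^n)$ and $\sum_{i,j}a_{ij}(x)\nu_i\nu_j>0$ for all $x\in\mathbb{R}^n$, $\nu\in\mathbb{R}^n\setminus\{0\}$. Let $f:\mathbb{R}^n\times[0,\infty)\to\mathbb{R}$ be locally Lipschitz in $x$ and in $u$. The Cauchy problem (1.1) with initial data $g\in C(\mathbb{R}^n)$, $g\ge0$: $u_t=Lu+f(x,u)$ in $\mathbb{R}^n\times(0,\infty)$, $u(x,0)=g(x)$, $u\ge0$; a classical solution is $u\in C^{2,1}(\mathbb{R}^n\times(0,\infty))\cap C(\mathbb{R}^n\times[0,\infty))$ satisfying these. The stationary equation (1.3): $LW+f(x,W)=0$ in $\mathbb{R}^n$, $W\ge0$, $W\in C^2(\mathbb{R}^n)$. Let $F(u)=\sup_{x\in\mathbb{R}^n}f(x,u)$ and let $\log^{(i)}$ be the $i$-th iterate of $\log$, with $\prod_{i=1}^0\log^{(i)}u=1$.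 (F-1$'$): $\sup_{u>0}F(u)<\infty$. (F-2$'$): there exist an integer $m\ge0$ and $\epsilon>0$ with $\lim_{u\to\infty}\frac{F(u)}{u(\prod_{i=1}^m\log^{(i)}u)^2(\log^{(m+1)}u)^{2+\epsilon}}=-\infty$. (F-3): $f(x,0)=0$ for all $x$, and $F$ is locally Lipschitz. (F-4a): the function $G(u)=\sup_{x\in\mathbb{R}^n}\sup_{v\ge u}\big(f(x,v)-f(x,v-u)\big)$ is locally Lipschitz, is negative for all sufficiently large $u$, and satisfies $\int^\infty\frac{du}{-G(u)}<\infty$. *)

theory Defs
  imports "HOL-Analysis.Analysis"
begin

definition pd :: "'n::finite \<Rightarrow> (real^'n \<Rightarrow> real) \<Rightarrow> real^'n \<Rightarrow> real" where
  "pd i u x = deriv (\<lambda>s. u (x + s *\<^sub>R axis i 1)) 0"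

definition has_pd :: "'n::finite \<Rightarrow> (real^'n \<Rightarrow> real) \<Rightarrow> real^'n \<Rightarrow> bool" where
  "has_pd i u x \<longleftrightarrow> (\<lambda>s. u (x + s *\<^sub>R axis i 1)) differentiable (at 0)"

definition Lop :: "('n::finite \<Rightarrow> 'n \<Rightarrow> real^'n \<Rightarrow> real) \<Rightarrow> ('n \<Rightarrow> real^'n \<Rightarrow> real)
                   \<Rightarrow> (real^'n \<Rightarrow> real) \<Rightarrow> real^'n \<Rightarrow> real" where
  "Lop a b w x = (\<Sum>i\<in>UNIV. \<Sum>j\<in>UNIV. a i j x * pd i (pd j w) x) + (\<Sum>i\<in>UNIV. b i x * pd i w x)"

definition loc_holder :: "real \<Rightarrow> (real^'n::finite \<Rightarrow> real) \<Rightarrow> bool" where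
  "loc_holder \<alpha> h \<longleftrightarrow> (\<forall>R. \<exists>K. \<forall>x y. norm x \<le> R \<and> norm y \<le> R \<longrightarrow> \<bar>h x - h y\<bar> \<le> K * dist x y powr \<alpha>)"

definition loc_lip_f :: "(real^'n::finite \<Rightarrow> real \<Rightarrow> real) \<Rightarrow> bool" where
  "loc_lip_f f \<longleftrightarrow> (\<forall>R. \<exists>K. \<forall>x y u v. norm x \<le> R \<and> norm y \<le> R \<and> 0 \<le> u \<and> u \<le> R \<and> 0 \<le> v \<and> v \<le> R
       \<longrightarrow> \<bar>f x u - f y v\<bar> \<le> K * (dist x y + \<bar>u - v\<bar>))"

definition loc_lip_half :: "(real \<Rightarrow> real) \<Rightarrow> bool" where
  "loc_lip_half F \<longleftrightarrow> (\<forall>c. \<exists>K. \<forall>u v. 0 \<le> u \<and> u \<le> c \<and> 0 \<le> v \<and> v \<le> c \<longrightarrow> \<bar>F u - F v\<bar> \<le> K * \<bar>u - v\<bar>)"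

definition C2 :: "(real^'n::finite \<Rightarrow> real) \<Rightarrow> bool" where
  "C2 w \<longleftrightarrow> continuous_on UNIV w
     \<and> (\<forall>i x. has_pd i w x) \<and> (\<forall>i. continuous_on UNIV (pd i w))
     \<and> (\<forall>i j x. has_pd j (pd i w) x) \<and> (\<forall>i j. continuous_on UNIV (pd j (pd i w)))"

definition C21 :: "(real^'n::finite \<Rightarrow> real \<Rightarrow> real) \<Rightarrow> bool" where
  "C21 u \<longleftrightarrow> continuous_on (UNIV \<times> {0..}) (\<lambda>(x,t). u x t)
     \<and> (\<forall>x t. t > 0 \<longrightarrow> (u x) differentiable (at t))
     \<and> continuous_on (UNIV \<times> {0<..}) (\<lambda>(x,t). deriv (u x) t)
     \<and> (\<forall>i x t. t > 0 \<longrightarrow> has_pd i (\<lambda>y. u y t) x)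
     \<and> (\<forall>i. continuous_on (UNIV \<times> {0<..}) (\<lambda>(x,t). pd i (\<lambda>y. u y t) x))
     \<and> (\<forall>i j x t. t > 0 \<longrightarrow> has_pd j (pd i (\<lambda>y. u y t)) x)
     \<and> (\<forall>i j. continuous_on (UNIV \<times> {0<..}) (\<lambda>(x,t). pd j (pd i (\<lambda>y. u y t)) x))"

definition cauchy_sol where
  "cauchy_sol a b f g u \<longleftrightarrow> C21 u
     \<and> (\<forall>x t. t > 0 \<longrightarrow> deriv (u x) t = Lop a b (\<lambda>y. u y t) x + f x (u x t))
     \<and> (\<forall>x. u x 0 = g x) \<and> (\<forall>x t. t \<ge> 0 \<longrightarrow> u x t \<ge> 0)"

definition stat_sol where
  "stat_sol a b f W \<longleftrightarrow> C2 W \<and> (\<forall>x. Lop a b W x + f x (W x) = 0) \<and> (\<forall>x. W x \<ge> 0)"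

definition Fsup :: "(real^'n::finite \<Rightarrow> real \<Rightarrow> real) \<Rightarrow> real \<Rightarrow> real" where
  "Fsup f u = (SUP x. f x u)"

definition Gsup :: "(real^'n::finite \<Rightarrow> real \<Rightarrow> real) \<Rightarrow> real \<Rightarrow> ereal" where
  "Gsup f u = (SUP x. SUP v\<in>{u..}. ereal (f x v - f x (v - u)))"

definition iterlog :: "nat \<Rightarrow> real \<Rightarrow> real" where
  "iterlog i = (ln ^^ i)"

end

(* Put c_0 = the largest root of G and let c > c_0. Since 1/(-G) is integrable at infinity, the
   solution of phi' = G(phi), phi(0) = M, falls below c within a time tau that does not depend on
   M. By the definition of G, W - phi is a subsolution of u_t = Lu + f(x,u) wherever phi <= W,
   while W itself is a solution. Take M_k >= sup W on the ball of radius k + 4 and cut the equation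
   off outside the ball of radius k, adding a strong penalty that keeps u close to W on an annulus.
   The cut-off problem with zero initial data has a solution with W - phi_k - 1/k <= u <= W + 1/k
   on the ball of radius k. Interior estimates give a limit, which is a classical solution of the
   Cauchy problem with zero initial data and hence vanishes; at time tau this says W <= c.

   The parabolic theory is built on the maximum principle alone. Interior Schauder estimates: freeze
   the coefficients at a point and apply to second difference quotients v the comparison principle
   in doubled variables, for v(y + s e) - v(y - s e). Existence: heat potentials, then the
   continuity method, then Picard iteration. *)
theory Submission
  imports Defs "HOL-Probability.Distributions"
begin

section \<open>Maximum principles\<close>

text \<open>The coefficients and W may grow without bound and ellipticity may degenerate at
  infinity, so the equation itself has no comparison principle on the whole space. On a ball
  comparison needs boundary control, and the penalty supplies it: on an annulus a large multiple of
  u - W beats whatever the operator produces from a boundary layer function. The price is that u and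
  the size of the penalty depend on k. The interior bounds do not see this: on a fixed ball u lies
  between 0 and W + 1, and together with the local data this determines all Hoelder bounds of u and
  its derivatives. As W may be unbounded, M_k may tend to infinity with k; this is why tau must not
  depend on M. The constant M_k is moreover a supersolution, since f(x,M) = f(x,M) - f(x,0) <= G(M)
  < 0. The approximating problems are posed on the whole space, with the Laplacian far out and
  sources supported in a box. There is no lateral boundary, hence neither boundary regularity nor a
  compatibility condition, and zero initial values let every estimate hold up to t = 0.\<close>

lemma sum_sum_nonneg_trace:
  fixes C H :: "'i \<Rightarrow> 'i \<Rightarrow> real"
  assumes "finite S"
    and "\<And>i j. i \<in> S \<Longrightarrow> j \<in> S \<Longrightarrow> C i j = C j i"
    and "\<And>v. 0 \<le> (\<Sum>i\<in>S. \<Sum>j\<in>S. C i j * v i * v j)"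
    and "\<And>v. (\<Sum>i\<in>S. \<Sum>j\<in>S. H i j * v i * v j) \<le> 0"
  shows "(\<Sum>i\<in>S. \<Sum>j\<in>S. C i j * H i j) \<le> 0"
  using assms
proof (induction S arbitrary: C rule: finite_induct)
  case empty
  then show ?case by simp
next
  case (insert k S)
  have sym: "C i j = C j i" if "i \<in> insert k S" "j \<in> insert k S" for i j
    using insert.prems(1) that by blast
  have expand: "(\<Sum>i\<in>insert k S. \<Sum>j\<in>insert k S. X i j) =
      X k k + (\<Sum>j\<in>S. X k j) + (\<Sum>i\<in>S. X i k) + (\<Sum>i\<in>S. \<Sum>j\<in>S. X i j)" for X :: "'i \<Rightarrow> 'i \<Rightarrow> real"
    using insert.hyps by (simp add: sum.distrib)
  have quad: "0 \<le> C k k * s * s + 2 * s * (\<Sum>j\<in>S. C k j * v j) + (\<Sum>i\<in>S. \<Sum>j\<in>S. C i j * v i * v j)" for s v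
  proof -
    let ?w = "v(k := s)"
    have eq: "?w i = v i" if "i \<in> S" for i using that insert.hyps by auto
    have "(\<Sum>i\<in>insert k S. \<Sum>j\<in>insert k S. C i j * ?w i * ?w j) =
       C k k * s * s + (\<Sum>j\<in>S. C k j * s * v j) + (\<Sum>i\<in>S. C i k * v i * s) + (\<Sum>i\<in>S. \<Sum>j\<in>S. C i j * v i * v j)"
      unfolding expand using eq by (simp cong: sum.cong)
    also have "(\<Sum>i\<in>S. C i k * v i * s) = s * (\<Sum>j\<in>S. C k j * v j)"
      unfolding sum_distrib_left using sym by (intro sum.cong) auto
    also have "(\<Sum>j\<in>S. C k j * s * v j) = s * (\<Sum>j\<in>S. C k j * v j)"
      unfolding sum_distrib_left by (intro sum.cong) auto
    finally show ?thesis using insert.prems(2)[of ?w] by simp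
  qed
  have HS: "(\<Sum>i\<in>S. \<Sum>j\<in>S. H i j * v i * v j) \<le> 0" for v
  proof -
    let ?w = "v(k := 0)"
    have eq: "?w i = v i" if "i \<in> S" for i using that insert.hyps by auto
    show ?thesis
      using insert.prems(3)[of ?w] unfolding expand using eq by (simp cong: sum.cong)
  qed
  show ?case
  proof (cases "C k k = 0")
    case True
    \<comment> \<open>A nonnegative function that is affine in \<open>s\<close> has slope 0; the
      value of \<open>s\<close> used below would make it equal to -1.\<close>
    have z: "C k j = 0" if j: "j \<in> S" for j
    proof (rule ccontr)
      assume nz: "C k j \<noteq> 0"
      let ?v = "\<lambda>i. if i = j then 1 else (0::real)"
      have f1: "(\<Sum>i\<in>S. C k i * ?v i) = C k j"
        using j insert.hyps by (simp add: if_distrib cong: if_cong)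
      have "0 \<le> 2 * s * C k j + (\<Sum>i\<in>S. \<Sum>j\<in>S. C i j * ?v i * ?v j)" for s
        using quad[of s ?v] True f1 by simp
      from this[of "- ((\<Sum>i\<in>S. \<Sum>j\<in>S. C i j * ?v i * ?v j) + 1) / (2 * C k j)"]
      show False using nz by (simp add: field_simps)
    qed
    have "(\<Sum>i\<in>S. \<Sum>j\<in>S. C i j * H i j) \<le> 0"
      using insert.IH[of C] sym quad[of 0] HS by simp
    moreover have "C i k = 0" if "i \<in> S" for i using z sym that by auto
    ultimately show ?thesis unfolding expand using z True by simp
  next
    case False
    have pos: "C k k > 0"
      using quad[of 1 "\<lambda>_. 0"] False by simp
    \<comment> \<open>Schur complement: row and column \<open>k\<close> of \<open>C'\<close> vanish,
      so the induction hypothesis applies to it. What is removed from \<open>C\<close> is a rank-one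
      form, and its pairing with \<open>H\<close> is a single value of the quadratic form of
      \<open>H\<close>.\<close>
    define C' where "C' i j = C i j - C i k * C k j / C k k" for i j
    have "(\<Sum>i\<in>S. \<Sum>j\<in>S. C' i j * H i j) \<le> 0"
    proof (rule insert.IH)
      show "C' i j = C' j i" if "i \<in> S" "j \<in> S" for i j
        using sym[of i j] sym[of i k] sym[of j k] that by (simp add: C'_def)
      show "0 \<le> (\<Sum>i\<in>S. \<Sum>j\<in>S. C' i j * v i * v j)" for v
      proof -
        let ?r = "\<Sum>j\<in>S. C k j * v j"
        have "(\<Sum>i\<in>S. \<Sum>j\<in>S. (C i k * C k j / C k k) * v i * v j) = (\<Sum>i\<in>S. \<Sum>j\<in>S. (C k i * v i) * (C k j * v j) / C k k)"
          using sym by (intro sum.cong refl) auto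
        also have "\<dots> = ?r * ?r / C k k"
          unfolding sum_product sum_divide_distrib by simp
        finally have 1: "(\<Sum>i\<in>S. \<Sum>j\<in>S. (C i k * C k j / C k k) * v i * v j) = ?r * ?r / C k k" .
        have "(\<Sum>i\<in>S. \<Sum>j\<in>S. C' i j * v i * v j) = (\<Sum>i\<in>S. \<Sum>j\<in>S. C i j * v i * v j) - ?r * ?r / C k k"
          unfolding 1[symmetric] C'_def by (simp add: left_diff_distrib sum_subtractf)
        moreover have "0 \<le> (\<Sum>i\<in>S. \<Sum>j\<in>S. C i j * v i * v j) - ?r * ?r / C k k"
          using quad[of "- ?r / C k k" v] pos by (simp add: field_simps)
        ultimately show ?thesis by simp
      qed
      show "(\<Sum>i\<in>S. \<Sum>j\<in>S. H i j * v i * v j) \<le> 0" for v by (rule HS)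
    qed
    moreover have "(\<Sum>i\<in>insert k S. \<Sum>j\<in>insert k S. H i j * C i k * C j k) \<le> 0"
      using insert.prems(3)[of "\<lambda>i. C i k"] by simp
    moreover have "(\<Sum>i\<in>insert k S. \<Sum>j\<in>insert k S. C i j * H i j) =
        (\<Sum>i\<in>S. \<Sum>j\<in>S. C' i j * H i j) + (\<Sum>i\<in>insert k S. \<Sum>j\<in>insert k S. H i j * C i k * C j k) / C k k"
    proof -
      have "(\<Sum>i\<in>S. \<Sum>j\<in>S. C i j * H i j) = (\<Sum>i\<in>S. \<Sum>j\<in>S. C' i j * H i j + H i j * C i k * C j k / C k k)"
        using sym pos by (intro sum.cong refl) (auto simp: C'_def field_simps)
      moreover have "(\<Sum>j\<in>S. C k j * H k j) = (\<Sum>j\<in>S. H k j * C k k * C j k / C k k)"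
        using sym pos by (intro sum.cong refl) auto
      moreover have "(\<Sum>i\<in>S. C i k * H i k) = (\<Sum>i\<in>S. H i k * C i k * C k k / C k k)"
        using sym pos by (intro sum.cong refl) auto
      ultimately show ?thesis
        unfolding expand using pos by (simp add: sum.distrib add_divide_distrib sum_divide_distrib)
    qed
    ultimately show ?thesis
      using pos by (smt (verit) divide_nonpos_pos)
  qed
qed

lemma quad_form_eq_sum:
  fixes A :: "real^'n^'n"
  shows "v \<bullet> (A *v v) = (\<Sum>i\<in>UNIV. \<Sum>j\<in>UNIV. A $ i $ j * v $ i * v $ j)"
  by (simp add: inner_vec_def matrix_vector_mult_def sum_distrib_left mult_ac)

lemma inner_matrix_nonpos:
  fixes C H :: "real^'n^'n"
  assumes "transpose C = C" "\<And>v. 0 \<le> v \<bullet> (C *v v)" "\<And>v. v \<bullet> (H *v v) \<le> 0"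
  shows "C \<bullet> H \<le> 0"
proof -
  have "C $ i $ j = C $ j $ i" for i j
    using assms(1) by (metis transpose_def vec_lambda_beta)
  moreover have "0 \<le> (\<Sum>i\<in>UNIV. \<Sum>j\<in>UNIV. C $ i $ j * v i * v j)" for v :: "'n \<Rightarrow> real"
    using assms(2)[of "\<chi> i. v i"] by (simp add: quad_form_eq_sum)
  moreover have "(\<Sum>i\<in>UNIV. \<Sum>j\<in>UNIV. H $ i $ j * v i * v j) \<le> 0" for v :: "'n \<Rightarrow> real"
    using assms(3)[of "\<chi> i. v i"] by (simp add: quad_form_eq_sum)
  ultimately have "(\<Sum>i\<in>UNIV. \<Sum>j\<in>UNIV. C $ i $ j * H $ i $ j) \<le> 0"
    by (rule sum_sum_nonneg_trace[OF finite])
  then show ?thesis by (simp add: inner_vec_def)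
qed

lemma has_derivative_line:
  fixes g :: "real^'n \<Rightarrow> 'b::real_normed_vector"
  assumes "(g has_derivative D) (at (x + s *\<^sub>R v))"
  shows "((\<lambda>s. g (x + s *\<^sub>R v)) has_vector_derivative D v) (at s)"
proof -
  have "((\<lambda>s. x + s *\<^sub>R v) has_derivative (\<lambda>h. h *\<^sub>R v)) (at s)"
    by (auto intro!: derivative_eq_intros)
  from diff_chain_at[OF this] assms
  have "((\<lambda>s. g (x + s *\<^sub>R v)) has_derivative (\<lambda>h. D (h *\<^sub>R v))) (at s)"
    by (simp add: o_def)
  moreover have "D (h *\<^sub>R v) = h *\<^sub>R D v" for h
    using has_derivative_bounded_linear[OF assms] by (simp add: linear_simps)
  ultimately show ?thesis by (simp add: has_vector_derivative_def)
qed

lemma second_derivative_at_max: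
  fixes g g' :: "real \<Rightarrow> real"
  assumes "\<delta> > 0"
    and d1: "\<And>s. \<bar>s\<bar> < \<delta> \<Longrightarrow> (g has_real_derivative g' s) (at s)"
    and d2: "(g' has_real_derivative k) (at 0)"
    and mx: "\<And>s. \<bar>s\<bar> < \<delta> \<Longrightarrow> g s \<le> g 0"
  shows "g' 0 = 0" "k \<le> 0"
proof -
  show z: "g' 0 = 0"
    by (rule DERIV_local_max[OF d1 \<open>\<delta> > 0\<close>]) (use mx \<open>\<delta> > 0\<close> in auto)
  show "k \<le> 0"
  proof (rule ccontr)
    assume "\<not> k \<le> 0"
    then have "k > 0" by simp
    from DERIV_pos_inc_right[OF d2 this] z obtain d where d: "d > 0" "\<And>h. 0 < h \<Longrightarrow> h < d \<Longrightarrow> 0 < g' h"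
      by auto
    define e where "e = min d \<delta> / 2"
    have e: "0 < e" "e < d" "e < \<delta>" using d(1) \<open>\<delta> > 0\<close> by (auto simp: e_def)
    have "\<exists>z>0. z < e \<and> g e - g 0 = (e - 0) * g' z"
      using e by (intro MVT2) (auto intro!: d1)
    then obtain z where "0 < z" "z < e" "g e - g 0 = e * g' z" by auto
    moreover have "g' z > 0" using d(2)[of z] \<open>0 < z\<close> \<open>z < e\<close> e by auto
    ultimately have "g e > g 0" using e by (smt (verit) mult_pos_pos)
    with mx[of e] e show False by auto
  qed
qed

lemma derivatives_at_max:
  fixes g :: "real^'n \<Rightarrow> real"
  assumes "\<delta> > 0"
    and d1: "\<And>y. y \<in> ball x \<delta> \<Longrightarrow> (g has_derivative (\<lambda>h. G' y \<bullet> h)) (at y)"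
    and d2: "(G' has_derivative (\<lambda>h. G'' *v h)) (at x)"
    and mx: "\<And>y. y \<in> ball x \<delta> \<Longrightarrow> g y \<le> g x"
  shows "G' x = 0" "v \<bullet> (G'' *v v) \<le> 0"
proof -
  have *: "G' x \<bullet> v = 0 \<and> v \<bullet> (G'' *v v) \<le> 0" for v
  proof (cases "v = 0")
    case False
    define d where "d = \<delta> / norm v"
    have d: "d > 0" using assms(1) False by (auto simp: d_def)
    have inb: "x + s *\<^sub>R v \<in> ball x \<delta>" if "\<bar>s\<bar> < d" for s
      using that False by (auto simp: d_def dist_norm field_simps)
    let ?g = "\<lambda>s. g (x + s *\<^sub>R v)" and ?g' = "\<lambda>s. G' (x + s *\<^sub>R v) \<bullet> v"
    have 1: "(?g has_real_derivative ?g' s) (at s)" if "\<bar>s\<bar> < d" for s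
      using has_derivative_line[OF d1[OF inb[OF that]]] by (simp add: has_real_derivative_iff_has_vector_derivative)
    have 2: "(?g' has_real_derivative (G'' *v v) \<bullet> v) (at 0)"
    proof -
      have "(G' has_derivative (\<lambda>h. G'' *v h)) (at (x + 0 *\<^sub>R v))" using d2 by simp
      from has_derivative_line[OF this]
      have "((\<lambda>s. G' (x + s *\<^sub>R v)) has_vector_derivative G'' *v v) (at 0)" .
      then have "((\<lambda>s. G' (x + s *\<^sub>R v) \<bullet> v) has_vector_derivative (G'' *v v) \<bullet> v) (at 0)"
        unfolding has_vector_derivative_def by (auto intro!: derivative_eq_intros)
      then show ?thesis by (simp add: has_real_derivative_iff_has_vector_derivative)
    qed
    show ?thesis
      using second_derivative_at_max[OF d 1 2] mx[OF inb] by (auto simp: inner_commute)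
  qed auto
  show "G' x = 0" using *[of "G' x"] by simp
  show "v \<bullet> (G'' *v v) \<le> 0" using * by blast
qed

text \<open>The maximum over a space-time cylinder may lie at the final time, where only the past is
  available for comparison.\<close>

lemma left_derivative_at_max:
  fixes g :: "real \<Rightarrow> real"
  assumes "(g has_real_derivative d) (at t within {a..b})" "a < t" "t \<le> b"
    and "\<And>s. a \<le> s \<Longrightarrow> s \<le> t \<Longrightarrow> g s \<le> g t"
  shows "0 \<le> d"
proof (rule ccontr)
  assume "\<not> 0 \<le> d"
  with has_real_derivative_neg_dec_left[OF assms(1)]
  obtain e where e: "e > 0" "\<And>h. 0 < h \<Longrightarrow> t - h \<in> {a..b} \<Longrightarrow> h < e \<Longrightarrow> g t < g (t - h)" by auto
  define h where "h = min (e/2) (t - a)"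
  have "0 < h" "h < e" "t - h \<in> {a..b}" using assms(2,3) e(1) by (auto simp: h_def min_def)
  with e(2)[of h] assms(4)[of "t - h"] \<open>0<h\<close> show False by auto
qed

text \<open>Frechet derivatives in space and the derivative in time (one-sided at 0 and at T); the elliptic
  operator is written with inner products, as a x \<bullet> u2 x t + b x \<bullet> u1 x t.\<close>

definition drv :: "(real^'n) set \<Rightarrow> real \<Rightarrow> (real^'n \<Rightarrow> real \<Rightarrow> real) \<Rightarrow> (real^'n \<Rightarrow> real \<Rightarrow> real^'n)
    \<Rightarrow> (real^'n \<Rightarrow> real \<Rightarrow> real^'n^'n) \<Rightarrow> (real^'n \<Rightarrow> real \<Rightarrow> real) \<Rightarrow> bool" where
  "drv S T u u1 u2 ut \<longleftrightarrow> (\<forall>x\<in>S. \<forall>t\<in>{0..T}.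
      ((\<lambda>y. u y t) has_derivative (\<lambda>h. u1 x t \<bullet> h)) (at x) \<and>
      ((\<lambda>y. u1 y t) has_derivative (\<lambda>h. u2 x t *v h)) (at x) \<and>
      (u x has_real_derivative ut x t) (at t within {0..T}))"

text \<open>At a positive maximum of exp(-(K+1)t) w the gradient vanishes and the Hessian term is
  nonpositive, so the inequality gives wt <= K w, whereas the weight forces wt >= (K+1) w. The
  inequality is asked for only where w > 0, which lets penalties and clamped nonlinearities be
  treated by sign alone.\<close>

lemma maximum_principle_compact:
  fixes w :: "real^'n \<Rightarrow> real \<Rightarrow> real"
  assumes cont: "continuous_on (cball z r \<times> {0..T}) (\<lambda>(x,t). w x t)"
    and init: "\<And>x. x \<in> cball z r \<Longrightarrow> w x 0 \<le> 0"
    and bdry: "\<And>x t. x \<in> sphere z r \<Longrightarrow> t \<in> {0..T} \<Longrightarrow> w x t \<le> 0"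
    and d: "drv (ball z r) T w w1 w2 wt"
    and psd: "\<And>x. x \<in> ball z r \<Longrightarrow> transpose (a x) = a x"
      "\<And>x v. x \<in> ball z r \<Longrightarrow> 0 \<le> v \<bullet> (a x *v v)"
    and ineq: "\<And>x t. x \<in> ball z r \<Longrightarrow> t \<in> {0<..T} \<Longrightarrow> w x t > 0 \<Longrightarrow>
      wt x t \<le> a x \<bullet> w2 x t + b x \<bullet> w1 x t + K * w x t"
    and "x \<in> cball z r" "t \<in> {0..T}"
  shows "w x t \<le> 0"
proof (rule ccontr)
  assume pos: "\<not> w x t \<le> 0"
  define g where "g = (\<lambda>(x,t). exp (-(K+1)*t) * w x t)"
  have "continuous_on (cball z r \<times> {0..T}) g"
    unfolding g_def case_prod_beta
    by (intro continuous_intros cont[unfolded case_prod_beta])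
  moreover have "compact (cball z r \<times> {0..T})" by (intro compact_Times) auto
  moreover have "cball z r \<times> {0..T} \<noteq> {}" using \<open>x \<in> cball z r\<close> \<open>t \<in> {0..T}\<close> by blast
  ultimately obtain p where p: "p \<in> cball z r \<times> {0..T}" "\<And>q. q \<in> cball z r \<times> {0..T} \<Longrightarrow> g q \<le> g p"
    using continuous_attains_sup by metis
  obtain x0 t0 where xt: "p = (x0,t0)" by force
  have x0: "x0 \<in> cball z r" and t0: "t0 \<in> {0..T}" using p(1) xt by auto
  have "g (x,t) > 0" using pos by (simp add: g_def)
  then have "g (x0,t0) > 0" using p(2)[of "(x,t)"] \<open>x \<in> cball z r\<close> \<open>t \<in> {0..T}\<close> xt by auto
  then have w0: "w x0 t0 > 0" by (simp add: g_def zero_less_mult_iff)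
  have x0': "x0 \<in> ball z r" using bdry[of x0 t0] w0 x0 t0 by (force simp: sphere_def)
  have t0': "t0 \<in> {0<..T}" using init[of x0] w0 x0 t0 by (cases "t0 = 0") auto
  obtain \<delta> where \<delta>: "\<delta> > 0" "ball x0 \<delta> \<subseteq> ball z r"
    using x0' open_ball open_contains_ball by metis
  have dd: "((\<lambda>y. w y t0) has_derivative (\<lambda>h. w1 y t0 \<bullet> h)) (at y)" if "y \<in> ball x0 \<delta>" for y
    using d that \<delta> t0 unfolding drv_def by blast
  have dd2: "((\<lambda>y. w1 y t0) has_derivative (\<lambda>h. w2 x0 t0 *v h)) (at x0)"
    using d x0' t0 unfolding drv_def by blast
  have mx: "w y t0 \<le> w x0 t0" if "y \<in> ball x0 \<delta>" for y
  proof -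
    have "y \<in> cball z r" using that \<delta>(2) ball_subset_cball by blast
    then have "g (y,t0) \<le> g (x0,t0)" using p(2)[of "(y,t0)"] t0 xt by auto
    then show ?thesis by (simp add: g_def)
  qed
  have w1: "w1 x0 t0 = 0" and w2: "\<And>v. v \<bullet> (w2 x0 t0 *v v) \<le> 0"
    using derivatives_at_max[OF \<delta>(1) dd dd2 mx] by auto
  have "a x0 \<bullet> w2 x0 t0 \<le> 0"
    using inner_matrix_nonpos psd[OF x0'] w2 by blast
  with ineq[OF x0' t0' w0] w1 have 1: "wt x0 t0 \<le> K * w x0 t0" by simp
  have "(w x0 has_real_derivative wt x0 t0) (at t0 within {0..T})"
    using d x0' t0 unfolding drv_def by blast
  then have "((\<lambda>t. exp (-(K+1)*t) * w x0 t) has_real_derivative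
      exp (-(K+1)*t0) * (wt x0 t0 - (K+1) * w x0 t0)) (at t0 within {0..T})"
    by (auto intro!: derivative_eq_intros simp: algebra_simps)
  moreover have "exp (-(K+1) * s) * w x0 s \<le> exp (-(K+1)*t0) * w x0 t0" if "0 \<le> s" and "s \<le> t0" for s :: real
    using p(2)[of "(x0,s)"] x0 t0 that xt by (auto simp: g_def)
  ultimately have "0 \<le> exp (-(K+1)*t0) * (wt x0 t0 - (K+1) * w x0 t0)"
    using left_derivative_at_max t0' by (metis (no_types, lifting) greaterThanAtMost_iff)
  then have "(K+1) * w x0 t0 \<le> wt x0 t0" by (simp add: zero_le_mult_iff)
  with 1 w0 show False by (simp add: algebra_simps)
qed

lemma trace_mat1: "(A :: real^'n^'n) \<bullet> mat 1 = (\<Sum>i\<in>UNIV. A $ i $ i)"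
proof -
  have "A \<bullet> mat 1 = (\<Sum>i\<in>UNIV. \<Sum>j\<in>UNIV. if j = i then A $ i $ j else 0)"
    unfolding inner_vec_def mat_def by (intro sum.cong refl) auto
  then show ?thesis by simp
qed

definition outer :: "real^'n \<Rightarrow> real^'n^'n" where
  "outer e = (\<chi> i j. e $ i * e $ j)"

lemma inner_outer: "outer e \<bullet> X = e \<bullet> (X *v e)"
  unfolding quad_form_eq_sum by (simp add: outer_def inner_vec_def mult_ac)

lemma transpose_outer: "transpose (outer e) = outer e"
  by (simp add: outer_def transpose_def vec_eq_iff mult_ac)

lemma quad_outer: "v \<bullet> (outer e *v v) = (e \<bullet> v)\<^sup>2"
proof -
  have "v \<bullet> (outer e *v v) = (\<Sum>i\<in>UNIV. \<Sum>j\<in>UNIV. (e $ i * v $ i) * (e $ j * v $ j))"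
    unfolding quad_form_eq_sum by (simp add: outer_def mult_ac)
  also have "\<dots> = (e \<bullet> v)\<^sup>2"
    unfolding inner_vec_def power2_eq_square by (simp add: sum_product)
  finally show ?thesis .
qed


lemma drvD:
  assumes "drv S T u u1 u2 ut" "x \<in> S" "t \<in> {0..T}"
  shows "((\<lambda>y. u y t) has_derivative (\<lambda>h. u1 x t \<bullet> h)) (at x)"
    "((\<lambda>y. u1 y t) has_derivative (\<lambda>h. u2 x t *v h)) (at x)"
    "(u x has_real_derivative ut x t) (at t within {0..T})"
  using assms unfolding drv_def by blast+

lemma drv_subset: "drv S T u u1 u2 ut \<Longrightarrow> S' \<subseteq> S \<Longrightarrow> drv S' T u u1 u2 ut"
  unfolding drv_def by blast

lemma drv_time_mono:
  assumes "drv S T u u1 u2 ut" "T' \<le> T" shows "drv S T' u u1 u2 ut"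
  unfolding drv_def
proof (intro ballI conjI)
  fix x t assume "x \<in> S" "t \<in> {0..T'}"
  then have t: "t \<in> {0..T}" using assms(2) by auto
  note d = drvD[OF assms(1) \<open>x \<in> S\<close> t]
  show "((\<lambda>y. u y t) has_derivative (\<lambda>h. u1 x t \<bullet> h)) (at x)"
    "((\<lambda>y. u1 y t) has_derivative (\<lambda>h. u2 x t *v h)) (at x)" using d by auto
  show "(u x has_real_derivative ut x t) (at t within {0..T'})"
    by (rule DERIV_subset[OF d(3)]) (use assms(2) in auto)
qed

lemma drv_add:
  assumes "drv S T u u1 u2 ut" "drv S T v v1 v2 vt"
  shows "drv S T (\<lambda>x t. u x t + v x t) (\<lambda>x t. u1 x t + v1 x t) (\<lambda>x t. u2 x t + v2 x t) (\<lambda>x t. ut x t + vt x t)"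
  unfolding drv_def
proof (intro ballI conjI)
  fix x t assume xt: "x \<in> S" "t \<in> {0..T}"
  note u = drvD[OF assms(1) xt] and v = drvD[OF assms(2) xt]
  show "((\<lambda>y. u y t + v y t) has_derivative (\<lambda>h. (u1 x t + v1 x t) \<bullet> h)) (at x)"
    using has_derivative_add[OF u(1) v(1)] by (simp add: inner_add_left)
  show "((\<lambda>y. u1 y t + v1 y t) has_derivative (\<lambda>h. (u2 x t + v2 x t) *v h)) (at x)"
    using has_derivative_add[OF u(2) v(2)] by (simp add: matrix_vector_mult_add_rdistrib)
  show "((\<lambda>t. u x t + v x t) has_real_derivative ut x t + vt x t) (at t within {0..T})"
    by (rule DERIV_add[OF u(3) v(3)])
qed

lemma drv_scale:
  assumes "drv S T u u1 u2 ut"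
  shows "drv S T (\<lambda>x t. c * u x t) (\<lambda>x t. c *\<^sub>R u1 x t) (\<lambda>x t. c *\<^sub>R u2 x t) (\<lambda>x t. c * ut x t)"
  unfolding drv_def
proof (intro ballI conjI)
  fix x t assume xt: "x \<in> S" "t \<in> {0..T}"
  note u = drvD[OF assms(1) xt]
  show "((\<lambda>y. c * u y t) has_derivative (\<lambda>h. (c *\<^sub>R u1 x t) \<bullet> h)) (at x)"
    using has_derivative_scaleR_right[OF u(1), of c] by simp
  show "((\<lambda>y. c *\<^sub>R u1 y t) has_derivative (\<lambda>h. (c *\<^sub>R u2 x t) *v h)) (at x)"
    using has_derivative_scaleR_right[OF u(2), of c] by (simp add: scaleR_matrix_vector_assoc)
  show "((\<lambda>t. c * u x t) has_real_derivative c * ut x t) (at t within {0..T})"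
    by (rule DERIV_cmult[OF u(3)])
qed

lemma drv_diff:
  assumes "drv S T u u1 u2 ut" "drv S T v v1 v2 vt"
  shows "drv S T (\<lambda>x t. u x t - v x t) (\<lambda>x t. u1 x t - v1 x t) (\<lambda>x t. u2 x t - v2 x t) (\<lambda>x t. ut x t - vt x t)"
  using drv_add[OF assms(1) drv_scale[OF assms(2), of "-1"]] by simp

lemma drv_time:
  assumes "\<And>t. t \<in> {0..T} \<Longrightarrow> (g has_real_derivative g' t) (at t within {0..T})"
  shows "drv S T (\<lambda>x. g) (\<lambda>x t. 0) (\<lambda>x t. 0) (\<lambda>x. g')"
proof -
  have "((\<lambda>y. c) has_derivative (\<lambda>h. 0 \<bullet> h)) (at x)" for c and x :: "real^'n" by simp
  moreover have "((\<lambda>y. 0 :: real^'n) has_derivative (\<lambda>h. 0 *v h)) (at x)" for x :: "real^'n" by simp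
  ultimately show ?thesis unfolding drv_def using assms by blast
qed

lemma drv_quadratic:
  fixes E :: "real \<Rightarrow> real" and S :: "(real^'n) set"
  assumes "\<And>t. t \<in> {0..T} \<Longrightarrow> (E has_real_derivative E' t) (at t within {0..T})"
  shows "drv S T (\<lambda>x t. (1 + x \<bullet> x) * E t) (\<lambda>x t. (2 * E t) *\<^sub>R x) (\<lambda>x t. (2 * E t) *\<^sub>R mat 1) (\<lambda>x t. (1 + x \<bullet> x) * E' t)"
  unfolding drv_def
proof (intro ballI conjI)
  fix x :: "real^'n" and t assume xt: "x \<in> S" "t \<in> {0..T}"
  show "((\<lambda>y. (1 + y \<bullet> y) * E t) has_derivative (\<lambda>h. ((2 * E t) *\<^sub>R x) \<bullet> h)) (at x)"
    by (auto intro!: derivative_eq_intros simp: inner_commute algebra_simps fun_eq_iff)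
  show "((\<lambda>y. (2 * E t) *\<^sub>R y) has_derivative (\<lambda>h. ((2 * E t) *\<^sub>R mat 1) *v h)) (at x)"
    by (auto intro!: derivative_eq_intros simp: scaleR_matrix_vector_assoc[symmetric])
  show "((\<lambda>t. (1 + x \<bullet> x) * E t) has_real_derivative (1 + x \<bullet> x) * E' t) (at t within {0..T})"
    by (rule DERIV_cmult[OF assms[OF xt(2)]])
qed

text \<open>Subtracting \<epsilon> (1 + |x|^2) exp(C t), a supersolution for bounded coefficients,
  makes a bounded w nonpositive on a large sphere, so the version on balls applies; then \<epsilon>
  tends to 0.\<close>

lemma maximum_principle_space:
  fixes w :: "real^'n \<Rightarrow> real \<Rightarrow> real"
  assumes cont: "continuous_on (UNIV \<times> {0..T}) (\<lambda>(x,t). w x t)"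
    and bnd: "\<And>x t. t \<in> {0..T} \<Longrightarrow> w x t \<le> B"
    and init: "\<And>x. w x 0 \<le> 0"
    and d: "drv UNIV T w w1 w2 wt"
    and psd: "\<And>x. transpose (a x) = a x" "\<And>x v. 0 \<le> v \<bullet> (a x *v v)"
    and ab: "\<And>x. norm (a x) \<le> \<Lambda>" "\<And>x. norm (b x) \<le> \<Lambda>"
    and K: "0 \<le> K"
    and ineq: "\<And>x t. t \<in> {0<..T} \<Longrightarrow> w x t > 0 \<Longrightarrow> wt x t \<le> a x \<bullet> w2 x t + b x \<bullet> w1 x t + K * w x t"
    and t: "t \<in> {0..T}"
  shows "w x t \<le> 0"
proof -
  have \<Lambda>: "0 \<le> \<Lambda>" using ab(1)[of undefined] norm_ge_zero order_trans by blast
  \<comment> \<open>Chosen so that the operator applied to the quadratic barrier, at most 2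
    \<Lambda> (|I| + 1) (1 + |x|^2) exp(C t) times \<epsilon>, is paid for by the time derivative
    beyond the part needed for K.\<close>
  define C where "C = K + 2 * \<Lambda> * (norm (mat 1 :: real^'n^'n) + 1)"
  have *: "w x t \<le> \<epsilon> * ((1 + x \<bullet> x) * exp (C * t))" if \<epsilon>: "\<epsilon> > 0" for \<epsilon>
  proof -
    define E where "E t = \<epsilon> * exp (C * t)" for t
    have E: "E s > 0" for s using \<epsilon> by (simp add: E_def)
    \<comment> \<open>The second entry makes \<epsilon> r^2 at least |B|, so the barrier dominates w
      on the sphere; the first one puts the given point into the ball.\<close>
    define r where "r = max (norm x) (sqrt (\<bar>B\<bar> / \<epsilon>))"
    have r: "norm x \<le> r" "0 \<le> r" "\<bar>B\<bar> / \<epsilon> \<le> r\<^sup>2"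
      unfolding r_def using \<epsilon> by (auto simp: le_max_iff_disj) (metis abs_ge_zero divide_nonneg_pos max.cobounded2 real_sqrt_le_iff real_sqrt_pow2 power_mono real_sqrt_ge_zero)
    have C0: "C \<ge> 0" using K \<Lambda> by (simp add: C_def)
    have dE: "(E has_real_derivative C * E s) (at s within {0..T})" for s
      unfolding E_def by (auto intro!: derivative_eq_intros)
    have "w x t - (1 + x \<bullet> x) * E t \<le> 0"
    proof (rule maximum_principle_compact[where z=0 and r=r and T=T and K=K and a=a and b=b and w="\<lambda>x t. w x t - (1 + x \<bullet> x) * E t"])
      show "continuous_on (cball 0 r \<times> {0..T}) (\<lambda>(x, t). w x t - (1 + x \<bullet> x) * E t)"
        unfolding case_prod_beta E_def
        by (intro continuous_intros continuous_on_subset[OF cont[unfolded case_prod_beta]]) auto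
      show "w x 0 - (1 + x \<bullet> x) * E 0 \<le> 0" for x
        using init[of x] E[of 0] by (smt (verit) inner_ge_zero mult_nonneg_nonneg)
      show "w x t - (1 + x \<bullet> x) * E t \<le> 0" if "x \<in> sphere 0 r" "t \<in> {0..T}" for x t
      proof -
        have "w x t \<le> \<bar>B\<bar>" using bnd[OF that(2), of x] by linarith
        also have "\<dots> \<le> r\<^sup>2 * \<epsilon>" using r(3) \<epsilon> by (simp add: field_simps)
        also have "\<dots> \<le> (1 + x \<bullet> x) * E t"
        proof (rule mult_mono)
          show "r\<^sup>2 \<le> 1 + x \<bullet> x" using that by (simp add: dot_square_norm)
          show "\<epsilon> \<le> E t" unfolding E_def using \<epsilon> C0 that by simp
        qed (use \<epsilon> in auto)
        finally show ?thesis by simp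
      qed
      show "drv (ball 0 r) T (\<lambda>x t. w x t - (1 + x \<bullet> x) * E t) (\<lambda>x t. w1 x t - (2 * E t) *\<^sub>R x)
          (\<lambda>x t. w2 x t - (2 * E t) *\<^sub>R mat 1) (\<lambda>x t. wt x t - (1 + x \<bullet> x) * (C * E t))"
        by (intro drv_diff drv_quadratic drv_subset[OF d] dE) auto
      show "wt x t - (1 + x \<bullet> x) * (C * E t) \<le> a x \<bullet> (w2 x t - (2 * E t) *\<^sub>R mat 1) + b x \<bullet> (w1 x t - (2 * E t) *\<^sub>R x)
            + K * (w x t - (1 + x \<bullet> x) * E t)"
        if "t \<in> {0<..T}" "0 < w x t - (1 + x \<bullet> x) * E t" for x t
      proof -
        have "0 \<le> (1 + x \<bullet> x) * E t" using E[of t] by (simp add: add_nonneg_nonneg)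
        then have "w x t > 0" using that(2) by linarith
        from ineq[OF that(1) this] have 1: "wt x t \<le> a x \<bullet> w2 x t + b x \<bullet> w1 x t + K * w x t" .
        have nx: "norm x \<le> 1 + x \<bullet> x"
        proof -
          have "0 \<le> (norm x - 1/2)\<^sup>2" by simp
          then show ?thesis unfolding dot_square_norm power2_eq_square by (simp add: algebra_simps)
        qed
        have 2: "a x \<bullet> mat 1 \<le> \<Lambda> * norm (mat 1 :: real^'n^'n) * (1 + x \<bullet> x)"
        proof -
          have "a x \<bullet> mat 1 \<le> norm (a x) * norm (mat 1 :: real^'n^'n)" by (rule norm_cauchy_schwarz)
          also have "\<dots> \<le> \<Lambda> * norm (mat 1 :: real^'n^'n)" by (intro mult_right_mono ab) auto
          also have "\<dots> \<le> \<Lambda> * norm (mat 1 :: real^'n^'n) * (1 + x \<bullet> x)"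
            using \<Lambda> by (simp add: algebra_simps)
          finally show ?thesis .
        qed
        have 3: "b x \<bullet> x \<le> \<Lambda> * (1 + x \<bullet> x)"
        proof -
          have "b x \<bullet> x \<le> norm (b x) * norm x" by (rule norm_cauchy_schwarz)
          also have "\<dots> \<le> \<Lambda> * (1 + x \<bullet> x)" by (intro mult_mono ab nx) (use \<Lambda> in auto)
          finally show ?thesis .
        qed
        have "2 * E t * (a x \<bullet> mat 1 + b x \<bullet> x) \<le> 2 * E t * (\<Lambda> * norm (mat 1 :: real^'n^'n) * (1 + x \<bullet> x) + \<Lambda> * (1 + x \<bullet> x))"
          using 2 3 E[of t] by (intro mult_left_mono) auto
        also have "\<dots> = (C - K) * ((1 + x \<bullet> x) * E t)" by (simp add: C_def algebra_simps)
        finally show ?thesis using 1 by (simp add: inner_diff_right algebra_simps)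
      qed
      show "x \<in> cball 0 r" using r by simp
    qed (use psd t in auto)
    then show ?thesis by (simp add: E_def algebra_simps)
  qed
  show ?thesis
  proof (rule ccontr)
    assume n: "\<not> w x t \<le> 0"
    define Q where "Q = (1 + x \<bullet> x) * exp (C * t)"
    have Q: "Q > 0" unfolding Q_def by (simp add: add_pos_nonneg)
    from *[of "w x t / (2 * Q)"] n Q show False
      unfolding Q_def[symmetric] by (simp add: field_simps)
  qed
qed

text \<open>The mean value theorem is applied along \<open>p\<close> to the increment in
  \<open>q\<close>, then along \<open>q\<close> to the derivative along \<open>p\<close>. The order
  of the two directions is recorded in the result, so exchanging them later yields the symmetry of
  second derivatives.\<close>

lemma second_difference_mvt:
  fixes u :: "real^'n \<Rightarrow> real"
  assumes d1: "\<And>x. x \<in> S \<Longrightarrow> (u has_derivative (\<lambda>h. u1 x \<bullet> h)) (at x)"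
    and d2: "\<And>x. x \<in> S \<Longrightarrow> (u1 has_derivative (\<lambda>h. u2 x *v h)) (at x)"
    and S: "\<And>r s. r \<in> {0..1} \<Longrightarrow> s \<in> {0..1} \<Longrightarrow> y + r *\<^sub>R p + s *\<^sub>R q \<in> S"
  obtains r s where "r \<in> {0..1}" "s \<in> {0..1}"
    "u (y + p + q) - u (y + p) - u (y + q) + u y = p \<bullet> (u2 (y + r *\<^sub>R p + s *\<^sub>R q) *v q)"
proof -
  let ?g = "\<lambda>r. u (y + q + r *\<^sub>R p) - u (y + r *\<^sub>R p)"
  let ?g' = "\<lambda>r. (u1 (y + q + r *\<^sub>R p) - u1 (y + r *\<^sub>R p)) \<bullet> p"
  have dg: "(?g has_real_derivative ?g' r) (at r)" if "0 \<le> r" "r \<le> 1" for r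
  proof -
    have "y + q + r *\<^sub>R p \<in> S" "y + r *\<^sub>R p \<in> S"
      using S[of r 1] S[of r 0] that by (auto simp: algebra_simps)
    from has_derivative_line[OF d1[OF this(1)]] has_derivative_line[OF d1[OF this(2)]]
    show ?thesis
      unfolding has_real_derivative_iff_has_vector_derivative inner_diff_left
      by (intro has_vector_derivative_diff)
  qed
  obtain r where r: "0 < r" "r < 1" "?g 1 - ?g 0 = (1 - 0) * ?g' r"
    using MVT2[of 0 1 ?g ?g'] dg by auto
  let ?h = "\<lambda>s. u1 (y + r *\<^sub>R p + s *\<^sub>R q) \<bullet> p"
  let ?h' = "\<lambda>s. (u2 (y + r *\<^sub>R p + s *\<^sub>R q) *v q) \<bullet> p"
  have dh: "(?h has_real_derivative ?h' s) (at s)" if "0 \<le> s" "s \<le> 1" for s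
  proof -
    have "y + r *\<^sub>R p + s *\<^sub>R q \<in> S" using S[of r s] r that by auto
    from has_derivative_line[OF d2[OF this]]
    show ?thesis
      unfolding has_real_derivative_iff_has_vector_derivative has_vector_derivative_def
      by (auto intro!: derivative_eq_intros)
  qed
  obtain s where s: "0 < s" "s < 1" "?h 1 - ?h 0 = (1 - 0) * ?h' s"
    using MVT2[of 0 1 ?h ?h'] dh by auto
  show ?thesis
    using that[of r s] r s by (simp add: inner_commute inner_diff_left algebra_simps)
qed

lemma first_difference_mvt:
  fixes u :: "real^'n \<Rightarrow> real"
  assumes d1: "\<And>r. r \<in> {0..1} \<Longrightarrow> (u has_derivative (\<lambda>h. u1 (y + r *\<^sub>R p) \<bullet> h)) (at (y + r *\<^sub>R p))"
  obtains r where "r \<in> {0..1}" "u (y + p) - u y = u1 (y + r *\<^sub>R p) \<bullet> p"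
proof -
  have "((\<lambda>r. u (y + r *\<^sub>R p)) has_real_derivative u1 (y + r *\<^sub>R p) \<bullet> p) (at r)" if "0 \<le> r" "r \<le> 1" for r
    using has_derivative_line[OF d1] that
    unfolding has_real_derivative_iff_has_vector_derivative by auto
  then obtain r where "0 < r" "r < 1" "u (y + 1 *\<^sub>R p) - u (y + 0 *\<^sub>R p) = (1 - 0) * (u1 (y + r *\<^sub>R p) \<bullet> p)"
    using MVT2[of 0 1 "\<lambda>r. u (y + r *\<^sub>R p)" "\<lambda>r. u1 (y + r *\<^sub>R p) \<bullet> p"] by auto
  then show ?thesis using that[of r] by auto
qed

section \<open>Interior Schauder estimates\<close>

text \<open>The maximum principle in the variables (y, s) for v (y + s e) - v (y - s e). Along e its second
  derivatives in y and in s agree, so the part \<kappa> e e of the diffusion matrix can be moved to the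
  variable s, in which the barrier is strictly concave.\<close>

lemma coupling_one_sided:
  fixes v :: "real^'n \<Rightarrow> real \<Rightarrow> real" and A0 :: "real^'n^'n"
  assumes sub: "cball m (2*R) \<subseteq> S" and R: "R > 0" and e: "norm e = 1" and M: "M > 0"
    and d: "drv S T v v1 v2 vt"
    and cont: "continuous_on (S \<times> {0..T}) (\<lambda>(x,t). v x t)"
    and A0: "transpose A0 = A0" "\<And>h. \<kappa> * (h \<bullet> h) \<le> h \<bullet> (A0 *v h)" "norm A0 \<le> \<Lambda>"
    and \<kappa>: "0 < \<kappa>" "\<kappa> \<le> 1"
    and P: "0 \<le> P" "\<And>y s. y \<in> cball m (2*R) \<Longrightarrow> s \<in> {t1..t} \<Longrightarrow> \<bar>vt y s - A0 \<bullet> v2 y s\<bar> \<le> P"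
    and t: "0 \<le> t1" "t1 \<le> t" "t \<le> T"
    and osc: "\<And>y z s. y \<in> cball m (2*R) \<Longrightarrow> z \<in> cball m (2*R) \<Longrightarrow> s \<in> {t1..t} \<Longrightarrow> v y s - v z s \<le> M"
    and start: "t1 = t - R\<^sup>2 \<or> (\<forall>y\<in>cball m (2*R). \<forall>z\<in>cball m (2*R). v y t1 = v z t1)"
    and \<sigma>: "0 \<le> \<sigma>" "\<sigma> \<le> R"
  shows "v (m + \<sigma> *\<^sub>R e) t - v (m - \<sigma> *\<^sub>R e) t
     \<le> 2 * (\<sigma> / R) * (((1 + 2 * norm (mat 1 :: real^'n^'n) * \<Lambda>) * M + 2 * P * R\<^sup>2) / \<kappa>)"
proof -
  define c1 where "c1 = norm (mat 1 :: real^'n^'n)"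
  have \<Lambda>: "\<Lambda> \<ge> 0" using A0(3) norm_ge_zero order_trans by blast
  \<comment> \<open>At an interior maximum the trace term, the source at the two points and the
    slope in time add up to exactly N (after multiplication by R^2), while concavity in
    \<open>s\<close> contributes -2 N.\<close>
  define N where "N = (1 + 2 * c1 * \<Lambda>) * M + 2 * P * R\<^sup>2"
  have MN: "M \<le> N" "N > 0"
  proof -
    have "0 \<le> 2 * c1 * \<Lambda> * M" "0 \<le> 2 * P * R\<^sup>2" using \<Lambda> M P by (auto simp: c1_def)
    then show "M \<le> N" "N > 0" using M by (auto simp: N_def algebra_simps)
  qed
  define B where "B = N / \<kappa>"
  have BM: "M \<le> B"
  proof -
    have "N * \<kappa> \<le> N * 1" using MN \<kappa> by (intro mult_left_mono) auto
    then have "N \<le> B" using \<kappa> by (simp add: B_def field_simps)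
    then show ?thesis using MN by simp
  qed
  \<comment> \<open>Each term secures one face of the domain: the first reaches M on |y - m| = R,
    the second at the initial time t - R^2, and the third reaches B >= M at s = R. At s = 0 the
    doubled function vanishes.\<close>
  define \<psi> where "\<psi> = (\<lambda>(y,s,\<tau>). M * ((y - m) \<bullet> (y - m)) / R\<^sup>2 + M * (t - \<tau>) / R\<^sup>2 + B * (2 * s / R - s\<^sup>2 / R\<^sup>2))"
  define W where "W = (\<lambda>(y,s,\<tau>). v (y + s *\<^sub>R e) \<tau> - v (y - s *\<^sub>R e) \<tau>)"
  define X where "X = cball m R \<times> {0..R} \<times> {t1..t}"
  have inb: "y + s *\<^sub>R e \<in> cball m (2*R)" "y - s *\<^sub>R e \<in> cball m (2*R)" if "y \<in> cball m R" "\<bar>s\<bar> \<le> R" for y s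
  proof -
    have *: "dist m y \<le> R" "norm (s *\<^sub>R e) \<le> R" using that e by auto
    have "norm (m - y - s *\<^sub>R e) \<le> norm (m - y) + norm (s *\<^sub>R e)" by (rule norm_triangle_ineq4)
    then show "y + s *\<^sub>R e \<in> cball m (2*R)" using * by (simp add: dist_norm algebra_simps)
    have "norm (m - y + s *\<^sub>R e) \<le> norm (m - y) + norm (s *\<^sub>R e)" by (rule norm_triangle_ineq)
    then show "y - s *\<^sub>R e \<in> cball m (2*R)" using * by (simp add: dist_norm algebra_simps)
  qed
  have parab: "0 \<le> 2 * s / R - s\<^sup>2 / R\<^sup>2" if "s \<in> {0..R}" for s
  proof -
    have "0 \<le> s / R" "s / R \<le> 1" using that R by auto
    then have "(s / R) * (s / R) \<le> (s/R) * 1" by (intro mult_left_mono) auto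
    then show ?thesis using \<open>0 \<le> s/R\<close> by (simp add: power2_eq_square)
  qed
  have le: "W p \<le> \<psi> p" if pX: "p \<in> X" for p
  proof (rule ccontr)
    assume neg: "\<not> W p \<le> \<psi> p"
    have "continuous_on X (\<lambda>p. W p - \<psi> p)"
    proof -
      have 1: "continuous_on X (\<lambda>p. v (fst p + fst (snd p) *\<^sub>R e) (snd (snd p)))"
        by (rule continuous_on_compose2[OF cont, where f="\<lambda>p. (fst p + fst (snd p) *\<^sub>R e, snd (snd p))", simplified])
          (use inb sub t in \<open>auto intro!: continuous_intros simp: X_def\<close>)
      have 2: "continuous_on X (\<lambda>p. v (fst p - fst (snd p) *\<^sub>R e) (snd (snd p)))"
        by (rule continuous_on_compose2[OF cont, where f="\<lambda>p. (fst p - fst (snd p) *\<^sub>R e, snd (snd p))", simplified])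
          (use inb sub t in \<open>auto intro!: continuous_intros simp: X_def\<close>)
      show ?thesis unfolding W_def \<psi>_def case_prod_beta
        by (intro continuous_intros 1 2) (use R in auto)
    qed
    moreover have "compact X" unfolding X_def by (intro compact_Times) auto
    ultimately obtain q where q: "q \<in> X" "\<And>p. p \<in> X \<Longrightarrow> W p - \<psi> p \<le> W q - \<psi> q"
      using continuous_attains_sup[of X "\<lambda>p. W p - \<psi> p"] pX by (metis empty_iff)
    have qpos: "W q > \<psi> q" using q(2)[OF pX] neg by linarith
    obtain y s \<tau> where qe: "q = (y,s,\<tau>)" by (metis prod_cases3)
    have y: "y \<in> cball m R" and s: "s \<in> {0..R}" and \<tau>: "\<tau> \<in> {t1..t}" using q(1) qe by (auto simp: X_def)
    have WM: "W q \<le> M" unfolding qe W_def using osc inb[OF y, of s] s \<tau> by simp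
    have y': "y \<in> ball m R"
    proof (rule ccontr)
      assume "y \<notin> ball m R"
      then have "norm (y - m) = R" using y by (auto simp: dist_norm norm_minus_commute)
      then have "M * ((y - m) \<bullet> (y - m)) / R\<^sup>2 = M" using R by (simp add: dot_square_norm)
      moreover have "0 \<le> M * (t - \<tau>) / R\<^sup>2" using M \<tau> by auto
      moreover have "0 \<le> B * (2 * s / R - s\<^sup>2 / R\<^sup>2)" using parab[OF s] BM M by auto
      ultimately have "M \<le> \<psi> q" by (simp add: \<psi>_def qe)
      with qpos WM show False by simp
    qed
    have s0: "0 < s"
    proof (rule ccontr)
      assume "\<not> 0 < s"
      then have "s = 0" using s by auto
      then have "W q = 0" by (simp add: W_def qe)
      moreover have "0 \<le> \<psi> q" using M \<tau> parab[OF s] BM by (auto simp: \<psi>_def qe)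
      ultimately show False using qpos by simp
    qed
    have sR: "s < R"
    proof (rule ccontr)
      assume "\<not> s < R"
      then have "s = R" using s by auto
      then have "B \<le> \<psi> q" using M \<tau> BM R by (auto simp: \<psi>_def qe)
      then show False using qpos WM BM by simp
    qed
    have \<tau>1: "t1 < \<tau>"
    proof (rule ccontr)
      assume "\<not> t1 < \<tau>"
      then have eq: "\<tau> = t1" using \<tau> by auto
      from start show False
      proof
        assume "t1 = t - R\<^sup>2"
        then have "M * (t - \<tau>) / R\<^sup>2 = M" using eq R by simp
        moreover have "0 \<le> M * ((y - m) \<bullet> (y - m)) / R\<^sup>2" using M by auto
        moreover have "0 \<le> B * (2 * s / R - s\<^sup>2 / R\<^sup>2)" using parab[OF s] BM M by auto
        ultimately have "M \<le> \<psi> q" by (simp add: \<psi>_def qe)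
        with qpos WM show False by simp
      \<comment> \<open>If the cylinder starts where v is constant in space, the doubled function
        vanishes there, and nonnegativity of the barrier suffices.\<close>
      next
        assume st: "\<forall>y\<in>cball m (2*R). \<forall>z\<in>cball m (2*R). v y t1 = v z t1"
        have "\<bar>s\<bar> \<le> R" using s by auto
        have "v (y + s *\<^sub>R e) t1 = v (y - s *\<^sub>R e) t1"
          by (rule st[rule_format]) (rule inb[OF y \<open>\<bar>s\<bar> \<le> R\<close>])+
        then have "W q = 0" by (simp add: W_def qe eq)
        moreover have "0 \<le> \<psi> q" using M \<tau> parab[OF s] BM by (auto simp: \<psi>_def qe)
        ultimately show False using qpos by simp
      qed
    qed
    have tT: "\<tau> \<in> {0..T}" using \<tau> t by auto
    define Y1 Y2 where "Y1 = y + s *\<^sub>R e" and "Y2 = y - s *\<^sub>R e"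
    have Y: "Y1 \<in> S" "Y2 \<in> S" "Y1 \<in> cball m (2*R)" "Y2 \<in> cball m (2*R)"
      using inb[OF y, of s] s sub by (auto simp: Y1_def Y2_def)
    define H where "H = v2 Y1 \<tau> - v2 Y2 \<tau>"
    have dshift: "((\<lambda>y. v (y + k) \<tau>) has_derivative (\<lambda>h. v1 (z + k) \<tau> \<bullet> h)) (at z)"
         "((\<lambda>y. v1 (y + k) \<tau>) has_derivative (\<lambda>h. v2 (z + k) \<tau> *v h)) (at z)" if "z + k \<in> S" for z k
    proof -
      have sh: "((\<lambda>y. y + k) has_derivative (\<lambda>h. h)) (at z)" by (auto intro!: derivative_eq_intros)
      show "((\<lambda>y. v (y + k) \<tau>) has_derivative (\<lambda>h. v1 (z + k) \<tau> \<bullet> h)) (at z)"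
        using diff_chain_at[OF sh drvD(1)[OF d that tT]] by (simp add: o_def)
      show "((\<lambda>y. v1 (y + k) \<tau>) has_derivative (\<lambda>h. v2 (z + k) \<tau> *v h)) (at z)"
        using diff_chain_at[OF sh drvD(2)[OF d that tT]] by (simp add: o_def)
    qed
    \<comment> \<open>Maximality in \<open>y\<close> alone, with \<open>s\<close> fixed:
      \<open>H\<close> is the difference of the Hessians at the two points, and the barrier has
      Hessian 2 M / R^2 times the identity.\<close>
    have quadH: "h \<bullet> ((H - (2 * M / R\<^sup>2) *\<^sub>R mat 1) *v h) \<le> 0" for h
    proof -
      obtain \<delta> where \<delta>: "\<delta> > 0" "ball y \<delta> \<subseteq> ball m R"
        using y' open_ball open_contains_ball by metis
      let ?g = "\<lambda>y. v (y + s *\<^sub>R e) \<tau> - v (y + (- s) *\<^sub>R e) \<tau> - M * ((y - m) \<bullet> (y - m)) / R\<^sup>2"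
      let ?g1 = "\<lambda>y. v1 (y + s *\<^sub>R e) \<tau> - v1 (y + (- s) *\<^sub>R e) \<tau> - (2 * M / R\<^sup>2) *\<^sub>R (y - m)"
      show ?thesis
      proof (rule derivatives_at_max(2)[OF \<delta>(1), where g = ?g and G' = ?g1])
        fix z assume z: "z \<in> ball y \<delta>"
        then have zm: "z \<in> cball m R" using \<delta>(2) ball_subset_cball by blast
        have i: "z + s *\<^sub>R e \<in> S" "z + (-s) *\<^sub>R e \<in> S" using inb[OF zm, of s] s sub by auto
        have "((\<lambda>y. (y - m) \<bullet> (y - m)) has_derivative (\<lambda>h. (z - m) \<bullet> h + h \<bullet> (z - m))) (at z)"
          by (auto intro!: derivative_eq_intros)
        from has_derivative_mult_right[OF this, of "M / R\<^sup>2"] have "((\<lambda>y. M * ((y - m) \<bullet> (y - m)) / R\<^sup>2) has_derivative (\<lambda>h. ((2 * M / R\<^sup>2) *\<^sub>R (z - m)) \<bullet> h)) (at z)"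
          by (simp add: inner_commute mult_ac)
        from has_derivative_diff[OF has_derivative_diff[OF dshift(1)[OF i(1)] dshift(1)[OF i(2)]] this]
        show "(?g has_derivative (\<lambda>h. ?g1 z \<bullet> h)) (at z)"
          by (simp add: inner_diff_left)
        have "(z,s,\<tau>) \<in> X" using zm s \<tau> by (auto simp: X_def)
        from q(2)[OF this] show "?g z \<le> ?g y" by (simp add: qe W_def \<psi>_def)
      next
        have i: "y + s *\<^sub>R e \<in> S" "y + (-s) *\<^sub>R e \<in> S" using Y by (auto simp: Y1_def Y2_def)
        have "(?g1 has_derivative (\<lambda>h. v2 (y + s *\<^sub>R e) \<tau> *v h - v2 (y + (- s) *\<^sub>R e) \<tau> *v h - (2 * M / R\<^sup>2) *\<^sub>R h)) (at y)"
          by (intro has_derivative_diff dshift(2) i has_derivative_scaleR_right)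
            (auto intro!: derivative_eq_intros)
        then show "(?g1 has_derivative (\<lambda>h. (H - (2 * M / R\<^sup>2) *\<^sub>R mat 1) *v h)) (at y)"
          by (simp add: H_def Y1_def Y2_def matrix_vector_mult_diff_rdistrib scaleR_matrix_vector_assoc[symmetric])
      qed
    qed
    \<comment> \<open>Maximality in \<open>s\<close> alone. Both points move, in opposite directions
      along \<open>e\<close>, so the second derivative in \<open>s\<close> is again the value of
      \<open>H\<close> at \<open>e\<close>; the concave part of the barrier makes it strictly
      negative.\<close>
    have quadE: "e \<bullet> (H *v e) \<le> - (2 * B / R\<^sup>2)"
    proof -
      define \<delta> where "\<delta> = min s (R - s)"
      have \<delta>: "\<delta> > 0" using s0 sR by (auto simp: \<delta>_def)
      let ?g = "\<lambda>r. v (Y1 + r *\<^sub>R e) \<tau> - v (Y2 + r *\<^sub>R (-e)) \<tau> - B * (2 * (s + r) / R - (s + r)\<^sup>2 / R\<^sup>2)"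
      let ?g1 = "\<lambda>r. v1 (Y1 + r *\<^sub>R e) \<tau> \<bullet> e - v1 (Y2 + r *\<^sub>R (-e)) \<tau> \<bullet> (-e) - B * (2 / R - 2 * (s + r) / R\<^sup>2)"
      have "(v2 Y1 \<tau> *v e) \<bullet> e - (v2 Y2 \<tau> *v (-e)) \<bullet> (-e) + B * (2 / R\<^sup>2) \<le> 0"
      proof (rule second_derivative_at_max(2)[OF \<delta>, where g = ?g and g' = ?g1])
        fix r assume r: "\<bar>r\<bar> < \<delta>"
        have rr: "s + r \<in> {0..R}" using r by (auto simp: \<delta>_def)
        have eqs: "Y1 + r *\<^sub>R e = y + (s + r) *\<^sub>R e" "Y2 + r *\<^sub>R (-e) = y - (s + r) *\<^sub>R e"
          by (auto simp: Y1_def Y2_def algebra_simps)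
        have i: "Y1 + r *\<^sub>R e \<in> S" "Y2 + r *\<^sub>R (-e) \<in> S"
          unfolding eqs using inb[OF y, of "s + r"] rr sub by auto
        have f1: "((\<lambda>r. v (Y1 + r *\<^sub>R e) \<tau>) has_real_derivative v1 (Y1 + r *\<^sub>R e) \<tau> \<bullet> e) (at r)"
          using has_derivative_line[OF drvD(1)[OF d i(1) tT]] by (simp add: has_real_derivative_iff_has_vector_derivative)
        have f2: "((\<lambda>r. v (Y2 + r *\<^sub>R (-e)) \<tau>) has_real_derivative v1 (Y2 + r *\<^sub>R (-e)) \<tau> \<bullet> (-e)) (at r)"
          using has_derivative_line[OF drvD(1)[OF d i(2) tT]] unfolding has_real_derivative_iff_has_vector_derivative .
        have "((\<lambda>r. B * (2 * (s + r) / R - (s + r)\<^sup>2 / R\<^sup>2)) has_real_derivative B * (2 / R - 2 * (s + r) / R\<^sup>2)) (at r)"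
          using R by (auto intro!: derivative_eq_intros simp: field_simps)
        then show "(?g has_real_derivative ?g1 r) (at r)"
          by (intro DERIV_diff f1 f2)
        have "(y,s+r,\<tau>) \<in> X" using y rr \<tau> by (auto simp: X_def)
        from q(2)[OF this] show "?g r \<le> ?g 0" unfolding eqs by (simp add: qe W_def \<psi>_def Y1_def Y2_def)
      next
        have f1: "((\<lambda>r. v1 (Y1 + r *\<^sub>R e) \<tau>) has_vector_derivative v2 Y1 \<tau> *v e) (at 0)"
          using has_derivative_line[of "\<lambda>y. v1 y \<tau>" _ Y1 0 e] drvD(2)[OF d Y(1) tT] by simp
        have f2: "((\<lambda>r. v1 (Y2 + r *\<^sub>R (-e)) \<tau>) has_vector_derivative v2 Y2 \<tau> *v (-e)) (at 0)"
          using has_derivative_line[of "\<lambda>y. v1 y \<tau>" _ Y2 0 "-e"] drvD(2)[OF d Y(2) tT] by simp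
        have g1: "((\<lambda>r. v1 (Y1 + r *\<^sub>R e) \<tau> \<bullet> e) has_real_derivative (v2 Y1 \<tau> *v e) \<bullet> e) (at 0)"
          using f1 unfolding has_real_derivative_iff_has_vector_derivative has_vector_derivative_def
          by (auto intro!: derivative_eq_intros)
        have g2: "((\<lambda>r. v1 (Y2 + r *\<^sub>R (-e)) \<tau> \<bullet> (-e)) has_real_derivative (v2 Y2 \<tau> *v (-e)) \<bullet> (-e)) (at 0)"
          using f2 unfolding has_real_derivative_iff_has_vector_derivative has_vector_derivative_def
          by (auto intro!: derivative_eq_intros)
        show "(?g1 has_real_derivative (v2 Y1 \<tau> *v e) \<bullet> e - (v2 Y2 \<tau> *v (-e)) \<bullet> (-e) + B * (2 / R\<^sup>2)) (at 0)"
        proof -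
          have "((\<lambda>r. B * (2 / R - 2 * (s + r) / R\<^sup>2)) has_real_derivative - (B * (2 / R\<^sup>2))) (at 0)"
            using R by (auto intro!: derivative_eq_intros simp: field_simps)
          from DERIV_diff[OF DERIV_diff[OF g1 g2] this] show ?thesis by simp
        qed
      qed
      moreover have "v2 Y2 \<tau> *v (-e) = - (v2 Y2 \<tau> *v e)"
        using matrix_vector_mult_scaleR[of "v2 Y2 \<tau>" "-1" e] by simp
      ultimately show ?thesis
        by (simp add: H_def matrix_vector_mult_diff_rdistrib inner_diff_right inner_commute)
    qed
    \<comment> \<open>\<open>A0\<close> splits into \<open>C\<close> and \<kappa> times the
      projection on \<open>e\<close>. By ellipticity \<open>C\<close> is still positive semidefinite
      and can be paired with \<open>quadH\<close>; the projection is paired with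
      \<open>quadE\<close>.\<close>
    define C where "C = A0 - \<kappa> *\<^sub>R outer e"
    have C1: "transpose C = C"
    proof -
      have "transpose (A0 - \<kappa> *\<^sub>R outer e) = transpose A0 - \<kappa> *\<^sub>R transpose (outer e)"
        by (simp add: transpose_def vec_eq_iff)
      then show ?thesis unfolding C_def by (simp add: A0 transpose_outer)
    qed
    have C2: "0 \<le> h \<bullet> (C *v h)" for h
    proof -
      have "(e \<bullet> h)\<^sup>2 \<le> (e \<bullet> e) * (h \<bullet> h)" by (rule Cauchy_Schwarz_ineq)
      also have "\<dots> = h \<bullet> h" using e by (simp add: dot_square_norm)
      finally have "\<kappa> * (e \<bullet> h)\<^sup>2 \<le> \<kappa> * (h \<bullet> h)" using \<kappa> by simp
      then have "\<kappa> * (e \<bullet> h)\<^sup>2 \<le> h \<bullet> (A0 *v h)" using A0(2)[of h] by linarith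
      then show ?thesis
        unfolding C_def by (simp add: matrix_vector_mult_diff_rdistrib scaleR_matrix_vector_assoc[symmetric] inner_diff_right quad_outer)
    qed
    have "C \<bullet> (H - (2 * M / R\<^sup>2) *\<^sub>R mat 1) \<le> 0"
      by (rule inner_matrix_nonpos[OF C1 C2 quadH])
    moreover have "C \<bullet> mat 1 \<le> \<Lambda> * c1"
    proof -
      have "outer e \<bullet> mat 1 = 1" using e by (simp add: inner_outer dot_square_norm)
      then have "C \<bullet> mat 1 \<le> A0 \<bullet> mat 1" using \<kappa> by (simp add: C_def inner_diff_left)
      also have "\<dots> \<le> norm A0 * c1" unfolding c1_def by (rule norm_cauchy_schwarz)
      also have "\<dots> \<le> \<Lambda> * c1" by (intro mult_right_mono A0) (simp add: c1_def)
      finally show ?thesis .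
    qed
    then have "(2 * M / R\<^sup>2) * (C \<bullet> mat 1) \<le> (2 * M / R\<^sup>2) * (\<Lambda> * c1)" using M by (intro mult_left_mono) auto
    ultimately have 1: "C \<bullet> H \<le> (2 * M / R\<^sup>2) * (\<Lambda> * c1)" by (simp add: inner_diff_right)
    have "A0 \<bullet> H = C \<bullet> H + \<kappa> * (e \<bullet> (H *v e))"
      unfolding C_def by (simp add: inner_diff_left inner_outer)
    moreover have "\<kappa> * (e \<bullet> (H *v e)) \<le> \<kappa> * (- (2 * B / R\<^sup>2))" using quadE \<kappa> by (intro mult_left_mono) auto
    ultimately have 2: "A0 \<bullet> H \<le> (2 * M / R\<^sup>2) * (\<Lambda> * c1) - 2 * N / R\<^sup>2"
      using 1 \<kappa> by (simp add: B_def)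
    have "vt Y1 \<tau> - vt Y2 \<tau> \<le> A0 \<bullet> H + 2 * P"
      using P(2)[OF Y(3) \<tau>] P(2)[OF Y(4) \<tau>] by (simp add: H_def inner_diff_right)
    moreover have "0 \<le> vt Y1 \<tau> - vt Y2 \<tau> + M / R\<^sup>2"
    proof (rule left_derivative_at_max[where g = "\<lambda>\<tau>. v Y1 \<tau> - v Y2 \<tau> - M * (t - \<tau>) / R\<^sup>2" and a = t1 and b = t and t = \<tau>])
      have "{t1..t} \<subseteq> {0..T}" using t by auto
      note f = DERIV_subset[OF drvD(3)[OF d Y(1) tT] this] DERIV_subset[OF drvD(3)[OF d Y(2) tT] this]
      show "((\<lambda>\<tau>. v Y1 \<tau> - v Y2 \<tau> - M * (t - \<tau>) / R\<^sup>2) has_real_derivative vt Y1 \<tau> - vt Y2 \<tau> + M / R\<^sup>2) (at \<tau> within {t1..t})"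
      proof -
        have "((\<lambda>\<tau>. M * (t - \<tau>) / R\<^sup>2) has_real_derivative - (M / R\<^sup>2)) (at \<tau> within {t1..t})"
          using R by (auto intro!: derivative_eq_intros simp: field_simps)
        from DERIV_diff[OF DERIV_diff[OF f] this] show ?thesis by simp
      qed
      fix r assume "t1 \<le> r" "r \<le> \<tau>"
      then have "(y,s,r) \<in> X" using y s \<tau> by (auto simp: X_def)
      from q(2)[OF this] show "v Y1 r - v Y2 r - M * (t - r) / R\<^sup>2 \<le> v Y1 \<tau> - v Y2 \<tau> - M * (t - \<tau>) / R\<^sup>2"
        by (simp add: qe W_def \<psi>_def Y1_def Y2_def)
    qed (use \<tau> \<tau>1 in auto)
    ultimately have "0 \<le> (2 * M / R\<^sup>2) * (\<Lambda> * c1) - 2 * N / R\<^sup>2 + 2 * P + M / R\<^sup>2" using 2 by linarith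
    then have "0 \<le> ((2 * M / R\<^sup>2) * (\<Lambda> * c1) - 2 * N / R\<^sup>2 + 2 * P + M / R\<^sup>2) * R\<^sup>2" by simp
    also have "\<dots> = 2 * M * (\<Lambda> * c1) - 2 * N + 2 * P * R\<^sup>2 + M" using R by (simp add: field_simps)
    also have "\<dots> = - N" by (simp add: N_def algebra_simps)
    finally show False using MN by simp
  qed
  have "(m,\<sigma>,t) \<in> X" using R \<sigma> t by (auto simp: X_def)
  from le[OF this] have "v (m + \<sigma> *\<^sub>R e) t - v (m - \<sigma> *\<^sub>R e) t \<le> B * (2 * \<sigma> / R - \<sigma>\<^sup>2 / R\<^sup>2)"
    by (simp add: W_def \<psi>_def)
  also have "\<dots> \<le> B * (2 * \<sigma> / R)" using BM M by (intro mult_left_mono) auto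
  finally show ?thesis by (simp add: B_def N_def c1_def mult_ac)
qed

section \<open>Hoelder classes, difference quotients and interpolation inequalities\<close>

lemma norm_matrix_vector_le: "norm ((A :: real^'n^'m) *v x) \<le> norm A * norm x"
proof -
  have "norm (A *v x) = L2_set (\<lambda>i. norm ((A *v x) $ i)) UNIV" by (simp add: norm_vec_def)
  also have "\<dots> \<le> L2_set (\<lambda>i. norm (A $ i) * norm x) UNIV"
    by (intro L2_set_mono) (auto simp: matrix_vector_mul_component Cauchy_Schwarz_ineq2)
  also have "\<dots> = norm A * norm x"
    by (simp add: L2_set_left_distrib norm_vec_def)
  finally show ?thesis .
qed

lemma matrix_entry_le_norm: "\<bar>(A :: real^'n^'m) $ i $ j\<bar> \<le> norm A"
  using component_le_norm_cart[of "A $ i" j] Finite_Cartesian_Product.norm_nth_le[of A i] by linarith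

lemma matrix_norm_le:
  fixes A :: "real^'n^'m"
  assumes "\<And>i j. \<bar>A $ i $ j\<bar> \<le> c"
  shows "norm A \<le> real CARD('m) * real CARD('n) * c"
proof -
  have "norm A \<le> (\<Sum>i\<in>UNIV. norm (A $ i))" by (simp add: norm_vec_def L2_set_le_sum)
  also have "\<dots> \<le> (\<Sum>i\<in>(UNIV::'m set). real CARD('n) * c)"
  proof (rule sum_mono)
    fix i
    have "norm (A $ i) \<le> (\<Sum>j\<in>UNIV. \<bar>A $ i $ j\<bar>)" by (rule norm_le_l1_cart)
    also have "\<dots> \<le> real CARD('n) * c" using sum_bounded_above[of UNIV "\<lambda>j. \<bar>A $ i $ j\<bar>" c] assms by simp
    finally show "norm (A $ i) \<le> real CARD('n) * c" .
  qed
  finally show ?thesis by simp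
qed

lemma vector_norm_le:
  fixes v :: "real^'n"
  assumes "\<And>i. \<bar>v $ i\<bar> \<le> c"
  shows "norm v \<le> real CARD('n) * c"
  using norm_le_l1_cart[of v] sum_bounded_above[of UNIV "\<lambda>j. \<bar>v $ j\<bar>" c] assms by simp

definition hol :: "real \<Rightarrow> 'a::metric_space set \<Rightarrow> real \<Rightarrow> real \<Rightarrow> ('a \<Rightarrow> real \<Rightarrow> 'b::real_normed_vector) \<Rightarrow> bool" where
  "hol \<alpha> S T K g \<longleftrightarrow> (\<forall>x\<in>S. \<forall>t\<in>{0..T}. norm (g x t) \<le> K) \<and>
     (\<forall>x\<in>S. \<forall>y\<in>S. \<forall>t\<in>{0..T}. \<forall>s\<in>{0..T}. norm (g x t - g y s) \<le> K * (dist x y powr \<alpha> + \<bar>t - s\<bar> powr (\<alpha>/2)))"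

text \<open>The derivatives are arguments rather than operators applied to \<open>u\<close>, and all
  bounds are pointwise inequalities with one constant. Hence the predicate survives pointwise limits
  of the four functions, which is all that the compactness argument provides.\<close>

definition reg :: "real \<Rightarrow> (real^'n) set \<Rightarrow> real \<Rightarrow> real \<Rightarrow> (real^'n \<Rightarrow> real \<Rightarrow> real) \<Rightarrow> (real^'n \<Rightarrow> real \<Rightarrow> real^'n)
    \<Rightarrow> (real^'n \<Rightarrow> real \<Rightarrow> real^'n^'n) \<Rightarrow> (real^'n \<Rightarrow> real \<Rightarrow> real) \<Rightarrow> bool" where
  "reg \<alpha> S T K u u1 u2 ut \<longleftrightarrow> drv S T u u1 u2 ut \<and> (\<forall>x\<in>S. u x 0 = 0) \<and>
     (\<forall>x\<in>S. \<forall>t\<in>{0..T}. transpose (u2 x t) = u2 x t) \<and>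
     hol \<alpha> S T K u \<and> hol \<alpha> S T K u1 \<and> hol \<alpha> S T K u2 \<and> hol \<alpha> S T K ut"

definition coef :: "real \<Rightarrow> real \<Rightarrow> real \<Rightarrow> (real^'n) set \<Rightarrow> (real^'n \<Rightarrow> real^'n^'n) \<Rightarrow> (real^'n \<Rightarrow> real^'n) \<Rightarrow> bool" where
  "coef \<kappa> \<Lambda> \<alpha> S a b \<longleftrightarrow> (\<forall>x\<in>S. transpose (a x) = a x \<and> (\<forall>h. \<kappa> * (h \<bullet> h) \<le> h \<bullet> (a x *v h)) \<and>
      norm (a x) \<le> \<Lambda> \<and> norm (b x) \<le> \<Lambda>) \<and>
     (\<forall>x\<in>S. \<forall>y\<in>S. norm (a x - a y) \<le> \<Lambda> * dist x y powr \<alpha> \<and> norm (b x - b y) \<le> \<Lambda> * dist x y powr \<alpha>)"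

lemma holD:
  assumes "hol \<alpha> S T K g" "x \<in> S" "t \<in> {0..T}"
  shows "norm (g x t) \<le> K"
    "y \<in> S \<Longrightarrow> s \<in> {0..T} \<Longrightarrow> norm (g x t - g y s) \<le> K * (dist x y powr \<alpha> + \<bar>t - s\<bar> powr (\<alpha>/2))"
    "y \<in> S \<Longrightarrow> norm (g x t - g y t) \<le> K * dist x y powr \<alpha>"
proof -
  show "norm (g x t) \<le> K" and *: "y \<in> S \<Longrightarrow> s \<in> {0..T} \<Longrightarrow> norm (g x t - g y s) \<le> K * (dist x y powr \<alpha> + \<bar>t - s\<bar> powr (\<alpha>/2))" for y s
    using assms unfolding hol_def by blast+
  show "y \<in> S \<Longrightarrow> norm (g x t - g y t) \<le> K * dist x y powr \<alpha>"
    using *[of y t] assms(3) by simp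
qed

lemma hol_subset: "hol \<alpha> S T K g \<Longrightarrow> S' \<subseteq> S \<Longrightarrow> hol \<alpha> S' T K g"
  unfolding hol_def by blast

lemma hol_continuous:
  assumes "hol \<alpha> S T K g" "\<alpha> > 0"
  shows "continuous_on (S \<times> {0..T}) (\<lambda>(x,t). g x t)"
  unfolding continuous_on_def
proof
  fix p assume p: "p \<in> S \<times> {0..T}"
  obtain x t where xt: "p = (x,t)" by force
  let ?F = "at p within S \<times> {0..T}"
  have d1: "((\<lambda>q. dist (fst q) x) \<longlongrightarrow> 0) ?F"
    using tendsto_dist[OF tendsto_fst[OF tendsto_ident_at[of p "S \<times> {0..T}"]] tendsto_const[of x]] by (simp add: xt)
  have d2: "((\<lambda>q. \<bar>snd q - t\<bar>) \<longlongrightarrow> 0) ?F"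
    using tendsto_rabs[OF tendsto_diff[OF tendsto_snd[OF tendsto_ident_at[of p "S \<times> {0..T}"]] tendsto_const[of t]]] by (simp add: xt)
  have e1: "((\<lambda>q. dist (fst q) x powr \<alpha>) \<longlongrightarrow> 0) ?F"
    using tendsto_powr2[OF d1 tendsto_const[of \<alpha>]] assms(2) by simp
  have e2: "((\<lambda>q. \<bar>snd q - t\<bar> powr (\<alpha>/2)) \<longlongrightarrow> 0) ?F"
    using tendsto_powr2[OF d2 tendsto_const[of "\<alpha>/2"]] assms(2) by simp
  have "((\<lambda>q. K * (dist (fst q) x powr \<alpha> + \<bar>snd q - t\<bar> powr (\<alpha>/2))) \<longlongrightarrow> 0) ?F"
    using tendsto_mult_left[OF tendsto_add[OF e1 e2], of K] by simp
  then have "((\<lambda>q. (case q of (x,t) \<Rightarrow> g x t) - g x t) \<longlongrightarrow> 0) ?F"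
  proof (rule Lim_null_comparison[rotated])
    show "\<forall>\<^sub>F q in ?F. norm ((case q of (x,t) \<Rightarrow> g x t) - g x t) \<le> K * (dist (fst q) x powr \<alpha> + \<bar>snd q - t\<bar> powr (\<alpha>/2))"
      unfolding eventually_at_filter
      by (rule always_eventually) (use holD(2)[OF assms(1)] p xt in auto)
  qed
  from LIM_zero_cancel[OF this] show "((\<lambda>(x,t). g x t) \<longlongrightarrow> (\<lambda>(x,t). g x t) p) ?F"
    by (simp add: xt)
qed

lemma add_in_cball: "norm p \<le> r \<Longrightarrow> y + p \<in> cball y r"
  by (simp add: dist_norm)

definition sd :: "(real^'n \<Rightarrow> real \<Rightarrow> real) \<Rightarrow> real \<Rightarrow> 'n \<Rightarrow> 'n \<Rightarrow> real^'n \<Rightarrow> real \<Rightarrow> real" where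
  "sd u h i j y t = u (y + axis i h + axis j h) t - u (y + axis i h) t - u (y + axis j h) t + u y t"

lemma axis_scale: "axis i h = h *\<^sub>R (axis i 1 :: real^'n)"
  by (simp add: vec_eq_iff axis_def)

lemma norm_axis [simp]: "norm (axis i h :: real^'n) = \<bar>h\<bar>"
  by (subst axis_scale) (simp add: norm_axis_1)

lemma inner_axis_matrix: "axis i h \<bullet> (A *v axis j k) = h * k * (A :: real^'n^'n) $ i $ j"
  by (simp add: inner_axis' matrix_vector_mul_component inner_axis)

lemma sd_eq:
  assumes d: "drv S T u u1 u2 ut" and sub: "cball y (2*h) \<subseteq> S" and "t \<in> {0..T}" "0 \<le> h"
  obtains \<xi> where "\<xi> \<in> cball y (2*h)" "sd u h i j y t = h\<^sup>2 * u2 \<xi> t $ i $ j"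
proof -
  have inb: "y + r *\<^sub>R axis i h + s *\<^sub>R axis j h \<in> cball y (2*h)" if "r \<in> {0..1}" "s \<in> {0..1}" for r s
  proof -
    have "norm (r *\<^sub>R axis i h + s *\<^sub>R axis j h) \<le> norm (r *\<^sub>R axis i h) + norm (s *\<^sub>R axis j h)"
      by (rule norm_triangle_ineq)
    also have "\<dots> = r * h + s * h" using that assms by (simp add: norm_axis)
    also have "\<dots> \<le> 1 * h + 1 * h" using that assms by (intro add_mono mult_right_mono) auto
    finally show ?thesis using add_in_cball[of "r *\<^sub>R axis i h + s *\<^sub>R axis j h" "2*h" y] by (simp add: add.assoc)
  qed
  obtain r s where rs: "r \<in> {0..1}" "s \<in> {0..1}"
    "u (y + axis i h + axis j h) t - u (y + axis i h) t - u (y + axis j h) t + u y t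
      = axis i h \<bullet> (u2 (y + r *\<^sub>R axis i h + s *\<^sub>R axis j h) t *v axis j h)"
    using second_difference_mvt[of S "\<lambda>y. u y t" "\<lambda>y. u1 y t" "\<lambda>y. u2 y t" y "axis i h" "axis j h",
      OF drvD(1)[OF d _ \<open>t \<in> {0..T}\<close>] drvD(2)[OF d _ \<open>t \<in> {0..T}\<close>] subsetD[OF sub inb]] by blast
  show ?thesis
    by (rule that[OF inb[OF rs(1,2)]]) (use rs(3) in \<open>simp add: sd_def inner_axis_matrix power2_eq_square\<close>)
qed

text \<open>A second difference with step h is at most 4 M, and divided by h^2 it is a second
  derivative at a point within 2 h; the Hoelder seminorm pays for that displacement. Small h makes
  the top-order contribution small.\<close>

lemma interpolation_second:
  fixes u :: "real^'n \<Rightarrow> real \<Rightarrow> real"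
  assumes d: "drv S T u u1 u2 ut" and sub: "cball y (2*h) \<subseteq> S" and t: "t \<in> {0..T}" and h: "0 < h" and "0 < \<alpha>"
    and H: "0 \<le> H" "\<And>x z. x \<in> S \<Longrightarrow> z \<in> S \<Longrightarrow> norm (u2 x t - u2 z t) \<le> H * dist x z powr \<alpha>"
    and M: "\<And>x. x \<in> S \<Longrightarrow> \<bar>u x t\<bar> \<le> M"
  shows "norm (u2 y t) \<le> real CARD('n) * real CARD('n) * ((2*h) powr \<alpha> * H + 4 * M / h\<^sup>2)"
proof (rule matrix_norm_le)
  fix i j :: 'n
  obtain \<xi> where \<xi>: "\<xi> \<in> cball y (2*h)" "sd u h i j y t = h\<^sup>2 * u2 \<xi> t $ i $ j"
    using sd_eq[OF d sub t] h by (metis less_imp_le)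
  have yS: "y \<in> S" "\<xi> \<in> S" using sub \<xi> h by auto
  have inb: "y + axis i h + axis j h \<in> S" "y + axis i h \<in> S" "y + axis j h \<in> S"
  proof -
    have "norm (axis i h + axis j h :: real^'n) \<le> 2 * h"
      using norm_triangle_ineq[of "axis i h" "axis j h :: real^'n"] h by (simp add: norm_axis)
    then show "y + axis i h + axis j h \<in> S"
      using subsetD[OF sub add_in_cball, of "axis i h + axis j h"] by (simp add: add.assoc)
    show "y + axis i h \<in> S" "y + axis j h \<in> S"
      using subsetD[OF sub add_in_cball, of "axis i h"] subsetD[OF sub add_in_cball, of "axis j h"]
        subsetD[OF sub add_in_cball, of 0] h by simp_all
  qed
  have "\<bar>sd u h i j y t\<bar> \<le> 4 * M"
    unfolding sd_def using M[OF inb(1)] M[OF inb(2)] M[OF inb(3)] M[OF yS(1)] by linarith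
  then have 1: "\<bar>u2 \<xi> t $ i $ j\<bar> \<le> 4 * M / h\<^sup>2"
    unfolding \<xi>(2) using h by (simp add: abs_mult field_simps)
  have "\<bar>u2 y t $ i $ j - u2 \<xi> t $ i $ j\<bar> \<le> norm (u2 y t - u2 \<xi> t)"
    using matrix_entry_le_norm[of "u2 y t - u2 \<xi> t" i j] by simp
  also have "\<dots> \<le> H * dist y \<xi> powr \<alpha>" using H yS by auto
  also have "\<dots> \<le> H * (2*h) powr \<alpha>"
    using \<xi>(1) H \<open>0 < \<alpha>\<close> by (intro mult_left_mono powr_mono2) auto
  finally show "\<bar>u2 y t $ i $ j\<bar> \<le> (2*h) powr \<alpha> * H + 4 * M / h\<^sup>2" using 1 by (simp add: mult.commute)
qed

lemma gradient_lipschitz: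
  fixes u :: "real^'n \<Rightarrow> real \<Rightarrow> real"
  assumes d: "drv S T u u1 u2 ut" and t: "t \<in> {0..T}" and "convex S"
    and M: "\<And>x. x \<in> S \<Longrightarrow> norm (u2 x t) \<le> M2" and xy: "x \<in> S" "y \<in> S"
  shows "norm (u1 x t - u1 y t) \<le> M2 * dist x y"
  unfolding dist_norm
proof (rule differentiable_bound[OF \<open>convex S\<close>])
  fix z assume z: "z \<in> S"
  show "((\<lambda>y. u1 y t) has_derivative (\<lambda>h. u2 z t *v h)) (at z within S)"
    using drvD(2)[OF d z t] has_derivative_at_withinI by blast
  show "onorm (\<lambda>h. u2 z t *v h) \<le> M2"
    by (rule onorm_le) (meson M[OF z] mult_right_mono norm_ge_zero norm_matrix_vector_le order_trans)
qed (use xy in auto)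

lemma function_lipschitz:
  fixes u :: "real^'n \<Rightarrow> real \<Rightarrow> real"
  assumes d: "drv S T u u1 u2 ut" and t: "t \<in> {0..T}" and "convex S"
    and M: "\<And>x. x \<in> S \<Longrightarrow> norm (u1 x t) \<le> M1" and xy: "x \<in> S" "y \<in> S"
  shows "\<bar>u x t - u y t\<bar> \<le> M1 * dist x y"
proof -
  have "norm (u x t - u y t) \<le> M1 * norm (x - y)"
  proof (rule differentiable_bound[OF \<open>convex S\<close>])
    fix z assume z: "z \<in> S"
    show "((\<lambda>y. u y t) has_derivative (\<lambda>h. u1 z t \<bullet> h)) (at z within S)"
      using drvD(1)[OF d z t] has_derivative_at_withinI by blast
    show "onorm (\<lambda>h. u1 z t \<bullet> h) \<le> M1"
    proof (rule onorm_le)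
      fix h
      have "norm (u1 z t \<bullet> h) \<le> norm (u1 z t) * norm h" using Cauchy_Schwarz_ineq2 by simp
      also have "\<dots> \<le> M1 * norm h" by (intro mult_right_mono M[OF z]) simp
      finally show "norm (u1 z t \<bullet> h) \<le> M1 * norm h" .
    qed
  qed (use xy in auto)
  then show ?thesis by (simp add: dist_norm)
qed

lemma time_lipschitz:
  assumes "\<And>t. t \<in> {0..T} \<Longrightarrow> (g has_real_derivative g' t) (at t within {0..T})"
    and "\<And>t. t \<in> {0..T} \<Longrightarrow> \<bar>g' t\<bar> \<le> B" and "s \<in> {0..T}" "t \<in> {0..T}"
  shows "\<bar>g t - g s\<bar> \<le> B * \<bar>t - s\<bar>"
  using field_differentiable_bound[of "{0..T}" g g' B t s] assms by auto

lemma interpolation_first: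
  fixes u :: "real^'n \<Rightarrow> real \<Rightarrow> real"
  assumes d: "drv S T u u1 u2 ut" and sub: "cball y h \<subseteq> S" and t: "t \<in> {0..T}" and h: "0 < h"
    and M2: "\<And>x. x \<in> cball y h \<Longrightarrow> norm (u2 x t) \<le> M2"
    and M: "\<And>x. x \<in> S \<Longrightarrow> \<bar>u x t\<bar> \<le> M"
  shows "norm (u1 y t) \<le> real CARD('n) * (2 * M / h + h * M2)"
proof (rule vector_norm_le)
  fix i :: 'n
  have inb: "y + r *\<^sub>R axis i h \<in> cball y h" if "r \<in> {0..1}" for r
  proof (rule add_in_cball)
    have "\<bar>r\<bar> * h \<le> 1 * h" using that h by (intro mult_right_mono) auto
    then show "norm (r *\<^sub>R axis i h :: real^'n) \<le> h" using h by simp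
  qed
  obtain r where r: "r \<in> {0..1}" "u (y + axis i h) t - u y t = u1 (y + r *\<^sub>R axis i h) t \<bullet> axis i h"
    using first_difference_mvt[of "\<lambda>y. u y t" "\<lambda>y. u1 y t" y "axis i h", OF drvD(1)[OF d subsetD[OF sub inb] t]] by blast
  have yS: "y \<in> S" "y + axis i h \<in> S" using sub h inb[of 1] by auto
  have "\<bar>h * u1 (y + r *\<^sub>R axis i h) t $ i\<bar> \<le> 2 * M"
    using r(2) M[OF yS(1)] M[OF yS(2)] by (simp add: inner_axis mult.commute)
  then have 1: "\<bar>u1 (y + r *\<^sub>R axis i h) t $ i\<bar> \<le> 2 * M / h" using h by (simp add: abs_mult field_simps)
  have "\<bar>u1 y t $ i - u1 (y + r *\<^sub>R axis i h) t $ i\<bar> \<le> norm (u1 y t - u1 (y + r *\<^sub>R axis i h) t)"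
    using component_le_norm_cart[of "u1 y t - u1 (y + r *\<^sub>R axis i h) t" i] by simp
  also have "\<dots> \<le> M2 * dist y (y + r *\<^sub>R axis i h)"
    by (rule gradient_lipschitz[OF drv_subset[OF d sub] t convex_cball M2]) (use inb[OF r(1)] h in auto)
  also have "\<dots> \<le> M2 * h"
    using inb[OF r(1)] M2[of y] h by (intro mult_left_mono) (auto intro: order_trans[OF norm_ge_zero])
  finally show "\<bar>u1 y t $ i\<bar> \<le> 2 * M / h + h * M2" using 1 by (simp add: mult.commute)
qed

text \<open>Spatial regularity is traded for regularity in time: a second difference of u with step
  R changes in time at the rate of the second difference of ut, which is at most 2 G R powr
  \<alpha>. With R^2 = |t - s| both terms become multiples of |t - s| powr (\<alpha>/2).\<close>

lemma time_oscillation: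
  fixes u :: "real^'n \<Rightarrow> real \<Rightarrow> real"
  assumes d: "drv S T u u1 u2 ut" and sub: "cball x (2*R) \<subseteq> S" and t: "t \<in> {0..T}" "s \<in> {0..T}" and R: "0 < R" and "0 < \<alpha>"
    and H: "0 \<le> H" "\<And>x z t. t \<in> {0..T} \<Longrightarrow> x \<in> S \<Longrightarrow> z \<in> S \<Longrightarrow> norm (u2 x t - u2 z t) \<le> H * dist x z powr \<alpha>"
    and G: "\<And>x z t. t \<in> {0..T} \<Longrightarrow> x \<in> S \<Longrightarrow> z \<in> S \<Longrightarrow> \<bar>ut x t - ut z t\<bar> \<le> G * dist x z powr \<alpha>"
  shows "\<bar>u2 x t $ i $ j - u2 x s $ i $ j\<bar> \<le> 2 * (2*R) powr \<alpha> * H + 2 * R powr \<alpha> * G * \<bar>t - s\<bar> / R\<^sup>2"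
proof -
  have inb: "x + axis i R + axis j R \<in> S" "x + axis i R \<in> S" "x + axis j R \<in> S" "x \<in> S"
  proof -
    have "norm (axis i R + axis j R :: real^'n) \<le> 2 * R"
      using norm_triangle_ineq[of "axis i R" "axis j R :: real^'n"] R by (simp add: norm_axis)
    then show "x + axis i R + axis j R \<in> S"
      using subsetD[OF sub add_in_cball, of "axis i R + axis j R"] by (simp add: add.assoc)
    show "x + axis i R \<in> S" "x + axis j R \<in> S" "x \<in> S"
      using subsetD[OF sub add_in_cball, of "axis i R"] subsetD[OF sub add_in_cball, of "axis j R"]
        subsetD[OF sub add_in_cball, of 0] R by simp_all
  qed
  have "\<bar>sd u R i j x t - sd u R i j x s\<bar> \<le> (2 * R powr \<alpha> * G) * \<bar>t - s\<bar>"
  proof (rule time_lipschitz[OF _ _ t(2,1)])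
    fix \<tau> assume \<tau>: "\<tau> \<in> {0..T}"
    show "(sd u R i j x has_real_derivative sd ut R i j x \<tau>) (at \<tau> within {0..T})"
      unfolding sd_def by (intro DERIV_add DERIV_diff drvD(3)[OF d _ \<tau>] inb)
    have "\<bar>ut (x + axis i R + axis j R) \<tau> - ut (x + axis i R) \<tau>\<bar> \<le> G * R powr \<alpha>"
      using G[OF \<tau> inb(1,2)] R by (simp add: dist_norm norm_axis)
    moreover have "\<bar>ut (x + axis j R) \<tau> - ut x \<tau>\<bar> \<le> G * R powr \<alpha>"
      using G[OF \<tau> inb(3,4)] R by (simp add: dist_norm norm_axis)
    ultimately show "\<bar>sd ut R i j x \<tau>\<bar> \<le> 2 * R powr \<alpha> * G" unfolding sd_def by (simp add: mult.commute)
  qed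
  then have 1: "\<bar>sd u R i j x t - sd u R i j x s\<bar> / R\<^sup>2 \<le> 2 * R powr \<alpha> * G * \<bar>t - s\<bar> / R\<^sup>2"
    using R by (intro divide_right_mono) auto
  have 2: "\<bar>u2 x \<tau> $ i $ j - sd u R i j x \<tau> / R\<^sup>2\<bar> \<le> (2*R) powr \<alpha> * H" if \<tau>: "\<tau> \<in> {0..T}" for \<tau>
  proof -
    obtain \<xi> where \<xi>: "\<xi> \<in> cball x (2*R)" "sd u R i j x \<tau> = R\<^sup>2 * u2 \<xi> \<tau> $ i $ j"
      using sd_eq[OF d sub \<tau>] R by (metis less_imp_le)
    have "\<bar>u2 x \<tau> $ i $ j - u2 \<xi> \<tau> $ i $ j\<bar> \<le> norm (u2 x \<tau> - u2 \<xi> \<tau>)"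
      using matrix_entry_le_norm[of "u2 x \<tau> - u2 \<xi> \<tau>" i j] by simp
    also have "\<dots> \<le> H * dist x \<xi> powr \<alpha>" using H(2)[OF \<tau>] inb(4) \<xi>(1) sub by blast
    also have "\<dots> \<le> H * (2*R) powr \<alpha>"
      using \<xi>(1) H(1) \<open>0 < \<alpha>\<close> by (intro mult_left_mono powr_mono2) auto
    finally show ?thesis using R by (simp add: \<xi>(2) mult.commute)
  qed
  have "\<bar>u2 x t $ i $ j - u2 x s $ i $ j\<bar> \<le> \<bar>u2 x t $ i $ j - sd u R i j x t / R\<^sup>2\<bar> + \<bar>u2 x s $ i $ j - sd u R i j x s / R\<^sup>2\<bar>
     + \<bar>sd u R i j x t - sd u R i j x s\<bar> / R\<^sup>2"
  proof -
    have "\<bar>sd u R i j x t - sd u R i j x s\<bar> / R\<^sup>2 = \<bar>sd u R i j x t / R\<^sup>2 - sd u R i j x s / R\<^sup>2\<bar>"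
      using R by (simp add: diff_divide_distrib[symmetric])
    then show ?thesis by linarith
  qed
  then show ?thesis using 1 2[OF t(1)] 2[OF t(2)] by linarith
qed

lemma drv_shift:
  assumes d: "drv S T u u1 u2 ut" and sub: "\<And>y. y \<in> S' \<Longrightarrow> y + p \<in> S"
  shows "drv S' T (\<lambda>y. u (y + p)) (\<lambda>y. u1 (y + p)) (\<lambda>y. u2 (y + p)) (\<lambda>y. ut (y + p))"
  unfolding drv_def
proof (intro ballI conjI)
  fix x t assume x: "x \<in> S'" and t: "t \<in> {0..T}"
  have sh: "((\<lambda>y. y + p) has_derivative (\<lambda>h. h)) (at x)" by (auto intro!: derivative_eq_intros)
  show "((\<lambda>y. u (y + p) t) has_derivative (\<lambda>h. u1 (x + p) t \<bullet> h)) (at x)"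
    using diff_chain_at[OF sh drvD(1)[OF d sub[OF x] t]] by (simp add: o_def)
  show "((\<lambda>y. u1 (y + p) t) has_derivative (\<lambda>h. u2 (x + p) t *v h)) (at x)"
    using diff_chain_at[OF sh drvD(2)[OF d sub[OF x] t]] by (simp add: o_def)
  show "(u (x + p) has_real_derivative ut (x + p) t) (at t within {0..T})"
    by (rule drvD(3)[OF d sub[OF x] t])
qed

lemma powr_scale_le: "1 \<le> c \<Longrightarrow> 0 \<le> R \<Longrightarrow> 0 < \<alpha> \<Longrightarrow> \<alpha> < 1 \<Longrightarrow> (c * R) powr \<alpha> \<le> c * R powr \<alpha>" for R :: real
proof -
  assume a: "1 \<le> c" "0 \<le> R" "0 < \<alpha>" "\<alpha> < 1"
  have "(c * R) powr \<alpha> = c powr \<alpha> * R powr \<alpha>" using a by (simp add: powr_mult)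
  also have "c powr \<alpha> \<le> c powr 1" using a by (intro powr_mono) auto
  finally show ?thesis using a by (simp add: mult_right_mono)
qed

text \<open>The second difference quotient of u with step h solves the frozen equation with a source of size
  Q h powr \<alpha> / h^2 and differs from the second derivative by at most a multiple of H h powr \<alpha>.\<close>

lemma schauder_core:
  fixes u :: "real^'n \<Rightarrow> real \<Rightarrow> real" and A0 :: "real^'n^'n"
  assumes d: "drv S T u u1 u2 ut"
    and cont: "continuous_on (S \<times> {0..T}) (\<lambda>(x,t). u x t)"
    and init: "\<And>x. x \<in> S \<Longrightarrow> u x 0 = 0"
    and \<alpha>: "0 < \<alpha>" "\<alpha> < 1"
    and sub: "cball x (8*R) \<subseteq> S" and xy: "x \<noteq> y" "dist x y \<le> R"
    and h: "0 < h" "h \<le> R" and t: "t \<in> {0..T}"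
    and H: "0 < H" "\<And>x z t. t \<in> {0..T} \<Longrightarrow> x \<in> S \<Longrightarrow> z \<in> S \<Longrightarrow> norm (u2 x t - u2 z t) \<le> H * dist x z powr \<alpha>"
    and A0: "transpose A0 = A0" "\<And>h. \<kappa> * (h \<bullet> h) \<le> h \<bullet> (A0 *v h)" "norm A0 \<le> \<Lambda>"
    and \<kappa>: "0 < \<kappa>" "\<kappa> \<le> 1" "1 \<le> \<Lambda>"
    and Q: "0 \<le> Q" "\<And>x z t. t \<in> {0..T} \<Longrightarrow> x \<in> S \<Longrightarrow> z \<in> S \<Longrightarrow>
        \<bar>(ut x t - A0 \<bullet> u2 x t) - (ut z t - A0 \<bullet> u2 z t)\<bar> \<le> Q * dist x z powr \<alpha>"
  shows "\<bar>u2 x t $ i $ j - u2 y t $ i $ j\<bar> \<le> 4 * h powr \<alpha> * H + (dist x y / R) *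
     (((1 + 2 * norm (mat 1 :: real^'n^'n) * \<Lambda>) * (24 * \<Lambda> * R powr \<alpha> * (H + Q)) + 4 * (h powr \<alpha> / h\<^sup>2) * R\<^sup>2 * Q) / \<kappa>)"
proof -
  have R: "R > 0" using h by simp
  define \<rho> where "\<rho> = dist x y"
  have \<rho>: "0 < \<rho>" "\<rho> \<le> R" using xy by (auto simp: \<rho>_def)
  define G where "G = \<Lambda> * H + Q"
  have G: "\<bar>ut x t - ut z t\<bar> \<le> G * dist x z powr \<alpha>" if "t \<in> {0..T}" "x \<in> S" "z \<in> S" for x z t
  proof -
    have "\<bar>A0 \<bullet> (u2 x t - u2 z t)\<bar> \<le> norm A0 * norm (u2 x t - u2 z t)" by (rule Cauchy_Schwarz_ineq2)
    also have "\<dots> \<le> \<Lambda> * (H * dist x z powr \<alpha>)" using A0 \<kappa> by (intro mult_mono H that) auto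
    finally show ?thesis using Q(2)[OF that] by (simp add: G_def inner_diff_right algebra_simps)
  qed
  define S' where "S' = cball x (4*R)"
  have shS: "y + p \<in> S" if "y \<in> S'" "norm p \<le> 2*h" for y p
  proof -
    have "dist x (y + p) \<le> dist x y + norm p" by (metis add.commute add_diff_cancel_right' dist_norm dist_triangle norm_minus_commute)
    also have "\<dots> \<le> 4 * R + 2 * R" using that h by (auto simp: S'_def)
    finally show ?thesis using sub R by auto
  qed
  have nax: "norm (axis i h :: real^'n) \<le> 2*h" "norm (axis j h :: real^'n) \<le> 2*h"
    "norm (axis i h + axis j h :: real^'n) \<le> 2*h"
    using norm_triangle_ineq[of "axis i h" "axis j h :: real^'n"] h by simp_all
  define v where "v y t = (1/h\<^sup>2) * sd u h i j y t" for y t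
  define v1 where "v1 y t = (1/h\<^sup>2) *\<^sub>R (u1 (y + (axis i h + axis j h)) t - u1 (y + axis i h) t - u1 (y + axis j h) t + u1 y t)" for y t
  define v2 where "v2 y t = (1/h\<^sup>2) *\<^sub>R (u2 (y + (axis i h + axis j h)) t - u2 (y + axis i h) t - u2 (y + axis j h) t + u2 y t)" for y t
  define vt where "vt y t = (1/h\<^sup>2) * (ut (y + (axis i h + axis j h)) t - ut (y + axis i h) t - ut (y + axis j h) t + ut y t)" for y t
  have dv: "drv S' T v v1 v2 vt"
  proof -
    have S'S: "S' \<subseteq> S" using shS[of _ 0] h by auto
    have "drv S' T (\<lambda>y t. (1/h\<^sup>2) * (u (y + (axis i h + axis j h)) t - u (y + axis i h) t - u (y + axis j h) t + u y t)) v1 v2 vt"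
      unfolding v1_def v2_def vt_def
      by (intro drv_scale drv_add drv_diff drv_shift[OF d] drv_subset[OF d S'S] shS nax)
    then show ?thesis unfolding v_def[abs_def] sd_def by (simp add: add.assoc)
  qed
  have cv: "continuous_on (S' \<times> {0..T}) (\<lambda>(x,t). v x t)"
  proof -
    have "continuous_on (S' \<times> {0..T}) (\<lambda>q. u (fst q + p) (snd q))" if "norm p \<le> 2*h" for p
      by (rule continuous_on_compose2[OF cont, where f="\<lambda>q. (fst q + p, snd q)", simplified])
        (use shS that in \<open>auto intro!: continuous_intros\<close>)
    note c = this[OF nax(1)] this[OF nax(2)] this[OF nax(3)] this[of 0]
    show ?thesis
      unfolding v_def sd_def case_prod_beta
      using c h by (auto intro!: continuous_intros simp: add.assoc)
  qed
  define P where "P = 2 * Q * (h powr \<alpha> / h\<^sup>2)"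
  \<comment> \<open>Midpoint and direction: x = m + (\<rho>/2) e and y = m - (\<rho>/2) e, so the
    coupling estimate is used with \<sigma> = \<rho>/2.\<close>
  define m where "m = (1/2) *\<^sub>R (x + y)"
  define e where "e = (1/\<rho>) *\<^sub>R (x - y)"
  have e1: "norm e = 1" using \<rho> by (simp add: e_def \<rho>_def dist_norm)
  have mx: "m + (\<rho>/2) *\<^sub>R e = x" and my: "m - (\<rho>/2) *\<^sub>R e = y"
    using \<rho> by (auto simp: m_def e_def algebra_simps simp flip: scaleR_add_left)
  have dmx: "dist m x \<le> R / 2"
  proof -
    have "dist m x = norm ((\<rho>/2) *\<^sub>R e)" unfolding dist_norm by (subst mx[symmetric]) simp
    then show ?thesis using e1 \<rho> by simp
  qed
  have mS': "cball m (2*R) \<subseteq> S'"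
  proof
    fix z assume "z \<in> cball m (2*R)"
    then have "dist m z \<le> 2*R" by simp
    then show "z \<in> S'" unfolding S'_def mem_cball using dmx dist_triangle[of x z m] R by (simp add: dist_commute)
  qed
  \<comment> \<open>Replacing \<open>v\<close> by the second derivative costs 2, moving to
    \<open>x\<close> costs 4 and moving in time costs 4 multiples of R powr \<alpha> times H, plus 2
    R powr \<alpha> times G. Since 1 <= \<Lambda>, 10 H + 2 G is at most 12 \<Lambda> (H +
    Q).\<close>
  define E where "E = 12 * \<Lambda> * R powr \<alpha> * (H + Q)"
  define c where "c = u2 x t $ i $ j"
  \<comment> \<open>The cylinder has height R^2 unless it hits t = 0, where \<open>v\<close>
    vanishes together with \<open>u\<close>; these are the two alternatives of the coupling
    lemma.\<close>
  define t1 where "t1 = max 0 (t - R\<^sup>2)"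
  have t1: "0 \<le> t1" "t1 \<le> t" "t \<le> T" using t by (auto simp: t1_def)
  have near: "\<bar>v z s - u2 z s $ i $ j\<bar> \<le> 2 * h powr \<alpha> * H" if zs: "z \<in> S'" "s \<in> {0..T}" for z s
  proof -
    have cb: "cball z (2*h) \<subseteq> S"
    proof
      fix w assume "w \<in> cball z (2*h)"
      then have "norm (w - z) \<le> 2*h" by (simp add: dist_norm norm_minus_commute)
      from shS[OF zs(1) this] show "w \<in> S" by simp
    qed
    obtain \<xi> where \<xi>: "\<xi> \<in> cball z (2*h)" "sd u h i j z s = h\<^sup>2 * u2 \<xi> s $ i $ j"
      using sd_eq[OF d cb zs(2)] h by (metis less_imp_le)
    have "\<bar>u2 \<xi> s $ i $ j - u2 z s $ i $ j\<bar> \<le> norm (u2 \<xi> s - u2 z s)"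
      using matrix_entry_le_norm[of "u2 \<xi> s - u2 z s" i j] by simp
    also have "\<dots> \<le> H * dist \<xi> z powr \<alpha>"
      by (rule H(2)[OF zs(2)]) (use \<xi>(1) cb shS[OF zs(1), of 0] h in auto)
    also have "\<dots> \<le> H * (2*h) powr \<alpha>"
      using \<xi>(1) H(1) \<alpha> by (intro mult_left_mono powr_mono2) (auto simp: dist_commute)
    also have "\<dots> \<le> H * (2 * h powr \<alpha>)" using powr_scale_le[of 2 h \<alpha>] \<alpha> h H by (intro mult_left_mono) auto
    finally show ?thesis using h by (simp add: v_def \<xi>(2) mult_ac)
  qed
  have osc: "\<bar>v z s - c\<bar> \<le> E" if "z \<in> cball m (2*R)" "s \<in> {t1..t}" for z s
  proof -
    have s: "s \<in> {0..T}" using that t1 by auto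
    have zS': "z \<in> S'" using mS' that by auto
    have zS: "z \<in> S" "x \<in> S" using shS[OF zS', of 0] h sub R by auto
    have 1: "\<bar>v z s - u2 z s $ i $ j\<bar> \<le> 2 * R powr \<alpha> * H"
    proof -
      have "h powr \<alpha> \<le> R powr \<alpha>" using h \<alpha> by (intro powr_mono2) auto
      then have "2 * h powr \<alpha> * H \<le> 2 * R powr \<alpha> * H" using H by (intro mult_right_mono) auto
      then show ?thesis using near[OF zS' s] by linarith
    qed
    have 2: "\<bar>u2 z s $ i $ j - u2 x s $ i $ j\<bar> \<le> 4 * R powr \<alpha> * H"
    proof -
      have "\<bar>u2 z s $ i $ j - u2 x s $ i $ j\<bar> \<le> norm (u2 z s - u2 x s)"
        using matrix_entry_le_norm[of "u2 z s - u2 x s" i j] by simp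
      also have "\<dots> \<le> H * dist z x powr \<alpha>" by (rule H(2)[OF s zS])
      also have "\<dots> \<le> H * (4*R) powr \<alpha>"
        using zS' H(1) \<alpha> by (intro mult_left_mono powr_mono2) (auto simp: dist_commute S'_def)
      also have "\<dots> \<le> H * (4 * R powr \<alpha>)" using powr_scale_le[of 4 R \<alpha>] \<alpha> R H by (intro mult_left_mono) auto
      finally show ?thesis by (simp add: mult_ac)
    qed
    have 3: "\<bar>u2 x s $ i $ j - c\<bar> \<le> 4 * R powr \<alpha> * H + 2 * R powr \<alpha> * G"
    proof -
      have "cball x (2*R) \<subseteq> cball x (8*R)" by (rule subset_cball) (use R in simp)
      with sub have sub2: "cball x (2*R) \<subseteq> S" by blast
      have "\<bar>u2 x t $ i $ j - u2 x s $ i $ j\<bar> \<le> 2 * (2*R) powr \<alpha> * H + 2 * R powr \<alpha> * G * \<bar>t - s\<bar> / R\<^sup>2"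
        using time_oscillation[OF d sub2 t s R \<alpha>(1) less_imp_le[OF H(1)] H(2) G] by blast
      moreover have "2 * (2*R) powr \<alpha> * H \<le> 2 * (2 * R powr \<alpha>) * H"
        using powr_scale_le[of 2 R \<alpha>] \<alpha> R H by (intro mult_right_mono mult_left_mono) auto
      moreover have "2 * R powr \<alpha> * G * \<bar>t - s\<bar> / R\<^sup>2 \<le> 2 * R powr \<alpha> * G"
      proof -
        have "\<bar>t - s\<bar> / R\<^sup>2 \<le> 1" using that(2) R by (auto simp: t1_def field_simps)
        then have "2 * R powr \<alpha> * G * (\<bar>t - s\<bar> / R\<^sup>2) \<le> 2 * R powr \<alpha> * G * 1"
          using H Q \<kappa> by (intro mult_left_mono) (auto simp: G_def)
        then show ?thesis by simp
      qed
      ultimately show ?thesis unfolding c_def abs_minus_commute[of "u2 x s $ i $ j"] by linarith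
    qed
    have "\<bar>v z s - c\<bar> \<le> R powr \<alpha> * (10 * H + 2 * G)" using 1 2 3 unfolding distrib_left by linarith
    also have "\<dots> \<le> R powr \<alpha> * (12 * \<Lambda> * (H + Q))"
    proof (rule mult_left_mono)
      have "1 * H \<le> \<Lambda> * H" "1 * Q \<le> \<Lambda> * Q" using mult_right_mono[OF \<kappa>(3), of H] mult_right_mono[OF \<kappa>(3) Q(1)] H(1) by auto
      then show "10 * H + 2 * G \<le> 12 * \<Lambda> * (H + Q)" using Q(1) H(1) unfolding G_def ring_distribs by linarith
    qed simp
    finally show ?thesis by (simp add: E_def algebra_simps)
  qed
  define M where "M = 24 * \<Lambda> * R powr \<alpha> * (H + Q)"
  have M: "M > 0" "M = 2 * E" using \<kappa> R H Q by (auto simp: M_def E_def)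
  have oscM: "v y s - v z s \<le> M" if "y \<in> cball m (2*R)" "z \<in> cball m (2*R)" "s \<in> {t1..t}" for y z s
    using osc[OF that(1,3)] osc[OF that(2,3)] M(2) by linarith
  have Pb: "\<bar>vt z s - A0 \<bullet> v2 z s\<bar> \<le> P" if "z \<in> cball m (2*R)" "s \<in> {t1..t}" for z s
  proof -
    have s: "s \<in> {0..T}" using that t1 by auto
    have zS': "z \<in> S'" using mS' that by auto
    note i = shS[OF zS' nax(1)] shS[OF zS' nax(2)] shS[OF zS' nax(3)]
    have zS: "z \<in> S" using shS[OF zS', of 0] h by auto
    let ?q = "\<lambda>y. ut y s - A0 \<bullet> u2 y s"
    have 1: "\<bar>?q (z + (axis i h + axis j h)) - ?q (z + axis i h)\<bar> \<le> Q * h powr \<alpha>"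
      using Q(2)[OF s i(3) i(1)] h by (simp add: dist_norm)
    have 2: "\<bar>?q (z + axis j h) - ?q z\<bar> \<le> Q * h powr \<alpha>"
      using Q(2)[OF s i(2) zS] h by (simp add: dist_norm)
    have 3: "vt z s - A0 \<bullet> v2 z s = (1/h\<^sup>2) * ((?q (z + (axis i h + axis j h)) - ?q (z + axis i h)) - (?q (z + axis j h) - ?q z))"
      by (simp add: vt_def v2_def inner_diff_right inner_add_right algebra_simps)
    have "\<bar>(?q (z + (axis i h + axis j h)) - ?q (z + axis i h)) - (?q (z + axis j h) - ?q z)\<bar> \<le> 2 * Q * h powr \<alpha>"
      using 1 2 by linarith
    then have "(1/h\<^sup>2) * \<bar>(?q (z + (axis i h + axis j h)) - ?q (z + axis i h)) - (?q (z + axis j h) - ?q z)\<bar>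
        \<le> (1/h\<^sup>2) * (2 * Q * h powr \<alpha>)" by (intro mult_left_mono) auto
    then have "\<bar>vt z s - A0 \<bullet> v2 z s\<bar> \<le> (1/h\<^sup>2) * (2 * Q * h powr \<alpha>)"
      unfolding 3 abs_mult by simp
    then show ?thesis by (simp add: P_def)
  qed
  have start: "t1 = t - R\<^sup>2 \<or> (\<forall>y\<in>cball m (2*R). \<forall>z\<in>cball m (2*R). v y t1 = v z t1)"
  proof (cases "t1 = 0")
    case True
    have "v z 0 = 0" if "z \<in> cball m (2*R)" for z
    proof -
      have zS': "z \<in> S'" using mS' that by auto
      have "z \<in> S" using shS[OF zS', of 0] h by auto
      then show ?thesis
        using init[OF shS[OF zS' nax(1)]] init[OF shS[OF zS' nax(2)]] init[OF shS[OF zS' nax(3)]] init[of z]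
        by (simp add: v_def sd_def add.assoc)
    qed
    then show ?thesis using True by simp
  next
    case False
    then show ?thesis by (auto simp: t1_def max_def)
  qed
  have P0: "0 \<le> P" using Q by (simp add: P_def)
  have half: "0 \<le> \<rho>/2" "\<rho>/2 \<le> R" using \<rho> R by auto
  let ?B = "((1 + 2 * norm (mat 1 :: real^'n^'n) * \<Lambda>) * M + 2 * P * R\<^sup>2) / \<kappa>"
  note cpl = coupling_one_sided[OF mS' R _ M(1) dv cv A0 \<kappa>(1,2) P0 Pb t1 oscM start half]
  have c1: "v x t - v y t \<le> 2 * ((\<rho>/2) / R) * ?B" using cpl[OF e1] mx my by simp
  \<comment> \<open>The coupling estimate is one-sided; reversing \<open>e\<close> exchanges the two
    points.\<close>
  have e2: "norm (-e) = 1" using e1 by simp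
  have c2: "v y t - v x t \<le> 2 * ((\<rho>/2) / R) * ?B" using cpl[OF e2] mx my by simp
  have c3: "\<bar>v x t - v y t\<bar> \<le> (\<rho> / R) * ?B" using c1 c2 by simp
  have xS: "x \<in> S'" "y \<in> S'" using R xy by (auto simp: S'_def)
  have "\<bar>u2 x t $ i $ j - u2 y t $ i $ j\<bar> \<le> 4 * h powr \<alpha> * H + (\<rho> / R) * ?B"
    using near[OF xS(1) t] near[OF xS(2) t] c3 by linarith
  then show ?thesis unfolding M_def P_def \<rho>_def by (simp add: mult_ac)
qed

section \<open>Absorption of the top-order seminorm and its iteration over growing balls\<close>

lemma powr_small:
  fixes c \<epsilon> \<alpha> :: real
  assumes "0 \<le> c" "0 < \<epsilon>" "0 < \<alpha>"
  obtains x where "0 < x" "x \<le> 1" "c * x powr \<alpha> \<le> \<epsilon>"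
proof -
  define y where "y = \<epsilon> / (c + 1)"
  have y: "y > 0" using assms by (simp add: y_def)
  define x where "x = min 1 (y powr (1/\<alpha>))"
  have x: "0 < x" "x \<le> 1" using y by (auto simp: x_def)
  have "x powr \<alpha> \<le> (y powr (1/\<alpha>)) powr \<alpha>" using x assms by (intro powr_mono2) (auto simp: x_def)
  also have "\<dots> = y" using assms y by (simp add: powr_powr)
  finally have "c * x powr \<alpha> \<le> c * y" using assms by (intro mult_left_mono) auto
  also have "\<dots> \<le> \<epsilon>" using assms by (simp add: y_def field_simps)
  finally show ?thesis using that x by blast
qed

lemma le_powr_self: "0 \<le> d \<Longrightarrow> d \<le> 1 \<Longrightarrow> 0 < \<alpha> \<Longrightarrow> \<alpha> < 1 \<Longrightarrow> d \<le> d powr \<alpha>" for d :: real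
  using powr_mono'[of \<alpha> 1 d] by simp

text \<open>Only the spatial seminorm of the second derivatives has to be absorbed; regularity in
  time is recovered from it afterwards. For this reason the time variable enters as a mere
  parameter.\<close>

definition hx :: "real \<Rightarrow> 'a::metric_space set \<Rightarrow> real \<Rightarrow> real \<Rightarrow> ('a \<Rightarrow> real \<Rightarrow> 'b::real_normed_vector) \<Rightarrow> bool" where
  "hx \<alpha> S T H g \<longleftrightarrow> (\<forall>t\<in>{0..T}. \<forall>x\<in>S. \<forall>y\<in>S. norm (g x t - g y t) \<le> H * dist x y powr \<alpha>)"

text \<open>The source h may depend on the solution in a Lipschitz way, so that semilinear problems are covered
  with a constant that involves the solution only through its sup bound.\<close>

definition prob :: "real \<Rightarrow> real \<Rightarrow> real \<Rightarrow> (real^'n) set \<Rightarrow> real \<Rightarrow> (real^'n \<Rightarrow> real^'n^'n) \<Rightarrow> (real^'n \<Rightarrow> real^'n)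
    \<Rightarrow> (real^'n \<Rightarrow> real \<Rightarrow> real) \<Rightarrow> real \<Rightarrow> real \<Rightarrow> (real^'n \<Rightarrow> real \<Rightarrow> real) \<Rightarrow> (real^'n \<Rightarrow> real \<Rightarrow> real^'n)
    \<Rightarrow> (real^'n \<Rightarrow> real \<Rightarrow> real^'n^'n) \<Rightarrow> (real^'n \<Rightarrow> real \<Rightarrow> real) \<Rightarrow> bool" where
  "prob \<alpha> \<kappa> \<Lambda> S T a b h M A u u1 u2 ut \<longleftrightarrow> drv S T u u1 u2 ut \<and>
     continuous_on (S \<times> {0..T}) (\<lambda>(x,t). u x t) \<and> (\<forall>x\<in>S. u x 0 = 0) \<and> coef \<kappa> \<Lambda> \<alpha> S a b \<and>
     (\<forall>x\<in>S. \<forall>t\<in>{0..T}. ut x t = a x \<bullet> u2 x t + b x \<bullet> u1 x t + h x t \<and> \<bar>u x t\<bar> \<le> M) \<and>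
     (\<forall>x\<in>S. \<forall>y\<in>S. \<forall>t\<in>{0..T}. \<bar>h x t - h y t\<bar> \<le> A * dist x y powr \<alpha> + \<Lambda> * \<bar>u x t - u y t\<bar>)"

lemma hx_subset: "hx \<alpha> S T H g \<Longrightarrow> S' \<subseteq> S \<Longrightarrow> hx \<alpha> S' T H g"
  unfolding hx_def by blast

lemma hx_mono: "hx \<alpha> S T H g \<Longrightarrow> H \<le> H' \<Longrightarrow> hx \<alpha> S T H' g"
  unfolding hx_def by (meson mult_right_mono order_trans powr_ge_zero)

lemma coef_subset: "coef \<kappa> \<Lambda> \<alpha> S a b \<Longrightarrow> S' \<subseteq> S \<Longrightarrow> coef \<kappa> \<Lambda> \<alpha> S' a b"
  unfolding coef_def by blast

lemma prob_subset:
  assumes "prob \<alpha> \<kappa> \<Lambda> S T a b h M A u u1 u2 ut" "S' \<subseteq> S"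
  shows "prob \<alpha> \<kappa> \<Lambda> S' T a b h M A u u1 u2 ut"
proof -
  have "S' \<times> {0..T} \<subseteq> S \<times> {0..T}" using assms(2) by blast
  then show ?thesis
    using assms drv_subset[of S T u u1 u2 ut S'] coef_subset[of \<kappa> \<Lambda> \<alpha> S a b S']
      continuous_on_subset[of "S \<times> {0..T}" "\<lambda>(x,t). u x t" "S' \<times> {0..T}"]
    unfolding prob_def by blast
qed

text \<open>In the increment of ut - a(x) u2 the seminorm H of the second derivatives appears only
  multiplied by a(y) - a(x), which is small on a small ball. All other terms involve sup bounds of
  the first and second derivatives, which interpolation controls.\<close>

lemma frozen_source_hoelder:
  fixes a :: "real^'n \<Rightarrow> real^'n^'n"
  assumes p: "prob \<alpha> \<kappa> \<Lambda> S T a b h M A u u1 u2 ut" and \<Lambda>: "1 \<le> \<Lambda>" and \<alpha>: "0 < \<alpha>" "\<alpha> < 1"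
    and "convex S" and xS: "x \<in> S" and rad: "\<And>y. y \<in> S \<Longrightarrow> dist y x \<le> r" and diam: "\<And>y w. y \<in> S \<Longrightarrow> w \<in> S \<Longrightarrow> dist y w \<le> 1"
    and H: "hx \<alpha> S T H u2" "0 \<le> H"
    and M12: "\<And>y t. y \<in> S \<Longrightarrow> t \<in> {0..T} \<Longrightarrow> norm (u1 y t) \<le> M1" "\<And>y t. y \<in> S \<Longrightarrow> t \<in> {0..T} \<Longrightarrow> norm (u2 y t) \<le> M2"
    and y: "y \<in> S" "w \<in> S" "t \<in> {0..T}"
  shows "\<bar>(ut y t - a x \<bullet> u2 y t) - (ut w t - a x \<bullet> u2 w t)\<bar> \<le>
     (\<Lambda> * r powr \<alpha> * H + 2 * \<Lambda> * (M1 + M2) + A) * dist y w powr \<alpha>"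
proof -
  let ?d = "dist y w powr \<alpha>"
  note c = p[unfolded prob_def]
  have d: "drv S T u u1 u2 ut" using c by blast
  have M0: "0 \<le> M1" "0 \<le> M2" using M12[OF y(1,3)] norm_ge_zero order_trans by blast+
  have dd: "dist y w \<le> ?d" by (rule le_powr_self) (use diam y \<alpha> in auto)
  have "\<bar>(a y - a x) \<bullet> (u2 y t - u2 w t)\<bar> \<le> norm (a y - a x) * norm (u2 y t - u2 w t)" by (rule Cauchy_Schwarz_ineq2)
  also have "\<dots> \<le> (\<Lambda> * r powr \<alpha>) * (H * ?d)"
  proof (rule mult_mono)
    have "norm (a y - a x) \<le> \<Lambda> * dist y x powr \<alpha>" using c y xS unfolding coef_def by blast
    also have "\<dots> \<le> \<Lambda> * r powr \<alpha>" using \<Lambda> \<alpha> rad[OF y(1)] by (intro mult_left_mono powr_mono2) auto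
    finally show "norm (a y - a x) \<le> \<Lambda> * r powr \<alpha>" .
    show "norm (u2 y t - u2 w t) \<le> H * ?d" using H(1) y unfolding hx_def by blast
  qed (use \<Lambda> in auto)
  finally have 1: "\<bar>(a y - a x) \<bullet> (u2 y t - u2 w t)\<bar> \<le> \<Lambda> * r powr \<alpha> * H * ?d" by simp
  have "\<bar>(a y - a w) \<bullet> u2 w t\<bar> \<le> norm (a y - a w) * norm (u2 w t)" by (rule Cauchy_Schwarz_ineq2)
  also have "\<dots> \<le> (\<Lambda> * ?d) * M2"
  proof (rule mult_mono)
    show "norm (a y - a w) \<le> \<Lambda> * ?d" using c y unfolding coef_def by blast
  qed (use \<Lambda> M12 y in auto)
  finally have 2: "\<bar>(a y - a w) \<bullet> u2 w t\<bar> \<le> \<Lambda> * M2 * ?d" by (simp add: mult_ac)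
  have "\<bar>b y \<bullet> (u1 y t - u1 w t)\<bar> \<le> norm (b y) * norm (u1 y t - u1 w t)" by (rule Cauchy_Schwarz_ineq2)
  also have "\<dots> \<le> \<Lambda> * (M2 * ?d)"
  proof (rule mult_mono)
    show "norm (b y) \<le> \<Lambda>" using c y unfolding coef_def by blast
    have "norm (u1 y t - u1 w t) \<le> M2 * dist y w"
      by (rule gradient_lipschitz[OF d y(3) \<open>convex S\<close> M12(2)[OF _ y(3)] y(1,2)])
    also have "\<dots> \<le> M2 * ?d" using dd M0 by (intro mult_left_mono) auto
    finally show "norm (u1 y t - u1 w t) \<le> M2 * ?d" .
  qed (use \<Lambda> in auto)
  finally have 3: "\<bar>b y \<bullet> (u1 y t - u1 w t)\<bar> \<le> \<Lambda> * M2 * ?d" by simp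
  have "\<bar>(b y - b w) \<bullet> u1 w t\<bar> \<le> norm (b y - b w) * norm (u1 w t)" by (rule Cauchy_Schwarz_ineq2)
  also have "\<dots> \<le> (\<Lambda> * ?d) * M1"
  proof (rule mult_mono)
    show "norm (b y - b w) \<le> \<Lambda> * ?d" using c y unfolding coef_def by blast
  qed (use \<Lambda> M12 y in auto)
  finally have 4: "\<bar>(b y - b w) \<bullet> u1 w t\<bar> \<le> \<Lambda> * M1 * ?d" by (simp add: mult_ac)
  have "\<bar>h y t - h w t\<bar> \<le> A * ?d + \<Lambda> * \<bar>u y t - u w t\<bar>" using c y by blast
  moreover have "\<bar>u y t - u w t\<bar> \<le> M1 * ?d"
  proof -
    have "\<bar>u y t - u w t\<bar> \<le> M1 * dist y w"
      by (rule function_lipschitz[OF d y(3) \<open>convex S\<close> M12(1)[OF _ y(3)] y(1,2)])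
    also have "\<dots> \<le> M1 * ?d" using dd M0 by (intro mult_left_mono) auto
    finally show ?thesis .
  qed
  then have "\<Lambda> * \<bar>u y t - u w t\<bar> \<le> \<Lambda> * (M1 * ?d)" using \<Lambda> by (intro mult_left_mono) auto
  ultimately have 5: "\<bar>h y t - h w t\<bar> \<le> A * ?d + \<Lambda> * M1 * ?d" by simp
  have eq: "ut y t = a y \<bullet> u2 y t + b y \<bullet> u1 y t + h y t" "ut w t = a w \<bullet> u2 w t + b w \<bullet> u1 w t + h w t"
    using c y by blast+
  have "(ut y t - a x \<bullet> u2 y t) - (ut w t - a x \<bullet> u2 w t) = (a y - a x) \<bullet> (u2 y t - u2 w t) + (a y - a w) \<bullet> u2 w t
     + b y \<bullet> (u1 y t - u1 w t) + (b y - b w) \<bullet> u1 w t + (h y t - h w t)"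
    unfolding eq by (simp add: inner_diff_left inner_diff_right)
  then have "\<bar>(ut y t - a x \<bullet> u2 y t) - (ut w t - a x \<bullet> u2 w t)\<bar> \<le> \<Lambda> * r powr \<alpha> * H * ?d + \<Lambda> * M2 * ?d + \<Lambda> * M2 * ?d
      + \<Lambda> * M1 * ?d + (A * ?d + \<Lambda> * M1 * ?d)" using 1 2 3 4 5 by linarith
  then show ?thesis by (simp add: algebra_simps)
qed

text \<open>The factor 1/2 in front of H is gained by taking the difference step small relative to the
  distance of the two points, and that distance small relative to the radius of the freezing ball.\<close>

lemma schauder_step:
  fixes \<alpha> \<kappa> \<Lambda> :: real
  assumes \<alpha>: "0 < \<alpha>" "\<alpha> < 1" and \<kappa>: "0 < \<kappa>" "\<kappa> \<le> 1" "1 \<le> \<Lambda>"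
  obtains C where "0 \<le> C"
    "\<And>(z::real^'n) r r' T a b h M A H u u1 u2 ut. 0 < r \<Longrightarrow> r < r' \<Longrightarrow> r' \<le> 1 \<Longrightarrow> 0 \<le> M \<Longrightarrow> 0 \<le> A \<Longrightarrow> 0 < H \<Longrightarrow>
      prob \<alpha> \<kappa> \<Lambda> (ball z r') T a b h M A u u1 u2 ut \<Longrightarrow> hx \<alpha> (ball z r') T H u2 \<Longrightarrow>
      hx \<alpha> (ball z r) T (H / 2 + C * (M + A) / (r' - r) ^ 3) u2"
proof -
  define n where "n = real CARD('n)"
  have n: "n \<ge> 1" unfolding n_def by (simp add: Suc_leI)
  define c1 where "c1 = norm (mat 1 :: real^'n^'n)"
  define c2 where "c2 = (1 + 2 * c1 * \<Lambda>) * (24 * \<Lambda>)"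
  have c2: "c2 \<ge> 0" unfolding c2_def c1_def using \<kappa> by simp
  define c3 where "c3 = 4 * (n + 1) * n\<^sup>2 + 2 * n"
  have c3: "c3 \<ge> 0" using n by (simp add: c3_def)
  \<comment> \<open>\<open>\<theta>\<close> is the ratio of the difference step to the distance of
    the two points.\<close>
  obtain \<theta> where \<theta>: "0 < \<theta>" "\<theta> \<le> 1" "n\<^sup>2 * 4 * \<theta> powr \<alpha> \<le> 1/16"
    using powr_small[of "n\<^sup>2 * 4" "1/16" \<alpha>] \<alpha> by auto
  \<comment> \<open>\<open>\<nu>\<close> is the ratio of that distance to the radius R of the
    coupling; the gain comes from the linear decay \<rho> / R against R powr \<alpha>.\<close>
  obtain \<nu> where \<nu>: "0 < \<nu>" "\<nu> \<le> 1" "n\<^sup>2 * (c2/\<kappa>) * \<nu> powr (1-\<alpha>) \<le> 1/16"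
    using powr_small[of "n\<^sup>2 * (c2/\<kappa>)" "1/16" "1-\<alpha>"] \<alpha> c2 \<kappa> by auto
  define D where "D = 1/16 + n\<^sup>2 * (4/\<kappa>) * (\<theta> powr \<alpha> / (\<theta>\<^sup>2 * \<nu>))"
  have D: "D \<ge> 0" using \<theta> \<nu> \<kappa> by (simp add: D_def)
  \<comment> \<open>\<open>\<xi>\<close> limits the radius of the freezing ball, so that the
    oscillation of the leading coefficients compensates the factor \<open>D\<close>.\<close>
  obtain \<xi> where \<xi>: "0 < \<xi>" "\<xi> \<le> 1" "D * \<Lambda> * \<xi> powr \<alpha> \<le> 1/8"
    using powr_small[of "D * \<Lambda>" "1/8" \<alpha>] \<alpha> D \<kappa> by auto
  \<comment> \<open>For points closer than \<epsilon> \<delta> the radius R = \<rho> / \<nu>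
    satisfies 8 R <= \<xi> \<delta> / 2, which keeps the freezing ball small and inside the larger
    ball.\<close>
  define \<epsilon> where "\<epsilon> = \<xi> * \<nu> / 16"
  have \<epsilon>: "0 < \<epsilon>" "\<epsilon> \<le> 1/16" using \<xi> \<nu> mult_mono[of \<xi> 1 \<nu> 1] by (auto simp: \<epsilon>_def)
  \<comment> \<open>First and second derivatives are interpolated at the scale \<tau> = \<zeta>
    \<epsilon> \<delta>. Smallness of \<zeta> relative to the threshold \<epsilon> \<delta> keeps
    their share of H below the required fraction, for distant as well as for close points.\<close>
  obtain \<zeta> where \<zeta>: "0 < \<zeta>" "\<zeta> \<le> 1" "(2 * c3 + 2 * D * \<Lambda> * c3) * \<zeta> powr \<alpha> \<le> 1/8"
    using powr_small[of "2 * c3 + 2 * D * \<Lambda> * c3" "1/8" \<alpha>] \<alpha> D \<kappa> c3 by auto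
  define \<eta> where "\<eta> = \<epsilon> * \<zeta>"
  have \<eta>: "0 < \<eta>" "\<eta> \<le> 1/16" using \<epsilon> \<zeta> mult_mono[of \<epsilon> "1/16" \<zeta> 1] by (auto simp: \<eta>_def)
  define C where "C = 2 * c3 / (\<epsilon> * \<eta>\<^sup>2) + 2 * D * \<Lambda> * c3 / \<eta>\<^sup>2 + D"
  have C: "C \<ge> 0" using c3 \<epsilon> \<eta> D \<kappa> by (simp add: C_def)
  show ?thesis
  proof (rule that[OF C])
    fix z :: "real^'n" and r r' T a b h M A H u u1 u2 ut
    assume r: "0 < r" "r < r'" "r' \<le> 1" and M: "0 \<le> M" and A: "0 \<le> A" and H: "(0::real) < H"
      and p: "prob \<alpha> \<kappa> \<Lambda> (ball z r') T a b h M A u u1 u2 ut" and hx: "hx \<alpha> (ball z r') T H u2"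
    define \<delta> where "\<delta> = r' - r"
    have \<delta>: "0 < \<delta>" "\<delta> \<le> 1" using r by (auto simp: \<delta>_def)
    have d: "drv (ball z r') T u u1 u2 ut" using p unfolding prob_def by blast
    define \<tau> where "\<tau> = \<eta> * \<delta>"
    have "\<tau> \<le> 1/16 * \<delta>" unfolding \<tau>_def using \<eta> \<delta> by (intro mult_right_mono) auto
    then have \<tau>: "0 < \<tau>" "\<tau> \<le> \<delta> / 16" "\<tau> \<le> 1" using mult_pos_pos[OF \<eta>(1) \<delta>(1)] \<delta> unfolding \<tau>_def[symmetric] by linarith+
    define Z where "Z = 2 * \<tau> powr \<alpha> * H + 4 * M / \<tau>\<^sup>2"
    have Z: "Z \<ge> 0" using H M by (simp add: Z_def)
    have M2: "norm (u2 w t) \<le> n\<^sup>2 * Z" if w: "w \<in> ball z (r + 3 * \<delta> / 4)" and t: "t \<in> {0..T}" for w t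
    proof -
      have sub: "cball w (2 * \<tau>) \<subseteq> ball z r'"
      proof
        fix v assume "v \<in> cball w (2*\<tau>)"
        then have "dist z v < r + 3 * \<delta> / 4 + 2 * \<tau>" using w dist_triangle[of z v w] by simp
        also have "\<dots> \<le> r'" using \<tau> by (simp add: \<delta>_def field_simps)
        finally show "v \<in> ball z r'" by simp
      qed
      have "norm (u2 w t) \<le> n * n * ((2*\<tau>) powr \<alpha> * H + 4 * M / \<tau>\<^sup>2)"
        unfolding n_def
      proof (rule interpolation_second[OF d sub t \<tau>(1) \<alpha>(1) less_imp_le[OF H]])
        show "norm (u2 x t - u2 z' t) \<le> H * dist x z' powr \<alpha>" if "x \<in> ball z r'" "z' \<in> ball z r'" for x z'
          using hx t that unfolding hx_def by blast
        show "\<bar>u x t\<bar> \<le> M" if "x \<in> ball z r'" for x using p t that unfolding prob_def by blast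
      qed
      also have "\<dots> \<le> n * n * Z"
        unfolding Z_def using powr_scale_le[of 2 \<tau> \<alpha>] \<alpha> \<tau> H n by (intro mult_left_mono add_right_mono mult_right_mono) auto
      finally show ?thesis by (simp add: power2_eq_square)
    qed
    have M1: "norm (u1 w t) \<le> n * (2 * M / \<tau> + n\<^sup>2 * Z)" if w: "w \<in> ball z (r + \<delta> / 2)" and t: "t \<in> {0..T}" for w t
    proof -
      have sub: "cball w \<tau> \<subseteq> ball z (r + 3 * \<delta> / 4)"
      proof
        fix v assume "v \<in> cball w \<tau>"
        then have "dist z v < r + \<delta> / 2 + \<tau>" using w dist_triangle[of z v w] by simp
        also have "\<dots> \<le> r + 3 * \<delta> / 4" using \<tau> \<delta> by (simp add: field_simps)
        finally show "v \<in> ball z (r + 3 * \<delta> / 4)" by simp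
      qed
      have "r + 3 * \<delta> / 4 \<le> r'" using \<delta> by (simp add: \<delta>_def field_simps)
      then have sub2: "cball w \<tau> \<subseteq> ball z r'" using sub subset_ball by blast
      have "norm (u1 w t) \<le> n * (2 * M / \<tau> + \<tau> * (n\<^sup>2 * Z))"
        unfolding n_def
      proof (rule interpolation_first[OF d sub2 t \<tau>(1)])
        show "norm (u2 x t) \<le> (real CARD('n))\<^sup>2 * Z" if "x \<in> cball w \<tau>" for x
          using M2[of x t] sub that t unfolding n_def by blast
        show "\<bar>u x t\<bar> \<le> M" if "x \<in> ball z r'" for x using p t that unfolding prob_def by blast
      qed
      also have "\<dots> \<le> n * (2 * M / \<tau> + 1 * (n\<^sup>2 * Z))"
        using \<tau> n Z by (intro mult_left_mono add_left_mono mult_right_mono) auto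
      finally show ?thesis by simp
    qed
    define B where "B = \<tau> powr \<alpha> * H + M / \<tau>\<^sup>2"
    have B12: "n\<^sup>2 * Z + n * (2 * M / \<tau> + n\<^sup>2 * Z) \<le> c3 * B"
    proof -
      have "Z \<le> 4 * B" using H M by (simp add: Z_def B_def)
      then have "(n + 1) * n\<^sup>2 * Z \<le> (n + 1) * n\<^sup>2 * (4 * B)" using n by (intro mult_left_mono) auto
      moreover have "M / \<tau> \<le> B"
      proof -
        have "\<tau>\<^sup>2 \<le> \<tau>" using \<tau> by (simp add: power2_eq_square mult_left_le_one_le)
        then have "M / \<tau> \<le> M / \<tau>\<^sup>2" using M \<tau> by (intro divide_left_mono) auto
        moreover have "0 \<le> \<tau> powr \<alpha> * H" using H by simp
        ultimately show ?thesis by (simp add: B_def)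
      qed
      then have "2 * n * (M / \<tau>) \<le> 2 * n * B" using n by (intro mult_left_mono) auto
      ultimately show ?thesis by (simp add: c3_def algebra_simps)
    qed
    show "hx \<alpha> (ball z r) T (H / 2 + C * (M + A) / (r' - r) ^ 3) u2"
      unfolding hx_def
    proof (intro ballI)
      fix t x y assume t: "t \<in> {0..T}" and x: "x \<in> ball z r" and y: "y \<in> ball z r"
      define \<rho> where "\<rho> = dist x y"
      have \<delta>3: "1 \<le> 1 / \<delta>^3" "1 / \<delta>\<^sup>2 \<le> 1 / \<delta>^3"
        using \<delta> power_le_one[of \<delta> 3] power_decreasing[of 2 3 \<delta>] by (auto intro!: divide_left_mono)
      show "norm (u2 x t - u2 y t) \<le> (H / 2 + C * (M + A) / (r' - r) ^ 3) * dist x y powr \<alpha>"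
      proof (cases "\<rho> = 0")
        case True
        then show ?thesis by (simp add: \<rho>_def)
      next
        case False
        then have \<rho>: "\<rho> > 0" by (simp add: \<rho>_def)
        show ?thesis
        \<comment> \<open>Points at distance at least \<epsilon> \<delta> need only the interpolated
          sup bound of the second derivatives, since \<tau> is \<zeta> times this threshold. Closer
          points need the coupling estimate.\<close>
        proof (cases "\<epsilon> * \<delta> \<le> \<rho>")
          case True
          have "norm (u2 x t - u2 y t) \<le> norm (u2 x t) + norm (u2 y t)" by (rule norm_triangle_ineq4)
          also have "\<dots> \<le> 2 * (n\<^sup>2 * Z)"
          proof -
            have "ball z r \<subseteq> ball z (r + 3 * \<delta> / 4)" using \<delta> by (intro subset_ball) auto
            then show ?thesis using M2[of x t] M2[of y t] x y t by fastforce
          qed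
          also have "\<dots> \<le> 2 * c3 * B"
          proof -
            have "0 \<le> n * (2 * M / \<tau> + n\<^sup>2 * Z)" using n M \<tau> Z by simp
            then show ?thesis using B12 by linarith
          qed
          also have "B \<le> \<rho> powr \<alpha> * (\<zeta> powr \<alpha> * H + M / (\<epsilon> * \<eta>\<^sup>2 * \<delta>^3))"
          proof -
            have "\<tau> = \<zeta> * (\<epsilon> * \<delta>)" by (simp add: \<tau>_def \<eta>_def)
            then have "\<tau> powr \<alpha> = \<zeta> powr \<alpha> * (\<epsilon> * \<delta>) powr \<alpha>" using \<zeta> \<epsilon> \<delta> by (simp add: powr_mult)
            also have "\<dots> \<le> \<zeta> powr \<alpha> * \<rho> powr \<alpha>" using True \<alpha> \<epsilon> \<delta> by (intro mult_left_mono powr_mono2) auto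
            finally have 1: "\<tau> powr \<alpha> * H \<le> \<zeta> powr \<alpha> * \<rho> powr \<alpha> * H" using H by (intro mult_right_mono) auto
            have "\<epsilon> * \<delta> \<le> 1" using \<epsilon> \<delta> mult_mono[of \<epsilon> 1 \<delta> 1] by auto
            then have "\<epsilon> * \<delta> \<le> (\<epsilon> * \<delta>) powr \<alpha>" using \<epsilon> \<delta> \<alpha> by (intro le_powr_self) auto
            also have "\<dots> \<le> \<rho> powr \<alpha>" using True \<alpha> \<epsilon> \<delta> by (intro powr_mono2) auto
            finally have "\<epsilon> * \<delta> \<le> \<rho> powr \<alpha>" .
            then have "M / \<tau>\<^sup>2 * (\<epsilon> * \<delta>) \<le> M / \<tau>\<^sup>2 * \<rho> powr \<alpha>" using M by (intro mult_left_mono) auto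
            then have "M / \<tau>\<^sup>2 \<le> M / \<tau>\<^sup>2 * \<rho> powr \<alpha> / (\<epsilon> * \<delta>)"
              using pos_le_divide_eq[OF mult_pos_pos[OF \<epsilon>(1) \<delta>(1)]] by blast
            also have "\<dots> = \<rho> powr \<alpha> * (M / (\<epsilon> * \<eta>\<^sup>2 * \<delta>^3))"
              by (simp add: \<tau>_def power_mult_distrib power2_eq_square power3_eq_cube mult_ac)
            finally show ?thesis using 1 by (simp add: B_def algebra_simps)
          qed
          then have "2 * c3 * B \<le> 2 * c3 * (\<rho> powr \<alpha> * (\<zeta> powr \<alpha> * H + M / (\<epsilon> * \<eta>\<^sup>2 * \<delta>^3)))"
            using c3 by (intro mult_left_mono) auto
          also have "\<dots> = ((2 * c3 * \<zeta> powr \<alpha>) * H + (2 * c3 / (\<epsilon> * \<eta>\<^sup>2)) * M / \<delta>^3) * \<rho> powr \<alpha>"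
            by (simp add: algebra_simps)
          also have "\<dots> \<le> (H / 2 + C * (M + A) / \<delta>^3) * \<rho> powr \<alpha>"
          proof (rule mult_right_mono[OF add_mono])
            have "0 \<le> 2 * D * \<Lambda> * c3 * \<zeta> powr \<alpha>" using D \<kappa> c3 by simp
            then have "2 * c3 * \<zeta> powr \<alpha> \<le> 1/2" using \<zeta>(3) by (simp add: algebra_simps)
            then have "2 * c3 * \<zeta> powr \<alpha> * H \<le> 1/2 * H" using H by (intro mult_right_mono) auto
            then show "2 * c3 * \<zeta> powr \<alpha> * H \<le> H / 2" by simp
            have "2 * c3 / (\<epsilon> * \<eta>\<^sup>2) \<le> C" using D c3 \<kappa> by (simp add: C_def)
            then show "(2 * c3 / (\<epsilon> * \<eta>\<^sup>2)) * M / \<delta>^3 \<le> C * (M + A) / \<delta>^3"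
              using M A C \<delta> by (intro divide_right_mono mult_mono) auto
          qed auto
          finally show ?thesis by (simp add: \<rho>_def \<delta>_def)
        next
          case False
          define R where "R = \<rho> / \<nu>"
          have R: "R > 0" "\<rho> \<le> R" "8 * R \<le> \<xi> * \<delta> / 2"
          proof -
            show "R > 0" using \<rho> \<nu> by (simp add: R_def)
            show "\<rho> \<le> R" using \<rho> \<nu> by (simp add: R_def field_simps)
            have "\<rho> \<le> \<xi> * \<nu> / 16 * \<delta>" using False by (simp add: \<epsilon>_def)
            then show "8 * R \<le> \<xi> * \<delta> / 2" using \<nu> by (simp add: R_def field_simps)
          qed
          have R1: "8 * R \<le> \<delta> / 2" "8 * R \<le> \<xi> / 2"
          proof -
            have "\<xi> * \<delta> \<le> 1 * \<delta>" "\<xi> * \<delta> \<le> \<xi> * 1" using \<xi> \<delta> by (intro mult_mono; simp)+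
            then show "8 * R \<le> \<delta> / 2" "8 * R \<le> \<xi> / 2" using R(3) by auto
          qed
          define h' where "h' = \<theta> * \<rho>"
          have "\<theta> * \<rho> \<le> 1 * \<rho>" using \<theta>(2) \<rho> by (intro mult_right_mono) auto
          then have h': "0 < h'" "h' \<le> R" using R(2) mult_pos_pos[OF \<theta>(1) \<rho>] unfolding h'_def by linarith+
          define S where "S = cball x (8 * R)"
          have Ssub: "S \<subseteq> ball z (r + \<delta> / 2)"
          proof
            fix v assume "v \<in> S"
            then have "dist z v < r + 8 * R" using x dist_triangle[of z v x] by (simp add: S_def)
            then show "v \<in> ball z (r + \<delta> / 2)" using R1 by simp
          qed
          have "r + \<delta> / 2 \<le> r'" "r + \<delta> / 2 \<le> r + 3 * \<delta> / 4" using \<delta> by (auto simp: \<delta>_def field_simps)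
          then have Ssub2: "S \<subseteq> ball z r'" "S \<subseteq> ball z (r + 3 * \<delta> / 4)"
            using Ssub subset_ball by blast+
          have dS: "drv S T u u1 u2 ut" by (rule drv_subset[OF d Ssub2(1)])
          define Q where "Q = \<Lambda> * (8 * R) powr \<alpha> * H + 2 * \<Lambda> * (n * (2 * M / \<tau> + n\<^sup>2 * Z) + n\<^sup>2 * Z) + A"
          have Q0: "0 \<le> Q" using \<kappa> H M Z n A \<tau> by (simp add: Q_def)
          have pS: "prob \<alpha> \<kappa> \<Lambda> S T a b h M A u u1 u2 ut" by (rule prob_subset[OF p Ssub2(1)])
          have HS: "hx \<alpha> S T H u2" by (rule hx_subset[OF hx Ssub2(1)])
          have xS: "x \<in> S" using R by (simp add: S_def)
          have Q: "\<bar>(ut y t - a x \<bullet> u2 y t) - (ut w t - a x \<bullet> u2 w t)\<bar> \<le> Q * dist y w powr \<alpha>"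
            if "t \<in> {0..T}" "y \<in> S" "w \<in> S" for y w t
            unfolding Q_def
          proof (rule frozen_source_hoelder[OF pS \<kappa>(3) \<alpha> _ xS _ _ HS])
            show "convex S" unfolding S_def by simp
            show "dist y x \<le> 8 * R" if "y \<in> S" for y using that by (simp add: S_def dist_commute)
            show "dist y w \<le> 1" if "y \<in> S" "w \<in> S" for y w
            proof -
              have "dist y w \<le> 8 * R + 8 * R" using that dist_triangle[of y w x] by (simp add: S_def dist_commute)
              then show ?thesis using R1 \<delta> by simp
            qed
            show "norm (u1 y t) \<le> n * (2 * M / \<tau> + n\<^sup>2 * Z)" if "y \<in> S" "t \<in> {0..T}" for y t
              using M1 Ssub that by blast
            show "norm (u2 y t) \<le> n\<^sup>2 * Z" if "y \<in> S" "t \<in> {0..T}" for y t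
              using M2 Ssub2 that by blast
          qed (use that H in auto)
          have coefx: "transpose (a x) = a x" "\<And>h. \<kappa> * (h \<bullet> h) \<le> h \<bullet> (a x *v h)" "norm (a x) \<le> \<Lambda>"
            using pS xS unfolding prob_def coef_def by blast+
          have entry: "\<bar>(u2 x t - u2 y t) $ i $ j\<bar> \<le> (4 * h' powr \<alpha> * H + (dist x y / R) *
             (((1 + 2 * norm (mat 1 :: real^'n^'n) * \<Lambda>) * (24 * \<Lambda> * R powr \<alpha> * (H + Q)) + 4 * (h' powr \<alpha> / h'\<^sup>2) * R\<^sup>2 * Q) / \<kappa>))" for i j
            unfolding vector_minus_component
          proof (rule schauder_core[OF dS _ _ \<alpha> _ _ _ h' t H _ coefx \<kappa> Q0 Q])
            show "continuous_on (S \<times> {0..T}) (\<lambda>(x, t). u x t)" "\<And>x. x \<in> S \<Longrightarrow> u x 0 = 0" using pS unfolding prob_def by blast+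
            show "cball x (8 * R) \<subseteq> S" by (simp add: S_def)
            show "x \<noteq> y" "dist x y \<le> R" using \<rho> R(2) by (auto simp: \<rho>_def)
            show "norm (u2 x t - u2 z t) \<le> H * dist x z powr \<alpha>" if "t \<in> {0..T}" "x \<in> S" "z \<in> S" for x z t
              using HS that unfolding hx_def by blast
          qed
          have e1: "h' powr \<alpha> = \<theta> powr \<alpha> * \<rho> powr \<alpha>" using \<theta> \<rho> by (simp add: h'_def powr_mult)
          have e2: "(\<rho> / R) * R powr \<alpha> = \<nu> powr (1 - \<alpha>) * \<rho> powr \<alpha>"
          proof -
            have "\<rho> / R = \<nu>" using \<rho> by (simp add: R_def)
            moreover have "R powr \<alpha> = \<rho> powr \<alpha> / \<nu> powr \<alpha>" using \<rho> \<nu> by (simp add: R_def powr_divide)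
            moreover have "\<nu> powr (1 - \<alpha>) = \<nu> / \<nu> powr \<alpha>" using \<nu> by (simp add: powr_diff)
            ultimately show ?thesis by simp
          qed
          have e3: "(\<rho> / R) * ((h' powr \<alpha> / h'\<^sup>2) * R\<^sup>2) = \<theta> powr \<alpha> / (\<theta>\<^sup>2 * \<nu>) * \<rho> powr \<alpha>"
            unfolding e1 using \<rho> \<nu> \<theta> by (simp add: R_def h'_def power2_eq_square field_simps)
          have "norm (u2 x t - u2 y t) \<le> n * n * (4 * h' powr \<alpha> * H + (dist x y / R) *
             (((1 + 2 * norm (mat 1 :: real^'n^'n) * \<Lambda>) * (24 * \<Lambda> * R powr \<alpha> * (H + Q)) + 4 * (h' powr \<alpha> / h'\<^sup>2) * R\<^sup>2 * Q) / \<kappa>))"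
            unfolding n_def by (rule matrix_norm_le[OF entry])
          also have "\<dots> = n\<^sup>2 * 4 * h' powr \<alpha> * H + n\<^sup>2 * (c2/\<kappa>) * ((\<rho> / R) * R powr \<alpha>) * (H + Q)
             + n\<^sup>2 * (4/\<kappa>) * ((\<rho> / R) * ((h' powr \<alpha> / h'\<^sup>2) * R\<^sup>2)) * Q"
            unfolding \<rho>_def[symmetric] c1_def[symmetric] c2_def by (simp add: algebra_simps add_divide_distrib power2_eq_square)
          also have "\<dots> = \<rho> powr \<alpha> * ((n\<^sup>2 * 4 * \<theta> powr \<alpha>) * H + (n\<^sup>2 * (c2/\<kappa>) * \<nu> powr (1-\<alpha>)) * (H + Q)
             + n\<^sup>2 * (4/\<kappa>) * (\<theta> powr \<alpha> / (\<theta>\<^sup>2 * \<nu>)) * Q)"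
            unfolding e2 e3 unfolding e1 by (simp add: algebra_simps)
          also have "\<dots> \<le> \<rho> powr \<alpha> * ((1/16) * H + (1/16) * (H + Q) + (D - 1/16) * Q)"
            using \<theta>(3) \<nu>(3) H Q0 by (intro mult_left_mono add_mono mult_right_mono) (auto simp: D_def)
          also have "\<dots> = \<rho> powr \<alpha> * (H / 8 + D * Q)" by (simp add: algebra_simps add_divide_distrib)
          also have "\<dots> \<le> \<rho> powr \<alpha> * (H / 2 + C * (M + A) / \<delta>^3)"
          proof (rule mult_left_mono)
            have "(8 * R) powr \<alpha> \<le> \<xi> powr \<alpha>" using R1 R \<alpha> \<xi> by (intro powr_mono2) auto
            then have "D * \<Lambda> * (8 * R) powr \<alpha> \<le> D * \<Lambda> * \<xi> powr \<alpha>" using D \<kappa> by (intro mult_left_mono) auto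
            then have "D * \<Lambda> * (8 * R) powr \<alpha> \<le> 1/8" using \<xi>(3) by linarith
            then have q1: "D * \<Lambda> * (8 * R) powr \<alpha> * H \<le> 1/8 * H" using H by (intro mult_right_mono) auto
            have q2: "D * (2 * \<Lambda> * (n * (2 * M / \<tau> + n\<^sup>2 * Z) + n\<^sup>2 * Z)) \<le> D * (2 * \<Lambda> * (c3 * B))"
              using B12 D \<kappa> by (intro mult_left_mono) auto
            have q3: "D * (2 * \<Lambda> * (c3 * B)) \<le> 1/8 * H + 2 * D * \<Lambda> * c3 / \<eta>\<^sup>2 * M / \<delta>^3"
            proof -
              have "\<tau> \<le> \<zeta>" using \<epsilon> \<delta> \<zeta> mult_mono[of "\<epsilon> * \<delta>" 1 \<zeta> \<zeta>] mult_mono[of \<epsilon> 1 \<delta> 1] by (simp add: \<tau>_def \<eta>_def mult_ac)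
              then have "\<tau> powr \<alpha> \<le> \<zeta> powr \<alpha>" using \<tau> \<alpha> by (intro powr_mono2) auto
              then have "2 * D * \<Lambda> * c3 * \<tau> powr \<alpha> \<le> 2 * D * \<Lambda> * c3 * \<zeta> powr \<alpha>" using D \<kappa> c3 by (intro mult_left_mono) auto
              moreover have "0 \<le> 2 * c3 * \<zeta> powr \<alpha>" using c3 by simp
              ultimately have "2 * D * \<Lambda> * c3 * \<tau> powr \<alpha> \<le> 1/8" using \<zeta>(3) by (simp add: algebra_simps)
              then have s1: "2 * D * \<Lambda> * c3 * \<tau> powr \<alpha> * H \<le> 1/8 * H" using H by (intro mult_right_mono) auto
              have "2 * D * \<Lambda> * c3 / \<eta>\<^sup>2 * M * (1 / \<delta>\<^sup>2) \<le> 2 * D * \<Lambda> * c3 / \<eta>\<^sup>2 * M * (1 / \<delta>^3)"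
                using \<delta>3 D \<kappa> c3 M by (intro mult_left_mono) auto
              moreover have "2 * D * \<Lambda> * c3 * (M / \<tau>\<^sup>2) = 2 * D * \<Lambda> * c3 / \<eta>\<^sup>2 * M * (1 / \<delta>\<^sup>2)"
                by (simp add: \<tau>_def power_mult_distrib)
              moreover have "D * (2 * \<Lambda> * (c3 * B)) = 2 * D * \<Lambda> * c3 * \<tau> powr \<alpha> * H + 2 * D * \<Lambda> * c3 * (M / \<tau>\<^sup>2)"
                by (simp add: B_def algebra_simps)
              moreover have "2 * D * \<Lambda> * c3 / \<eta>\<^sup>2 * M * (1 / \<delta>^3) = 2 * D * \<Lambda> * c3 / \<eta>\<^sup>2 * M / \<delta>^3" by simp
              ultimately show ?thesis using s1 by linarith
            qed
            have "D * Q = D * \<Lambda> * (8 * R) powr \<alpha> * H + D * (2 * \<Lambda> * (n * (2 * M / \<tau> + n\<^sup>2 * Z) + n\<^sup>2 * Z)) + D * A"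
              by (simp add: Q_def algebra_simps)
            then have "D * Q \<le> H / 4 + 2 * D * \<Lambda> * c3 / \<eta>\<^sup>2 * M / \<delta>^3 + D * A" using q1 q2 q3 by linarith
            moreover have "D * A \<le> D * A / \<delta>^3" using \<delta>3(1) D A mult_left_mono[of 1 "1/\<delta>^3" "D * A"] by simp
            moreover have "2 * D * \<Lambda> * c3 / \<eta>\<^sup>2 * M / \<delta>^3 + D * A / \<delta>^3 \<le> C * (M + A) / \<delta>^3"
            proof -
              have "2 * D * \<Lambda> * c3 / \<eta>\<^sup>2 * M \<le> C * M" unfolding C_def using c3 \<epsilon> D M by (intro mult_right_mono) auto
              moreover have "D * A \<le> C * A" unfolding C_def using c3 \<epsilon> D A \<kappa> by (intro mult_right_mono) auto
              ultimately have "2 * D * \<Lambda> * c3 / \<eta>\<^sup>2 * M + D * A \<le> C * (M + A)" by (simp add: distrib_left)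
              then show ?thesis unfolding add_divide_distrib[symmetric] using \<delta> by (intro divide_right_mono) auto
            qed
            moreover have "H / 8 + H / 4 \<le> H / 2" using H by simp
            ultimately show "H / 8 + D * Q \<le> H / 2 + C * (M + A) / \<delta>^3" by linarith
          qed simp
          finally show ?thesis by (simp add: \<rho>_def \<delta>_def mult.commute)
        qed
      qed
    qed
  qed
qed

text \<open>The one-step estimate is iterated over balls whose gaps shrink geometrically; the gained
  factor 1/2 outweighs the growth of the inverse cube of the gap. The a priori bound K only starts
  the iteration: it is multiplied by a power of 1/2 and disappears in the limit.\<close>

lemma interior_hoelder:
  fixes \<alpha> \<kappa> \<Lambda> :: real
  assumes \<alpha>: "0 < \<alpha>" "\<alpha> < 1" and \<kappa>: "0 < \<kappa>" "\<kappa> \<le> 1" "1 \<le> \<Lambda>"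
  obtains C where "0 \<le> C"
    "\<And>(z::real^'n) T a b h M A K u u1 u2 ut. 0 \<le> M \<Longrightarrow> 0 \<le> A \<Longrightarrow>
      prob \<alpha> \<kappa> \<Lambda> (ball z 1) T a b h M A u u1 u2 ut \<Longrightarrow> hx \<alpha> (ball z 1) T K u2 \<Longrightarrow>
      hx \<alpha> (ball z (1/2)) T (C * (M + A)) u2"
proof (rule schauder_step[OF \<alpha> \<kappa>, where 'n = 'n], goal_cases)
  case (1 C)
  note C = 1(2) and step = 1(3)
  show ?thesis
  \<comment> \<open>32000 = 4 * 20^3: the gap between consecutive radii is (1/20) (9/10)^j, and the
    geometric series below sums to 729/229 < 4.\<close>
  proof (rule that[of "32000 * C"])
    show "0 \<le> 32000 * C" using C by simp
    fix z :: "real^'n" and T a b h M A K u u1 u2 ut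
    assume M: "0 \<le> M" and A: "0 \<le> A" and p: "prob \<alpha> \<kappa> \<Lambda> (ball z 1) T a b h M A u u1 u2 ut"
      and K: "hx \<alpha> (ball z 1) T K u2"
    define r :: "nat \<Rightarrow> real" where "r j = 1 - (1/2) * (9/10)^j" for j
    have r: "0 < r j" "r j \<le> 1" "r j < r (Suc j)" for j
    proof -
      have "(9/10::real)^j \<le> 1" "(0::real) < (9/10)^j" by (auto simp: power_le_one)
      then show "0 < r j" "r j \<le> 1" "r j < r (Suc j)" by (auto simp: r_def)
    qed
    \<comment> \<open>One half of (10/9)^3, the ratio of consecutive contributions of the source
      term.\<close>
    define q where "q = (500/729 :: real)"
    define B where "B = 8000 * C * (M + A)"
    have B: "B \<ge> 0" using C M A by (simp add: B_def)
    have iter: "H > 0 \<Longrightarrow> hx \<alpha> (ball z (r J)) T H u2 \<Longrightarrow> hx \<alpha> (ball z (r 0)) T ((1/2)^J * H + B * (\<Sum>j<J. q^j)) u2" for J H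
    proof (induction J arbitrary: H)
      case 0
      then show ?case by simp
    next
      case (Suc J)
      define H' where "H' = H / 2 + C * (M + A) / (r (Suc J) - r J) ^ 3"
      have pS: "prob \<alpha> \<kappa> \<Lambda> (ball z (r (Suc J))) T a b h M A u u1 u2 ut"
        by (rule prob_subset[OF p subset_ball]) (rule r)
      have 1: "hx \<alpha> (ball z (r J)) T H' u2"
        unfolding H'_def by (rule step[OF r(1) r(3) r(2) M A Suc.prems(1) pS Suc.prems(2)])
      have rd: "r (Suc J) - r J = (1/20) * (9/10)^J" by (simp add: r_def)
      have "0 \<le> C * (M + A) / (r (Suc J) - r J) ^ 3" unfolding rd using C M A by simp
      then have "H' > 0" using Suc.prems(1) by (simp add: H'_def)
      from Suc.IH[OF this 1] have "hx \<alpha> (ball z (r 0)) T ((1/2)^J * H' + B * (\<Sum>j<J. q^j)) u2" .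
      moreover have "(1/2)^J * H' = (1/2)^(Suc J) * H + B * q^J"
      proof -
        have "((9/10::real)^J)^3 = ((9/10)^3)^J" unfolding power_mult[symmetric] by (simp only: mult.commute)
        then have e: "((9/10::real)^J)^3 = (729/1000)^J" by (simp add: power3_eq_cube)
        have gen: "x * (C * (M + A) / ((1/20)^3 * y)) = B * (x / y)" for x y :: real
          by (simp add: B_def power3_eq_cube)
        have "q^J = (1/2)^J / (729/1000)^J" unfolding power_divide[symmetric] q_def by simp
        then have "(1/2)^J * (C * (M + A) / (r (Suc J) - r J) ^ 3) = B * q^J"
          unfolding rd power_mult_distrib e using gen by metis
        then show ?thesis by (simp add: H'_def algebra_simps)
      qed
      ultimately show ?case by (simp add: algebra_simps)
    qed
    have r0: "r 0 = 1/2" by (simp add: r_def)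
    define K' where "K' = max K 1"
    have bound: "hx \<alpha> (ball z (1/2)) T ((1/2)^J * K' + B * 4) u2" for J
    proof -
      have "hx \<alpha> (ball z (r J)) T K' u2"
        by (rule hx_mono[OF hx_subset[OF K subset_ball]]) (auto simp: K'_def r)
      then have "hx \<alpha> (ball z (1/2)) T ((1/2)^J * K' + B * (\<Sum>j<J. q^j)) u2"
        using iter[of K' J] by (simp add: K'_def r0)
      then show ?thesis
      proof (rule hx_mono)
        have "(\<Sum>j<J. q^j) \<le> 4"
        proof -
          have "(\<Sum>j<J. q^j) = (1 - q^J) / (1 - q)" by (simp add: sum_gp_strict q_def)
          also have "\<dots> \<le> 4"
          proof -
            have z: "0 \<le> q^J" and qq: "1 - q = 229/729" by (auto simp: q_def)
            show ?thesis unfolding qq using z by simp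
          qed
          finally show ?thesis .
        qed
        then show "(1/2)^J * K' + B * (\<Sum>j<J. q^j) \<le> (1/2)^J * K' + B * 4" using B by (simp add: mult_left_mono)
      qed
    qed
    show "hx \<alpha> (ball z (1/2)) T (32000 * C * (M + A)) u2"
      unfolding hx_def
    proof (intro ballI)
      fix t x y assume *: "t \<in> {0..T}" "x \<in> ball z (1/2)" "y \<in> ball z (1/2)"
      have "(\<lambda>J. ((1/2)^J * K' + B * 4) * dist x y powr \<alpha>) \<longlonglongrightarrow> (0 * K' + B * 4) * dist x y powr \<alpha>"
        by (intro tendsto_intros LIMSEQ_realpow_zero) auto
      moreover have "norm (u2 x t - u2 y t) \<le> ((1/2)^J * K' + B * 4) * dist x y powr \<alpha>" for J
        using bound[of J] * unfolding hx_def by blast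
      ultimately have "norm (u2 x t - u2 y t) \<le> (0 * K' + B * 4) * dist x y powr \<alpha>"
        by (intro Lim_bounded2) auto
      then show "norm (u2 x t - u2 y t) \<le> 32000 * C * (M + A) * dist x y powr \<alpha>" by (simp add: B_def)
    qed
  qed
qed

section \<open>From the spatial seminorm of the second derivatives to the full interior
  estimate\<close>

lemma holI:
  assumes "\<And>x t. x \<in> S \<Longrightarrow> t \<in> {0..T} \<Longrightarrow> norm (g x t) \<le> K" "hx \<alpha> S T K g"
    and "\<And>x t s. x \<in> S \<Longrightarrow> t \<in> {0..T} \<Longrightarrow> s \<in> {0..T} \<Longrightarrow> norm (g x t - g x s) \<le> K * \<bar>t - s\<bar> powr (\<alpha>/2)"
  shows "hol \<alpha> S T K g"
  unfolding hol_def
proof (intro conjI ballI)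
  fix x y t s assume *: "x \<in> S" "y \<in> S" "t \<in> {0..T}" "s \<in> {0..T}"
  have "norm (g x t - g y s) \<le> norm (g x t - g y t) + norm (g y t - g y s)" using norm_triangle_ineq[of "g x t - g y t" "g y t - g y s"] by simp
  also have "norm (g x t - g y t) \<le> K * dist x y powr \<alpha>" using assms(2) * unfolding hx_def by blast
  also have "norm (g y t - g y s) \<le> K * \<bar>t - s\<bar> powr (\<alpha>/2)" by (rule assms(3)[OF *(2,3,4)])
  finally show "norm (g x t - g y s) \<le> K * (dist x y powr \<alpha> + \<bar>t - s\<bar> powr (\<alpha>/2))" by (simp add: distrib_left)
qed (rule assms(1))

lemma hol_mono: "hol \<alpha> S T K g \<Longrightarrow> K \<le> K' \<Longrightarrow> hol \<alpha> S T K' g"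
  unfolding hol_def by (meson add_nonneg_nonneg mult_right_mono order_trans powr_ge_zero)

lemma hol_hx: "hol \<alpha> S T K g \<Longrightarrow> hx \<alpha> S T K g"
  unfolding hx_def using holD(3) by blast

text \<open>The threshold is (1/16)^2: for smaller gaps R = sqrt |t - s| satisfies 2 R < 1/8, so
  that difference quotients of step R at points of the ball of radius 1/8 stay in the ball of radius
  1/4. For larger gaps a sup bound is already a Hoelder bound.\<close>

lemma large_time_gap:
  assumes "1/256 \<le> (\<tau>::real)" "0 < \<alpha>" "\<alpha> < 1"
  shows "1 \<le> 16 * \<tau> powr (\<alpha>/2)"
proof -
  have "(1/256::real) powr (1/2) \<le> (1/256) powr (\<alpha>/2)" using assms by (intro powr_mono') auto
  also have "\<dots> \<le> \<tau> powr (\<alpha>/2)" using assms by (intro powr_mono2) auto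
  finally have "(1/256::real) powr (1/2) \<le> \<tau> powr (\<alpha>/2)" .
  moreover have "(1/256::real) powr (1/2) = 1/16"
  proof -
    have "sqrt (1/256) = 1/16" by (rule real_sqrt_unique) (auto simp: power2_eq_square)
    then show ?thesis by (simp add: powr_half_sqrt)
  qed
  ultimately show ?thesis by simp
qed

text \<open>Everything follows from the seminorm of the second derivatives on the ball of radius
  1/2. Interpolation on the balls of radius 3/8 and 1/4 bounds the derivatives, the equation bounds
  \<open>ut\<close>, difference quotients with step sqrt |t - s| give regularity in time, and the
  equation once more treats \<open>ut\<close>. The constant is independent of K.\<close>

lemma interior_estimate:
  fixes \<alpha> \<kappa> \<Lambda> :: real
  assumes \<alpha>: "0 < \<alpha>" "\<alpha> < 1" and \<kappa>: "0 < \<kappa>" "\<kappa> \<le> 1" "1 \<le> \<Lambda>"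
  obtains C where "1 \<le> C"
    "\<And>(z::real^'n) T a b h M A K u u1 u2 ut. 0 \<le> M \<Longrightarrow> 0 \<le> A \<Longrightarrow>
      prob \<alpha> \<kappa> \<Lambda> (ball z 1) T a b h M A u u1 u2 ut \<Longrightarrow> hx \<alpha> (ball z 1) T K u2 \<Longrightarrow>
      (\<And>x t. x \<in> ball z 1 \<Longrightarrow> t \<in> {0..T} \<Longrightarrow> transpose (u2 x t) = u2 x t) \<Longrightarrow>
      (\<And>x t. x \<in> ball z 1 \<Longrightarrow> t \<in> {0..T} \<Longrightarrow> \<bar>h x t\<bar> \<le> A) \<Longrightarrow>
      (\<And>x t s. x \<in> ball z 1 \<Longrightarrow> t \<in> {0..T} \<Longrightarrow> s \<in> {0..T} \<Longrightarrow>
         \<bar>h x t - h x s\<bar> \<le> A * \<bar>t - s\<bar> powr (\<alpha>/2) + \<Lambda> * \<bar>u x t - u x s\<bar>) \<Longrightarrow>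
      reg \<alpha> (ball z (1/8)) T (C * (M + A)) u u1 u2 ut"
proof (rule interior_hoelder[OF \<alpha> \<kappa>, where 'n = 'n], goal_cases)
  case (1 C0)
  note C0 = 1(2) and IH = 1(3)
  define n where "n = real CARD('n)"
  have n: "n \<ge> 1" unfolding n_def by (simp add: Suc_leI)
  \<comment> \<open>\<open>k2\<close>, \<open>k1\<close>, \<open>kt\<close> belong to the sup bounds
    of u2, u1, ut, \<open>kG\<close> to the spatial seminorm of ut, and \<open>h2\<close>,
    \<open>h1\<close>, \<open>h0\<close>, \<open>ht\<close> to the seminorms in time; all are to be
    multiplied by M + A.\<close>
  define k2 where "k2 = n * n * (C0 + 1024)"
  define k1 where "k1 = n * (32 + k2)"
  define kt where "kt = \<Lambda> * (k2 + k1) + 1"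
  define kG where "kG = 2 * \<Lambda> * C0 + 2 * \<Lambda> * (k1 + k2) + 1"
  define h2 where "h2 = n * n * (4 * C0 + 2 * kG) + 32 * k2"
  define h1 where "h1 = n * (2 * k2 + 2 * kt) + 32 * k1"
  define h0 where "h0 = kt + 2"
  define ht where "ht = \<Lambda> * (h2 + h1 + h0) + 1"
  have pos: "0 \<le> k2" "0 \<le> k1" "0 \<le> kt" "0 \<le> kG" "0 \<le> h2" "0 \<le> h1" "0 \<le> h0" "0 \<le> ht"
  proof -
    show k2: "0 \<le> k2" using n C0 by (simp add: k2_def)
    show k1: "0 \<le> k1" using n k2 by (simp add: k1_def)
    show kt: "0 \<le> kt" using k1 k2 \<kappa> by (simp add: kt_def)
    show kG: "0 \<le> kG" using k1 k2 \<kappa> C0 by (simp add: kG_def)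
    show h2: "0 \<le> h2" using kG n k2 C0 by (simp add: h2_def)
    show h1: "0 \<le> h1" using kt n k2 k1 by (simp add: h1_def)
    show h0: "0 \<le> h0" using kt by (simp add: h0_def)
    show "0 \<le> ht" using h0 h1 h2 \<kappa> by (simp add: ht_def)
  qed
  define C where "C = 1 + C0 + k2 + k1 + kt + kG + h2 + h1 + h0 + ht"
  have CC: "1 \<le> C" "C0 \<le> C" "k2 \<le> C" "k1 \<le> C" "kt \<le> C" "kG \<le> C" "h2 \<le> C" "h1 \<le> C" "h0 \<le> C" "ht \<le> C"
    using pos C0 unfolding C_def by linarith+
  show ?thesis
  proof (rule that[OF CC(1)])
    fix z :: "real^'n" and T a b h M A K u u1 u2 ut
    assume M: "0 \<le> M" and A: "0 \<le> A" and p: "prob \<alpha> \<kappa> \<Lambda> (ball z 1) T a b h M A u u1 u2 ut"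
      and hxK: "hx \<alpha> (ball z 1) T K u2"
      and sym: "\<And>x t. x \<in> ball z 1 \<Longrightarrow> t \<in> {0..T} \<Longrightarrow> transpose (u2 x t) = u2 x t"
      and hA: "\<And>x t. x \<in> ball z 1 \<Longrightarrow> t \<in> {0..T} \<Longrightarrow> \<bar>h x t\<bar> \<le> A"
      and ht: "\<And>x t s. x \<in> ball z 1 \<Longrightarrow> t \<in> {0..T} \<Longrightarrow> s \<in> {0..T} \<Longrightarrow>
         \<bar>h x t - h x s\<bar> \<le> A * \<bar>t - s\<bar> powr (\<alpha>/2) + \<Lambda> * \<bar>u x t - u x s\<bar>"
    define B where "B = M + A"
    have B: "0 \<le> B" "M \<le> B" "A \<le> B" using M A by (auto simp: B_def)
    have sub: "ball z (1/8) \<subseteq> ball z (1/4)" "ball z (1/4) \<subseteq> ball z (3/8)" "ball z (3/8) \<subseteq> ball z (1/2)" "ball z (1/2) \<subseteq> ball z 1"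
      by (auto intro!: subset_ball)
    note q = p[unfolded prob_def]
    have d: "drv (ball z 1) T u u1 u2 ut" using q by blast
    have H: "hx \<alpha> (ball z (1/2)) T (C0 * B) u2" unfolding B_def by (rule IH[OF M A p hxK])
    have uM: "\<bar>u x t\<bar> \<le> M" if "x \<in> ball z 1" "t \<in> {0..T}" for x t using q that by blast
    have near: "cball w e \<subseteq> ball z r" if "w \<in> ball z r'" "r' + e \<le> r" for w e r r'
    proof
      fix v assume "v \<in> cball w e"
      then have "dist z v < r' + e" using that(1) dist_triangle[of z v w] by simp
      then show "v \<in> ball z r" using that(2) by simp
    qed
    have M2: "norm (u2 w t) \<le> k2 * B" if w: "w \<in> ball z (3/8)" and t: "t \<in> {0..T}" for w t
    proof -
      have cb: "cball w (2 * (1/16)) \<subseteq> ball z (1/2)" by (rule near[OF w]) simp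
      have "norm (u2 w t) \<le> n * n * ((2*(1/16)) powr \<alpha> * (C0 * B) + 4 * M / (1/16)\<^sup>2)"
        unfolding n_def
      proof (rule interpolation_second[OF drv_subset[OF d sub(4)] cb t _ \<alpha>(1)])
        show "norm (u2 x t - u2 z' t) \<le> C0 * B * dist x z' powr \<alpha>" if "x \<in> ball z (1/2)" "z' \<in> ball z (1/2)" for x z'
          using H t that unfolding hx_def by blast
        show "\<bar>u x t\<bar> \<le> M" if "x \<in> ball z (1/2)" for x using uM sub(4) t that by blast
      qed (use C0 B in auto)
      also have "\<dots> \<le> n * n * (1 * (C0 * B) + 1024 * B)"
      proof -
        have "(2*(1/16)) powr \<alpha> \<le> (1::real)" using \<alpha> by (intro powr_le1) auto
        moreover have "4 * M / (1/16)\<^sup>2 \<le> 1024 * B" using B by (simp add: power2_eq_square)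
        ultimately show ?thesis using n C0 B by (intro mult_left_mono add_mono mult_right_mono) auto
      qed
      also have "\<dots> = k2 * B" by (simp add: k2_def algebra_simps)
      finally show ?thesis .
    qed
    have M1: "norm (u1 w t) \<le> k1 * B" if w: "w \<in> ball z (1/4)" and t: "t \<in> {0..T}" for w t
    proof -
      have cb: "cball w (1/16) \<subseteq> ball z 1" and cb2: "cball w (1/16) \<subseteq> ball z (3/8)" by (rule near[OF w], simp)+
      have "norm (u1 w t) \<le> n * (2 * M / (1/16) + (1/16) * (k2 * B))"
        unfolding n_def
      proof (rule interpolation_first[OF d cb t])
        show "norm (u2 x t) \<le> k2 * B" if "x \<in> cball w (1/16)" for x using M2[OF _ t] cb2 that by blast
        show "\<bar>u x t\<bar> \<le> M" if "x \<in> ball z 1" for x using uM t that by blast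
      qed simp
      also have "\<dots> \<le> n * (32 * B + k2 * B)" using n B pos by (intro mult_left_mono add_mono) auto
      also have "\<dots> = k1 * B" by (simp add: k1_def algebra_simps)
      finally show ?thesis .
    qed
    have M2': "norm (u2 w t) \<le> k2 * B" if "w \<in> ball z (1/4)" "t \<in> {0..T}" for w t using M2 sub that by blast
    have in1: "w \<in> ball z 1" if "w \<in> ball z (1/4)" for w using sub that by blast
    have ab: "norm (a x) \<le> \<Lambda>" "norm (b x) \<le> \<Lambda>" if "x \<in> ball z 1" for x using q that unfolding coef_def by blast+
    have eq: "ut x t = a x \<bullet> u2 x t + b x \<bullet> u1 x t + h x t" if "x \<in> ball z 1" "t \<in> {0..T}" for x t using q that by blast
    have ip: "\<bar>v \<bullet> w\<bar> \<le> \<Lambda> * c" if "norm v \<le> \<Lambda>" "norm w \<le> c" for v w :: "'x::euclidean_space" and c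
    proof -
      have "\<bar>v \<bullet> w\<bar> \<le> norm v * norm w" by (rule Cauchy_Schwarz_ineq2)
      also have "\<dots> \<le> \<Lambda> * c" using that \<kappa> by (intro mult_mono) auto
      finally show ?thesis .
    qed
    have Mt: "\<bar>ut x t\<bar> \<le> kt * B" if x: "x \<in> ball z (1/4)" and t: "t \<in> {0..T}" for x t
    proof -
      have "\<bar>ut x t\<bar> \<le> \<Lambda> * (k2 * B) + \<Lambda> * (k1 * B) + B"
        unfolding eq[OF in1[OF x] t] using ip[OF ab(1)[OF in1[OF x]] M2'[OF x t]] ip[OF ab(2)[OF in1[OF x]] M1[OF x t]]
          hA[OF in1[OF x] t] B by linarith
      then show ?thesis by (simp add: kt_def algebra_simps)
    qed
    have G: "\<bar>ut x t - ut y t\<bar> \<le> (kG * B) * dist x y powr \<alpha>" if x: "x \<in> ball z (1/4)" and y: "y \<in> ball z (1/4)" and t: "t \<in> {0..T}" for x y t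
    proof -
      have p4: "prob \<alpha> \<kappa> \<Lambda> (ball z (1/4)) T a b h M A u u1 u2 ut"
        by (rule prob_subset[OF p]) (use sub in blast)
      have H4: "hx \<alpha> (ball z (1/4)) T (C0 * B) u2" by (rule hx_subset[OF H]) (use sub in blast)
      have z4: "z \<in> ball z (1/4)" by simp
      have 1: "\<bar>(ut x t - a z \<bullet> u2 x t) - (ut y t - a z \<bullet> u2 y t)\<bar> \<le>
           (\<Lambda> * 1 powr \<alpha> * (C0 * B) + 2 * \<Lambda> * (k1 * B + k2 * B) + A) * dist x y powr \<alpha>"
      proof (rule frozen_source_hoelder[OF p4 \<kappa>(3) \<alpha> convex_ball z4 _ _ H4 _ M1 M2' x y t])
        show "dist y z \<le> 1" if "y \<in> ball z (1/4)" for y using that by (simp add: dist_commute)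
        show "dist y w \<le> 1" if "y \<in> ball z (1/4)" "w \<in> ball z (1/4)" for y w
          using that dist_triangle[of y w z] by (simp add: dist_commute)
      qed (use C0 B in auto)
      have 2: "\<bar>a z \<bullet> (u2 x t - u2 y t)\<bar> \<le> \<Lambda> * (C0 * B * dist x y powr \<alpha>)"
        by (rule ip[OF ab(1)]) (use H4 x y t in \<open>auto simp: hx_def\<close>)
      have "\<bar>ut x t - ut y t\<bar> \<le> (\<Lambda> * 1 powr \<alpha> * (C0 * B) + 2 * \<Lambda> * (k1 * B + k2 * B) + A) * dist x y powr \<alpha>
          + \<Lambda> * (C0 * B * dist x y powr \<alpha>)"
        using 1 2 by (simp add: inner_diff_right)
      also have "\<dots> = (2 * \<Lambda> * (C0 * B) + 2 * \<Lambda> * (k1 * B + k2 * B) + A) * dist x y powr \<alpha>" by (simp add: algebra_simps)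
      also have "\<dots> \<le> (2 * \<Lambda> * (C0 * B) + 2 * \<Lambda> * (k1 * B + k2 * B) + B) * dist x y powr \<alpha>"
        using B by (intro mult_right_mono) auto
      finally show ?thesis by (simp add: kG_def algebra_simps)
    qed
    have far: "norm (v - w) \<le> h * B * \<tau> powr (\<alpha>/2)" if "norm v \<le> k * B" "norm w \<le> k * B" "32 * k \<le> h" "1/256 \<le> \<tau>"
      for v w :: "'x::real_normed_vector" and k h \<tau>
    proof -
      have "norm (v - w) \<le> 2 * (k * B)" using norm_triangle_ineq4[of v w] that by linarith
      also have "\<dots> \<le> 2 * (k * B) * (16 * \<tau> powr (\<alpha>/2))"
        using mult_left_mono[OF large_time_gap[OF that(4) \<alpha>], of "2 * (k * B)"] order_trans[OF norm_ge_zero that(1)] by simp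
      also have "\<dots> = 32 * k * (B * \<tau> powr (\<alpha>/2))" by simp
      also have "\<dots> \<le> h * (B * \<tau> powr (\<alpha>/2))" using that(3) B by (intro mult_right_mono) auto
      finally show ?thesis by simp
    qed
    have T2: "norm (u2 x t - u2 x s) \<le> (h2 * B) * \<bar>t - s\<bar> powr (\<alpha>/2)"
      if x: "x \<in> ball z (1/8)" and t: "t \<in> {0..T}" and s: "s \<in> {0..T}" for x t s
    proof (cases "1/256 \<le> \<bar>t - s\<bar>")
      case True
      have x4: "x \<in> ball z (1/4)" using x sub by blast
      show ?thesis by (rule far[OF M2'[OF x4 t] M2'[OF x4 s] _ True]) (use pos n C0 in \<open>auto simp: h2_def\<close>)
    next
      case False
      show ?thesis
      proof (cases "t = s")
        case True
        then show ?thesis by simp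
      next
        case ts: False
        \<comment> \<open>The parabolic scale: it balances the error R powr \<alpha> of the
          difference quotient against its change in time, |t - s| / R^2 times R powr
          \<alpha>.\<close>
        define R where "R = sqrt \<bar>t - s\<bar>"
        have R: "0 < R" "R\<^sup>2 = \<bar>t - s\<bar>" using ts by (auto simp: R_def)
        have "R < 1/16" using False unfolding R_def by (intro real_less_lsqrt) (auto simp: power2_eq_square)
        then have cb: "cball x (2*R) \<subseteq> ball z (1/4)" by (intro near[OF x]) simp
        have Ra: "R powr \<alpha> = \<bar>t - s\<bar> powr (\<alpha>/2)" using ts by (simp add: R_def powr_half_sqrt[symmetric] powr_powr)
        have "norm (u2 x t - u2 x s) \<le> n * n * ((4 * (C0 * B) + 2 * (kG * B)) * \<bar>t - s\<bar> powr (\<alpha>/2))"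
          unfolding n_def
        proof (rule matrix_norm_le)
          fix i j
          have "\<bar>u2 x t $ i $ j - u2 x s $ i $ j\<bar> \<le> 2 * (2*R) powr \<alpha> * (C0 * B) + 2 * R powr \<alpha> * (kG * B) * \<bar>t - s\<bar> / R\<^sup>2"
          proof (rule time_oscillation[OF drv_subset[OF d] cb t s R(1) \<alpha>(1)])
            show "ball z (1/4) \<subseteq> ball z 1" using sub by blast
            show "norm (u2 x t - u2 z' t) \<le> C0 * B * dist x z' powr \<alpha>" if "t \<in> {0..T}" "x \<in> ball z (1/4)" "z' \<in> ball z (1/4)" for x z' t
              using H sub that unfolding hx_def by blast
            show "\<bar>ut x t - ut z' t\<bar> \<le> kG * B * dist x z' powr \<alpha>" if "t \<in> {0..T}" "x \<in> ball z (1/4)" "z' \<in> ball z (1/4)" for x z' t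
              by (rule G[OF that(2,3,1)])
          qed (use C0 B in auto)
          also have "\<dots> = 2 * (2*R) powr \<alpha> * (C0 * B) + 2 * R powr \<alpha> * (kG * B)" using ts by (simp add: R(2))
          also have "\<dots> \<le> 2 * (2 * R powr \<alpha>) * (C0 * B) + 2 * R powr \<alpha> * (kG * B)"
            using powr_scale_le[of 2 R \<alpha>] \<alpha> R C0 B by (intro add_right_mono mult_right_mono mult_left_mono) auto
          finally show "\<bar>(u2 x t - u2 x s) $ i $ j\<bar> \<le> (4 * (C0 * B) + 2 * (kG * B)) * \<bar>t - s\<bar> powr (\<alpha>/2)"
            by (simp add: Ra algebra_simps)
        qed
        also have "\<dots> = (n * n * (4 * C0 + 2 * kG) * B) * \<bar>t - s\<bar> powr (\<alpha>/2)" by (simp add: algebra_simps)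
        also have "\<dots> \<le> (h2 * B) * \<bar>t - s\<bar> powr (\<alpha>/2)"
          using pos B by (intro mult_right_mono) (auto simp: h2_def)
        finally show ?thesis .
      qed
    qed
    have Lt: "\<bar>u x t - u x s\<bar> \<le> (kt * B) * \<bar>t - s\<bar>" if x: "x \<in> ball z (1/4)" and t: "t \<in> {0..T}" and s: "s \<in> {0..T}" for x t s
      by (rule time_lipschitz[OF drvD(3)[OF d in1[OF x]] Mt[OF x] s t])
    have T1: "norm (u1 x t - u1 x s) \<le> (h1 * B) * \<bar>t - s\<bar> powr (\<alpha>/2)"
      if x: "x \<in> ball z (1/8)" and t: "t \<in> {0..T}" and s: "s \<in> {0..T}" for x t s
    proof (cases "1/256 \<le> \<bar>t - s\<bar>")
      case True
      have x4: "x \<in> ball z (1/4)" using x sub by blast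
      show ?thesis by (rule far[OF M1[OF x4 t] M1[OF x4 s] _ True]) (use pos n C0 in \<open>auto simp: h1_def\<close>)
    next
      case False
      show ?thesis
      proof (cases "t = s")
        case True
        then show ?thesis by simp
      next
        case ts: False
        define R where "R = sqrt \<bar>t - s\<bar>"
        have R: "0 < R" "R\<^sup>2 = \<bar>t - s\<bar>" using ts by (auto simp: R_def)
        have R16: "R < 1/16" using False unfolding R_def by (intro real_less_lsqrt) (auto simp: power2_eq_square)
        then have cb: "cball x R \<subseteq> ball z (1/4)" by (intro near[OF x]) simp
        have Ra: "R powr \<alpha> = \<bar>t - s\<bar> powr (\<alpha>/2)" using ts by (simp add: R_def powr_half_sqrt[symmetric] powr_powr)
        have RR: "R \<le> R powr \<alpha>" using R R16 \<alpha> by (intro le_powr_self) auto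
        have x4: "x \<in> ball z (1/4)" using x sub by blast
        have "norm (u1 x t - u1 x s) \<le> n * ((2 * k2 + 2 * kt) * B * R)"
          unfolding n_def
        proof (rule vector_norm_le)
          fix i :: 'n
          have inb: "x + r *\<^sub>R axis i R \<in> cball x R" if "r \<in> {0..1}" for r
          proof (rule add_in_cball)
            have "\<bar>r\<bar> * R \<le> 1 * R" using that R by (intro mult_right_mono) auto
            then show "norm (r *\<^sub>R axis i R :: real^'n) \<le> R" using R by simp
          qed
          have e1: "x + axis i R \<in> ball z (1/4)" using inb[of 1] cb by auto
          \<comment> \<open>At the same scale a first difference of \<open>u\<close> reproduces the
            gradient up to an error of order R, and its change in time is controlled by the
            Lipschitz bound in time of \<open>u\<close>.\<close>
          have diff: "\<bar>R * u1 x \<sigma> $ i - (u (x + axis i R) \<sigma> - u x \<sigma>)\<bar> \<le> R * (k2 * B * R)" if \<sigma>: "\<sigma> \<in> {0..T}" for \<sigma>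
          proof -
            obtain r where r: "r \<in> {0..1}" "u (x + axis i R) \<sigma> - u x \<sigma> = u1 (x + r *\<^sub>R axis i R) \<sigma> \<bullet> axis i R"
              using first_difference_mvt[of "\<lambda>y. u y \<sigma>" "\<lambda>y. u1 y \<sigma>" x "axis i R", OF drvD(1)[OF d in1[OF subsetD[OF cb inb]] \<sigma>]] by blast
            have "\<bar>u1 x \<sigma> $ i - u1 (x + r *\<^sub>R axis i R) \<sigma> $ i\<bar> \<le> norm (u1 x \<sigma> - u1 (x + r *\<^sub>R axis i R) \<sigma>)"
              using component_le_norm_cart[of "u1 x \<sigma> - u1 (x + r *\<^sub>R axis i R) \<sigma>" i] by simp
            also have "\<dots> \<le> k2 * B * dist x (x + r *\<^sub>R axis i R)"
              by (rule gradient_lipschitz[OF drv_subset[OF d] \<sigma> convex_ball M2'[OF _ \<sigma>] x4 subsetD[OF cb inb[OF r(1)]]]) (use sub in blast)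
            also have "\<dots> \<le> k2 * B * R" using inb[OF r(1)] pos B by (intro mult_left_mono) auto
            finally have "R * \<bar>u1 x \<sigma> $ i - u1 (x + r *\<^sub>R axis i R) \<sigma> $ i\<bar> \<le> R * (k2 * B * R)" using R by (intro mult_left_mono) auto
            moreover have "\<bar>R * u1 x \<sigma> $ i - (u (x + axis i R) \<sigma> - u x \<sigma>)\<bar> = R * \<bar>u1 x \<sigma> $ i - u1 (x + r *\<^sub>R axis i R) \<sigma> $ i\<bar>"
            proof -
              have "R * u1 x \<sigma> $ i - (u (x + axis i R) \<sigma> - u x \<sigma>) = R * (u1 x \<sigma> $ i - u1 (x + r *\<^sub>R axis i R) \<sigma> $ i)"
                unfolding r(2) by (simp add: inner_axis algebra_simps)
              then show ?thesis using R by (simp add: abs_mult)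
            qed
            ultimately show ?thesis by simp
          qed
          have "\<bar>R * u1 x t $ i - R * u1 x s $ i\<bar> \<le> 2 * (R * (k2 * B * R)) + 2 * (kt * B * \<bar>t - s\<bar>)"
            using diff[OF t] diff[OF s] Lt[OF e1 t s] Lt[OF x4 t s] by linarith
          also have "\<dots> = R * ((2 * k2 + 2 * kt) * B * R)" by (simp add: R(2)[symmetric] power2_eq_square algebra_simps)
          finally have "R * \<bar>u1 x t $ i - u1 x s $ i\<bar> \<le> R * ((2 * k2 + 2 * kt) * B * R)"
            using R by (simp add: right_diff_distrib[symmetric] abs_mult)
          then show "\<bar>(u1 x t - u1 x s) $ i\<bar> \<le> (2 * k2 + 2 * kt) * B * R" using R by simp
        qed
        also have "\<dots> \<le> n * ((2 * k2 + 2 * kt) * B * R powr \<alpha>)"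
          using n pos B RR by (intro mult_left_mono) auto
        also have "\<dots> = (n * (2 * k2 + 2 * kt) * B) * \<bar>t - s\<bar> powr (\<alpha>/2)" by (simp add: Ra)
        also have "\<dots> \<le> (h1 * B) * \<bar>t - s\<bar> powr (\<alpha>/2)"
          using pos B by (intro mult_right_mono) (auto simp: h1_def)
        finally show ?thesis .
      qed
    qed
    have T0: "\<bar>u x t - u x s\<bar> \<le> (h0 * B) * \<bar>t - s\<bar> powr (\<alpha>/2)" if x: "x \<in> ball z (1/8)" and t: "t \<in> {0..T}" and s: "s \<in> {0..T}" for x t s
    proof (cases "\<bar>t - s\<bar> \<le> 1")
      case True
      have x4: "x \<in> ball z (1/4)" using x sub by blast
      have "\<bar>t - s\<bar> \<le> \<bar>t - s\<bar> powr (\<alpha>/2)" using True \<alpha> by (intro le_powr_self) auto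
      then have "(kt * B) * \<bar>t - s\<bar> \<le> (kt * B) * \<bar>t - s\<bar> powr (\<alpha>/2)" using pos B by (intro mult_left_mono) auto
      also have "\<dots> \<le> (h0 * B) * \<bar>t - s\<bar> powr (\<alpha>/2)" using pos B by (intro mult_right_mono) (auto simp: h0_def)
      finally show ?thesis using Lt[OF x4 t s] by linarith
    next
      case False
      have x1: "x \<in> ball z 1" using x sub by blast
      have "1 \<le> \<bar>t - s\<bar> powr (\<alpha>/2)" using False \<alpha> by (intro ge_one_powr_ge_zero) auto
      then have "2 * B * 1 \<le> 2 * B * \<bar>t - s\<bar> powr (\<alpha>/2)" using B by (intro mult_left_mono) auto
      also have "\<dots> \<le> (h0 * B) * \<bar>t - s\<bar> powr (\<alpha>/2)" using pos B by (intro mult_right_mono) (auto simp: h0_def)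
      finally show ?thesis using uM[OF x1 t] uM[OF x1 s] B by linarith
    qed
    have Tt: "\<bar>ut x t - ut x s\<bar> \<le> (ht * B) * \<bar>t - s\<bar> powr (\<alpha>/2)" if x: "x \<in> ball z (1/8)" and t: "t \<in> {0..T}" and s: "s \<in> {0..T}" for x t s
    proof -
      have x1: "x \<in> ball z 1" using x sub by blast
      let ?p = "\<bar>t - s\<bar> powr (\<alpha>/2)"
      have "ut x t - ut x s = a x \<bullet> (u2 x t - u2 x s) + b x \<bullet> (u1 x t - u1 x s) + (h x t - h x s)"
        unfolding eq[OF x1 t] eq[OF x1 s] by (simp add: inner_diff_right)
      moreover have "\<bar>a x \<bullet> (u2 x t - u2 x s)\<bar> \<le> \<Lambda> * (h2 * B * ?p)" by (rule ip[OF ab(1)[OF x1] T2[OF x t s]])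
      moreover have "\<bar>b x \<bullet> (u1 x t - u1 x s)\<bar> \<le> \<Lambda> * (h1 * B * ?p)" by (rule ip[OF ab(2)[OF x1] T1[OF x t s]])
      moreover have "\<Lambda> * \<bar>u x t - u x s\<bar> \<le> \<Lambda> * (h0 * B * ?p)" using T0[OF x t s] \<kappa> by (intro mult_left_mono) auto
      moreover have "A * ?p \<le> B * ?p" using B by (intro mult_right_mono) auto
      ultimately have "\<bar>ut x t - ut x s\<bar> \<le> \<Lambda> * (h2 * B * ?p) + \<Lambda> * (h1 * B * ?p) + (B * ?p + \<Lambda> * (h0 * B * ?p))"
        using ht[OF x1 t s] by linarith
      also have "\<dots> = (ht * B) * ?p" by (simp add: ht_def algebra_simps)
      finally show ?thesis .
    qed
    let ?S = "ball z (1/8)" and ?K = "C * (M + A)"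
    have up: "x * B \<le> ?K" if "x \<le> C" for x using that B unfolding B_def by (intro mult_right_mono) auto
    have up': "x * B * y \<le> ?K * y" if "x \<le> C" "0 \<le> y" for x y using up[OF that(1)] that(2) by (intro mult_right_mono) auto
    have s8: "?S \<subseteq> ball z 1" "?S \<subseteq> ball z (1/2)" using sub by blast+
    have i4: "x \<in> ball z (1/4)" if "x \<in> ?S" for x using sub that by blast
    have dd: "dist x y \<le> dist x y powr \<alpha>" if "x \<in> ?S" "y \<in> ?S" for x y
    proof (rule le_powr_self)
      show "dist x y \<le> 1" using that dist_triangle[of x y z] by (simp add: dist_commute)
    qed (use \<alpha> in auto)
    show "reg \<alpha> (?S) T ?K u u1 u2 ut"
      unfolding reg_def
    proof (intro conjI ballI)
      show "drv (?S) T u u1 u2 ut" by (rule drv_subset[OF d s8(1)])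
      show "u x 0 = 0" if "x \<in> ?S" for x using q s8 that by blast
      show "transpose (u2 x t) = u2 x t" if "x \<in> ?S" "t \<in> {0..T}" for x t using sym s8 that by blast
      show "hol \<alpha> (?S) T ?K u2"
      proof (rule holI)
        show "norm (u2 x t) \<le> ?K" if "x \<in> ?S" "t \<in> {0..T}" for x t
          using M2'[OF i4[OF that(1)] that(2)] up[OF CC(3)] by linarith
        show "hx \<alpha> (?S) T ?K u2"
          by (rule hx_mono[OF hx_subset[OF H s8(2)] up[OF CC(2)]])
        show "norm (u2 x t - u2 x s) \<le> ?K * \<bar>t - s\<bar> powr (\<alpha>/2)" if "x \<in> ?S" "t \<in> {0..T}" "s \<in> {0..T}" for x t s
          by (rule order_trans[OF T2[OF that] up'[OF CC(7)]]) simp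
      qed
      show "hol \<alpha> (?S) T ?K u1"
      proof (rule holI)
        show "norm (u1 x t) \<le> ?K" if "x \<in> ?S" "t \<in> {0..T}" for x t
          using M1[OF i4[OF that(1)] that(2)] up[OF CC(4)] by linarith
        show "hx \<alpha> (?S) T ?K u1"
          unfolding hx_def
        proof (intro ballI)
          fix t x y assume *: "t \<in> {0..T}" "x \<in> ?S" "y \<in> ?S"
          have "norm (u1 x t - u1 y t) \<le> k2 * B * dist x y"
            by (rule gradient_lipschitz[OF drv_subset[OF d s8(1)] *(1) convex_ball M2'[OF i4 *(1)] *(2,3)])
          also have "\<dots> \<le> k2 * B * dist x y powr \<alpha>" using dd[OF *(2,3)] pos B by (intro mult_left_mono) auto
          also have "\<dots> \<le> ?K * dist x y powr \<alpha>" by (rule up'[OF CC(3)]) simp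
          finally show "norm (u1 x t - u1 y t) \<le> ?K * dist x y powr \<alpha>" .
        qed
        show "norm (u1 x t - u1 x s) \<le> ?K * \<bar>t - s\<bar> powr (\<alpha>/2)" if "x \<in> ?S" "t \<in> {0..T}" "s \<in> {0..T}" for x t s
          by (rule order_trans[OF T1[OF that] up'[OF CC(8)]]) simp
      qed
      show "hol \<alpha> (?S) T ?K u"
      proof (rule holI)
        show "norm (u x t) \<le> ?K" if "x \<in> ?S" "t \<in> {0..T}" for x t
          using uM[of x t] s8 that up[OF CC(1)] B by auto
        show "hx \<alpha> (?S) T ?K u"
          unfolding hx_def
        proof (intro ballI)
          fix t x y assume *: "t \<in> {0..T}" "x \<in> ?S" "y \<in> ?S"
          have "\<bar>u x t - u y t\<bar> \<le> k1 * B * dist x y"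
            by (rule function_lipschitz[OF drv_subset[OF d s8(1)] *(1) convex_ball M1[OF i4 *(1)] *(2,3)])
          also have "\<dots> \<le> k1 * B * dist x y powr \<alpha>" using dd[OF *(2,3)] pos B by (intro mult_left_mono) auto
          also have "\<dots> \<le> ?K * dist x y powr \<alpha>" by (rule up'[OF CC(4)]) simp
          finally show "norm (u x t - u y t) \<le> ?K * dist x y powr \<alpha>" by simp
        qed
        show "norm (u x t - u x s) \<le> ?K * \<bar>t - s\<bar> powr (\<alpha>/2)" if "x \<in> ?S" "t \<in> {0..T}" "s \<in> {0..T}" for x t s
          using order_trans[OF T0[OF that] up'[OF CC(9)]] by simp
      qed
      show "hol \<alpha> (?S) T ?K ut"
      proof (rule holI)
        show "norm (ut x t) \<le> ?K" if "x \<in> ?S" "t \<in> {0..T}" for x t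
          using Mt[OF i4[OF that(1)] that(2)] up[OF CC(5)] by simp
        show "hx \<alpha> (?S) T ?K ut"
          unfolding hx_def
        proof (intro ballI)
          fix t x y assume *: "t \<in> {0..T}" "x \<in> ?S" "y \<in> ?S"
          have "\<bar>ut x t - ut y t\<bar> \<le> ?K * dist x y powr \<alpha>"
            by (rule order_trans[OF G[OF i4[OF *(2)] i4[OF *(3)] *(1)] up'[OF CC(6)]]) simp
          then show "norm (ut x t - ut y t) \<le> ?K * dist x y powr \<alpha>" by simp
        qed
        show "norm (ut x t - ut x s) \<le> ?K * \<bar>t - s\<bar> powr (\<alpha>/2)" if "x \<in> ?S" "t \<in> {0..T}" "s \<in> {0..T}" for x t s
          using order_trans[OF Tt[OF that] up'[OF CC(10)]] by simp
      qed
    qed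
  qed
qed

section \<open>Limits of regular functions, compactness and the estimate on the whole space\<close>

lemma tendsto_norm_le:
  fixes f :: "'i \<Rightarrow> 'b::real_normed_vector"
  assumes "F \<noteq> bot" "(f \<longlongrightarrow> l) F" "eventually (\<lambda>k. norm (f k) \<le> c) F"
  shows "norm l \<le> c"
  by (rule tendsto_upperbound[OF tendsto_norm[OF assms(2)] assms(3,1)])

lemma has_derivative_from_bound:
  fixes f :: "'a::real_normed_vector \<Rightarrow> 'b::real_normed_vector"
  assumes D: "bounded_linear D" and "0 < \<beta>" "0 \<le> K"
    and bound: "\<And>y. y \<in> U \<Longrightarrow> norm (f y - f x - D (y - x)) \<le> K * norm (y - x) powr \<beta> * norm (y - x)"
  shows "(f has_derivative D) (at x within U)"
  unfolding has_derivative_within_alt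
proof (intro conjI allI impI)
  fix e :: real assume e: "e > 0"
  obtain d where d: "0 < d" "d \<le> 1" "K * d powr \<beta> \<le> e" using powr_small[OF \<open>0 \<le> K\<close> e \<open>0 < \<beta>\<close>] by blast
  show "\<exists>d>0. \<forall>y\<in>U. norm (y - x) < d \<longrightarrow> norm (f y - f x - D (y - x)) \<le> e * norm (y - x)"
  proof (intro exI[of _ d] conjI ballI impI)
    fix y assume y: "y \<in> U" "norm (y - x) < d"
    have "norm (f y - f x - D (y - x)) \<le> K * norm (y - x) powr \<beta> * norm (y - x)" using bound y by simp
    also have "\<dots> \<le> e * norm (y - x)"
    proof (rule mult_right_mono)
      have "K * norm (y - x) powr \<beta> \<le> K * d powr \<beta>" using y assms by (intro mult_left_mono powr_mono2) auto
      then show "K * norm (y - x) powr \<beta> \<le> e" using d by linarith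
    qed simp
    finally show "norm (f y - f x - D (y - x)) \<le> e * norm (y - x)" .
  qed (use d assms in auto)
qed (rule D)

lemma taylor_bound:
  fixes g :: "'a::real_normed_vector \<Rightarrow> 'b::real_normed_vector"
  assumes "convex U" and d: "\<And>y. y \<in> U \<Longrightarrow> (g has_derivative D y) (at y within U)"
    and H: "\<And>y h. y \<in> U \<Longrightarrow> norm (D y h - D x h) \<le> K * dist y x powr \<beta> * norm h" and xy: "x \<in> U" "y \<in> U"
    and "0 \<le> K" "0 < \<beta>"
  shows "norm (g y - g x - D x (y - x)) \<le> K * norm (y - x) powr \<beta> * norm (y - x)"
proof -
  have seg: "x + t *\<^sub>R (y - x) \<in> U" if "t \<in> {0..1}" for t
    using convexD_alt[OF \<open>convex U\<close> xy, of t] that by (simp add: algebra_simps)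
  define S where "S = (\<lambda>t. x + t *\<^sub>R (y - x)) ` {0..1}"
  have SU: "S \<subseteq> U" using seg by (auto simp: S_def)
  have "norm (g y - g x - D x (y - x)) \<le> norm (y - x) * (K * norm (y - x) powr \<beta>)"
  proof (rule differentiable_bound_linearization[where S = S and f' = D])
    show "x + t *\<^sub>R (y - x) \<in> S" if "t \<in> {0..1}" for t using that by (auto simp: S_def)
    show "(g has_derivative D z) (at z within S)" if "z \<in> S" for z
      using has_derivative_subset[OF d SU] SU that by blast
    show "x \<in> S" unfolding S_def by (rule image_eqI[of _ _ 0]) auto
    fix z assume z: "z \<in> S"
    then obtain t where t: "t \<in> {0..1}" "z = x + t *\<^sub>R (y - x)" by (auto simp: S_def)
    show "onorm (D z - D x) \<le> K * norm (y - x) powr \<beta>"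
    proof (rule onorm_bound)
      fix h
      have "norm (D z h - D x h) \<le> K * dist z x powr \<beta> * norm h" using H SU z by blast
      also have "\<dots> \<le> K * norm (y - x) powr \<beta> * norm h"
        using t assms by (intro mult_right_mono mult_left_mono powr_mono2) (auto simp: dist_norm mult_left_le_one_le)
      finally show "norm ((D z - D x) h) \<le> K * norm (y - x) powr \<beta> * norm h" by (simp add: fun_diff_def)
    qed (use assms in simp)
  qed
  then show ?thesis by (simp add: mult_ac)
qed

text \<open>A uniform Hoelder bound on the derivatives makes the Taylor remainder uniformly small,
  and an inequality for the remainder passes to the limit. Therefore pointwise convergence suffices,
  for the derivatives even at the single point \<open>x\<close>.\<close>

lemma has_derivative_limit:
  fixes f :: "'a::real_normed_vector \<Rightarrow> 'b::real_normed_vector"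
  assumes F: "F \<noteq> bot" and U: "convex U" "x \<in> U" and D: "bounded_linear D" and K: "0 \<le> K" "0 < \<beta>"
    and ev: "\<forall>\<^sub>F k in F. \<forall>y\<in>U. (g k has_derivative G k y) (at y within U) \<and>
      (\<forall>h. norm (G k y h - G k x h) \<le> K * dist y x powr \<beta> * norm h)"
    and g: "\<And>y. y \<in> U \<Longrightarrow> ((\<lambda>k. g k y) \<longlongrightarrow> f y) F" and G: "\<And>h. ((\<lambda>k. G k x h) \<longlongrightarrow> D h) F"
  shows "(f has_derivative D) (at x within U)"
proof (rule has_derivative_from_bound[OF D K(2,1)])
  fix y assume y: "y \<in> U"
  show "norm (f y - f x - D (y - x)) \<le> K * norm (y - x) powr \<beta> * norm (y - x)"
  proof (rule tendsto_norm_le[OF F])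
    show "((\<lambda>k. g k y - g k x - G k x (y - x)) \<longlongrightarrow> f y - f x - D (y - x)) F" by (intro tendsto_diff g G y U)
    show "\<forall>\<^sub>F k in F. norm (g k y - g k x - G k x (y - x)) \<le> K * norm (y - x) powr \<beta> * norm (y - x)"
      using ev
    proof eventually_elim
      case (elim k)
      show ?case by (rule taylor_bound[OF U(1) _ _ U(2) y K, where D = "G k"]) (use elim in blast)+
    qed
  qed
qed

lemma regD:
  assumes "reg \<alpha> S T K u u1 u2 ut"
  shows "drv S T u u1 u2 ut" "x \<in> S \<Longrightarrow> u x 0 = 0" "x \<in> S \<Longrightarrow> t \<in> {0..T} \<Longrightarrow> transpose (u2 x t) = u2 x t"
    "hol \<alpha> S T K u" "hol \<alpha> S T K u1" "hol \<alpha> S T K u2" "hol \<alpha> S T K ut"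
  using assms unfolding reg_def by blast+

lemma reg_subset: "reg \<alpha> S T K u u1 u2 ut \<Longrightarrow> S' \<subseteq> S \<Longrightarrow> reg \<alpha> S' T K u u1 u2 ut"
  unfolding reg_def by (auto intro: drv_subset hol_subset)

lemma reg_mono: "reg \<alpha> S T K u u1 u2 ut \<Longrightarrow> K \<le> K' \<Longrightarrow> reg \<alpha> S T K' u u1 u2 ut"
  unfolding reg_def by (auto intro: hol_mono)

lemma hol_limit:
  assumes F: "F \<noteq> bot" and ev: "eventually (\<lambda>k. hol \<alpha> S T K (g k)) F"
    and lim: "\<And>x t. x \<in> S \<Longrightarrow> t \<in> {0..T} \<Longrightarrow> ((\<lambda>k. g k x t) \<longlongrightarrow> l x t) F"
  shows "hol \<alpha> S T K l"
  unfolding hol_def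
proof (intro conjI ballI)
  fix x t assume x: "x \<in> S" and t: "t \<in> {0..T}"
  show "norm (l x t) \<le> K"
    by (rule tendsto_norm_le[OF F lim[OF x t] eventually_mono[OF ev]]) (rule holD(1)[OF _ x t])
  fix y s assume y: "y \<in> S" and s: "s \<in> {0..T}"
  show "norm (l x t - l y s) \<le> K * (dist x y powr \<alpha> + \<bar>t - s\<bar> powr (\<alpha>/2))"
    by (rule tendsto_norm_le[OF F tendsto_diff[OF lim[OF x t] lim[OF y s]] eventually_mono[OF ev]])
      (rule holD(2)[OF _ x t y s])
qed

lemma reg_limit:
  fixes u :: "'i \<Rightarrow> real^'n \<Rightarrow> real \<Rightarrow> real"
  assumes F: "F \<noteq> bot" and "open S" and \<alpha>: "0 < \<alpha>" and K: "0 \<le> K"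
    and ev: "eventually (\<lambda>k. reg \<alpha> S T K (u k) (u1 k) (u2 k) (ut k)) F"
    and l0: "\<And>x t. x \<in> S \<Longrightarrow> t \<in> {0..T} \<Longrightarrow> ((\<lambda>k. u k x t) \<longlongrightarrow> v x t) F"
    and l1: "\<And>x t. x \<in> S \<Longrightarrow> t \<in> {0..T} \<Longrightarrow> ((\<lambda>k. u1 k x t) \<longlongrightarrow> v1 x t) F"
    and l2: "\<And>x t. x \<in> S \<Longrightarrow> t \<in> {0..T} \<Longrightarrow> ((\<lambda>k. u2 k x t) \<longlongrightarrow> v2 x t) F"
    and lt: "\<And>x t. x \<in> S \<Longrightarrow> t \<in> {0..T} \<Longrightarrow> ((\<lambda>k. ut k x t) \<longlongrightarrow> vt x t) F"
    and T: "0 \<le> T"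
  shows "reg \<alpha> S T K v v1 v2 vt"
proof -
  have D: "drv S T v v1 v2 vt"
    unfolding drv_def
  proof (intro ballI conjI)
    fix x t assume x: "x \<in> S" and t: "t \<in> {0..T}"
    obtain r where r: "r > 0" "ball x r \<subseteq> S" using \<open>open S\<close> x open_contains_ball by metis
    have xr: "x \<in> ball x r" using r by simp
    have "((\<lambda>y. v y t) has_derivative (\<lambda>h. v1 x t \<bullet> h)) (at x within ball x r)"
    proof (rule has_derivative_limit[OF F convex_ball xr bounded_linear_inner_right K \<alpha>, where g = "\<lambda>k y. u k y t" and G = "\<lambda>k y h. u1 k y t \<bullet> h"])
      show "\<forall>\<^sub>F k in F. \<forall>y\<in>ball x r. ((\<lambda>y. u k y t) has_derivative (\<lambda>h. u1 k y t \<bullet> h)) (at y within ball x r) \<and>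
          (\<forall>h. norm (u1 k y t \<bullet> h - u1 k x t \<bullet> h) \<le> K * dist y x powr \<alpha> * norm h)"
        using ev
      proof eventually_elim
        case (elim k)
        have "norm (u1 k y t \<bullet> h - u1 k x t \<bullet> h) \<le> K * dist y x powr \<alpha> * norm h" if "y \<in> S" for y h
          using order_trans[OF Cauchy_Schwarz_ineq2[of "u1 k y t - u1 k x t" h] mult_right_mono[OF holD(3)[OF regD(5)[OF elim] that t x] norm_ge_zero]]
          by (simp add: inner_diff_left)
        then show ?case using drvD(1)[OF regD(1)[OF elim] _ t] has_derivative_at_withinI r(2) by blast
      qed
      show "((\<lambda>k. u1 k x t \<bullet> h) \<longlongrightarrow> v1 x t \<bullet> h) F" for h by (intro tendsto_intros l1 x t)
    qed (use l0 r(2) t in blast)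
    then show "((\<lambda>y. v y t) has_derivative (\<lambda>h. v1 x t \<bullet> h)) (at x)" by (simp only: at_within_open[OF xr open_ball])
    have "((\<lambda>y. v1 y t) has_derivative (\<lambda>h. v2 x t *v h)) (at x within ball x r)"
    proof (rule has_derivative_limit[OF F convex_ball xr matrix_vector_mul_bounded_linear K \<alpha>, where g = "\<lambda>k y. u1 k y t" and G = "\<lambda>k y h. u2 k y t *v h"])
      show "\<forall>\<^sub>F k in F. \<forall>y\<in>ball x r. ((\<lambda>y. u1 k y t) has_derivative (\<lambda>h. u2 k y t *v h)) (at y within ball x r) \<and>
          (\<forall>h. norm (u2 k y t *v h - u2 k x t *v h) \<le> K * dist y x powr \<alpha> * norm h)"
        using ev
      proof eventually_elim
        case (elim k)
        have "norm (u2 k y t *v h - u2 k x t *v h) \<le> K * dist y x powr \<alpha> * norm h" if "y \<in> S" for y h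
          using order_trans[OF norm_matrix_vector_le[of "u2 k y t - u2 k x t" h] mult_right_mono[OF holD(3)[OF regD(6)[OF elim] that t x] norm_ge_zero]]
          by (simp add: matrix_vector_mult_diff_rdistrib)
        then show ?case using drvD(2)[OF regD(1)[OF elim] _ t] has_derivative_at_withinI r(2) by blast
      qed
      show "((\<lambda>k. u2 k x t *v h) \<longlongrightarrow> v2 x t *v h) F" for h
      proof (rule vec_tendstoI)
        have "((\<lambda>k. u2 k x t $ i \<bullet> h) \<longlongrightarrow> v2 x t $ i \<bullet> h) F" for i by (intro tendsto_intros l2 x t)
        then show "((\<lambda>k. (u2 k x t *v h) $ i) \<longlongrightarrow> (v2 x t *v h) $ i) F" for i by (simp add: matrix_vector_mul_component)
      qed
    qed (use l1 r(2) t in blast)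
    then show "((\<lambda>y. v1 y t) has_derivative (\<lambda>h. v2 x t *v h)) (at x)" by (simp only: at_within_open[OF xr open_ball])
    have \<alpha>2: "0 < \<alpha>/2" using \<alpha> by simp
    show "(v x has_real_derivative vt x t) (at t within {0..T})"
      unfolding has_field_derivative_def
    proof (rule has_derivative_limit[OF F convex_real_interval(5) t bounded_linear_mult_right K \<alpha>2, where g = "\<lambda>k. u k x" and G = "\<lambda>k s h. ut k x s * h"])
      show "\<forall>\<^sub>F k in F. \<forall>s\<in>{0..T}. (u k x has_derivative (\<lambda>h. ut k x s * h)) (at s within {0..T}) \<and>
          (\<forall>h. norm (ut k x s * h - ut k x t * h) \<le> K * dist s t powr (\<alpha>/2) * norm h)"
        using ev
      proof eventually_elim
        case (elim k)
        have "norm (ut k x s * h - ut k x t * h) \<le> K * dist s t powr (\<alpha>/2) * norm h" if "s \<in> {0..T}" for s h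
          using mult_right_mono[OF holD(2)[OF regD(7)[OF elim] x that x t] norm_ge_zero[of h]]
          by (simp add: dist_real_def left_diff_distrib[symmetric] abs_mult)
        then show ?case using drvD(3)[OF regD(1)[OF elim] x] unfolding has_field_derivative_def by blast
      qed
      show "((\<lambda>k. ut k x t * h) \<longlongrightarrow> vt x t * h) F" for h by (intro tendsto_intros lt x t)
    qed (use l0 x in blast)
  qed
  moreover have "v x 0 = 0" if x: "x \<in> S" for x
  proof -
    have "eventually (\<lambda>k. u k x 0 = 0) F" using ev by (rule eventually_mono) (rule regD(2)[OF _ x])
    then have "((\<lambda>k. u k x 0) \<longlongrightarrow> 0) F" by (rule tendsto_eventually)
    with l0[OF x, of 0] show ?thesis using F T tendsto_unique by fastforce
  qed
  moreover have "transpose (v2 x t) = v2 x t" if x: "x \<in> S" and t: "t \<in> {0..T}" for x t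
  proof -
    have e: "v2 x t $ i $ j = v2 x t $ j $ i" for i j
    proof -
      have 1: "((\<lambda>k. u2 k x t $ i $ j) \<longlongrightarrow> v2 x t $ i $ j) F" by (intro tendsto_intros l2 x t)
      have 2: "((\<lambda>k. u2 k x t $ j $ i) \<longlongrightarrow> v2 x t $ j $ i) F" by (intro tendsto_intros l2 x t)
      have "eventually (\<lambda>k. u2 k x t $ j $ i = u2 k x t $ i $ j) F"
        using ev
      proof (rule eventually_mono)
        fix k assume "reg \<alpha> S T K (u k) (u1 k) (u2 k) (ut k)"
        from regD(3)[OF this x t] show "u2 k x t $ j $ i = u2 k x t $ i $ j"
          by (metis transpose_def vec_lambda_beta)
      qed
      from Lim_transform_eventually[OF 2 this] show ?thesis using 1 F tendsto_unique by blast
    qed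
    show ?thesis by (simp add: transpose_def vec_eq_iff e)
  qed
  moreover have "hol \<alpha> S T K v" "hol \<alpha> S T K v1" "hol \<alpha> S T K v2" "hol \<alpha> S T K vt"
    by (rule hol_limit[OF F eventually_mono[OF ev]], erule regD, erule (1) l0 l1 l2 lt)+
  ultimately show ?thesis unfolding reg_def by blast
qed

text \<open>Tychonoff's theorem replaces the diagonal argument: any cluster point of the sequence in the
  product of the compact balls is a limit along some finer filter.\<close>

lemma pointwise_compactness:
  fixes g :: "nat \<Rightarrow> 'p \<Rightarrow> 'b::euclidean_space"
  assumes bd: "\<And>p. \<exists>B. eventually (\<lambda>k. norm (g k p) \<le> B) sequentially"
  obtains F l where "F \<noteq> bot" "F \<le> sequentially" "\<And>p. ((\<lambda>k. g k p) \<longlongrightarrow> l p) F"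
proof -
  obtain B where B: "\<And>p. eventually (\<lambda>k. norm (g k p) \<le> B p) sequentially" using bd by metis
  \<comment> \<open>The bounds hold only eventually; truncation places every term in the product of
    the balls without changing limits along filters finer than \<open>sequentially\<close>.\<close>
  define g' where "g' k p = (if norm (g k p) \<le> B p then g k p else 0)" for k p
  define B' where "B' p = \<bar>B p\<bar>" for p
  have g': "g' k p \<in> cball 0 (B' p)" for k p by (auto simp: g'_def B'_def)
  have "compact (PiE UNIV (\<lambda>p. cball 0 (B' p) :: 'b set))"
  proof -
    have "compactin (product_topology (\<lambda>p. euclidean) UNIV) (PiE UNIV (\<lambda>p. cball 0 (B' p) :: 'b set))"
      unfolding compactin_PiE by (auto intro: compact_cball)
    then show ?thesis by (simp add: euclidean_product_topology)
  qed
  moreover have "eventually (\<lambda>h. h \<in> PiE UNIV (\<lambda>p. cball 0 (B' p) :: 'b set)) (filtermap g' sequentially)"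
    unfolding eventually_filtermap using g' by (intro always_eventually allI PiE_I) auto
  moreover have "filtermap g' sequentially \<noteq> bot" by (simp add: filtermap_bot_iff)
  ultimately obtain l where l: "inf (nhds l) (filtermap g' sequentially) \<noteq> bot"
    unfolding compact_filter by metis
  \<comment> \<open>Large indices whose terms are close to the cluster point \<open>l\<close>;
    clustering says precisely that these conditions are compatible.\<close>
  define F where "F = inf sequentially (filtercomap g' (nhds l))"
  have "F \<noteq> bot"
  proof
    assume "F = bot"
    then have "eventually (\<lambda>k. False) F" by simp
    then obtain P Q where P: "eventually P sequentially" and Q: "eventually Q (filtercomap g' (nhds l))"
      and PQ: "\<And>k. P k \<Longrightarrow> Q k \<Longrightarrow> False" unfolding F_def eventually_inf by auto
    obtain R where R: "eventually R (nhds l)" "\<And>k. R (g' k) \<Longrightarrow> Q k" using Q unfolding eventually_filtercomap by blast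
    have "eventually (\<lambda>h. \<not> R h) (filtermap g' sequentially)"
      unfolding eventually_filtermap using P by (rule eventually_mono) (use PQ R in blast)
    with R(1) have "eventually (\<lambda>h. False) (inf (nhds l) (filtermap g' sequentially))"
      unfolding eventually_inf by blast
    with l show False by (simp add: trivial_limit_def)
  qed
  moreover have Fs: "F \<le> sequentially" by (simp add: F_def)
  moreover have "((\<lambda>k. g k p) \<longlongrightarrow> l p) F" for p
  proof -
    have "filterlim g' (nhds l) F"
      unfolding F_def by (rule filterlim_mono[OF filterlim_filtercomap order_refl]) simp
    then have "((\<lambda>k. g' k p) \<longlongrightarrow> l p) F"
      by (rule continuous_on_tendsto_compose[OF continuous_on_product_coordinates[of p]]) simp_all
    moreover have "eventually (\<lambda>k. g' k p = g k p) F"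
      using filter_leD[OF Fs B[of p]] by (rule eventually_mono) (simp add: g'_def)
    ultimately show ?thesis by (rule Lim_transform_eventually)
  qed
  ultimately show ?thesis using that by blast
qed

text \<open>The interior constant does not depend on the centre, so local bounds are uniform. The
  assumed local Hoelder bound of the second derivatives is qualitative: its size may vary with the
  centre and does not enter the constant.\<close>

lemma global_estimate:
  fixes \<alpha> \<kappa> \<Lambda> :: real
  assumes \<alpha>: "0 < \<alpha>" "\<alpha> < 1" and \<kappa>: "0 < \<kappa>" "\<kappa> \<le> 1" "1 \<le> \<Lambda>"
  obtains C where "1 \<le> C"
    "\<And>T (a::real^'n \<Rightarrow> real^'n^'n) b h M A u u1 u2 ut. 0 \<le> M \<Longrightarrow> 0 \<le> A \<Longrightarrow>
      prob \<alpha> \<kappa> \<Lambda> UNIV T a b h M A u u1 u2 ut \<Longrightarrow> (\<And>z. \<exists>K. hx \<alpha> (ball z 1) T K u2) \<Longrightarrow>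
      (\<And>x t. t \<in> {0..T} \<Longrightarrow> transpose (u2 x t) = u2 x t) \<Longrightarrow>
      (\<And>x t. t \<in> {0..T} \<Longrightarrow> \<bar>h x t\<bar> \<le> A) \<Longrightarrow>
      (\<And>x t s. t \<in> {0..T} \<Longrightarrow> s \<in> {0..T} \<Longrightarrow>
         \<bar>h x t - h x s\<bar> \<le> A * \<bar>t - s\<bar> powr (\<alpha>/2) + \<Lambda> * \<bar>u x t - u x s\<bar>) \<Longrightarrow>
      reg \<alpha> UNIV T (C * (M + A)) u u1 u2 ut"
proof (rule interior_estimate[OF \<alpha> \<kappa>, where 'n = 'n], goal_cases)
  case (1 C)
  note C = 1(2) and I = 1(3)
  show thesis
  \<comment> \<open>For points at distance at least 1/8 the trivial bound 2 B equals 16 B * (1/8),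
    and 1/8 is at most the distance to the power \<alpha>.\<close>
  proof (rule that[of "16 * C"])
    show "1 \<le> 16 * C" using C by simp
    fix T and a :: "real^'n \<Rightarrow> real^'n^'n" and b h M A u u1 u2 ut
    assume M: "0 \<le> M" and A: "0 \<le> A" and p: "prob \<alpha> \<kappa> \<Lambda> UNIV T a b h M A u u1 u2 ut"
      and K: "\<And>z. \<exists>K. hx \<alpha> (ball z 1) T K u2"
      and sym: "\<And>x t. t \<in> {0..T} \<Longrightarrow> transpose (u2 x t) = u2 x t"
      and hA: "\<And>x t. t \<in> {0..T} \<Longrightarrow> \<bar>h x t\<bar> \<le> A"
      and ht: "\<And>x t s. t \<in> {0..T} \<Longrightarrow> s \<in> {0..T} \<Longrightarrow>
         \<bar>h x t - h x s\<bar> \<le> A * \<bar>t - s\<bar> powr (\<alpha>/2) + \<Lambda> * \<bar>u x t - u x s\<bar>"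
    define B where "B = C * (M + A)"
    have B: "B \<ge> 0" using C M A by (simp add: B_def)
    have R: "reg \<alpha> (ball z (1/8)) T B u u1 u2 ut" for z
    proof -
      obtain Kz where "hx \<alpha> (ball z 1) T Kz u2" using K by blast
      then show ?thesis unfolding B_def
        by (rule I[OF M A prob_subset[OF p subset_UNIV]]) (use sym hA ht in auto)
    qed
    have zz: "z \<in> ball z (1/8)" for z :: "real^'n" by simp
    have hol: "hol \<alpha> UNIV T (16 * B) g" if g: "\<And>z. hol \<alpha> (ball z (1/8)) T B g" for g :: "real^'n \<Rightarrow> real \<Rightarrow> 'y::real_normed_vector"
      unfolding hol_def
    proof (intro conjI ballI)
      fix x y t s assume t: "t \<in> {0..T}"
      show "norm (g x t) \<le> 16 * B" using holD(1)[OF g[of x] zz t] B by linarith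
      assume s: "s \<in> {0..T}"
      show "norm (g x t - g y s) \<le> 16 * B * (dist x y powr \<alpha> + \<bar>t - s\<bar> powr (\<alpha>/2))"
      proof (cases "dist x y < 1/8")
        case True
        then have "norm (g x t - g y s) \<le> B * (dist x y powr \<alpha> + \<bar>t - s\<bar> powr (\<alpha>/2))"
          using holD(2)[OF g[of x] zz t, of y s] s by simp
        also have "\<dots> \<le> 16 * B * (dist x y powr \<alpha> + \<bar>t - s\<bar> powr (\<alpha>/2))"
          using B by (intro mult_right_mono add_nonneg_nonneg) auto
        finally show ?thesis .
      next
        case False
        have "1/8 \<le> (1/8) powr \<alpha>" using \<alpha> by (intro le_powr_self) auto
        also have "\<dots> \<le> dist x y powr \<alpha>" using False \<alpha> by (intro powr_mono2) auto
        finally have "1/8 \<le> dist x y powr \<alpha> + \<bar>t - s\<bar> powr (\<alpha>/2)" by (simp add: add_increasing2)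
        then have "16 * B * (1/8) \<le> 16 * B * (dist x y powr \<alpha> + \<bar>t - s\<bar> powr (\<alpha>/2))" using B by (intro mult_left_mono) auto
        moreover have "norm (g x t - g y s) \<le> norm (g x t) + norm (g y s)" by (rule norm_triangle_ineq4)
        ultimately show ?thesis using holD(1)[OF g[of x] zz t] holD(1)[OF g[of y] zz s] by linarith
      qed
    qed
    show "reg \<alpha> UNIV T (16 * C * (M + A)) u u1 u2 ut"
      unfolding reg_def
    proof (intro conjI ballI)
      show "drv UNIV T u u1 u2 ut" using p unfolding prob_def by blast
      show "u x 0 = 0" for x using p unfolding prob_def by blast
      show "transpose (u2 x t) = u2 x t" if "t \<in> {0..T}" for x t by (rule sym[OF that])
      show "hol \<alpha> UNIV T (16 * C * (M + A)) u" "hol \<alpha> UNIV T (16 * C * (M + A)) u1"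
        "hol \<alpha> UNIV T (16 * C * (M + A)) u2" "hol \<alpha> UNIV T (16 * C * (M + A)) ut"
        using hol[OF regD(4)[OF R]] hol[OF regD(5)[OF R]] hol[OF regD(6)[OF R]] hol[OF regD(7)[OF R]]
        unfolding B_def mult.assoc by auto
    qed
  qed
qed

section \<open>Differentiation under the integral sign and of the Duhamel integral\<close>

lemma has_derivative_vecI:
  fixes f :: "'a::real_normed_vector \<Rightarrow> real^'n"
  assumes "\<And>i. ((\<lambda>x. f x $ i) has_derivative (\<lambda>h. f' h $ i)) (at x within S)"
  shows "(f has_derivative f') (at x within S)"
  unfolding has_derivative_componentwise_within[of f]
proof
  fix b :: "real^'n" assume "b \<in> Basis"
  then obtain i where "b = axis i 1" by (auto simp: Basis_vec_def)
  then show "((\<lambda>x. f x \<bullet> b) has_derivative (\<lambda>x. f' x \<bullet> b)) (at x within S)"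
    using assms[of i] by (simp add: inner_axis)
qed

lemma integral_vec_nth:
  fixes f :: "'b::euclidean_space \<Rightarrow> 'c::euclidean_space^'n"
  assumes "f integrable_on S"
  shows "integral S (\<lambda>p. f p $ i) = integral S f $ i"
  using integral_linear[OF assms bounded_linear_vec_nth[of i]] by (simp add: o_def)

lemma gradient_under_integral:
  fixes f :: "real^'n \<Rightarrow> 'b::euclidean_space \<Rightarrow> real"
  assumes d: "\<And>x p. p \<in> cbox a b \<Longrightarrow> ((\<lambda>x. f x p) has_derivative (\<lambda>h. g x p \<bullet> h)) (at x)"
    and cf: "continuous_on (UNIV \<times> cbox a b) (\<lambda>(x,p). f x p)"
    and cg: "continuous_on (UNIV \<times> cbox a b) (\<lambda>(x,p). g x p)"
  shows "((\<lambda>x. integral (cbox a b) (f x)) has_derivative (\<lambda>h. integral (cbox a b) (g x) \<bullet> h)) (at x)"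
proof -
  have ci: "continuous_on (cbox a b) (g x)" "continuous_on (cbox a b) (f x)" for x
    by (rule continuous_on_compose2[OF cg, where f="\<lambda>p. (x,p)", simplified], auto intro!: continuous_intros)
      (rule continuous_on_compose2[OF cf, where f="\<lambda>p. (x,p)", simplified], auto intro!: continuous_intros)
  have "((\<lambda>x. integral (cbox a b) (f x)) has_derivative
      blinfun_apply (integral (cbox a b) (\<lambda>p. blinfun_inner_right (g x p)))) (at x within UNIV)"
  proof (rule leibniz_rule)
    show "((\<lambda>x. f x t) has_derivative blinfun_apply (blinfun_inner_right (g x t))) (at x within UNIV)" if "t \<in> cbox a b" for x t
      using d[OF that] by simp
    show "f x integrable_on cbox a b" for x by (rule integrable_continuous[OF ci(2)])
    show "continuous_on (UNIV \<times> cbox a b) (\<lambda>(x, t). blinfun_inner_right (g x t))"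
      using bounded_linear.continuous_on[OF bounded_linear_blinfun_inner_right cg] by (simp add: case_prod_beta)
  qed auto
  moreover have "integral (cbox a b) (\<lambda>p. blinfun_inner_right (g x p)) = blinfun_inner_right (integral (cbox a b) (g x))"
    using integral_linear[OF integrable_continuous[OF ci(1)] bounded_linear_blinfun_inner_right] by (simp add: o_def)
  ultimately show ?thesis by simp
qed

text \<open>The integrand is available slightly past the diagonal, for s <= t + \<delta>. Hence the
  integral over the fixed interval [0,t] makes sense also for earlier first arguments and is
  differentiated under the integral sign; the moving upper limit contributes the value on the
  diagonal.\<close>

lemma duhamel_derivative:
  fixes \<phi> \<phi>t :: "real \<Rightarrow> real \<Rightarrow> real"
  assumes \<delta>: "0 < \<delta>"
    and c: "continuous_on {(t,s). t \<in> {0..T} \<and> s \<in> {0..T} \<and> s \<le> t + \<delta>} (\<lambda>(t,s). \<phi> t s)"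
    and ct: "continuous_on {(t,s). t \<in> {0..T} \<and> s \<in> {0..T} \<and> s \<le> t + \<delta>} (\<lambda>(t,s). \<phi>t t s)"
    and d: "\<And>t s. t \<in> {0..T} \<Longrightarrow> s \<in> {0..T} \<Longrightarrow> s \<le> t + \<delta> \<Longrightarrow> ((\<lambda>t. \<phi> t s) has_real_derivative \<phi>t t s) (at t within {0..T})"
    and t: "t \<in> {0..T}"
  shows "((\<lambda>t. integral {0..t} (\<phi> t)) has_real_derivative \<phi> t t + integral {0..t} (\<phi>t t)) (at t within {0..T})"
proof -
  let ?D = "{(t,s). t \<in> {0..T} \<and> s \<in> {0..T} \<and> s \<le> t + \<delta>}"
  have cs: "continuous_on {u..v} (\<phi> t')" if "t' \<in> {0..T}" "0 \<le> u" "v \<le> T" "v \<le> t' + \<delta>" for u v t'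
    by (rule continuous_on_compose2[OF c, where f="\<lambda>s. (t',s)", simplified]) (use that in \<open>auto intro!: continuous_intros\<close>)
  define U where "U = {max 0 (t - \<delta>)..T}"
  have p1: "((\<lambda>t'. integral {0..t} (\<phi> t')) has_real_derivative integral {0..t} (\<phi>t t)) (at t within {0..T})"
  proof -
    have "((\<lambda>t'. integral (cbox 0 t) (\<phi> t')) has_field_derivative integral (cbox 0 t) (\<phi>t t)) (at t within U)"
    proof (rule leibniz_rule_field_derivative)
      show "((\<lambda>x. \<phi> x s) has_field_derivative \<phi>t x s) (at x within U)" if "x \<in> U" "s \<in> cbox 0 t" for x s
        by (rule DERIV_subset[OF d]) (use that t in \<open>auto simp: U_def\<close>)
      show "\<phi> x integrable_on cbox 0 t" if "x \<in> U" for x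
        unfolding cbox_interval by (rule integrable_continuous_real[OF cs]) (use that t in \<open>auto simp: U_def\<close>)
      show "continuous_on (U \<times> cbox 0 t) (\<lambda>(x, s). \<phi>t x s)"
        by (rule continuous_on_subset[OF ct]) (use t in \<open>auto simp: U_def\<close>)
    qed (use t \<delta> in \<open>auto simp: U_def\<close>)
    moreover have "at t within U = at t within {0..T}"
      by (rule at_within_nhd[of t "{t-\<delta><..<t+\<delta>}"]) (use t \<delta> in \<open>auto simp: U_def\<close>)
    ultimately show ?thesis by simp
  qed
  \<comment> \<open>The part of the increment that is due to the moving upper limit; continuity at
    the diagonal point (t,t) gives its derivative, with separate treatment of times after and before
    \<open>t\<close>.\<close>
  define e where "e t' = integral {0..t'} (\<phi> t') - integral {0..t} (\<phi> t')" for t'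
  have p2: "(e has_real_derivative \<phi> t t) (at t within {0..T})"
    unfolding has_field_derivative_def has_derivative_within_alt
  proof (intro conjI allI impI)
    show "bounded_linear ((*) (\<phi> t t))" by (rule bounded_linear_mult_right)
    fix \<epsilon> :: real assume \<epsilon>: "\<epsilon> > 0"
    have "(t,t) \<in> ?D" using t \<delta> by auto
    from c[unfolded continuous_on_iff, rule_format, OF this \<epsilon>]
    obtain d0 where "d0 > 0" "\<forall>p\<in>?D. dist p (t,t) < d0 \<longrightarrow> dist (case p of (t,s) \<Rightarrow> \<phi> t s) (case (t,t) of (t,s) \<Rightarrow> \<phi> t s) < \<epsilon>" by blast
    then have d0: "d0 > 0" "p \<in> ?D \<Longrightarrow> dist p (t,t) < d0 \<Longrightarrow> dist (case p of (t,s) \<Rightarrow> \<phi> t s) (\<phi> t t) < \<epsilon>" for p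
      by (cases p, auto)
    define d1 where "d1 = min \<delta> (d0/2)"
    have d1: "d1 > 0" using \<delta> d0 by (simp add: d1_def)
    have near: "\<bar>\<phi> t' s - \<phi> t t\<bar> \<le> \<epsilon>" if "t' \<in> {0..T}" "s \<in> {0..T}" "\<bar>t' - t\<bar> < d1" "\<bar>s - t\<bar> < d1" "s \<le> t' + \<delta>" for t' s
    proof -
      have "dist (t',s) (t,t) \<le> \<bar>t' - t\<bar> + \<bar>s - t\<bar>"
        unfolding dist_prod_def by (simp add: dist_real_def sqrt_sum_squares_le_sum_abs)
      also have "\<dots> < d0" using that by (simp add: d1_def)
      finally show ?thesis using d0(2)[of "(t',s)"] that by (auto simp: dist_real_def)
    qed
    show "\<exists>d>0. \<forall>y\<in>{0..T}. norm (y - t) < d \<longrightarrow> norm (e y - e t - \<phi> t t * (y - t)) \<le> \<epsilon> * norm (y - t)"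
    proof (intro exI[of _ d1] conjI ballI impI d1)
      fix y assume y: "y \<in> {0..T}" and yt: "norm (y - t) < d1"
      have et: "e t = 0" by (simp add: e_def)
      show "norm (e y - e t - \<phi> t t * (y - t)) \<le> \<epsilon> * norm (y - t)"
      proof (cases "t \<le> y")
        case True
        have c': "continuous_on {0..y} (\<phi> y)" "continuous_on {t..y} (\<phi> y)" by (rule cs; use y t \<delta> in auto)+
        have "e y = integral {t..y} (\<phi> y)"
          using Henstock_Kurzweil_Integration.integral_combine[OF _ True integrable_continuous_real[OF c'(1)]] t by (simp add: e_def)
        also have "\<dots> - \<phi> t t * (y - t) = integral {t..y} (\<lambda>s. \<phi> y s - \<phi> t t)"
          using True by (subst Henstock_Kurzweil_Integration.integral_diff) (auto intro: integrable_continuous_real c'(2))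
        also have "norm \<dots> \<le> \<epsilon> * (y - t)"
        proof (rule integral_bound[OF True])
          show "continuous_on {t..y} (\<lambda>s. \<phi> y s - \<phi> t t)" by (intro continuous_intros c'(2))
          show "norm (\<phi> y s - \<phi> t t) \<le> \<epsilon>" if "s \<in> {t..y}" for s
            using near[of y s] y t yt that \<delta> by auto
        qed
        finally show ?thesis using True by (simp add: et)
      next
        case False
        then have yle: "y \<le> t" by simp
        have yd: "t \<le> y + \<delta>" using yt by (auto simp: d1_def abs_if split: if_splits)
        have c': "continuous_on {0..t} (\<phi> y)" "continuous_on {y..t} (\<phi> y)" by (rule cs; use y t yd in auto)+
        have "e y = - integral {y..t} (\<phi> y)"
          using Henstock_Kurzweil_Integration.integral_combine[OF _ yle integrable_continuous_real[OF c'(1)]] y by (simp add: e_def)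
        also have "\<dots> - \<phi> t t * (y - t) = - integral {y..t} (\<lambda>s. \<phi> y s - \<phi> t t)"
          using yle by (subst Henstock_Kurzweil_Integration.integral_diff) (auto intro: integrable_continuous_real c'(2) simp: algebra_simps)
        also have "norm \<dots> \<le> \<epsilon> * (t - y)"
          unfolding norm_minus_cancel
        proof (rule integral_bound[OF yle])
          show "continuous_on {y..t} (\<lambda>s. \<phi> y s - \<phi> t t)" by (intro continuous_intros c'(2))
          show "norm (\<phi> y s - \<phi> t t) \<le> \<epsilon>" if "s \<in> {y..t}" for s
            using near[of y s] y t yt that yd by auto
        qed
        finally show ?thesis using yle by (simp add: et)
      qed
    qed
  qed
  have "((\<lambda>t'. e t' + integral {0..t} (\<phi> t')) has_real_derivative \<phi> t t + integral {0..t} (\<phi>t t)) (at t within {0..T})"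
    by (rule DERIV_add[OF p2 p1])
  then show ?thesis by (simp add: e_def)
qed

section \<open>Heat potentials\<close>

text \<open>The Gaussian kernel without its normalising constant.\<close>

definition heat :: "real \<Rightarrow> real^'n \<Rightarrow> real" where
  "heat \<tau> z = \<tau> powr (- (real CARD('n) / 2)) * exp (- (z \<bullet> z) / (4 * \<tau>))"

definition heat1 :: "real \<Rightarrow> real^'n \<Rightarrow> real^'n" where
  "heat1 \<tau> z = (- heat \<tau> z / (2 * \<tau>)) *\<^sub>R z"

definition heat2 :: "real \<Rightarrow> real^'n \<Rightarrow> real^'n^'n" where
  "heat2 \<tau> z = heat \<tau> z *\<^sub>R ((1 / (4 * \<tau>\<^sup>2)) *\<^sub>R outer z - (1 / (2 * \<tau>)) *\<^sub>R mat 1)"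

definition heatt :: "real \<Rightarrow> real^'n \<Rightarrow> real" where
  "heatt \<tau> z = heat \<tau> z * ((z \<bullet> z) / (4 * \<tau>\<^sup>2) - real CARD('n) / (2 * \<tau>))"

text \<open>The spatial gradient of the entry (i,j) of \<open>heat2\<close>. It serves only to make
  the second derivatives of the potential locally Lipschitz.\<close>

definition heat3 :: "'n \<Rightarrow> 'n \<Rightarrow> real \<Rightarrow> real^'n \<Rightarrow> real^'n" where
  "heat3 i j \<tau> z = (z $ i * z $ j / (4 * \<tau>\<^sup>2) - mat 1 $ i $ j / (2 * \<tau>)) *\<^sub>R heat1 \<tau> z
     + (heat \<tau> z / (4 * \<tau>\<^sup>2)) *\<^sub>R (z $ j *\<^sub>R axis i 1 + z $ i *\<^sub>R axis j 1)"

lemma outer_vector: "outer z *v h = (z \<bullet> h) *\<^sub>R z"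
  by (simp add: outer_def matrix_vector_mult_def vec_eq_iff inner_vec_def sum_distrib_left sum_distrib_right mult_ac)

lemma heat_space_derivative:
  fixes z :: "real^'n"
  shows "(heat \<tau> has_derivative (\<lambda>h. heat1 \<tau> z \<bullet> h)) (at z)"
proof -
  let ?c = "\<tau> powr (- (real CARD('n) / 2))"
  have "((\<lambda>z. - (z \<bullet> z) * (1 / (4 * \<tau>))) has_derivative (\<lambda>h. - (z \<bullet> h + h \<bullet> z) * (1 / (4 * \<tau>)))) (at z)"
    by (rule has_derivative_mult_left has_derivative_minus has_derivative_inner has_derivative_ident)+
  note X = has_derivative_mult_right[OF has_derivative_exp[OF this], of ?c]
  have f: "heat \<tau> = (\<lambda>z::real^'n. ?c * exp (- (z \<bullet> z) * (1 / (4 * \<tau>))))" by (simp add: heat_def fun_eq_iff)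
  show ?thesis
    unfolding f by (rule has_derivative_eq_rhs[OF X]) (auto simp: fun_eq_iff heat1_def heat_def inner_commute algebra_simps)
qed

lemma heat1_space_derivative:
  fixes z :: "real^'n"
  shows "(heat1 \<tau> has_derivative (\<lambda>h. heat2 \<tau> z *v h)) (at z)"
proof -
  note X = has_derivative_scaleR_right[OF has_derivative_scaleR[OF heat_space_derivative[of \<tau> z] has_derivative_ident], of "- (1 / (2 * \<tau>))"]
  have f: "heat1 \<tau> = (\<lambda>z::real^'n. (- (1 / (2 * \<tau>))) *\<^sub>R (heat \<tau> z *\<^sub>R z))" by (simp add: heat1_def fun_eq_iff)
  have heq: "heat2 \<tau> z *v h = (- (1 / (2 * \<tau>))) *\<^sub>R (heat \<tau> z *\<^sub>R h + (heat1 \<tau> z \<bullet> h) *\<^sub>R z)" for h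
    unfolding heat2_def heat1_def
    by (simp add: scaleR_matrix_vector_assoc[symmetric] matrix_vector_mult_diff_rdistrib outer_vector vec_eq_iff power2_eq_square algebra_simps)
  show ?thesis unfolding f by (rule has_derivative_eq_rhs[OF X]) (simp only: heq)
qed

lemma heat_time_derivative:
  assumes \<tau>: "\<tau> > 0"
  shows "((\<lambda>\<tau>. heat \<tau> z) has_real_derivative heatt \<tau> z) (at \<tau>)"
proof -
  let ?c = "- (real CARD('a) / 2)"
  have 1: "((\<lambda>\<tau>. - (z \<bullet> z) / (4 * \<tau>)) has_real_derivative (z \<bullet> z) / (4 * \<tau>\<^sup>2)) (at \<tau>)"
    using \<tau> by (auto intro!: derivative_eq_intros simp: power2_eq_square)
  have 2: "((\<lambda>\<tau>. \<tau> powr ?c) has_real_derivative ?c * \<tau> powr (?c - 1)) (at \<tau>)"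
    by (rule has_real_derivative_powr[OF \<tau>])
  have 3: "\<tau> powr (?c - 1) = \<tau> powr ?c / \<tau>" using \<tau> by (simp add: powr_diff)
  show ?thesis
    unfolding heat_def
    by (rule DERIV_cong[OF DERIV_mult[OF 2 DERIV_fun_exp[OF 1]]])
      (simp add: 3 heatt_def heat_def algebra_simps)
qed

lemma heat2_space_derivative:
  fixes z :: "real^'n"
  shows "((\<lambda>z. heat2 \<tau> z $ i $ j) has_derivative (\<lambda>h. heat3 i j \<tau> z \<bullet> h)) (at z)"
proof -
  have 1: "((\<lambda>z::real^'n. z $ i * z $ j / (4 * \<tau>\<^sup>2) - mat 1 $ i $ j / (2 * \<tau>)) has_derivative
      (\<lambda>h. (z $ i * h $ j + h $ i * z $ j) / (4 * \<tau>\<^sup>2))) (at z)"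
  proof -
    have p: "((\<lambda>z::real^'n. z $ k) has_derivative (\<lambda>h. h $ k)) (at z)" for k
      by (rule bounded_linear.has_derivative[OF bounded_linear_vec_nth has_derivative_ident])
    show ?thesis
      using has_derivative_diff[OF has_derivative_mult_left[OF has_derivative_mult[OF p[of i] p[of j]], of "1 / (4 * \<tau>\<^sup>2)"] has_derivative_const]
      by simp
  qed
  have f: "heat2 \<tau> z $ i $ j = heat \<tau> z * (z $ i * z $ j / (4 * \<tau>\<^sup>2) - mat 1 $ i $ j / (2 * \<tau>))" for z :: "real^'n"
    by (simp add: heat2_def outer_def)
  show ?thesis
    unfolding f
    by (rule has_derivative_eq_rhs[OF has_derivative_mult[OF heat_space_derivative 1]])
      (auto simp: fun_eq_iff heat3_def inner_add_left inner_axis' algebra_simps add_divide_distrib)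
qed

lemma heat_equation: "heatt \<tau> z = mat 1 \<bullet> heat2 \<tau> (z :: real^'n)"
proof -
  have "mat 1 \<bullet> outer z = z \<bullet> z" unfolding inner_commute[of "mat 1"] inner_outer by simp
  moreover have "(mat 1 :: real^'n^'n) \<bullet> mat 1 = real CARD('n)" unfolding trace_mat1 by (simp add: mat_def)
  ultimately show ?thesis by (simp add: heatt_def heat2_def inner_diff_right)
qed

lemma transpose_heat2: "transpose (heat2 \<tau> z) = heat2 \<tau> z"
  by (simp add: heat2_def transpose_def outer_def vec_eq_iff mat_def mult_ac)

lemma continuous_on_locally_lipschitz:
  fixes u :: "'a::metric_space \<Rightarrow> real \<Rightarrow> real"
  assumes "\<And>z. \<exists>L. \<forall>x\<in>ball z 1. \<forall>t\<in>{0..T}. \<forall>s\<in>{0..T}. \<bar>u x t - u z s\<bar> \<le> L * (dist x z + \<bar>t - s\<bar>)"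
  shows "continuous_on (UNIV \<times> {0..T}) (\<lambda>(x,t). u x t)"
  unfolding continuous_on_iff
proof (intro ballI allI impI)
  fix p :: "'a \<times> real" and e :: real assume p: "p \<in> UNIV \<times> {0..T}" and e: "e > 0"
  obtain z s where zs: "p = (z,s)" by force
  have s: "s \<in> {0..T}" using p zs by auto
  obtain L where L: "\<And>x t. x \<in> ball z 1 \<Longrightarrow> t \<in> {0..T} \<Longrightarrow> \<bar>u x t - u z s\<bar> \<le> L * (dist x z + \<bar>t - s\<bar>)"
    using assms[of z] s by blast
  define d where "d = min 1 (e / (2 * (\<bar>L\<bar> + 1)))"
  have d: "d > 0" using e by (simp add: d_def)
  show "\<exists>d>0. \<forall>x'\<in>UNIV \<times> {0..T}. dist x' p < d \<longrightarrow> dist (case x' of (x, t) \<Rightarrow> u x t) (case p of (x, t) \<Rightarrow> u x t) < e"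
  proof (intro exI[of _ d] conjI ballI impI d)
    fix q assume q: "q \<in> UNIV \<times> {0..T}" "dist q p < d"
    obtain x t where xt: "q = (x,t)" by force
    have dl: "dist x z < d" "\<bar>t - s\<bar> < d"
      using q(2) dist_fst_le[of q p] dist_snd_le[of q p] unfolding xt zs by (auto simp: dist_real_def)
    have "\<bar>u x t - u z s\<bar> \<le> L * (dist x z + \<bar>t - s\<bar>)"
      by (rule L) (use q dl xt in \<open>auto simp: d_def dist_commute\<close>)
    also have "\<dots> \<le> (\<bar>L\<bar> + 1) * (dist x z + \<bar>t - s\<bar>)" by (intro mult_right_mono) auto
    also have "\<dots> < (\<bar>L\<bar> + 1) * (d + d)" using dl by (intro mult_strict_left_mono add_strict_mono) auto
    also have "\<dots> \<le> (\<bar>L\<bar> + 1) * (2 * (e / (2 * (\<bar>L\<bar> + 1))))"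
      by (intro mult_left_mono) (auto simp: d_def)
    also have "\<dots> = e" by (simp add: field_simps)
    finally show "dist (case q of (x, t) \<Rightarrow> u x t) (case p of (x, t) \<Rightarrow> u x t) < e"
      by (simp add: xt zs dist_real_def)
  qed
qed

context
  fixes q :: "real^'n \<Rightarrow> real \<Rightarrow> real" and T :: real and a b :: "real^'n"
  assumes qc: "continuous_on (UNIV \<times> {0..T}) (\<lambda>(x,t). q x t)"
begin

text \<open>The kernel \<open>w\<close> is arbitrary and vector-valued, so that the heat kernel and
  all its derivatives are covered at once; kernel time and source time are separate variables, which
  allows the shift introduced below.\<close>

definition pot :: "(real \<Rightarrow> real^'n \<Rightarrow> 'c::euclidean_space) \<Rightarrow> real^'n \<Rightarrow> real \<Rightarrow> real \<Rightarrow> 'c" where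
  "pot w x \<tau> s = integral (cbox a b) (\<lambda>y. q y s *\<^sub>R w \<tau> (x - y))"

lemma pot_integrand_continuous:
  fixes w :: "real \<Rightarrow> real^'n \<Rightarrow> 'c::euclidean_space"
  assumes "continuous_on ({0<..} \<times> UNIV) (\<lambda>(\<tau>,z). w \<tau> z)"
  shows "continuous_on ((UNIV \<times> {0<..} \<times> {0..T}) \<times> cbox a b) (\<lambda>(p,y). q y (snd (snd p)) *\<^sub>R w (fst (snd p)) (fst p - y))"
proof -
  have 1: "continuous_on (((UNIV :: (real^'n) set) \<times> {0::real<..} \<times> {0..T}) \<times> cbox a b) (\<lambda>p. q (snd p) (snd (snd (fst p))))"
    by (rule continuous_on_compose2[OF qc, where f="\<lambda>p. (snd p, snd (snd (fst p)))", simplified]) (auto intro!: continuous_intros)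
  have 2: "continuous_on ((UNIV \<times> {0<..} \<times> {0..T}) \<times> cbox a b) (\<lambda>p. w (fst (snd (fst p))) (fst (fst p) - snd p))"
    by (rule continuous_on_compose2[OF assms, where f="\<lambda>p. (fst (snd (fst p)), fst (fst p) - snd p)", simplified]) (auto intro!: continuous_intros)
  show ?thesis unfolding case_prod_beta by (rule continuous_on_scaleR[OF 1 2])
qed

lemma pot_continuous:
  assumes "continuous_on ({0<..} \<times> UNIV) (\<lambda>(\<tau>,z). w \<tau> z)"
  shows "continuous_on (UNIV \<times> {0<..} \<times> {0..T}) (\<lambda>p. pot w (fst p) (fst (snd p)) (snd (snd p)))"
  unfolding pot_def by (rule integral_continuous_on_param[OF pot_integrand_continuous[OF assms]])

lemma pot_integrand_continuous':
  fixes w :: "real \<Rightarrow> real^'n \<Rightarrow> 'c::euclidean_space"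
  assumes "continuous_on ({0<..} \<times> UNIV) (\<lambda>(\<tau>,z). w \<tau> z)" "0 < \<tau>" "s \<in> {0..T}"
  shows "continuous_on (UNIV \<times> cbox a b) (\<lambda>(x,y). q y s *\<^sub>R w \<tau> (x - y))"
    "continuous_on (cbox a b) (\<lambda>y. q y s *\<^sub>R w \<tau> (x - y))"
proof -
  have "continuous_on (UNIV \<times> cbox a b) (\<lambda>p. case ((fst p, \<tau>, s), snd p) of (p,y) \<Rightarrow> q y (snd (snd p)) *\<^sub>R w (fst (snd p)) (fst p - y))"
    by (rule continuous_on_compose2[OF pot_integrand_continuous[OF assms(1)], where f="\<lambda>p. ((fst p, \<tau>, s), snd p)"])
      (use assms(2,3) in \<open>auto intro!: continuous_intros\<close>)
  then show "continuous_on (UNIV \<times> cbox a b) (\<lambda>(x,y). q y s *\<^sub>R w \<tau> (x - y))" by (simp add: case_prod_beta)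
  have "continuous_on (cbox a b) (\<lambda>y. case ((x, \<tau>, s), y) of (p,y) \<Rightarrow> q y (snd (snd p)) *\<^sub>R w (fst (snd p)) (fst p - y))"
    by (rule continuous_on_compose2[OF pot_integrand_continuous[OF assms(1)], where f="\<lambda>y. ((x, \<tau>, s), y)"])
      (use assms(2,3) in \<open>auto intro!: continuous_intros\<close>)
  then show "continuous_on (cbox a b) (\<lambda>y. q y s *\<^sub>R w \<tau> (x - y))" by simp
qed

lemma pot_nth:
  fixes w :: "real \<Rightarrow> real^'n \<Rightarrow> 'c::euclidean_space^'m"
  assumes "continuous_on ({0<..} \<times> UNIV) (\<lambda>(\<tau>,z). w \<tau> z)" "0 < \<tau>" "s \<in> {0..T}"
  shows "pot (\<lambda>\<tau> z. w \<tau> z $ i) x \<tau> s = pot w x \<tau> s $ i"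
  unfolding pot_def using integral_vec_nth[OF integrable_continuous[OF pot_integrand_continuous'(2)[OF assms]]] by simp

lemma pot_gradient:
  assumes c: "continuous_on ({0<..} \<times> UNIV) (\<lambda>(\<tau>,z). w \<tau> z)" "continuous_on ({0<..} \<times> UNIV) (\<lambda>(\<tau>,z). w1 \<tau> z)"
    and d: "\<And>z. (w \<tau> has_derivative (\<lambda>h. w1 \<tau> z \<bullet> h)) (at z)" and \<tau>: "0 < \<tau>" "s \<in> {0..T}"
  shows "((\<lambda>x. pot w x \<tau> s) has_derivative (\<lambda>h. pot w1 x \<tau> s \<bullet> h)) (at x)"
  unfolding pot_def
proof (rule gradient_under_integral)
  show "((\<lambda>x. q y s *\<^sub>R w \<tau> (x - y)) has_derivative (\<lambda>h. (q y s *\<^sub>R w1 \<tau> (x - y)) \<bullet> h)) (at x)" for x y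
  proof -
    have "((\<lambda>x. x - y) has_derivative (\<lambda>h. h)) (at x)" by (auto intro!: derivative_eq_intros)
    from has_derivative_scaleR_right[OF diff_chain_at[OF this d], of "q y s"] show ?thesis by (simp add: o_def)
  qed
qed (rule pot_integrand_continuous'(1)[OF c(1) \<tau>] pot_integrand_continuous'(1)[OF c(2) \<tau>])+

lemma pot_time_derivative:
  assumes c: "continuous_on ({0<..} \<times> UNIV) (\<lambda>(\<tau>,z). w \<tau> z)" "continuous_on ({0<..} \<times> UNIV) (\<lambda>(\<tau>,z). wt \<tau> z)"
    and d: "\<And>\<tau> z. 0 < \<tau> \<Longrightarrow> ((\<lambda>\<tau>. w \<tau> z) has_real_derivative wt \<tau> z) (at \<tau>)" and \<tau>: "0 < \<tau>" "s \<in> {0..T}"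
  shows "((\<lambda>\<tau>. pot w x \<tau> s) has_real_derivative pot wt x \<tau> s) (at \<tau>)"
proof -
  have "((\<lambda>\<tau>. pot w x \<tau> s) has_real_derivative pot wt x \<tau> s) (at \<tau> within {0<..})"
    unfolding pot_def
  proof (rule leibniz_rule_field_derivative)
    show "((\<lambda>\<tau>. q y s *\<^sub>R w \<tau> (x - y)) has_real_derivative q y s *\<^sub>R wt \<tau> (x - y)) (at \<tau> within {0<..})" if "\<tau> \<in> {0<..}" for \<tau> y
      using DERIV_cmult[OF has_field_derivative_at_within[OF d], of \<tau> "q y s"] that by simp
    show "(\<lambda>y. q y s *\<^sub>R w \<tau> (x - y)) integrable_on cbox a b" if "\<tau> \<in> {0<..}" for \<tau>
      using that by (intro integrable_continuous pot_integrand_continuous'[OF c(1) _ \<tau>(2)]) auto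
    show "continuous_on ({0<..} \<times> cbox a b) (\<lambda>(\<tau>,y). q y s *\<^sub>R wt \<tau> (x - y))"
    proof -
      have "continuous_on ({0<..} \<times> cbox a b) (\<lambda>p. case ((x, fst p, s), snd p) of (p,y) \<Rightarrow> q y (snd (snd p)) *\<^sub>R wt (fst (snd p)) (fst p - y))"
        by (rule continuous_on_compose2[OF pot_integrand_continuous[OF c(2)], where f="\<lambda>p. ((x, fst p, s), snd p)"])
          (use \<tau>(2) in \<open>auto intro!: continuous_intros\<close>)
      then show ?thesis by (simp add: case_prod_beta)
    qed
  qed (use \<tau> in auto)
  moreover have "at \<tau> within {0<..} = at \<tau>" by (rule at_within_open) (use \<tau> in auto)
  ultimately show ?thesis by simp
qed

text \<open>The shift \<epsilon> > 0 of the time argument keeps the kernel smooth up to s = t; the potential then solves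
  the heat equation with the source smoothed by the heat semigroup at time \<epsilon>.\<close>

definition duh :: "real \<Rightarrow> (real \<Rightarrow> real^'n \<Rightarrow> 'c::euclidean_space) \<Rightarrow> real^'n \<Rightarrow> real \<Rightarrow> 'c" where
  "duh \<epsilon> w x t = integral (cbox 0 t) (\<lambda>s. pot w x (t - s + \<epsilon>) s)"

lemma duh_integrand_continuous:
  assumes "continuous_on ({0<..} \<times> UNIV) (\<lambda>(\<tau>,z). w \<tau> z)" "0 < \<epsilon>" "t \<in> {0..T}"
  shows "continuous_on (UNIV \<times> cbox 0 t) (\<lambda>(x,s). pot w x (t - s + \<epsilon>) s)"
    "continuous_on (cbox 0 t) (\<lambda>s. pot w x (t - s + \<epsilon>) s)"
proof -
  have "continuous_on (UNIV \<times> cbox 0 t) (\<lambda>p. pot w (fst (fst p, t - snd p + \<epsilon>, snd p)) (fst (snd (fst p, t - snd p + \<epsilon>, snd p))) (snd (snd (fst p, t - snd p + \<epsilon>, snd p))))"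
    by (rule continuous_on_compose2[OF pot_continuous[OF assms(1)], where f="\<lambda>p. (fst p, t - snd p + \<epsilon>, snd p)"])
      (use assms(2,3) in \<open>auto intro!: continuous_intros\<close>)
  then show "continuous_on (UNIV \<times> cbox 0 t) (\<lambda>(x,s). pot w x (t - s + \<epsilon>) s)" by (simp add: case_prod_beta)
  have "continuous_on (cbox 0 t) (\<lambda>s. pot w (fst (x, t - s + \<epsilon>, s)) (fst (snd (x, t - s + \<epsilon>, s))) (snd (snd (x, t - s + \<epsilon>, s))))"
    by (rule continuous_on_compose2[OF pot_continuous[OF assms(1)], where f="\<lambda>s. (x, t - s + \<epsilon>, s)"])
      (use assms(2,3) in \<open>auto intro!: continuous_intros\<close>)
  then show "continuous_on (cbox 0 t) (\<lambda>s. pot w x (t - s + \<epsilon>) s)" by simp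
qed

lemma duh_nth:
  fixes w :: "real \<Rightarrow> real^'n \<Rightarrow> 'c::euclidean_space^'m"
  assumes "continuous_on ({0<..} \<times> UNIV) (\<lambda>(\<tau>,z). w \<tau> z)" "0 < \<epsilon>" "t \<in> {0..T}"
  shows "duh \<epsilon> (\<lambda>\<tau> z. w \<tau> z $ i) x t = duh \<epsilon> w x t $ i"
proof -
  have "duh \<epsilon> (\<lambda>\<tau> z. w \<tau> z $ i) x t = integral (cbox 0 t) (\<lambda>s. pot w x (t - s + \<epsilon>) s $ i)"
    unfolding duh_def by (rule integral_cong) (use assms in \<open>auto intro!: pot_nth\<close>)
  also have "\<dots> = duh \<epsilon> w x t $ i"
    unfolding duh_def by (rule integral_vec_nth[OF integrable_continuous[OF duh_integrand_continuous(2)[OF assms]]])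
  finally show ?thesis .
qed

lemma duh_gradient:
  assumes c: "continuous_on ({0<..} \<times> UNIV) (\<lambda>(\<tau>,z). w \<tau> z)" "continuous_on ({0<..} \<times> UNIV) (\<lambda>(\<tau>,z). w1 \<tau> z)"
    and d: "\<And>\<tau> z. (w \<tau> has_derivative (\<lambda>h. w1 \<tau> z \<bullet> h)) (at z)" and \<epsilon>: "0 < \<epsilon>" and t: "t \<in> {0..T}"
  shows "((\<lambda>x. duh \<epsilon> w x t) has_derivative (\<lambda>h. duh \<epsilon> w1 x t \<bullet> h)) (at x)"
  unfolding duh_def
  by (rule gradient_under_integral[OF pot_gradient[OF c d] duh_integrand_continuous(1)[OF c(1) \<epsilon> t] duh_integrand_continuous(1)[OF c(2) \<epsilon> t]])
    (use \<epsilon> t in auto)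

text \<open>Kernel times stay in the compact interval from \<epsilon> to T + \<epsilon>, away from
  the singularity. The bound depends on \<epsilon> and is used only qualitatively.\<close>

lemma duh_bounded:
  assumes c: "continuous_on ({0<..} \<times> UNIV) (\<lambda>(\<tau>,z). w \<tau> z)" and \<epsilon>: "0 < \<epsilon>"
  shows "\<exists>B\<ge>0. \<forall>x\<in>cball z r. \<forall>t\<in>{0..T}. norm (duh \<epsilon> w x t) \<le> B \<and> norm (pot w x \<epsilon> t) \<le> B"
proof -
  let ?K = "cball z r \<times> {\<epsilon>..T+\<epsilon>} \<times> {0..T}"
  have "compact ((\<lambda>p. pot w (fst p) (fst (snd p)) (snd (snd p))) ` ?K)"
    by (intro compact_continuous_image continuous_on_subset[OF pot_continuous[OF c]] compact_Times) (use \<epsilon> in auto)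
  from compact_imp_bounded[OF this]
  obtain B where "B > 0" "\<forall>y \<in> (\<lambda>p. pot w (fst p) (fst (snd p)) (snd (snd p))) ` ?K. norm y \<le> B"
    unfolding bounded_pos by blast
  then have B: "B > 0" "\<And>y. y \<in> (\<lambda>p. pot w (fst p) (fst (snd p)) (snd (snd p))) ` ?K \<Longrightarrow> norm y \<le> B" by blast+
  have b: "norm (pot w x \<tau> s) \<le> B" if "x \<in> cball z r" "\<tau> \<in> {\<epsilon>..T+\<epsilon>}" "s \<in> {0..T}" for x \<tau> s
    by (rule B(2), rule image_eqI[of _ _ "(x,\<tau>,s)"]) (use that in auto)
  have "norm (duh \<epsilon> w x t) \<le> B * max T 1 \<and> norm (pot w x \<epsilon> t) \<le> B * max T 1" if x: "x \<in> cball z r" and t: "t \<in> {0..T}" for x t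
  proof
    have "norm (duh \<epsilon> w x t) \<le> B * (t - 0)"
      unfolding duh_def cbox_interval
    proof (rule integral_bound)
      show "continuous_on {0..t} (\<lambda>s. pot w x (t - s + \<epsilon>) s)" using duh_integrand_continuous(2)[OF c \<epsilon> t] by simp
      show "norm (pot w x (t - s + \<epsilon>) s) \<le> B" if "s \<in> {0..t}" for s by (rule b[OF x]) (use that t \<epsilon> in auto)
    qed (use t in auto)
    also have "\<dots> \<le> B * max T 1" using B t by (intro mult_left_mono) auto
    finally show "norm (duh \<epsilon> w x t) \<le> B * max T 1" .
    have "norm (pot w x \<epsilon> t) \<le> B * 1" using b[OF x _ t, of \<epsilon>] \<epsilon> t by auto
    also have "\<dots> \<le> B * max T 1" using B by (intro mult_left_mono) auto
    finally show "norm (pot w x \<epsilon> t) \<le> B * max T 1" .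
  qed
  moreover have "0 \<le> B * max T 1" using B by simp
  ultimately show ?thesis by blast
qed

lemma heat_continuous:
  "continuous_on ({0<..} \<times> UNIV) (\<lambda>(\<tau>,z::real^'n). heat \<tau> z)"
  "continuous_on ({0<..} \<times> UNIV) (\<lambda>(\<tau>,z::real^'n). heat1 \<tau> z)"
  "continuous_on ({0<..} \<times> UNIV) (\<lambda>(\<tau>,z::real^'n). heat2 \<tau> z)"
  "continuous_on ({0<..} \<times> UNIV) (\<lambda>(\<tau>,z::real^'n). heatt \<tau> z)"
  "continuous_on ({0<..} \<times> UNIV) (\<lambda>(\<tau>,z::real^'n). heat3 i j \<tau> z)"
proof -
  show h: "continuous_on ({0<..} \<times> UNIV) (\<lambda>(\<tau>,z::real^'n). heat \<tau> z)"
    unfolding heat_def case_prod_beta by (intro continuous_intros) auto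
  show h1: "continuous_on ({0<..} \<times> UNIV) (\<lambda>(\<tau>,z::real^'n). heat1 \<tau> z)"
    unfolding heat1_def case_prod_beta by (intro continuous_intros h[unfolded case_prod_beta]) auto
  have o: "continuous_on ({0<..} \<times> UNIV) (\<lambda>p::real \<times> (real^'n). outer (snd p))"
    unfolding outer_def by (intro continuous_on_vec_lambda continuous_intros)
  show "continuous_on ({0<..} \<times> UNIV) (\<lambda>(\<tau>,z::real^'n). heat2 \<tau> z)"
    unfolding heat2_def case_prod_beta by (intro continuous_intros h[unfolded case_prod_beta] o) auto
  show "continuous_on ({0<..} \<times> UNIV) (\<lambda>(\<tau>,z::real^'n). heatt \<tau> z)"
    unfolding heatt_def case_prod_beta by (intro continuous_intros h[unfolded case_prod_beta]) auto
  show "continuous_on ({0<..} \<times> UNIV) (\<lambda>(\<tau>,z::real^'n). heat3 i j \<tau> z)"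
    unfolding heat3_def case_prod_beta by (intro continuous_intros h[unfolded case_prod_beta] h1[unfolded case_prod_beta]) auto
qed

lemma nth_continuous:
  "continuous_on S (\<lambda>(\<tau>,z). w \<tau> z) \<Longrightarrow> continuous_on S (\<lambda>(\<tau>,z). w \<tau> z $ i)"
  unfolding case_prod_beta by (intro continuous_intros)

lemma duh_drv:
  assumes \<epsilon>: "0 < \<epsilon>"
  shows "drv UNIV T (duh \<epsilon> heat) (duh \<epsilon> heat1) (duh \<epsilon> heat2) (\<lambda>x t. pot heat x \<epsilon> t + duh \<epsilon> heatt x t)"
  unfolding drv_def
proof (intro ballI conjI)
  fix x t assume t: "t \<in> {0..T}"
  show "((\<lambda>y. duh \<epsilon> heat y t) has_derivative (\<lambda>h. duh \<epsilon> heat1 x t \<bullet> h)) (at x)"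
    by (rule duh_gradient[OF heat_continuous(1,2) heat_space_derivative \<epsilon> t])
  show "((\<lambda>y. duh \<epsilon> heat1 y t) has_derivative (\<lambda>h. duh \<epsilon> heat2 x t *v h)) (at x)"
  proof (rule has_derivative_vecI)
    fix i
    have "((\<lambda>z. heat1 \<tau> z $ i) has_derivative (\<lambda>h. heat2 \<tau> z $ i \<bullet> h)) (at z)" for \<tau> and z :: "real^'n"
      using bounded_linear.has_derivative[OF bounded_linear_vec_nth[of i] heat1_space_derivative] by (simp add: matrix_vector_mul_component)
    from duh_gradient[OF nth_continuous[OF heat_continuous(2)] nth_continuous[OF heat_continuous(3)] this \<epsilon> t]
    show "((\<lambda>x. duh \<epsilon> heat1 x t $ i) has_derivative (\<lambda>h. (duh \<epsilon> heat2 x t *v h) $ i)) (at x)"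
      unfolding duh_nth[OF heat_continuous(2) \<epsilon> t] duh_nth[OF heat_continuous(3) \<epsilon> t] by (simp add: matrix_vector_mul_component)
  qed
  \<comment> \<open>For s <= t + \<epsilon>/2 the kernel time t - s + \<epsilon> is at least
    \<epsilon>/2, so there is room past the diagonal.\<close>
  have cc: "continuous_on {(t,s). t \<in> {0..T} \<and> s \<in> {0..T} \<and> s \<le> t + \<epsilon>/2} (\<lambda>(t,s). pot w x (t - s + \<epsilon>) s)"
    if "continuous_on ({0<..} \<times> UNIV) (\<lambda>(\<tau>,z). w \<tau> z)" for w :: "real \<Rightarrow> real^'n \<Rightarrow> real"
  proof -
    have "continuous_on {(t,s). t \<in> {0..T} \<and> s \<in> {0..T} \<and> s \<le> t + \<epsilon>/2} (\<lambda>p. pot w (fst (x, fst p - snd p + \<epsilon>, snd p))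
        (fst (snd (x, fst p - snd p + \<epsilon>, snd p))) (snd (snd (x, fst p - snd p + \<epsilon>, snd p))))"
      by (rule continuous_on_compose2[OF pot_continuous[OF that], where f="\<lambda>p. (x, fst p - snd p + \<epsilon>, snd p)"])
        (use \<epsilon> in \<open>auto intro!: continuous_intros\<close>)
    then show ?thesis by (simp add: case_prod_beta)
  qed
  have "((\<lambda>t. integral {0..t} (\<lambda>s. pot heat x (t - s + \<epsilon>) s)) has_real_derivative
      pot heat x (t - t + \<epsilon>) t + integral {0..t} (\<lambda>s. pot heatt x (t - s + \<epsilon>) s)) (at t within {0..T})"
  proof (rule duhamel_derivative[where \<delta> = "\<epsilon>/2", OF _ cc[OF heat_continuous(1)] cc[OF heat_continuous(4)] _ t])
    show "((\<lambda>t. pot heat x (t - s + \<epsilon>) s) has_real_derivative pot heatt x (t - s + \<epsilon>) s) (at t within {0..T})"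
      if "t \<in> {0..T}" "s \<in> {0..T}" "s \<le> t + \<epsilon>/2" for t s
    proof -
      have "0 < t - s + \<epsilon>" using that \<epsilon> by auto
      note D = pot_time_derivative[OF heat_continuous(1,4) heat_time_derivative this that(2), of x]
      have "((\<lambda>t. t - s + \<epsilon>) has_real_derivative 1) (at t within {0..T})" by (auto intro!: derivative_eq_intros)
      from DERIV_chain2[OF D this] show ?thesis by simp
    qed
  qed (use \<epsilon> in simp)
  then show "(duh \<epsilon> heat x has_real_derivative pot heat x \<epsilon> t + duh \<epsilon> heatt x t) (at t within {0..T})"
    unfolding duh_def[abs_def] cbox_interval by simp
qed

lemma duh_heat_equation:
  assumes \<epsilon>: "0 < \<epsilon>" and t: "t \<in> {0..T}"
  shows "duh \<epsilon> heatt x t = mat 1 \<bullet> duh \<epsilon> heat2 x t"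
proof -
  have p: "pot heatt x \<tau> s = mat 1 \<bullet> pot heat2 x \<tau> s" if "0 < \<tau>" "s \<in> {0..T}" for \<tau> s
    unfolding pot_def heat_equation
    using integral_linear[OF integrable_continuous[OF pot_integrand_continuous'(2)[OF heat_continuous(3) that]] bounded_linear_inner_right[of "mat 1"]]
    by (simp add: o_def)
  have "duh \<epsilon> heatt x t = integral (cbox 0 t) (\<lambda>s. mat 1 \<bullet> pot heat2 x (t - s + \<epsilon>) s)"
    unfolding duh_def by (rule integral_cong) (use \<epsilon> t in \<open>auto intro!: p\<close>)
  also have "\<dots> = mat 1 \<bullet> duh \<epsilon> heat2 x t"
    unfolding duh_def
    using integral_linear[OF integrable_continuous[OF duh_integrand_continuous(2)[OF heat_continuous(3) \<epsilon> t]] bounded_linear_inner_right[of "mat 1"]]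
    by (simp add: o_def)
  finally show ?thesis .
qed

lemma duh_entry:
  assumes "0 < \<epsilon>" "t \<in> {0..T}"
  shows "duh \<epsilon> heat2 x t $ i $ j = duh \<epsilon> (\<lambda>\<tau> z. heat2 \<tau> z $ i $ j) x t"
  using duh_nth[OF heat_continuous(3) assms] duh_nth[OF nth_continuous[OF heat_continuous(3)] assms] by simp

lemma duh_symmetric:
  assumes "0 < \<epsilon>" "t \<in> {0..T}"
  shows "transpose (duh \<epsilon> heat2 x t) = duh \<epsilon> heat2 x t"
proof -
  have "heat2 \<tau> z $ i $ j = heat2 \<tau> z $ j $ i" for \<tau> and z :: "real^'n" and i j
    using transpose_heat2[of \<tau> z] by (metis transpose_def vec_lambda_beta)
  then have "duh \<epsilon> heat2 x t $ i $ j = duh \<epsilon> heat2 x t $ j $ i" for i j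
    unfolding duh_entry[OF assms] by presburger
  then show ?thesis by (simp add: transpose_def vec_eq_iff)
qed

text \<open>This supplies the qualitative regularity from which the Schauder iteration starts. That
  the constant blows up as \<epsilon> tends to 0 is harmless, as the final estimate does not contain
  it.\<close>

lemma duh_locally_lipschitz:
  assumes \<epsilon>: "0 < \<epsilon>"
  shows "\<exists>L\<ge>0. \<forall>x\<in>ball z 1. \<forall>y\<in>ball z 1. \<forall>t\<in>{0..T}. norm (duh \<epsilon> heat2 x t - duh \<epsilon> heat2 y t) \<le> L * dist x y"
proof -
  have "\<exists>B\<ge>0. \<forall>x\<in>cball z 1. \<forall>t\<in>{0..T}. norm (duh \<epsilon> (heat3 i j) x t) \<le> B" for i j
    using duh_bounded[OF heat_continuous(5)[of i j] \<epsilon>, of z 1] by blast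
  then obtain B where B: "\<And>i j. 0 \<le> B i j" "\<And>i j x t. x \<in> cball z 1 \<Longrightarrow> t \<in> {0..T} \<Longrightarrow> norm (duh \<epsilon> (heat3 i j) x t) \<le> B i j" by metis
  define L where "L = (\<Sum>i\<in>UNIV. \<Sum>j\<in>UNIV. B i j)"
  have BL: "B i j \<le> L" for i j
  proof -
    have "B i j \<le> (\<Sum>j\<in>UNIV. B i j)" by (rule member_le_sum) (auto simp: B)
    also have "\<dots> \<le> L" unfolding L_def by (rule member_le_sum) (auto simp: B sum_nonneg)
    finally show ?thesis .
  qed
  have L0: "L \<ge> 0" unfolding L_def by (intro sum_nonneg B)
  have "norm (duh \<epsilon> heat2 x t - duh \<epsilon> heat2 y t) \<le> (real CARD('n) * real CARD('n) * L) * dist x y"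
    if x: "x \<in> ball z 1" and y: "y \<in> ball z 1" and t: "t \<in> {0..T}" for x y t
  proof -
    have "norm (duh \<epsilon> heat2 x t - duh \<epsilon> heat2 y t) \<le> real CARD('n) * real CARD('n) * (L * dist x y)"
    proof (rule matrix_norm_le)
      fix i j :: 'n
      let ?w = "\<lambda>\<tau> z::real^'n. heat2 \<tau> z $ i $ j"
      have "norm (duh \<epsilon> ?w x t - duh \<epsilon> ?w y t) \<le> L * norm (x - y)"
      proof (rule differentiable_bound[OF convex_ball _ _ x y])
        fix v assume v: "v \<in> ball z 1"
        show "((\<lambda>x. duh \<epsilon> ?w x t) has_derivative (\<lambda>h. duh \<epsilon> (heat3 i j) v t \<bullet> h)) (at v within ball z 1)"
          by (rule has_derivative_at_withinI[OF duh_gradient[OF nth_continuous[OF nth_continuous[OF heat_continuous(3)]] heat_continuous(5) heat2_space_derivative \<epsilon> t]])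
        show "onorm (\<lambda>h. duh \<epsilon> (heat3 i j) v t \<bullet> h) \<le> L"
        proof (rule onorm_bound[OF L0])
          fix h
          have "norm (duh \<epsilon> (heat3 i j) v t \<bullet> h) \<le> norm (duh \<epsilon> (heat3 i j) v t) * norm h" using Cauchy_Schwarz_ineq2 by simp
          also have "\<dots> \<le> L * norm h" using B(2)[of v t i j] v t BL[of i j] by (intro mult_right_mono) auto
          finally show "norm (duh \<epsilon> (heat3 i j) v t \<bullet> h) \<le> L * norm h" .
        qed
      qed
      then show "\<bar>(duh \<epsilon> heat2 x t - duh \<epsilon> heat2 y t) $ i $ j\<bar> \<le> L * dist x y"
        by (simp add: duh_entry[OF \<epsilon> t] dist_norm)
    qed
    then show ?thesis by simp
  qed
  then show ?thesis using L0 by (intro exI[of _ "real CARD('n) * real CARD('n) * L"]) auto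
qed

lemma duh_continuous:
  assumes \<epsilon>: "0 < \<epsilon>"
  shows "continuous_on (UNIV \<times> {0..T}) (\<lambda>(x,t). duh \<epsilon> heat x t)"
proof (rule continuous_on_locally_lipschitz)
  fix z
  obtain B1 where B1: "B1 \<ge> 0" "\<And>x t. x \<in> cball z 1 \<Longrightarrow> t \<in> {0..T} \<Longrightarrow> norm (duh \<epsilon> heat1 x t) \<le> B1"
    using duh_bounded[OF heat_continuous(2) \<epsilon>, of z 1] by blast
  obtain B2 where B2: "B2 \<ge> 0" "\<And>x t. x \<in> cball z 1 \<Longrightarrow> t \<in> {0..T} \<Longrightarrow> norm (pot heat x \<epsilon> t) \<le> B2"
    using duh_bounded[OF heat_continuous(1) \<epsilon>, of z 1] by blast
  obtain B3 where B3: "B3 \<ge> 0" "\<And>x t. x \<in> cball z 1 \<Longrightarrow> t \<in> {0..T} \<Longrightarrow> norm (duh \<epsilon> heatt x t) \<le> B3"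
    using duh_bounded[OF heat_continuous(4) \<epsilon>, of z 1] by blast
  have "\<bar>duh \<epsilon> heat x t - duh \<epsilon> heat z s\<bar> \<le> (B1 + B2 + B3) * (dist x z + \<bar>t - s\<bar>)"
    if x: "x \<in> ball z 1" and t: "t \<in> {0..T}" and s: "s \<in> {0..T}" for x t s
  proof -
    have "\<bar>duh \<epsilon> heat x t - duh \<epsilon> heat z t\<bar> \<le> B1 * dist x z"
      by (rule function_lipschitz[OF drv_subset[OF duh_drv[OF \<epsilon>] subset_UNIV] t convex_ball[of z 1]]) (use B1 x t in auto)
    moreover have "\<bar>duh \<epsilon> heat z t - duh \<epsilon> heat z s\<bar> \<le> (B2 + B3) * \<bar>t - s\<bar>"
    proof (rule time_lipschitz[OF drvD(3)[OF duh_drv[OF \<epsilon>]] _ s t])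
      show "\<bar>pot heat z \<epsilon> \<tau> + duh \<epsilon> heatt z \<tau>\<bar> \<le> B2 + B3" if "\<tau> \<in> {0..T}" for \<tau>
        using B2(2)[of z \<tau>] B3(2)[of z \<tau>] that by auto
    qed auto
    moreover have "B1 * dist x z \<le> (B1 + B2 + B3) * dist x z" "(B2 + B3) * \<bar>t - s\<bar> \<le> (B1 + B2 + B3) * \<bar>t - s\<bar>"
      using B1 B2 B3 by (auto intro!: mult_right_mono)
    ultimately show ?thesis unfolding distrib_left by linarith
  qed
  then show "\<exists>L. \<forall>x\<in>ball z 1. \<forall>t\<in>{0..T}. \<forall>s\<in>{0..T}. \<bar>duh \<epsilon> heat x t - duh \<epsilon> heat z s\<bar> \<le> L * (dist x z + \<bar>t - s\<bar>)" by blast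
qed

text \<open>The maximum principle on the whole space presupposes some bound; afterwards it replaces
  this one by a bound independent of \<epsilon>.\<close>

lemma duh_globally_bounded:
  assumes \<epsilon>: "0 < \<epsilon>" and A: "\<And>y s. s \<in> {0..T} \<Longrightarrow> \<bar>q y s\<bar> \<le> A"
  shows "\<exists>B. \<forall>x. \<forall>t\<in>{0..T}. \<bar>duh \<epsilon> heat x t\<bar> \<le> B"
proof -
  define c where "c = \<epsilon> powr (- (real CARD('n) / 2))"
  define V where "V = measure lborel (cbox a b)"
  have V: "V \<ge> 0" by (simp add: V_def)
  have "\<bar>duh \<epsilon> heat x t\<bar> \<le> (\<bar>A\<bar> * c * V) * T" if t: "t \<in> {0..T}" for x t
  proof -
    have p: "\<bar>pot heat x \<tau> s\<bar> \<le> \<bar>A\<bar> * c * V" if "\<epsilon> \<le> \<tau>" "s \<in> {0..T}" for \<tau> s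
    proof -
      have "((\<lambda>y. q y s *\<^sub>R heat \<tau> (x - y)) has_integral pot heat x \<tau> s) (cbox a b)"
        unfolding pot_def using \<epsilon> that
        by (intro integrable_integral integrable_continuous pot_integrand_continuous'(2)[OF heat_continuous(1)]) auto
      then have "norm (pot heat x \<tau> s) \<le> \<bar>A\<bar> * c * V"
        unfolding V_def
      proof (rule has_integral_bound[rotated])
        fix y
        show "norm (q y s *\<^sub>R heat \<tau> (x - y)) \<le> \<bar>A\<bar> * c"
        proof -
          have "\<bar>q y s\<bar> \<le> \<bar>A\<bar>" using A[OF that(2), of y] by linarith
          moreover have "\<bar>heat \<tau> (x - y)\<bar> \<le> c"
          proof -
            have "\<tau> powr (- (real CARD('n) / 2)) \<le> c" unfolding c_def using that \<epsilon> by (intro powr_mono2') auto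
            moreover have "exp (- ((x - y) \<bullet> (x - y)) / (4 * \<tau>)) \<le> 1" using that \<epsilon> by simp
            ultimately have "heat \<tau> (x - y) \<le> c * 1" unfolding heat_def by (intro mult_mono) (auto simp: c_def)
            moreover have "0 \<le> heat \<tau> (x - y)" by (simp add: heat_def)
            ultimately show ?thesis by simp
          qed
          ultimately show ?thesis by (simp add: abs_mult mult_mono)
        qed
      qed (simp add: c_def)
      then show ?thesis by simp
    qed
    have "norm (duh \<epsilon> heat x t) \<le> (\<bar>A\<bar> * c * V) * (t - 0)"
      unfolding duh_def cbox_interval
    proof (rule integral_bound)
      show "continuous_on {0..t} (\<lambda>s. pot heat x (t - s + \<epsilon>) s)" using duh_integrand_continuous(2)[OF heat_continuous(1) \<epsilon> t] by simp
      show "norm (pot heat x (t - s + \<epsilon>) s) \<le> \<bar>A\<bar> * c * V" if "s \<in> {0..t}" for s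
        using p[of "t - s + \<epsilon>" s] that t by auto
    qed (use t in auto)
    also have "\<dots> \<le> (\<bar>A\<bar> * c * V) * T" using t using V by (intro mult_left_mono) (auto simp: c_def)
    finally show ?thesis by simp
  qed
  then show ?thesis by blast
qed

end

section \<open>Gaussian smoothing and solvability of the heat equation\<close>

definition gauss_const :: "'n::finite itself \<Rightarrow> real" where
  "gauss_const _ = (1 / sqrt (4 * pi)) ^ CARD('n)"

lemma gauss_const_pos: "gauss_const TYPE('n::finite) > 0"
  by (simp add: gauss_const_def)

lemma heat_nonneg: "0 \<le> heat \<tau> z"
  by (simp add: heat_def)

lemma heat_continuous_on: "continuous_on UNIV (heat \<tau>)"
  by (rule has_derivative_continuous_on[OF has_derivative_at_withinI[OF heat_space_derivative]])

lemma heat_measurable [measurable]: "heat \<tau> \<in> borel_measurable borel"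
  by (rule borel_measurable_continuous_onI[OF heat_continuous_on])

text \<open>The normalised kernel at time 1 is a product of one-dimensional normal densities with
  variance 2.\<close>

lemma heat_has_integral:
  "has_bochner_integral lborel (\<lambda>z::real^'n. gauss_const TYPE('n) * heat 1 z) 1"
proof (rule has_bochner_integral_nn_integral)
  have N: "normal_density 0 (sqrt 2) x = (1 / sqrt (4 * pi)) * exp (- (x\<^sup>2) / 4)" for x :: real
    by (simp add: normal_density_def mult.commute)
  have eq: "(\<Prod>b\<in>(Basis::(real^'n) set). ennreal (normal_density 0 (sqrt 2) (z \<bullet> b))) = ennreal (gauss_const TYPE('n) * heat 1 z)" for z :: "real^'n"
  proof -
    have "(\<Prod>b\<in>(Basis::(real^'n) set). ennreal (normal_density 0 (sqrt 2) (z \<bullet> b))) = ennreal (\<Prod>b\<in>(Basis::(real^'n) set). normal_density 0 (sqrt 2) (z \<bullet> b))"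
      by (rule prod_ennreal) simp
    also have "(\<Prod>b\<in>(Basis::(real^'n) set). normal_density 0 (sqrt 2) (z \<bullet> b))
       = (1 / sqrt (4 * pi)) ^ DIM(real^'n) * (\<Prod>b\<in>(Basis::(real^'n) set). exp (- ((z \<bullet> b)\<^sup>2) / 4))"
      unfolding N prod.distrib by simp
    also have "(\<Prod>b\<in>(Basis::(real^'n) set). exp (- ((z \<bullet> b)\<^sup>2) / 4)) = exp (\<Sum>b\<in>(Basis::(real^'n) set). - ((z \<bullet> b)\<^sup>2) / 4)"
      by (rule exp_sum[symmetric]) simp
    also have "(\<Sum>b\<in>(Basis::(real^'n) set). - ((z \<bullet> b)\<^sup>2) / 4) = - (z \<bullet> z) / 4"
      by (subst (2) euclidean_inner) (simp add: sum_divide_distrib sum_negf power2_eq_square)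
    finally show ?thesis by (simp add: gauss_const_def heat_def)
  qed
  have "(\<integral>\<^sup>+z. ennreal (gauss_const TYPE('n) * heat 1 z) \<partial>(lborel :: (real^'n) measure))
     = (\<integral>\<^sup>+z. (\<Prod>b\<in>(Basis::(real^'n) set). ennreal (normal_density 0 (sqrt 2) (z \<bullet> b))) \<partial>lborel)"
    unfolding eq ..
  also have "\<dots> = (\<Prod>b\<in>(Basis::(real^'n) set). (\<integral>\<^sup>+x. ennreal (normal_density 0 (sqrt 2) x) \<partial>lborel))"
    by (rule nn_integral_lborel_prod) auto
  also have "(\<integral>\<^sup>+x. ennreal (normal_density 0 (sqrt 2) x) \<partial>lborel) = ennreal 1"
    by (subst nn_integral_eq_integral) auto
  finally show "(\<integral>\<^sup>+z. ennreal (gauss_const TYPE('n) * heat 1 z) \<partial>(lborel :: (real^'n) measure)) = ennreal 1" by simp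
qed (use gauss_const_pos[where 'n='n] in \<open>auto intro!: AE_I2 mult_nonneg_nonneg heat_nonneg simp: less_imp_le\<close>)

text \<open>The heat semigroup at time \<open>h\<close>, written after the substitution y = x - sqrt
  h z. The weight is then a fixed probability density, so Hoelder bounds are inherited with the same
  constant and dominated convergence applies as h tends to 0.\<close>

definition smoothing :: "real \<Rightarrow> (real^'n \<Rightarrow> real \<Rightarrow> real) \<Rightarrow> real^'n \<Rightarrow> real \<Rightarrow> real" where
  "smoothing h q x t = (\<integral>z. (gauss_const TYPE('n) * heat 1 z) * q (x - sqrt h *\<^sub>R z) t \<partial>lborel)"

lemma hol_section_continuous:
  assumes "hol \<alpha> UNIV T A q" "0 < \<alpha>" "t \<in> {0..T}"
  shows "continuous_on UNIV (\<lambda>x. q x t)"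
proof -
  have "continuous_on UNIV (\<lambda>x. case (x,t) of (x,t) \<Rightarrow> q x t)"
    by (rule continuous_on_compose2[OF hol_continuous[OF assms(1,2)], where f="\<lambda>x. (x,t)"])
      (use assms(3) in \<open>auto intro!: continuous_intros\<close>)
  then show ?thesis by simp
qed

lemma gauss_times_bound:
  assumes "\<bar>y\<bar> \<le> A"
  shows "\<bar>(gauss_const TYPE('n) * heat 1 (z::real^'n)) * y\<bar> \<le> A * (gauss_const TYPE('n) * heat 1 z)"
proof -
  have 0: "0 \<le> gauss_const TYPE('n) * heat 1 z" using gauss_const_pos[where 'n='n] heat_nonneg[of 1 z] by simp
  then have "\<bar>(gauss_const TYPE('n) * heat 1 z) * y\<bar> = (gauss_const TYPE('n) * heat 1 z) * \<bar>y\<bar>"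
    by (simp only: abs_mult[of _ y] abs_of_nonneg)
  also have "\<dots> \<le> (gauss_const TYPE('n) * heat 1 z) * A" by (rule mult_left_mono[OF assms 0])
  finally show ?thesis by (simp add: mult.commute)
qed

lemma gauss_times_integrable:
  fixes g :: "real^'n \<Rightarrow> real"
  assumes c: "continuous_on UNIV g" and A: "\<And>z. \<bar>g z\<bar> \<le> A"
  shows "integrable lborel (\<lambda>z. (gauss_const TYPE('n) * heat 1 z) * g z)"
    "\<bar>\<integral>z. (gauss_const TYPE('n) * heat 1 z) * g z \<partial>lborel\<bar> \<le> A"
proof -
  have m[measurable]: "g \<in> borel_measurable borel" by (rule borel_measurable_continuous_onI[OF c])
  have dom: "integrable lborel (\<lambda>z::real^'n. A * (gauss_const TYPE('n) * heat 1 z))"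
    using heat_has_integral by (intro integrable_mult_right) (auto simp: has_bochner_integral_iff)
  have b: "\<bar>(gauss_const TYPE('n) * heat 1 z) * g z\<bar> \<le> A * (gauss_const TYPE('n) * heat 1 z)" for z :: "real^'n"
    by (rule gauss_times_bound[OF A])
  show i: "integrable lborel (\<lambda>z. (gauss_const TYPE('n) * heat 1 z) * g z)"
    by (rule Bochner_Integration.integrable_bound[OF dom]) (use b in \<open>auto intro!: AE_I2 order_trans[OF _ abs_ge_self]\<close>)
  have "\<bar>\<integral>z. (gauss_const TYPE('n) * heat 1 z) * g z \<partial>lborel\<bar> \<le> (\<integral>z. \<bar>(gauss_const TYPE('n) * heat 1 z) * g z\<bar> \<partial>lborel)"
    by (rule integral_abs_bound)
  also have "\<dots> \<le> (\<integral>z. A * (gauss_const TYPE('n) * heat 1 z) \<partial>(lborel :: (real^'n) measure))"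
    by (rule integral_mono[OF integrable_abs[OF i] dom b])
  also have "\<dots> = A" using heat_has_integral[where 'n='n] by (simp add: has_bochner_integral_iff)
  finally show "\<bar>\<integral>z. (gauss_const TYPE('n) * heat 1 z) * g z \<partial>lborel\<bar> \<le> A" .
qed

lemma smoothing_hol:
  fixes q :: "real^'n \<Rightarrow> real \<Rightarrow> real"
  assumes q: "hol \<alpha> UNIV T A q" and \<alpha>: "0 < \<alpha>"
  shows "hol \<alpha> UNIV T A (smoothing h q)"
proof -
  have c: "continuous_on UNIV (\<lambda>z. q (x - sqrt h *\<^sub>R z) t)" if "t \<in> {0..T}" for x t
    by (rule continuous_on_compose2[OF hol_section_continuous[OF q \<alpha> that]]) (auto intro!: continuous_intros)
  have b: "\<bar>q z t\<bar> \<le> A" if "t \<in> {0..T}" for z t using holD(1)[OF q _ that, of z] by simp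
  show ?thesis
    unfolding hol_def
  proof (intro conjI ballI)
    fix x y t s assume t: "t \<in> {0..T}"
    show "norm (smoothing h q x t) \<le> A"
      unfolding smoothing_def real_norm_def by (rule gauss_times_integrable(2)[OF c[OF t] b[OF t]])
    assume s: "s \<in> {0..T}"
    have "smoothing h q x t - smoothing h q y s = (\<integral>z. (gauss_const TYPE('n) * heat 1 z) * (q (x - sqrt h *\<^sub>R z) t - q (y - sqrt h *\<^sub>R z) s) \<partial>lborel)"
      unfolding smoothing_def right_diff_distrib
      by (rule Bochner_Integration.integral_diff[symmetric]) (rule gauss_times_integrable(1)[OF c b], assumption?, (rule t s)+)+
    also have "\<bar>\<dots>\<bar> \<le> A * (dist x y powr \<alpha> + \<bar>t - s\<bar> powr (\<alpha>/2))"
    proof (rule gauss_times_integrable(2)[OF continuous_on_diff[OF c[OF t] c[OF s]]])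
      fix z
      show "\<bar>q (x - sqrt h *\<^sub>R z) t - q (y - sqrt h *\<^sub>R z) s\<bar> \<le> A * (dist x y powr \<alpha> + \<bar>t - s\<bar> powr (\<alpha>/2))"
        using holD(2)[OF q _ t _ s, of "x - sqrt h *\<^sub>R z" "y - sqrt h *\<^sub>R z"] by (simp add: dist_norm)
    qed
    finally show "norm (smoothing h q x t - smoothing h q y s) \<le> A * (dist x y powr \<alpha> + \<bar>t - s\<bar> powr (\<alpha>/2))" by simp
  qed
qed

lemma smoothing_tendsto:
  fixes q :: "real^'n \<Rightarrow> real \<Rightarrow> real"
  assumes q: "hol \<alpha> UNIV T A q" and \<alpha>: "0 < \<alpha>" and t: "t \<in> {0..T}"
  shows "(\<lambda>k. smoothing (1 / real (Suc k)) q x t) \<longlonglongrightarrow> q x t"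
proof -
  let ?g = "\<lambda>z::real^'n. gauss_const TYPE('n) * heat 1 z"
  have qc: "continuous_on UNIV (\<lambda>x. q x t)" by (rule hol_section_continuous[OF q \<alpha> t])
  have qm[measurable]: "(\<lambda>x. q x t) \<in> borel_measurable borel" by (rule borel_measurable_continuous_onI[OF qc])
  have dom: "integrable lborel (\<lambda>z::real^'n. A * ?g z)"
    using heat_has_integral by (intro integrable_mult_right) (auto simp: has_bochner_integral_iff)
  have "(\<lambda>k. \<integral>z. ?g z * q (x - sqrt (1 / real (Suc k)) *\<^sub>R z) t \<partial>lborel) \<longlonglongrightarrow> (\<integral>z. ?g z * q x t \<partial>lborel)"
  proof (rule integral_dominated_convergence[OF _ _ dom])
    show "(\<lambda>z. ?g z * q x t) \<in> borel_measurable lborel" by measurable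
    have m1: "(\<lambda>z::real^'n. q (x - c *\<^sub>R z) t) \<in> borel_measurable borel" for c
      by (rule borel_measurable_continuous_onI, rule continuous_on_compose2[OF qc]) (auto intro!: continuous_intros)
    show "(\<lambda>z. ?g z * q (x - sqrt (1 / real (Suc k)) *\<^sub>R z) t) \<in> borel_measurable lborel" for k
      using m1 by simp
    show "AE z in lborel. (\<lambda>k. ?g z * q (x - sqrt (1 / real (Suc k)) *\<^sub>R z) t) \<longlonglongrightarrow> ?g z * q x t"
    proof (rule AE_I2)
      fix z :: "real^'n"
      have "(\<lambda>k. sqrt (1 / real (Suc k))) \<longlonglongrightarrow> sqrt 0"
        by (intro tendsto_real_sqrt) (use LIMSEQ_inverse_real_of_nat in \<open>simp add: inverse_eq_divide del: of_nat_Suc\<close>)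
      then have "(\<lambda>k. x - sqrt (1 / real (Suc k)) *\<^sub>R z) \<longlonglongrightarrow> x - sqrt 0 *\<^sub>R z" by (intro tendsto_diff tendsto_const tendsto_scaleR)
      from continuous_on_tendsto_compose[OF qc this]
      show "(\<lambda>k. ?g z * q (x - sqrt (1 / real (Suc k)) *\<^sub>R z) t) \<longlonglongrightarrow> ?g z * q x t"
        by (intro tendsto_mult_left) simp
    qed
    show "AE z in lborel. norm (?g z * q (x - sqrt (1 / real (Suc k)) *\<^sub>R z) t) \<le> A * ?g z" for k
    proof (rule AE_I2)
      fix z :: "real^'n"
      show "norm (?g z * q (x - sqrt (1 / real (Suc k)) *\<^sub>R z) t) \<le> A * ?g z"
        unfolding real_norm_def by (rule gauss_times_bound) (use holD(1)[OF q UNIV_I t] in simp)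
    qed
  qed
  moreover have "(\<integral>z. ?g z * q x t \<partial>lborel) = q x t"
    using heat_has_integral[where 'n='n] by (simp add: has_bochner_integral_iff)
  ultimately show ?thesis unfolding smoothing_def by (simp only:)
qed

text \<open>Scaling by sqrt h turns the kernel at time \<open>h\<close> into the one at time 1;
  restricting to the box loses nothing, as the source vanishes outside. This identifies the diagonal
  term in the time derivative of the shifted potential.\<close>

lemma smoothing_eq_pot:
  fixes q :: "real^'n \<Rightarrow> real \<Rightarrow> real"
  assumes q: "hol \<alpha> UNIV T A q" and \<alpha>: "0 < \<alpha>" and t: "t \<in> {0..T}" and h: "0 < h"
    and supp: "\<And>y. y \<notin> cbox a b \<Longrightarrow> q y t = 0"
  shows "smoothing h q x t = gauss_const TYPE('n) * pot q a b heat x h t"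
proof -
  have qc: "continuous_on UNIV (\<lambda>x. q x t)" by (rule hol_section_continuous[OF q \<alpha> t])
  let ?f = "\<lambda>y. q y t * heat h (x - y)"
  have fc: "continuous_on UNIV ?f"
    by (intro continuous_intros qc continuous_on_compose2[OF heat_continuous_on]) auto
  have fm[measurable]: "?f \<in> borel_measurable borel" by (rule borel_measurable_continuous_onI[OF fc])
  have "integrable lborel (\<lambda>y. indicator (cbox a b) y *\<^sub>R ?f y)"
    by (rule borel_integrable_compact[OF compact_cbox continuous_on_subset[OF fc]]) auto
  moreover have "indicator (cbox a b) y *\<^sub>R ?f y = ?f y" for y using supp[of y] by (auto simp: indicator_def)
  ultimately have fi: "integrable lborel ?f" by (simp only:)
  have "pot q a b heat x h t = integral UNIV ?f"
  proof -
    have "integral UNIV ?f = integral UNIV (\<lambda>y. if y \<in> cbox a b then ?f y else 0)"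
      by (rule integral_cong) (use supp in auto)
    also have "\<dots> = integral (cbox a b) ?f" by (rule integral_restrict_UNIV)
    finally show ?thesis by (simp add: pot_def[OF hol_continuous[OF q \<alpha>]])
  qed
  also have "\<dots> = (\<integral>y. ?f y \<partial>lborel)" by (rule integral_lborel[OF fi])
  also have "\<dots> = (\<integral>z. \<bar>- sqrt h\<bar> ^ DIM(real^'n) *\<^sub>R ?f (x + (- sqrt h) *\<^sub>R z) \<partial>lborel)"
    using h by (subst lborel_affine[of "- sqrt h" x]) (auto simp: integral_density integral_distr)
  also have "\<dots> = (\<integral>z. heat 1 z * q (x - sqrt h *\<^sub>R z) t \<partial>lborel)"
  proof (rule Bochner_Integration.integral_cong[OF refl])
    fix z :: "real^'n"
    have "heat h (sqrt h *\<^sub>R z) = h powr (- (real CARD('n) / 2)) * heat 1 z"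
      using h by (simp add: heat_def power2_eq_square[symmetric] mult.assoc[symmetric])
    moreover have "(sqrt h) ^ CARD('n) * h powr (- (real CARD('n) / 2)) = 1"
    proof -
      have "(sqrt h) ^ CARD('n) = h powr (real CARD('n) / 2)"
        using h by (simp add: powr_half_sqrt[symmetric] powr_realpow[symmetric] powr_powr)
      then show ?thesis using h by (simp add: powr_minus field_simps)
    qed
    ultimately show "\<bar>- sqrt h\<bar> ^ DIM(real^'n) *\<^sub>R ?f (x + (- sqrt h) *\<^sub>R z) = heat 1 z * q (x - sqrt h *\<^sub>R z) t"
      using h by (simp add: mult.assoc[symmetric] mult.commute[of "q _ _"])
  qed
  finally show ?thesis unfolding smoothing_def by (simp add: mult.assoc)
qed

text \<open>A function of time alone is invisible to the elliptic part, so \<open>E\<close> is a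
  barrier as soon as its derivative dominates the source. Both signs of \<open>u\<close> are handled
  together by a factor \<sigma> of modulus 1.\<close>

lemma sup_bound:
  fixes u :: "real^'n \<Rightarrow> real \<Rightarrow> real"
  assumes d: "drv UNIV T u u1 u2 ut" and cont: "continuous_on (UNIV \<times> {0..T}) (\<lambda>(x,t). u x t)"
    and bnd: "\<And>x t. t \<in> {0..T} \<Longrightarrow> \<bar>u x t\<bar> \<le> B" and init: "\<And>x. u x 0 = 0"
    and psd: "\<And>x. transpose (a x) = a x" "\<And>x v. 0 \<le> v \<bullet> (a x *v v)"
    and ab: "\<And>x. norm (a x) \<le> \<Lambda>" "\<And>x. norm (b x) \<le> \<Lambda>"
    and eq: "\<And>x t. t \<in> {0..T} \<Longrightarrow> ut x t = a x \<bullet> u2 x t + b x \<bullet> u1 x t + h x t"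
    and E: "\<And>t. t \<in> {0..T} \<Longrightarrow> (E has_real_derivative E' t) (at t within {0..T})" "\<And>t. t \<in> {0..T} \<Longrightarrow> 0 \<le> E t"
    and h: "\<And>x t. t \<in> {0..T} \<Longrightarrow> \<bar>h x t\<bar> \<le> E' t" and t: "t \<in> {0..T}"
  shows "\<bar>u x t\<bar> \<le> E t"
proof -
  have *: "\<sigma> * u x t - E t \<le> 0" if \<sigma>: "\<bar>\<sigma>\<bar> = 1" for \<sigma> :: real
  proof (rule maximum_principle_space[where w = "\<lambda>x t. \<sigma> * u x t - E t" and K = 0 and B = B and a = a and b = b and T = T and \<Lambda> = \<Lambda>])
    have "continuous_on {0..T} E" by (rule DERIV_continuous_on[OF E(1)])
    then have "continuous_on (UNIV \<times> {0..T}) (\<lambda>p. E (snd p))"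
      by (rule continuous_on_compose2) (auto intro!: continuous_intros)
    then show "continuous_on (UNIV \<times> {0..T}) (\<lambda>(x, t). \<sigma> * u x t - E t)"
      using cont unfolding case_prod_beta by (intro continuous_intros)
    show "\<sigma> * u x t - E t \<le> B" if "t \<in> {0..T}" for x t
    proof -
      have "\<sigma> * u x t \<le> \<bar>\<sigma> * u x t\<bar>" by simp
      also have "\<dots> \<le> B" using bnd[OF that] \<sigma> by (simp add: abs_mult)
      finally show ?thesis using E(2)[OF that] by linarith
    qed
    show "drv UNIV T (\<lambda>x t. \<sigma> * u x t - E t) (\<lambda>x t. \<sigma> *\<^sub>R u1 x t - 0) (\<lambda>x t. \<sigma> *\<^sub>R u2 x t - 0) (\<lambda>x t. \<sigma> * ut x t - E' t)"
      by (intro drv_diff drv_scale d drv_time E(1))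
    show "\<sigma> * ut x t - E' t \<le> a x \<bullet> (\<sigma> *\<^sub>R u2 x t - 0) + b x \<bullet> (\<sigma> *\<^sub>R u1 x t - 0) + 0 * (\<sigma> * u x t - E t)" if "t \<in> {0<..T}" for x t
    proof -
      have t: "t \<in> {0..T}" using that by auto
      have "\<sigma> * h x t \<le> \<bar>\<sigma> * h x t\<bar>" by simp
      also have "\<dots> \<le> E' t" using h[OF t] \<sigma> by (simp add: abs_mult)
      finally show ?thesis using eq[OF t, of x] by (simp add: algebra_simps)
    qed
    show "\<sigma> * u x 0 - E 0 \<le> 0" for x using init[of x] E(2)[of 0] t by auto
  qed (use psd ab t in auto)
  from *[of 1] *[of "-1"] show ?thesis by auto
qed

text \<open>Four families are packed into one with values in a product space, so that they converge
  along one common filter.\<close>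

lemma pointwise_compactness_quadruple:
  fixes u :: "nat \<Rightarrow> 'x \<Rightarrow> 'y \<Rightarrow> 'a::euclidean_space" and u1 :: "nat \<Rightarrow> 'x \<Rightarrow> 'y \<Rightarrow> 'b::euclidean_space"
    and u2 :: "nat \<Rightarrow> 'x \<Rightarrow> 'y \<Rightarrow> 'c::euclidean_space" and u3 :: "nat \<Rightarrow> 'x \<Rightarrow> 'y \<Rightarrow> 'd::euclidean_space"
  assumes bd: "\<And>x t. P x t \<Longrightarrow> \<exists>K. \<forall>\<^sub>F k in sequentially.
      norm (u k x t) \<le> K \<and> norm (u1 k x t) \<le> K \<and> norm (u2 k x t) \<le> K \<and> norm (u3 k x t) \<le> K"
  obtains F v v1 v2 v3 where "F \<noteq> bot" "F \<le> sequentially"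
    "\<And>x t. P x t \<Longrightarrow> ((\<lambda>k. u k x t) \<longlongrightarrow> v x t) F" "\<And>x t. P x t \<Longrightarrow> ((\<lambda>k. u1 k x t) \<longlongrightarrow> v1 x t) F"
    "\<And>x t. P x t \<Longrightarrow> ((\<lambda>k. u2 k x t) \<longlongrightarrow> v2 x t) F" "\<And>x t. P x t \<Longrightarrow> ((\<lambda>k. u3 k x t) \<longlongrightarrow> v3 x t) F"
proof -
  define g where "g k p = (if P (fst p) (snd p) then (u k (fst p) (snd p), u1 k (fst p) (snd p), u2 k (fst p) (snd p), u3 k (fst p) (snd p)) else 0)"
    for k p
  have "\<exists>B. \<forall>\<^sub>F k in sequentially. norm (g k p) \<le> B" for p
  proof (cases "P (fst p) (snd p)")
    case True
    obtain K where "\<forall>\<^sub>F k in sequentially. norm (u k (fst p) (snd p)) \<le> K \<and> norm (u1 k (fst p) (snd p)) \<le> K \<and>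
        norm (u2 k (fst p) (snd p)) \<le> K \<and> norm (u3 k (fst p) (snd p)) \<le> K" using bd[OF True] by blast
    then have "\<forall>\<^sub>F k in sequentially. norm (g k p) \<le> 4 * K"
    proof eventually_elim
      case (elim k)
      have tr: "norm (a,b,c,d) \<le> norm a + norm b + norm c + norm d" for a :: 'a and b :: 'b and c :: 'c and d :: 'd
        using norm_Pair_le[of a "(b,c,d)"] norm_Pair_le[of b "(c,d)"] norm_Pair_le[of c d] by linarith
      show ?case using elim True tr[of "u k (fst p) (snd p)" "u1 k (fst p) (snd p)" "u2 k (fst p) (snd p)" "u3 k (fst p) (snd p)"]
        by (simp add: g_def)
    qed
    then show ?thesis by blast
  next
    case False
    then have "g k p = 0" for k unfolding g_def by (rule if_not_P)
    then show ?thesis by (intro exI[of _ 0]) simp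
  qed
  then obtain F l where F: "F \<noteq> bot" "F \<le> sequentially" and l: "\<And>p. ((\<lambda>k. g k p) \<longlongrightarrow> l p) F"
    using pointwise_compactness[of g] by metis
  have L: "((\<lambda>k. u k x t) \<longlongrightarrow> fst (l (x,t))) F" "((\<lambda>k. u1 k x t) \<longlongrightarrow> fst (snd (l (x,t)))) F"
    "((\<lambda>k. u2 k x t) \<longlongrightarrow> fst (snd (snd (l (x,t))))) F" "((\<lambda>k. u3 k x t) \<longlongrightarrow> snd (snd (snd (l (x,t))))) F" if "P x t" for x t
    using tendsto_fst[OF l[of "(x,t)"]] tendsto_fst[OF tendsto_snd[OF l[of "(x,t)"]]]
      tendsto_fst[OF tendsto_snd[OF tendsto_snd[OF l[of "(x,t)"]]]] tendsto_snd[OF tendsto_snd[OF tendsto_snd[OF l[of "(x,t)"]]]] that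
    by (simp_all add: g_def)
  show thesis by (rule that[OF F L])
qed

lemma reg_compact:
  fixes u :: "nat \<Rightarrow> real^'n \<Rightarrow> real \<Rightarrow> real"
  assumes R: "\<And>k. reg \<alpha> UNIV T K (u k) (u1 k) (u2 k) (ut k)" and \<alpha>: "0 < \<alpha>" and T: "0 \<le> T" and K: "0 \<le> K"
  obtains F v v1 v2 vt where "F \<noteq> bot" "F \<le> sequentially" "reg \<alpha> UNIV T K v v1 v2 vt"
    "\<And>x t. t \<in> {0..T} \<Longrightarrow> ((\<lambda>k. u k x t) \<longlongrightarrow> v x t) F"
    "\<And>x t. t \<in> {0..T} \<Longrightarrow> ((\<lambda>k. u1 k x t) \<longlongrightarrow> v1 x t) F"
    "\<And>x t. t \<in> {0..T} \<Longrightarrow> ((\<lambda>k. u2 k x t) \<longlongrightarrow> v2 x t) F"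
    "\<And>x t. t \<in> {0..T} \<Longrightarrow> ((\<lambda>k. ut k x t) \<longlongrightarrow> vt x t) F"
proof (rule pointwise_compactness_quadruple[of "\<lambda>x t. t \<in> {0..T}" u u1 u2 ut], goal_cases)
  case (1 x t)
  then show ?case using holD(1)[OF regD(4)[OF R] UNIV_I] holD(1)[OF regD(5)[OF R] UNIV_I] holD(1)[OF regD(6)[OF R] UNIV_I] holD(1)[OF regD(7)[OF R] UNIV_I]
    by (intro exI[of _ K] always_eventually allI) blast
next
  case (2 F v v1 v2 vt)
  note F = 2(2,3) and l = 2(4,5,6,7)
  from reg_limit[OF F(1) open_UNIV \<alpha> K always_eventually[OF allI[OF R]] l T] show ?case by (rule that[OF F _ l])
qed

lemma coef_identity:
  "coef 1 (norm (mat 1 :: real^'n^'n) + 1) \<alpha> S (\<lambda>_. mat 1) (\<lambda>_. 0 :: real^'n)"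
  by (simp add: coef_def)

text \<open>The shifted potentials solve the equation with the source smoothed at time 1/(k+1).
  Smoothing keeps the Hoelder constant \<open>A\<close>, so the global estimate is uniform in k, and
  a limit along a filter solves the equation with the original source.\<close>

lemma laplace_solvable:
  fixes q :: "real^'n \<Rightarrow> real \<Rightarrow> real"
  assumes \<alpha>: "0 < \<alpha>" "\<alpha> < 1" and T: "0 \<le> T" and q: "hol \<alpha> UNIV T A q"
    and supp: "\<And>x t. x \<notin> cbox a b \<Longrightarrow> t \<in> {0..T} \<Longrightarrow> q x t = 0"
  shows "\<exists>K u u1 u2 ut. reg \<alpha> UNIV T K u u1 u2 ut \<and>
     (\<forall>x. \<forall>t\<in>{0..T}. ut x t = mat 1 \<bullet> u2 x t + q x t)"
proof -
  define c where "c = gauss_const TYPE('n)"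
  have A: "0 \<le> A" using order_trans[OF norm_ge_zero holD(1)[OF q UNIV_I, of 0]] T by auto
  define \<Lambda> where "\<Lambda> = norm (mat 1 :: real^'n^'n) + 1"
  have \<Lambda>: "1 \<le> \<Lambda>" by (simp add: \<Lambda>_def)
  note qc = hol_continuous[OF q \<alpha>(1)]
  define h where "h k = 1 / real (Suc k)" for k
  have h: "h k > 0" for k by (simp add: h_def)
  define u where "u k x t = c * duh q a b (h k) heat x t" for k x t
  define u1 where "u1 k x t = c *\<^sub>R duh q a b (h k) heat1 x t" for k x t
  define u2 where "u2 k x t = c *\<^sub>R duh q a b (h k) heat2 x t" for k x t
  define ut where "ut k x t = c * (pot q a b heat x (h k) t + duh q a b (h k) heatt x t)" for k x t
  have d: "drv UNIV T (u k) (u1 k) (u2 k) (ut k)" for k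
    unfolding u_def[abs_def] u1_def[abs_def] u2_def[abs_def] ut_def[abs_def] by (rule drv_scale[OF duh_drv[OF qc h]])
  have cont: "continuous_on (UNIV \<times> {0..T}) (\<lambda>(x,t). u k x t)" for k
    unfolding u_def case_prod_beta by (intro continuous_on_mult_left duh_continuous[OF qc h, unfolded case_prod_beta])
  have init: "u k x 0 = 0" for k x by (simp add: u_def duh_def[OF qc])
  have sh: "hol \<alpha> UNIV T A (smoothing (h k) q)" for k by (rule smoothing_hol[OF q \<alpha>(1)])
  have eq: "ut k x t = mat 1 \<bullet> u2 k x t + smoothing (h k) q x t" if t: "t \<in> {0..T}" for k x t
  proof -
    have E: "duh q a b (h k) heatt x t = mat 1 \<bullet> duh q a b (h k) heat2 x t" by (rule duh_heat_equation[OF qc h t])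
    have S: "smoothing (h k) q x t = c * pot q a b heat x (h k) t"
      unfolding c_def by (rule smoothing_eq_pot[OF q \<alpha>(1) t h supp[OF _ t]])
    show ?thesis unfolding ut_def u2_def E S by (simp add: distrib_left)
  qed
  have bd: "\<bar>u k x t\<bar> \<le> A * t" if t: "t \<in> {0..T}" for k x t
  proof -
    have "\<exists>B. \<forall>x. \<forall>t\<in>{0..T}. \<bar>duh q a b (h k) heat x t\<bar> \<le> B"
      by (rule duh_globally_bounded[OF qc h, where A=A]) (use holD(1)[OF q UNIV_I] in auto)
    then obtain B where B: "\<And>x t. t \<in> {0..T} \<Longrightarrow> \<bar>duh q a b (h k) heat x t\<bar> \<le> B" by blast
    show ?thesis
    proof (rule sup_bound[OF d cont, where a = "\<lambda>_. mat 1" and b = "\<lambda>_. 0" and B = "c * B" and \<Lambda> = \<Lambda> and h = "smoothing (h k) q" and E' = "\<lambda>_. A"])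
      show "((*) A has_real_derivative A) (at t within {0..T})" for t by (auto intro!: derivative_eq_intros)
      show "\<bar>u k x t\<bar> \<le> c * B" if "t \<in> {0..T}" for x t
        using B[OF that] gauss_const_pos[where 'n='n] by (simp add: u_def c_def abs_mult)
      show "ut k x t = mat 1 \<bullet> u2 k x t + 0 \<bullet> u1 k x t + smoothing (h k) q x t" if "t \<in> {0..T}" for x t using eq[OF that] by simp
      show "\<bar>smoothing (h k) q x t\<bar> \<le> A" if "t \<in> {0..T}" for x t using holD(1)[OF sh UNIV_I that] by simp
    qed (use init A t \<Lambda> in \<open>auto simp: \<Lambda>_def\<close>)
  qed
  have AT: "0 \<le> A * T" using A T by simp
  obtain C where C: "1 \<le> C" and R: "\<And>k. reg \<alpha> UNIV T (C * (A * T + A)) (u k) (u1 k) (u2 k) (ut k)"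
  proof (rule global_estimate[OF \<alpha> zero_less_one order_refl \<Lambda>, where 'n = 'n], goal_cases)
    case (1 C)
    note C = 1(2) and G = 1(3)
    have "reg \<alpha> UNIV T (C * (A * T + A)) (u k) (u1 k) (u2 k) (ut k)" for k
    proof (rule G[OF AT A, where a = "\<lambda>_. mat 1" and b = "\<lambda>_. 0" and h = "smoothing (h k) q"])
      show "prob \<alpha> 1 \<Lambda> UNIV T (\<lambda>_. mat 1) (\<lambda>_. 0) (smoothing (h k) q) (A * T) A (u k) (u1 k) (u2 k) (ut k)"
        unfolding prob_def
      proof (intro conjI ballI)
        show "coef 1 \<Lambda> \<alpha> UNIV (\<lambda>_. mat 1) (\<lambda>_. 0 :: real^'n)" unfolding \<Lambda>_def by (rule coef_identity)
        show "ut k x t = mat 1 \<bullet> u2 k x t + 0 \<bullet> u1 k x t + smoothing (h k) q x t" if "t \<in> {0..T}" for x t using eq[OF that] by simp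
        show "\<bar>u k x t\<bar> \<le> A * T" if "t \<in> {0..T}" for x t
          using bd[OF that, of k x] A that mult_left_mono[of t T A] by auto
        show "\<bar>smoothing (h k) q x t - smoothing (h k) q y t\<bar> \<le> A * dist x y powr \<alpha> + \<Lambda> * \<bar>u k x t - u k y t\<bar>" if "t \<in> {0..T}" for x y t
          using holD(3)[OF sh[of k] UNIV_I that UNIV_I, of x y] \<Lambda> by (simp add: add_increasing2)
      qed (use d cont init in auto)
      show "\<exists>K. hx \<alpha> (ball z 1) T K (u2 k)" for z
      proof -
        obtain L where L: "L \<ge> 0" "\<And>x y t. x \<in> ball z 1 \<Longrightarrow> y \<in> ball z 1 \<Longrightarrow> t \<in> {0..T} \<Longrightarrow>
            norm (duh q a b (h k) heat2 x t - duh q a b (h k) heat2 y t) \<le> L * dist x y"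
          using duh_locally_lipschitz[OF qc h[of k]] by blast
        have "hx \<alpha> (ball z 1) T (c * (L * 2)) (u2 k)"
          unfolding hx_def
        proof (intro ballI)
          fix t x y assume *: "t \<in> {0..T}" "x \<in> ball z 1" "y \<in> ball z 1"
          have cpos: "0 \<le> c" using gauss_const_pos[where 'n='n] by (simp add: c_def)
          have "dist x y \<le> 2" using *(2,3) dist_triangle[of x y z] by (simp add: dist_commute)
          then have "dist x y / 2 \<le> (dist x y / 2) powr \<alpha>" using \<alpha> by (intro le_powr_self) auto
          also have "\<dots> \<le> dist x y powr \<alpha>" using \<alpha> by (intro powr_mono2) auto
          finally have dd: "dist x y \<le> 2 * dist x y powr \<alpha>" by simp
          have "norm (u2 k x t - u2 k y t) = c * norm (duh q a b (h k) heat2 x t - duh q a b (h k) heat2 y t)"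
            unfolding u2_def using cpos by (simp flip: scaleR_diff_right)
          also have "\<dots> \<le> c * (L * dist x y)" using L(2)[OF *(2,3,1)] cpos by (intro mult_left_mono) auto
          also have "\<dots> \<le> c * (L * (2 * dist x y powr \<alpha>))" using dd L(1) cpos by (intro mult_left_mono) auto
          finally show "norm (u2 k x t - u2 k y t) \<le> c * (L * 2) * dist x y powr \<alpha>" by (simp add: mult_ac)
        qed
        then show ?thesis by blast
      qed
      show "transpose (u2 k x t) = u2 k x t" if "t \<in> {0..T}" for x t
        unfolding u2_def using duh_symmetric[OF qc h[of k] that, where a=a and b=b and x=x] by (simp add: transpose_def vec_eq_iff)
      show "\<bar>smoothing (h k) q x t\<bar> \<le> A" if "t \<in> {0..T}" for x t using holD(1)[OF sh UNIV_I that] by simp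
      show "\<bar>smoothing (h k) q x t - smoothing (h k) q x s\<bar> \<le> A * \<bar>t - s\<bar> powr (\<alpha>/2) + \<Lambda> * \<bar>u k x t - u k x s\<bar>"
        if "t \<in> {0..T}" "s \<in> {0..T}" for x t s
        using holD(2)[OF sh[of k] UNIV_I that(1) UNIV_I that(2), of x x] \<Lambda> by (simp add: add_increasing2)
    qed
    then show thesis using that C by blast
  qed
  have K0: "0 \<le> C * (A * T + A)" using C A T by simp
  show ?thesis
  proof (rule reg_compact[of \<alpha> T "C * (A * T + A)" u u1 u2 ut, OF R \<alpha>(1) T K0], goal_cases)
    case (1 F v v1 v2 vt)
    note F = 1(1,2) and Rv = 1(3) and l2 = 1(6) and lt = 1(7)
    have "vt x t = mat 1 \<bullet> v2 x t + q x t" if t: "t \<in> {0..T}" for x t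
    proof -
      have "((\<lambda>k. mat 1 \<bullet> u2 k x t + smoothing (h k) q x t) \<longlongrightarrow> mat 1 \<bullet> v2 x t + q x t) F"
        by (intro tendsto_intros l2[OF t] tendsto_mono[OF F(2)] smoothing_tendsto[OF q \<alpha>(1) t, folded h_def])
      then have "((\<lambda>k. ut k x t) \<longlongrightarrow> mat 1 \<bullet> v2 x t + q x t) F" by (simp add: eq[OF t])
      then show ?thesis using lt[OF t] F(1) tendsto_unique by blast
    qed
    then show ?thesis using Rv by blast
  qed
qed

section \<open>Hoelder classes under algebraic operations\<close>

lemma hol_add:
  assumes f: "hol \<alpha> S T A f" and g: "hol \<alpha> S T B g"
  shows "hol \<alpha> S T (A + B) (\<lambda>x t. f x t + g x t)"
  unfolding hol_def
proof (intro conjI ballI)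
  fix x y t s assume x: "x \<in> S" and t: "t \<in> {0..T}"
  show "norm (f x t + g x t) \<le> A + B"
    using norm_triangle_ineq[of "f x t" "g x t"] holD(1)[OF f x t] holD(1)[OF g x t] by linarith
  assume y: "y \<in> S" and s: "s \<in> {0..T}"
  have "norm (f x t + g x t - (f y s + g y s)) \<le> norm (f x t - f y s) + norm (g x t - g y s)"
    by (rule norm_diff_triangle_ineq)
  then show "norm (f x t + g x t - (f y s + g y s)) \<le> (A + B) * (dist x y powr \<alpha> + \<bar>t - s\<bar> powr (\<alpha>/2))"
    using holD(2)[OF f x t y s] holD(2)[OF g x t y s] unfolding distrib_right[of A B] by linarith
qed

lemma hol_scale:
  assumes f: "hol \<alpha> S T A f"
  shows "hol \<alpha> S T (\<bar>c\<bar> * A) (\<lambda>x t. c *\<^sub>R f x t)"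
  unfolding hol_def
proof (intro conjI ballI)
  fix x y t s assume x: "x \<in> S" and t: "t \<in> {0..T}"
  show "norm (c *\<^sub>R f x t) \<le> \<bar>c\<bar> * A" using holD(1)[OF f x t] by (simp add: mult_left_mono)
  assume y: "y \<in> S" and s: "s \<in> {0..T}"
  have "norm (c *\<^sub>R f x t - c *\<^sub>R f y s) = \<bar>c\<bar> * norm (f x t - f y s)" by (simp flip: scaleR_diff_right)
  also have "\<dots> \<le> \<bar>c\<bar> * (A * (dist x y powr \<alpha> + \<bar>t - s\<bar> powr (\<alpha>/2)))"
    by (rule mult_left_mono[OF holD(2)[OF f x t y s]]) simp
  finally show "norm (c *\<^sub>R f x t - c *\<^sub>R f y s) \<le> \<bar>c\<bar> * A * (dist x y powr \<alpha> + \<bar>t - s\<bar> powr (\<alpha>/2))" by simp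
qed

lemma hol_inner:
  assumes f: "hol \<alpha> S T A f" and g: "hol \<alpha> S T B g" and A: "0 \<le> A" and B: "0 \<le> B"
  shows "hol \<alpha> S T (2 * A * B) (\<lambda>x t. f x t \<bullet> g x t)"
  unfolding hol_def
proof (intro conjI ballI)
  fix x y t s assume x: "x \<in> S" and t: "t \<in> {0..T}"
  have "\<bar>f x t \<bullet> g x t\<bar> \<le> norm (f x t) * norm (g x t)" by (rule Cauchy_Schwarz_ineq2)
  also have "\<dots> \<le> A * B" using holD(1)[OF f x t] holD(1)[OF g x t] A by (intro mult_mono) auto
  also have "\<dots> \<le> 2 * A * B" using A B by simp
  finally show "norm (f x t \<bullet> g x t) \<le> 2 * A * B" by simp
  assume y: "y \<in> S" and s: "s \<in> {0..T}"
  let ?w = "dist x y powr \<alpha> + \<bar>t - s\<bar> powr (\<alpha>/2)"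
  have w: "0 \<le> ?w" by simp
  have "f x t \<bullet> g x t - f y s \<bullet> g y s = f x t \<bullet> (g x t - g y s) + (f x t - f y s) \<bullet> g y s"
    by (simp add: inner_diff_left inner_diff_right)
  moreover have "\<bar>f x t \<bullet> (g x t - g y s)\<bar> \<le> A * (B * ?w)"
    by (rule order_trans[OF Cauchy_Schwarz_ineq2 mult_mono[OF holD(1)[OF f x t] holD(2)[OF g x t y s]]]) (use A in auto)
  moreover have "\<bar>(f x t - f y s) \<bullet> g y s\<bar> \<le> (A * ?w) * B"
    by (rule order_trans[OF Cauchy_Schwarz_ineq2 mult_mono[OF holD(2)[OF f x t y s] holD(1)[OF g y s]]]) (use A w in auto)
  ultimately have "\<bar>f x t \<bullet> g x t - f y s \<bullet> g y s\<bar> \<le> A * (B * ?w) + (A * ?w) * B" by linarith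
  then show "norm (f x t \<bullet> g x t - f y s \<bullet> g y s) \<le> 2 * A * B * ?w" by (simp add: algebra_simps)
qed

lemma reg_diff:
  fixes u :: "real^'n \<Rightarrow> real \<Rightarrow> real"
  assumes u: "reg \<alpha> S T K u u1 u2 ut" and v: "reg \<alpha> S T K' v v1 v2 vt"
  shows "reg \<alpha> S T (K + K') (\<lambda>x t. u x t - v x t) (\<lambda>x t. u1 x t - v1 x t) (\<lambda>x t. u2 x t - v2 x t) (\<lambda>x t. ut x t - vt x t)"
proof -
  have h: "hol \<alpha> S T (K + K') (\<lambda>x t. f x t - g x t)" if "hol \<alpha> S T K f" "hol \<alpha> S T K' g"
    for f g :: "real^'n \<Rightarrow> real \<Rightarrow> 'z::real_normed_vector"
    using hol_add[OF that(1) hol_scale[OF that(2), of "-1"]] by simp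
  show ?thesis
    unfolding reg_def
  proof (intro conjI ballI)
    show "drv S T (\<lambda>x t. u x t - v x t) (\<lambda>x t. u1 x t - v1 x t) (\<lambda>x t. u2 x t - v2 x t) (\<lambda>x t. ut x t - vt x t)"
      by (rule drv_diff[OF regD(1)[OF u] regD(1)[OF v]])
    show "u x 0 - v x 0 = 0" if "x \<in> S" for x using regD(2)[OF u that] regD(2)[OF v that] by simp
    show "transpose (u2 x t - v2 x t) = u2 x t - v2 x t" if "x \<in> S" "t \<in> {0..T}" for x t
      using regD(3)[OF u that] regD(3)[OF v that] by (simp add: transpose_def vec_eq_iff)
  qed (rule h regD(4-7)[OF u] regD(4-7)[OF v])+
qed

lemma reg_zero: "0 \<le> K \<Longrightarrow> reg \<alpha> S T K (\<lambda>x t. 0) (\<lambda>x t. 0) (\<lambda>x t. 0) (\<lambda>x t. 0)"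
  using drv_time[of T "\<lambda>_. 0" "\<lambda>_. 0" S] by (auto simp: reg_def hol_def transpose_def vec_eq_iff)

section \<open>Linear and semilinear problems on the whole space\<close>

definition solution :: "real \<Rightarrow> real \<Rightarrow> (real^'n \<Rightarrow> real^'n^'n) \<Rightarrow> (real^'n \<Rightarrow> real^'n) \<Rightarrow> (real^'n \<Rightarrow> real \<Rightarrow> real)
    \<Rightarrow> real \<Rightarrow> (real^'n \<Rightarrow> real \<Rightarrow> real) \<Rightarrow> (real^'n \<Rightarrow> real \<Rightarrow> real^'n)
    \<Rightarrow> (real^'n \<Rightarrow> real \<Rightarrow> real^'n^'n) \<Rightarrow> (real^'n \<Rightarrow> real \<Rightarrow> real) \<Rightarrow> bool" where
  "solution \<alpha> T a b q K u u1 u2 ut \<longleftrightarrow> reg \<alpha> UNIV T K u u1 u2 ut \<and>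
     (\<forall>x. \<forall>t\<in>{0..T}. ut x t = a x \<bullet> u2 x t + b x \<bullet> u1 x t + q x t)"

definition supported :: "(real^'n) set \<Rightarrow> real \<Rightarrow> (real^'n \<Rightarrow> real \<Rightarrow> real) \<Rightarrow> bool" where
  "supported S T q \<longleftrightarrow> (\<forall>x t. x \<notin> S \<longrightarrow> t \<in> {0..T} \<longrightarrow> q x t = 0)"

text \<open>Sources are confined to \<open>S\<close> because the potentials integrate over a fixed
  box. The class is stable under the later perturbations: the operators differ from the Laplacian
  only inside \<open>S\<close>, so the correction terms are supported there too.\<close>

definition solvable :: "real \<Rightarrow> real \<Rightarrow> (real^'n) set \<Rightarrow> (real^'n \<Rightarrow> real^'n^'n) \<Rightarrow> (real^'n \<Rightarrow> real^'n) \<Rightarrow> bool" where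
  "solvable \<alpha> T S a b \<longleftrightarrow> (\<forall>q A. hol \<alpha> UNIV T A q \<longrightarrow> supported S T q \<longrightarrow> (\<exists>K u u1 u2 ut. solution \<alpha> T a b q K u u1 u2 ut))"

lemma solution_diff:
  assumes "solution \<alpha> T a b q K u u1 u2 ut" "solution \<alpha> T a b p K' v v1 v2 vt"
  shows "solution \<alpha> T a b (\<lambda>x t. q x t - p x t) (K + K') (\<lambda>x t. u x t - v x t) (\<lambda>x t. u1 x t - v1 x t) (\<lambda>x t. u2 x t - v2 x t) (\<lambda>x t. ut x t - vt x t)"
  using reg_diff[of \<alpha> UNIV T K u u1 u2 ut K' v v1 v2 vt] assms
  unfolding solution_def by (simp add: inner_diff_right)

lemma coef_psd: "coef \<kappa> \<Lambda> \<alpha> UNIV a b \<Longrightarrow> 0 < \<kappa> \<Longrightarrow> 0 \<le> v \<bullet> (a x *v v)"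
  unfolding coef_def by (meson UNIV_I inner_ge_zero less_imp_le mult_nonneg_nonneg order_trans)

lemma solution_sup_bound:
  assumes c: "coef \<kappa> \<Lambda> \<alpha> UNIV a b" and "0 < \<kappa>" and \<alpha>: "0 < \<alpha>" and s: "solution \<alpha> T a b q K u u1 u2 ut"
    and E: "\<And>t. t \<in> {0..T} \<Longrightarrow> (E has_real_derivative E' t) (at t within {0..T})" "\<And>t. t \<in> {0..T} \<Longrightarrow> 0 \<le> E t"
    and h: "\<And>x t. t \<in> {0..T} \<Longrightarrow> \<bar>q x t\<bar> \<le> E' t" and t: "t \<in> {0..T}"
  shows "\<bar>u x t\<bar> \<le> E t"
proof -
  have r: "reg \<alpha> UNIV T K u u1 u2 ut" using s unfolding solution_def by blast
  show ?thesis
  proof (rule sup_bound[OF regD(1)[OF r] hol_continuous[OF regD(4)[OF r] \<alpha>], where a=a and b=b and \<Lambda>=\<Lambda> and h=q, OF _ _ _ _ _ _ _ E h t])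
    show "\<bar>u x t\<bar> \<le> K" if "t \<in> {0..T}" for x t using holD(1)[OF regD(4)[OF r] UNIV_I that] by simp
    show "u x 0 = 0" for x by (rule regD(2)[OF r UNIV_I])
    show "transpose (a x) = a x" "norm (a x) \<le> \<Lambda>" "norm (b x) \<le> \<Lambda>" for x using c unfolding coef_def by blast+
    show "0 \<le> v \<bullet> (a x *v v)" for x v by (rule coef_psd[OF c \<open>0 < \<kappa>\<close>])
    show "ut x t = a x \<bullet> u2 x t + b x \<bullet> u1 x t + q x t" if "t \<in> {0..T}" for x t using s that unfolding solution_def by blast
  qed
qed

text \<open>The maximum principle bounds \<open>u\<close> by A T, after which the Schauder constant
  involves the source alone. The arbitrary K of a given solution is thereby replaced by a multiple
  of \<open>A\<close>, uniformly over all operators with the same structural constants.\<close>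

lemma linear_estimate:
  fixes \<alpha> \<kappa> \<Lambda> T :: real
  assumes \<alpha>: "0 < \<alpha>" "\<alpha> < 1" and \<kappa>: "0 < \<kappa>" "\<kappa> \<le> 1" "1 \<le> \<Lambda>" and T: "0 \<le> T"
  obtains C where "1 \<le> C"
    "\<And>(a::real^'n \<Rightarrow> real^'n^'n) b q A K u u1 u2 ut. coef \<kappa> \<Lambda> \<alpha> UNIV a b \<Longrightarrow> hol \<alpha> UNIV T A q \<Longrightarrow>
      solution \<alpha> T a b q K u u1 u2 ut \<Longrightarrow> solution \<alpha> T a b q (C * A) u u1 u2 ut"
proof (rule global_estimate[OF \<alpha> \<kappa>, where 'n = 'n], goal_cases)
  case (1 C)
  note C = 1(2) and G = 1(3)
  show thesis
  proof (rule that[of "C * (T + 1)"])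
    show "1 \<le> C * (T + 1)" using C T mult_mono[of 1 C 1 "T+1"] by simp
    fix a :: "real^'n \<Rightarrow> real^'n^'n" and b q A K u u1 u2 ut
    assume c: "coef \<kappa> \<Lambda> \<alpha> UNIV a b" and q: "hol \<alpha> UNIV T A q" and s: "solution \<alpha> T a b q K u u1 u2 ut"
    have A: "0 \<le> A" using order_trans[OF norm_ge_zero holD(1)[OF q UNIV_I, of 0]] T by auto
    have r: "reg \<alpha> UNIV T K u u1 u2 ut" using s unfolding solution_def by blast
    have eq: "ut x t = a x \<bullet> u2 x t + b x \<bullet> u1 x t + q x t" if "t \<in> {0..T}" for x t using s that unfolding solution_def by blast
    have bd: "\<bar>u x t\<bar> \<le> A * T" if t: "t \<in> {0..T}" for x t
    proof -
      have "\<bar>u x t\<bar> \<le> A * t"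
        by (rule solution_sup_bound[OF c \<kappa>(1) \<alpha>(1) s, where E' = "\<lambda>_. A"])
          (use A t holD(1)[OF q UNIV_I] in \<open>auto intro!: derivative_eq_intros\<close>)
      also have "\<dots> \<le> A * T" using A t by (intro mult_left_mono) auto
      finally show ?thesis .
    qed
    have AT: "0 \<le> A * T" using A T by simp
    have "reg \<alpha> UNIV T (C * (A * T + A)) u u1 u2 ut"
    proof (rule G[OF AT A, where a=a and b=b and h=q])
      show "prob \<alpha> \<kappa> \<Lambda> UNIV T a b q (A * T) A u u1 u2 ut"
        unfolding prob_def
      proof (intro conjI ballI)
        show "\<bar>q x t - q y t\<bar> \<le> A * dist x y powr \<alpha> + \<Lambda> * \<bar>u x t - u y t\<bar>" if "t \<in> {0..T}" for x y t
          using holD(3)[OF q UNIV_I that UNIV_I, of x y] \<kappa> by (simp add: add_increasing2)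
      qed (use regD(1,2)[OF r] hol_continuous[OF regD(4)[OF r] \<alpha>(1)] c eq bd in auto)
      show "\<exists>K. hx \<alpha> (ball z 1) T K u2" for z
        using hx_subset[OF hol_hx[OF regD(6)[OF r]] subset_UNIV] by blast
      show "transpose (u2 x t) = u2 x t" if "t \<in> {0..T}" for x t by (rule regD(3)[OF r UNIV_I that])
      show "\<bar>q x t\<bar> \<le> A" if "t \<in> {0..T}" for x t using holD(1)[OF q UNIV_I that] by simp
      show "\<bar>q x t - q x s\<bar> \<le> A * \<bar>t - s\<bar> powr (\<alpha>/2) + \<Lambda> * \<bar>u x t - u x s\<bar>"
        if "t \<in> {0..T}" "s \<in> {0..T}" for x t s
        using holD(2)[OF q UNIV_I that(1) UNIV_I that(2), of x x] \<kappa> by (simp add: add_increasing2)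
    qed
    moreover have "C * (A * T + A) = C * (T + 1) * A" by (simp add: algebra_simps)
    ultimately show "solution \<alpha> T a b q (C * (T + 1) * A) u u1 u2 ut"
      using eq unfolding solution_def by simp
  qed
qed

text \<open>The perturbation is moved to the right-hand side and evaluated at the previous iterate.
  By the a priori estimate one step multiplies the full regularity bound of the differences by at
  most C |\<theta>| 4 \<Lambda> <= 1/2.\<close>

lemma solvable_perturb:
  fixes a a1 :: "real^'n \<Rightarrow> real^'n^'n"
  assumes \<alpha>: "0 < \<alpha>" and T: "0 \<le> T" and C: "1 \<le> C"
    and est: "\<And>q A K u u1 u2 ut. hol \<alpha> UNIV T A q \<Longrightarrow> solution \<alpha> T a b q K u u1 u2 ut \<Longrightarrow> solution \<alpha> T a b q (C * A) u u1 u2 ut"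
    and sol: "solvable \<alpha> T S a b"
    and a1: "hol \<alpha> UNIV T \<Lambda> (\<lambda>x t. a1 x)" and b1: "hol \<alpha> UNIV T \<Lambda> (\<lambda>x t. b1 x)" and \<Lambda>: "0 \<le> \<Lambda>"
    and supp: "\<And>x. x \<notin> S \<Longrightarrow> a1 x = 0" "\<And>x. x \<notin> S \<Longrightarrow> b1 x = 0"
    and \<theta>: "\<bar>\<theta>\<bar> * (4 * \<Lambda> * C) \<le> 1/2"
  shows "solvable \<alpha> T S (\<lambda>x. a x + \<theta> *\<^sub>R a1 x) (\<lambda>x. b x + \<theta> *\<^sub>R b1 x)"
  unfolding solvable_def
proof (intro allI impI)
  fix q A assume q: "hol \<alpha> UNIV T A q" and qs: "supported S T q"
  have A: "0 \<le> A" using order_trans[OF norm_ge_zero holD(1)[OF q UNIV_I, of 0]] T by auto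
  define D where "D u1 u2 x t = \<theta> *\<^sub>R (a1 x \<bullet> u2 x t + b1 x \<bullet> u1 x t)" for u1 :: "real^'n \<Rightarrow> real \<Rightarrow> real^'n" and u2 x and t :: real
  have Dhol: "hol \<alpha> UNIV T (K / (2 * C)) (D u1 u2)" if "hol \<alpha> UNIV T K u1" "hol \<alpha> UNIV T K u2" "0 \<le> K" for K u1 u2
  proof -
    have "hol \<alpha> UNIV T (\<bar>\<theta>\<bar> * (2 * \<Lambda> * K + 2 * \<Lambda> * K)) (D u1 u2)"
      unfolding D_def[abs_def] by (intro hol_scale hol_add hol_inner a1 b1 that \<Lambda>)
    then show ?thesis
    proof (rule hol_mono)
      have "(\<bar>\<theta>\<bar> * (4 * \<Lambda> * C)) * K \<le> 1/2 * K" using \<theta> that(3) by (intro mult_right_mono) auto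
      then show "\<bar>\<theta>\<bar> * (2 * \<Lambda> * K + 2 * \<Lambda> * K) \<le> K / (2 * C)" using C by (simp add: field_simps)
    qed
  qed
  have Dsupp: "supported S T (D u1 u2)" for u1 u2 unfolding supported_def D_def using supp by simp
  have ex: "\<exists>s. hol \<alpha> UNIV T A p \<and> supported S T p \<longrightarrow> solution \<alpha> T a b p (C * A) (fst s) (fst (snd s)) (fst (snd (snd s))) (snd (snd (snd s)))" for p A
  proof (cases "hol \<alpha> UNIV T A p \<and> supported S T p")
    case True
    then obtain K u u1 u2 ut where "solution \<alpha> T a b p K u u1 u2 ut" using sol unfolding solvable_def by blast
    from est[OF conjunct1[OF True] this] have "solution \<alpha> T a b p (C * A) u u1 u2 ut" .
    then show ?thesis by (intro exI[of _ "(u,u1,u2,ut)"]) simp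
  qed auto
  define S' where "S' p A = (SOME s. hol \<alpha> UNIV T A p \<and> supported S T p \<longrightarrow> solution \<alpha> T a b p (C * A) (fst s) (fst (snd s)) (fst (snd (snd s))) (snd (snd (snd s))))" for p A
  have S': "solution \<alpha> T a b p (C * A) (fst (S' p A)) (fst (snd (S' p A))) (fst (snd (snd (S' p A)))) (snd (snd (snd (S' p A))))"
    if "hol \<alpha> UNIV T A p" "supported S T p" for p A
    using someI_ex[OF ex[of A p]] that unfolding S'_def by blast
  \<comment> \<open>The solution of B = A + B/2: a previous iterate with constant C B adds at most C
    B / (2 C) to the source.\<close>
  define B where "B = 2 * A"
  define s where "s = rec_nat ((\<lambda>x t. 0), (\<lambda>x t. 0), (\<lambda>x t. 0), (\<lambda>x t. 0))
     (\<lambda>m s. S' (\<lambda>x t. q x t + D (fst (snd s)) (fst (snd (snd s))) x t) B)"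
  define u where "u m = fst (s m)" for m
  define u1 where "u1 m = fst (snd (s m))" for m
  define u2 where "u2 m = fst (snd (snd (s m)))" for m
  define ut where "ut m = snd (snd (snd (s m)))" for m
  define src where "src m x t = q x t + D (u1 m) (u2 m) x t" for m x t
  have B: "0 \<le> B" using A by (simp add: B_def)
  have CB: "0 \<le> C * B" using B C by simp
  have srch: "hol \<alpha> UNIV T B (src m)" if "reg \<alpha> UNIV T (C * B) (u m) (u1 m) (u2 m) (ut m)" for m
  proof -
    have "hol \<alpha> UNIV T (A + (C * B) / (2 * C)) (src m)"
      unfolding src_def[abs_def] by (rule hol_add[OF q Dhol[OF regD(5)[OF that] regD(6)[OF that] CB]])
    moreover have "A + (C * B) / (2 * C) = B" using C by (simp add: B_def)
    ultimately show ?thesis by simp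
  qed
  have srcs: "supported S T (src m)" for m using qs Dsupp unfolding src_def supported_def by simp
  have suc: "solution \<alpha> T a b (src m) (C * B) (u (Suc m)) (u1 (Suc m)) (u2 (Suc m)) (ut (Suc m))"
    if "reg \<alpha> UNIV T (C * B) (u m) (u1 m) (u2 m) (ut m)" for m
  proof -
    have "s (Suc m) = S' (src m) B" by (simp add: s_def src_def[abs_def] u1_def u2_def)
    then show ?thesis using S'[OF srch[OF that] srcs] unfolding u_def u1_def u2_def ut_def by simp
  qed
  have reg: "reg \<alpha> UNIV T (C * B) (u m) (u1 m) (u2 m) (ut m)" for m
  proof (induction m)
    case 0
    show ?case using reg_zero[OF CB] by (simp add: u_def u1_def u2_def ut_def s_def)
  next
    case (Suc m)
    from suc[OF this] show ?case unfolding solution_def by blast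
  qed
  note sol_m = suc[OF reg]
  have diff: "reg \<alpha> UNIV T ((1/2)^m * (2 * C * B)) (\<lambda>x t. u (Suc m) x t - u m x t) (\<lambda>x t. u1 (Suc m) x t - u1 m x t)
     (\<lambda>x t. u2 (Suc m) x t - u2 m x t) (\<lambda>x t. ut (Suc m) x t - ut m x t)" for m
  proof (induction m)
    case 0
    have e: "C * B + C * B = (1/2)^0 * (2 * C * B)" by simp
    show ?case using reg_diff[OF reg[of "Suc 0"] reg[of 0]] unfolding e .
  next
    case (Suc m)
    let ?K = "(1/2)^m * (2 * C * B)"
    have K: "0 \<le> ?K" using B C by simp
    have s1: "solution \<alpha> T a b (\<lambda>x t. src (Suc m) x t - src m x t) (C * B + C * B) (\<lambda>x t. u (Suc (Suc m)) x t - u (Suc m) x t)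
       (\<lambda>x t. u1 (Suc (Suc m)) x t - u1 (Suc m) x t) (\<lambda>x t. u2 (Suc (Suc m)) x t - u2 (Suc m) x t) (\<lambda>x t. ut (Suc (Suc m)) x t - ut (Suc m) x t)"
      by (rule solution_diff[OF sol_m sol_m])
    have s2: "(\<lambda>x t. src (Suc m) x t - src m x t) = D (\<lambda>x t. u1 (Suc m) x t - u1 m x t) (\<lambda>x t. u2 (Suc m) x t - u2 m x t)"
      by (simp add: fun_eq_iff src_def D_def inner_diff_right algebra_simps)
    have s3: "hol \<alpha> UNIV T (?K / (2 * C)) (D (\<lambda>x t. u1 (Suc m) x t - u1 m x t) (\<lambda>x t. u2 (Suc m) x t - u2 m x t))"
      by (rule Dhol[OF regD(5)[OF Suc] regD(6)[OF Suc] K])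
    from est[OF s3 s1[unfolded s2]] have "reg \<alpha> UNIV T (C * (?K / (2 * C))) (\<lambda>x t. u (Suc (Suc m)) x t - u (Suc m) x t)
       (\<lambda>x t. u1 (Suc (Suc m)) x t - u1 (Suc m) x t) (\<lambda>x t. u2 (Suc (Suc m)) x t - u2 (Suc m) x t) (\<lambda>x t. ut (Suc (Suc m)) x t - ut (Suc m) x t)"
      unfolding solution_def by (rule conjunct1)
    moreover have "C * (?K / (2 * C)) = (1/2)^(Suc m) * (2 * C * B)" using C by simp
    ultimately show ?case by (simp only:)
  qed
  have small: "(\<lambda>m. (1/2)^m * (2 * C * B)) \<longlonglongrightarrow> 0"
    by (rule tendsto_mult_left_zero[OF LIMSEQ_realpow_zero]) auto
  show "\<exists>K u u1 u2 ut. solution \<alpha> T (\<lambda>x. a x + \<theta> *\<^sub>R a1 x) (\<lambda>x. b x + \<theta> *\<^sub>R b1 x) q K u u1 u2 ut"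
  proof (rule reg_compact[of \<alpha> T "C * B" "\<lambda>m. u (Suc m)" "\<lambda>m. u1 (Suc m)" "\<lambda>m. u2 (Suc m)" "\<lambda>m. ut (Suc m)", OF reg \<alpha> T CB], goal_cases)
    case (1 F v v1 v2 vt)
    note F = 1(1,2) and Rv = 1(3) and l1 = 1(5) and l2 = 1(6) and lt = 1(7)
    have "vt x t = (a x + \<theta> *\<^sub>R a1 x) \<bullet> v2 x t + (b x + \<theta> *\<^sub>R b1 x) \<bullet> v1 x t + q x t" if t: "t \<in> {0..T}" for x t
    proof -
      \<comment> \<open>Compactness yields limits of the shifted sequence only; as consecutive
        iterates merge, the unshifted ones in the source have the same limits.\<close>
      have "(\<lambda>m. u1 (Suc m) x t - u1 m x t) \<longlonglongrightarrow> 0"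
        by (rule Lim_null_comparison[OF always_eventually small]) (use holD(1)[OF regD(5)[OF diff] UNIV_I t] in blast)
      from tendsto_diff[OF l1[OF t, of x] tendsto_mono[OF F(2) this]] have l1': "((\<lambda>m. u1 m x t) \<longlongrightarrow> v1 x t) F" by simp
      have "(\<lambda>m. u2 (Suc m) x t - u2 m x t) \<longlonglongrightarrow> 0"
        by (rule Lim_null_comparison[OF always_eventually small]) (use holD(1)[OF regD(6)[OF diff] UNIV_I t] in blast)
      from tendsto_diff[OF l2[OF t, of x] tendsto_mono[OF F(2) this]] have l2': "((\<lambda>m. u2 m x t) \<longlongrightarrow> v2 x t) F" by simp
      have "((\<lambda>m. a x \<bullet> u2 (Suc m) x t + b x \<bullet> u1 (Suc m) x t + (q x t + \<theta> *\<^sub>R (a1 x \<bullet> u2 m x t + b1 x \<bullet> u1 m x t)))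
         \<longlongrightarrow> a x \<bullet> v2 x t + b x \<bullet> v1 x t + (q x t + \<theta> *\<^sub>R (a1 x \<bullet> v2 x t + b1 x \<bullet> v1 x t))) F"
        by (intro tendsto_intros l1[OF t] l2[OF t] l1' l2')
      moreover have "ut (Suc m) x t = a x \<bullet> u2 (Suc m) x t + b x \<bullet> u1 (Suc m) x t + (q x t + \<theta> *\<^sub>R (a1 x \<bullet> u2 m x t + b1 x \<bullet> u1 m x t))" for m
        using sol_m[of m] t unfolding solution_def src_def D_def by blast
      ultimately have "((\<lambda>m. ut (Suc m) x t) \<longlongrightarrow> a x \<bullet> v2 x t + b x \<bullet> v1 x t + (q x t + \<theta> *\<^sub>R (a1 x \<bullet> v2 x t + b1 x \<bullet> v1 x t))) F" by simp
      from tendsto_unique[OF F(1) lt[OF t] this] show ?thesis by (simp add: inner_add_left algebra_simps)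
    qed
    then show ?thesis using Rv unfolding solution_def by blast
  qed
qed

lemma hol_time_independent:
  assumes "\<And>x. norm (f x) \<le> A" "\<And>x y. norm (f x - f y) \<le> A * dist x y powr \<alpha>"
  shows "hol \<alpha> UNIV T A (\<lambda>x t. f x)"
proof -
  have A: "0 \<le> A" using order_trans[OF norm_ge_zero assms(1)] .
  show ?thesis unfolding hol_def
    using assms A by (auto intro: order_trans[OF assms(2)] simp: distrib_left)
qed

lemma identity_interpolation:
  fixes a :: "real^'n^'n"
  assumes a: "transpose a = a" "\<And>h. \<kappa> * (h \<bullet> h) \<le> h \<bullet> (a *v h)" and \<kappa>: "\<kappa> \<le> 1" and \<tau>: "0 \<le> \<tau>" "\<tau> \<le> 1"
  shows "transpose (mat 1 + \<tau> *\<^sub>R (a - mat 1)) = mat 1 + \<tau> *\<^sub>R (a - mat 1)"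
    "\<kappa> * (h \<bullet> h) \<le> h \<bullet> ((mat 1 + \<tau> *\<^sub>R (a - mat 1)) *v h)"
    "norm (mat 1 + \<tau> *\<^sub>R (a - mat 1)) \<le> norm (mat 1 :: real^'n^'n) + norm a"
proof -
  have tr: "transpose a $ i $ j = a $ i $ j" for i j using a(1) by simp
  show "transpose (mat 1 + \<tau> *\<^sub>R (a - mat 1)) = mat 1 + \<tau> *\<^sub>R (a - mat 1)"
    using tr by (auto simp: transpose_def vec_eq_iff mat_def)
  have "h \<bullet> ((mat 1 + \<tau> *\<^sub>R (a - mat 1)) *v h) = (1 - \<tau>) * (h \<bullet> h) + \<tau> * (h \<bullet> (a *v h))"
    by (simp add: matrix_vector_mult_add_rdistrib matrix_vector_mult_diff_rdistrib
        scaleR_matrix_vector_assoc[symmetric] inner_add_right inner_diff_right algebra_simps)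
  moreover have "\<tau> * (\<kappa> * (h \<bullet> h)) \<le> \<tau> * (h \<bullet> (a *v h))" using a(2) \<tau> by (intro mult_left_mono) auto
  moreover have "(1 - \<tau>) * (\<kappa> * (h \<bullet> h)) \<le> (1 - \<tau>) * (1 * (h \<bullet> h))" using \<kappa> \<tau> by (intro mult_left_mono mult_right_mono) auto
  ultimately show "\<kappa> * (h \<bullet> h) \<le> h \<bullet> ((mat 1 + \<tau> *\<^sub>R (a - mat 1)) *v h)" by (simp add: algebra_simps)
  have "mat 1 + \<tau> *\<^sub>R (a - mat 1) = (1 - \<tau>) *\<^sub>R mat 1 + \<tau> *\<^sub>R a" by (simp add: algebra_simps)
  then have "norm (mat 1 + \<tau> *\<^sub>R (a - mat 1)) \<le> (1 - \<tau>) * norm (mat 1 :: real^'n^'n) + \<tau> * norm a"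
    using norm_triangle_ineq[of "(1 - \<tau>) *\<^sub>R mat 1" "\<tau> *\<^sub>R a"] \<tau> by simp
  also have "\<dots> \<le> 1 * norm (mat 1 :: real^'n^'n) + 1 * norm a" using \<tau> by (intro add_mono mult_right_mono) auto
  finally show "norm (mat 1 + \<tau> *\<^sub>R (a - mat 1)) \<le> norm (mat 1 :: real^'n^'n) + norm a" by simp
qed

text \<open>Method of continuity from the Laplacian. The ellipticity constant \<kappa> <= 1 and the
  bound \<Lambda>' hold along the whole segment of operators, so one a priori constant and hence one
  step length serve throughout, and finitely many equal steps reach the target.\<close>

lemma linear_solvable:
  fixes a :: "real^'n \<Rightarrow> real^'n^'n"
  assumes \<alpha>: "0 < \<alpha>" "\<alpha> < 1" and \<kappa>: "0 < \<kappa>" "\<kappa> \<le> 1" "1 \<le> \<Lambda>" and T: "0 \<le> T"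
    and c: "coef \<kappa> \<Lambda> \<alpha> UNIV a b"
    and supp: "\<And>x. x \<notin> cbox l r \<Longrightarrow> a x = mat 1" "\<And>x. x \<notin> cbox l r \<Longrightarrow> b x = 0"
  shows "solvable \<alpha> T (cbox l r) a b"
proof -
  define \<Lambda>' where "\<Lambda>' = \<Lambda> + norm (mat 1 :: real^'n^'n)"
  have \<Lambda>': "1 \<le> \<Lambda>'" "\<Lambda> \<le> \<Lambda>'" using \<kappa> by (auto simp: \<Lambda>'_def add_increasing2)
  define A where "A \<tau> x = mat 1 + \<tau> *\<^sub>R (a x - mat 1)" for \<tau> x
  define B where "B \<tau> x = \<tau> *\<^sub>R b x" for \<tau> x
  have cf: "transpose (a x) = a x" "\<kappa> * (h \<bullet> h) \<le> h \<bullet> (a x *v h)" "norm (a x) \<le> \<Lambda>" "norm (b x) \<le> \<Lambda>"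
    "norm (a x - a y) \<le> \<Lambda> * dist x y powr \<alpha>" "norm (b x - b y) \<le> \<Lambda> * dist x y powr \<alpha>" for x y h
    using c unfolding coef_def by blast+
  have cA: "coef \<kappa> \<Lambda>' \<alpha> UNIV (A \<tau>) (B \<tau>)" if \<tau>: "0 \<le> \<tau>" "\<tau> \<le> 1" for \<tau>
    unfolding coef_def
  proof (intro ballI conjI allI)
    fix x y :: "real^'n"
    note ii = identity_interpolation[OF cf(1)[of x] cf(2)[where x = x] \<kappa>(2) \<tau>]
    show "transpose (A \<tau> x) = A \<tau> x" "\<kappa> * (h \<bullet> h) \<le> h \<bullet> (A \<tau> x *v h)" "norm (A \<tau> x) \<le> \<Lambda>'" for h
      using ii cf(3)[of x] unfolding A_def \<Lambda>'_def by auto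
    have s: "\<tau> * z \<le> \<Lambda>' * w" if "z \<le> \<Lambda> * w" "0 \<le> z" "0 \<le> w" for z w
    proof -
      have "\<tau> * z \<le> 1 * z" using \<tau> that by (intro mult_right_mono) auto
      also have "\<dots> \<le> \<Lambda>' * w" using that(1) mult_right_mono[OF \<Lambda>'(2) that(3)] by linarith
      finally show ?thesis .
    qed
    show "norm (B \<tau> x) \<le> \<Lambda>'" using s[of "norm (b x)" 1] cf(4)[of x] \<tau> by (simp add: B_def)
    show "norm (A \<tau> x - A \<tau> y) \<le> \<Lambda>' * dist x y powr \<alpha>"
      using s[OF cf(5)[of x y]] \<tau> by (simp add: A_def flip: scaleR_diff_right)
    show "norm (B \<tau> x - B \<tau> y) \<le> \<Lambda>' * dist x y powr \<alpha>"
      using s[OF cf(6)[of x y]] \<tau> by (simp add: B_def flip: scaleR_diff_right)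
  qed
  show ?thesis
  proof (rule linear_estimate[OF \<alpha> \<kappa>(1,2) \<Lambda>'(1) T, where 'n = 'n], goal_cases)
    case (1 C)
    note C = 1(1) and est = 1(2)
    \<comment> \<open>Makes (1/N) * 4 \<Lambda>' C at most 1/2, the smallness asked for in a single
      perturbation.\<close>
    obtain N :: nat where N: "8 * \<Lambda>' * C \<le> real N" using real_arch_simple by blast
    have "0 < 8 * \<Lambda>' * C" using C \<Lambda>' by simp
    then have N0: "0 < real N" using N by linarith
    have "solvable \<alpha> T (cbox l r) (A (real k / real N)) (B (real k / real N))" if "k \<le> N" for k
      using that
    proof (induction k)
      case 0
      have "\<exists>K u u1 u2 ut. solution \<alpha> T (\<lambda>_. mat 1) (\<lambda>_. 0) q K u u1 u2 ut" if "hol \<alpha> UNIV T A q" "supported (cbox l r) T q" for A and q :: "real^'n \<Rightarrow> real \<Rightarrow> real"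
        using laplace_solvable[OF \<alpha> T that(1), of l r] that(2) unfolding supported_def solution_def by simp
      then have "solvable \<alpha> T (cbox l r) (\<lambda>_. mat 1) (\<lambda>_. 0)" unfolding solvable_def by blast
      moreover have "A (real 0 / real N) = (\<lambda>_. mat 1)" "B (real 0 / real N) = (\<lambda>_. 0)" by (simp_all add: A_def B_def fun_eq_iff)
      ultimately show ?case by simp
    next
      case (Suc k)
      let ?\<tau> = "real k / real N"
      have IH: "solvable \<alpha> T (cbox l r) (A ?\<tau>) (B ?\<tau>)" using Suc by simp
      have \<tau>: "0 \<le> ?\<tau>" "?\<tau> \<le> 1" using Suc.prems N0 by auto
      have ha: "hol \<alpha> UNIV T \<Lambda>' (\<lambda>x t. a x - mat 1)"
      proof (rule hol_time_independent)
        show "norm (a x - mat 1) \<le> \<Lambda>'" for x using norm_triangle_ineq4[of "a x" "mat 1"] cf(3)[of x] by (simp add: \<Lambda>'_def)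
        show "norm (a x - mat 1 - (a y - mat 1)) \<le> \<Lambda>' * dist x y powr \<alpha>" for x y
          using cf(5)[of x y] mult_right_mono[OF \<Lambda>'(2), of "dist x y powr \<alpha>"] by simp
      qed
      have hb: "hol \<alpha> UNIV T \<Lambda>' (\<lambda>x t. b x)"
      proof (rule hol_time_independent)
        show "norm (b x) \<le> \<Lambda>'" for x using cf(4)[of x] \<Lambda>'(2) by linarith
        show "norm (b x - b y) \<le> \<Lambda>' * dist x y powr \<alpha>" for x y
          using cf(6)[of x y] mult_right_mono[OF \<Lambda>'(2), of "dist x y powr \<alpha>"] by simp
      qed
      have "solvable \<alpha> T (cbox l r) (\<lambda>x. A ?\<tau> x + (1 / real N) *\<^sub>R (a x - mat 1)) (\<lambda>x. B ?\<tau> x + (1 / real N) *\<^sub>R b x)"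
      proof (rule solvable_perturb[OF \<alpha>(1) T C _ IH ha hb])
        show "\<bar>1 / real N\<bar> * (4 * \<Lambda>' * C) \<le> 1/2" using N N0 by (simp add: field_simps)
      qed (use est[OF cA[OF \<tau>]] \<Lambda>' supp in auto)
      moreover have "(\<lambda>x. A ?\<tau> x + (1 / real N) *\<^sub>R (a x - mat 1)) = A (real (Suc k) / real N)"
        unfolding A_def fun_eq_iff by (simp add: add_divide_distrib scaleR_add_left)
      moreover have "(\<lambda>x. B ?\<tau> x + (1 / real N) *\<^sub>R b x) = B (real (Suc k) / real N)"
        unfolding B_def fun_eq_iff by (simp add: add_divide_distrib scaleR_add_left)
      ultimately show ?case by simp
    qed
    from this[of N] have "solvable \<alpha> T (cbox l r) (A 1) (B 1)" using N0 by simp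
    moreover have "A 1 = a" "B 1 = b" by (simp_all add: A_def B_def fun_eq_iff)
    ultimately show ?thesis by simp
  qed
qed

section \<open>Semilinear problems by Picard iteration\<close>

lemma min_le_powr:
  fixes \<beta> \<epsilon> :: real
  assumes \<beta>: "0 < \<beta>" "\<beta> < 1" and \<epsilon>: "0 < \<epsilon>"
  obtains C where "1 \<le> C"
    "\<And>K M d z. 0 \<le> K \<Longrightarrow> 0 \<le> M \<Longrightarrow> 0 \<le> d \<Longrightarrow> z \<le> K * d \<Longrightarrow> z \<le> 2 * M \<Longrightarrow> z \<le> (\<epsilon> * K + C * M) * d powr \<beta>"
proof -
  \<comment> \<open>Below \<eta> the Lipschitz bound K d wins, because d powr (1 - \<beta>) <=
    \<epsilon> there; above \<eta> the bound 2 M wins.\<close>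
  define \<eta> where "\<eta> = \<epsilon> powr (1 / (1 - \<beta>))"
  have \<eta>: "0 < \<eta>" "\<eta> powr (1 - \<beta>) = \<epsilon>" using \<epsilon> \<beta> by (auto simp: \<eta>_def powr_powr)
  show thesis
  proof (rule that[of "1 + 2 * \<eta> powr (- \<beta>)"])
    fix K M d z :: real
    assume K: "0 \<le> K" and M: "0 \<le> M" and d: "0 \<le> d" and z: "z \<le> K * d" "z \<le> 2 * M"
    show "z \<le> (\<epsilon> * K + (1 + 2 * \<eta> powr (- \<beta>)) * M) * d powr \<beta>"
    proof (cases "d \<le> \<eta>")
      case True
      have "K * d = K * (d powr (1 - \<beta>) * d powr \<beta>)" using d by (simp flip: powr_add)
      also have "\<dots> \<le> K * (\<epsilon> * d powr \<beta>)"
        using powr_mono2[OF _ d True, of "1 - \<beta>"] \<eta>(2) \<beta> K by (intro mult_left_mono mult_right_mono) auto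
      also have "\<dots> \<le> (\<epsilon> * K + (1 + 2 * \<eta> powr (- \<beta>)) * M) * d powr \<beta>"
        using M by (simp add: distrib_right)
      finally show ?thesis using z by linarith
    next
      case False
      have "1 \<le> \<eta> powr (- \<beta>) * d powr \<beta>"
        using powr_mono2[of \<beta> \<eta> d] False \<eta>(1) \<beta> by (simp add: powr_minus field_simps)
      then have "2 * M * 1 \<le> 2 * M * (\<eta> powr (- \<beta>) * d powr \<beta>)" using M by (intro mult_left_mono) auto
      also have "\<dots> \<le> (\<epsilon> * K + (1 + 2 * \<eta> powr (- \<beta>)) * M) * d powr \<beta>"
        using M K \<epsilon> by (simp add: distrib_right algebra_simps)
      finally show ?thesis using z by linarith
    qed
  qed simp
qed

text \<open>u is Lipschitz in space and time with constant K, hence its \<alpha>-Hoelder constant is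
  a small multiple of K plus a multiple of the sup bound. The small factor keeps the Picard iterates
  bounded on time intervals of any length.\<close>

lemma reg_hoelder_interpolation:
  fixes \<alpha> \<epsilon> :: real
  assumes \<alpha>: "0 < \<alpha>" "\<alpha> < 1" and \<epsilon>: "0 < \<epsilon>"
  obtains C where "1 \<le> C"
    "\<And>T K M (u :: real^'n \<Rightarrow> real \<Rightarrow> real) u1 u2 ut. reg \<alpha> UNIV T K u u1 u2 ut \<Longrightarrow> 0 \<le> K \<Longrightarrow> 0 \<le> M \<Longrightarrow>
      (\<And>x t. t \<in> {0..T} \<Longrightarrow> \<bar>u x t\<bar> \<le> M) \<Longrightarrow> hol \<alpha> UNIV T (\<epsilon> * K + C * M) u"
proof (rule min_le_powr[OF \<alpha> \<epsilon>], rule min_le_powr[of "\<alpha>/2" \<epsilon>])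
  show "0 < \<alpha>/2" "\<alpha>/2 < 1" using \<alpha> by auto
  show "0 < \<epsilon>" by (rule \<epsilon>)
  fix C C' :: real
  assume C: "1 \<le> C" "1 \<le> C'"
    and c: "\<And>K M d z. 0 \<le> K \<Longrightarrow> 0 \<le> M \<Longrightarrow> 0 \<le> d \<Longrightarrow> z \<le> K * d \<Longrightarrow> z \<le> 2 * M \<Longrightarrow> z \<le> (\<epsilon> * K + C * M) * d powr \<alpha>"
    and c': "\<And>K M d z. 0 \<le> K \<Longrightarrow> 0 \<le> M \<Longrightarrow> 0 \<le> d \<Longrightarrow> z \<le> K * d \<Longrightarrow> z \<le> 2 * M \<Longrightarrow> z \<le> (\<epsilon> * K + C' * M) * d powr (\<alpha>/2)"
  show thesis
  proof (rule that[of "max C C'"])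
    fix T K M :: real and u :: "real^'n \<Rightarrow> real \<Rightarrow> real" and u1 u2 ut
    assume r: "reg \<alpha> UNIV T K u u1 u2 ut" and K: "0 \<le> K" and M: "0 \<le> M" and b: "\<And>x t. t \<in> {0..T} \<Longrightarrow> \<bar>u x t\<bar> \<le> M"
    have CM: "C * M \<le> max C C' * M" "C' * M \<le> max C C' * M" using M by (auto intro!: mult_right_mono)
    show "hol \<alpha> UNIV T (\<epsilon> * K + max C C' * M) u"
      unfolding hol_def
    proof (intro conjI ballI)
      fix x y :: "real^'n" and t s assume t: "t \<in> {0..T}"
      have "M \<le> C * M" "0 \<le> \<epsilon> * K" using mult_right_mono[OF C(1) M] \<epsilon> K by auto
      then show "norm (u x t) \<le> \<epsilon> * K + max C C' * M" using b[OF t, of x] CM by simp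
      assume s: "s \<in> {0..T}"
      have "\<bar>u x t - u y t\<bar> \<le> K * dist x y"
        by (rule function_lipschitz[OF regD(1)[OF r] t convex_UNIV]) (use holD(1)[OF regD(5)[OF r] UNIV_I t] in auto)
      from c[OF K M zero_le_dist this] have 1: "\<bar>u x t - u y t\<bar> \<le> (\<epsilon> * K + C * M) * dist x y powr \<alpha>"
        using b[OF t, of x] b[OF t, of y] by linarith
      have "\<bar>u y t - u y s\<bar> \<le> K * \<bar>s - t\<bar>"
        by (rule order_trans[OF time_lipschitz[of T "u y" "ut y" K s t]])
          (use drvD(3)[OF regD(1)[OF r] UNIV_I] holD(1)[OF regD(7)[OF r] UNIV_I] s t in \<open>auto simp: abs_minus_commute\<close>)
      from c'[OF K M abs_ge_zero this] have 2: "\<bar>u y t - u y s\<bar> \<le> (\<epsilon> * K + C' * M) * \<bar>t - s\<bar> powr (\<alpha>/2)"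
        using b[OF t, of y] b[OF s, of y] by (simp add: abs_minus_commute)
      have "(\<epsilon> * K + C * M) * dist x y powr \<alpha> \<le> (\<epsilon> * K + max C C' * M) * dist x y powr \<alpha>"
        "(\<epsilon> * K + C' * M) * \<bar>t - s\<bar> powr (\<alpha>/2) \<le> (\<epsilon> * K + max C C' * M) * \<bar>t - s\<bar> powr (\<alpha>/2)"
        using CM by (auto intro!: mult_right_mono)
      with 1 2 show "norm (u x t - u y s) \<le> (\<epsilon> * K + max C C' * M) * (dist x y powr \<alpha> + \<bar>t - s\<bar> powr (\<alpha>/2))"
        unfolding distrib_left real_norm_def by linarith
    qed
  qed (use C in auto)
qed

text \<open>The sup bound B T of the iterates comes from the bound on F. Composition with F costs
  only a Hoelder norm of the previous iterate, which is of lower order, so interpolation keeps all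
  iterates in one regularity class. Convergence is needed merely in the sup norm; compactness does
  the rest.\<close>

lemma nonlinear_solvable:
  fixes a :: "real^'n \<Rightarrow> real^'n^'n"
  assumes \<alpha>: "0 < \<alpha>" "\<alpha> < 1" and \<kappa>: "0 < \<kappa>" "\<kappa> \<le> 1" "1 \<le> \<Lambda>" and T: "0 \<le> T"
    and c: "coef \<kappa> \<Lambda> \<alpha> UNIV a b" and sol: "solvable \<alpha> T S a b"
    and F: "\<And>x u. \<bar>F x u\<bar> \<le> B" "\<And>x y u v. \<bar>F x u - F y v\<bar> \<le> B * (dist x y powr \<alpha> + \<bar>u - v\<bar>)" "\<And>x u. x \<notin> S \<Longrightarrow> F x u = 0"
  shows "\<exists>K u u1 u2 ut. solution \<alpha> T a b (\<lambda>x t. F x (u x t)) K u u1 u2 ut"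
proof -
  have B: "0 \<le> B" using order_trans[OF abs_ge_zero F(1)] .
  define M where "M = B * T"
  have M: "0 \<le> M" using B T by (simp add: M_def)
  have supp: "supported S T (\<lambda>x t. F x (u x t))" for u using F(3) by (simp add: supported_def)
  have hF: "hol \<alpha> UNIV T (B * (1 + H)) (\<lambda>x t. F x (u x t))" if h: "hol \<alpha> UNIV T H u" and H: "0 \<le> H" for u H
    unfolding hol_def
  proof (intro conjI ballI)
    fix x y :: "real^'n" and t s assume t: "t \<in> {0..T}"
    show "norm (F x (u x t)) \<le> B * (1 + H)" using F(1)[of x "u x t"] mult_nonneg_nonneg[OF B H] by (simp add: distrib_left)
    assume s: "s \<in> {0..T}"
    let ?d = "dist x y powr \<alpha>" and ?t = "\<bar>t - s\<bar> powr (\<alpha>/2)"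
    have "\<bar>F x (u x t) - F y (u y s)\<bar> \<le> B * (?d + H * (?d + ?t))"
      by (rule order_trans[OF F(2)]) (use holD(2)[OF h UNIV_I t UNIV_I s, of x y] B in \<open>intro mult_left_mono add_mono, auto\<close>)
    also have "\<dots> \<le> B * ((?d + ?t) + H * (?d + ?t))" using B H by (intro mult_left_mono add_mono) auto
    finally show "norm (F x (u x t) - F y (u y s)) \<le> B * (1 + H) * (?d + ?t)" by (simp add: algebra_simps)
  qed
  show ?thesis
  proof (rule linear_estimate[OF \<alpha> \<kappa> T, where 'n = 'n], goal_cases)
    case (1 C)
    note C = 1(1) and est = 1(2)
    \<comment> \<open>Gives C B \<epsilon> <= 1/2, so that at most half of the previous constant K
      is passed on.\<close>
    define \<epsilon> where "\<epsilon> = 1 / (2 * C * (B + 1))"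
    have \<epsilon>: "0 < \<epsilon>" using C B by (simp add: \<epsilon>_def)
    have "C * (B * \<epsilon>) = B / (B + 1) / 2" using C by (simp add: \<epsilon>_def)
    then have CB\<epsilon>: "C * (B * \<epsilon>) \<le> 1/2" using B by (simp add: divide_le_eq)
    show ?thesis
    proof (rule reg_hoelder_interpolation[OF \<alpha> \<epsilon>, where 'n = 'n], goal_cases)
      case (1 C')
      note C' = 1(1) and ip = 1(2)
      \<comment> \<open>Twice the part of the bound that does not involve the previous iterate,
        hence reproduced by a step that halves K and adds this part.\<close>
      define K where "K = 2 * (C * (B * (1 + C' * M)))"
      define A where "A = B * (1 + (\<epsilon> * K + C' * M))"
      have K: "0 \<le> K" using C B C' M by (simp add: K_def)
      have A: "C * A \<le> K"
      proof -
        have "C * A = K / 2 + C * (B * \<epsilon>) * K" by (simp add: A_def K_def algebra_simps)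
        also have "\<dots> \<le> K / 2 + 1/2 * K" using CB\<epsilon> K by (intro add_left_mono mult_right_mono) auto
        finally show ?thesis by simp
      qed
      define P where "P p s \<longleftrightarrow> solution \<alpha> T a b p K (fst s) (fst (snd s)) (fst (snd (snd s))) (snd (snd (snd s)))" for p s
      define Q where "Q s \<longleftrightarrow> reg \<alpha> UNIV T K (fst s) (fst (snd s)) (fst (snd (snd s))) (snd (snd (snd s))) \<and> (\<forall>x. \<forall>t\<in>{0..T}. \<bar>fst s x t\<bar> \<le> M)"
        for s :: "(real^'n \<Rightarrow> real \<Rightarrow> real) \<times> (real^'n \<Rightarrow> real \<Rightarrow> real^'n) \<times> (real^'n \<Rightarrow> real \<Rightarrow> real^'n^'n) \<times> (real^'n \<Rightarrow> real \<Rightarrow> real)"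
      have bnd: "\<bar>u x t\<bar> \<le> M" if s: "solution \<alpha> T a b (\<lambda>x t. F x (v x t)) K u u1 u2 ut" and t: "t \<in> {0..T}" for u u1 u2 ut v x t
      proof -
        have "\<bar>u x t\<bar> \<le> B * t"
          by (rule solution_sup_bound[OF c \<kappa>(1) \<alpha>(1) s, where E' = "\<lambda>_. B"]) (use B t F(1) in \<open>auto intro!: derivative_eq_intros\<close>)
        also have "\<dots> \<le> M" unfolding M_def using B t by (intro mult_left_mono) auto
        finally show ?thesis .
      qed
      have step: "\<exists>s'. P (\<lambda>x t. F x (fst s x t)) s' \<and> Q s'" if "Q s" for s
      proof -
        have h: "hol \<alpha> UNIV T (\<epsilon> * K + C' * M) (fst s)" using ip[of T K _ _ _ _ M] that K M unfolding Q_def by blast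
        have q: "hol \<alpha> UNIV T A (\<lambda>x t. F x (fst s x t))" unfolding A_def by (rule hF[OF h]) (use \<epsilon> K C' M in auto)
        obtain K' u u1 u2 ut where "solution \<alpha> T a b (\<lambda>x t. F x (fst s x t)) K' u u1 u2 ut"
          using sol q supp[of "fst s"] unfolding solvable_def by blast
        from est[OF c q this] have s': "solution \<alpha> T a b (\<lambda>x t. F x (fst s x t)) K u u1 u2 ut"
          using reg_mono[OF _ A] unfolding solution_def by blast
        show ?thesis using s' bnd[OF s'] by (intro exI[of _ "(u,u1,u2,ut)"]) (auto simp: P_def Q_def solution_def)
      qed
      define N where "N s = (SOME s'. P (\<lambda>x t. F x (fst s x t)) s' \<and> Q s')"
        for s :: "(real^'n \<Rightarrow> real \<Rightarrow> real) \<times> (real^'n \<Rightarrow> real \<Rightarrow> real^'n) \<times> (real^'n \<Rightarrow> real \<Rightarrow> real^'n^'n) \<times> (real^'n \<Rightarrow> real \<Rightarrow> real)"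
      have N: "P (\<lambda>x t. F x (fst s x t)) (N s) \<and> Q (N s)" if "Q s" for s unfolding N_def by (rule someI_ex[OF step[OF that]])
      define s where "s m = (N ^^ m) ((\<lambda>x t. 0), (\<lambda>x t. 0), (\<lambda>x t. 0), (\<lambda>x t. 0))" for m
      have Qs: "Q (s m)" for m
      proof (induction m)
        case 0
        show ?case using reg_zero[OF K] M by (simp add: Q_def s_def)
      next
        case (Suc m)
        then show ?case using N by (simp add: s_def)
      qed
      define u where "u m = fst (s m)" for m
      define u1 where "u1 m = fst (snd (s m))" for m
      define u2 where "u2 m = fst (snd (snd (s m)))" for m
      define ut where "ut m = snd (snd (snd (s m)))" for m
      have R: "reg \<alpha> UNIV T K (u m) (u1 m) (u2 m) (ut m)" and um: "t \<in> {0..T} \<Longrightarrow> \<bar>u m x t\<bar> \<le> M" for m x t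
        using Qs[of m] by (auto simp: Q_def u_def u1_def u2_def ut_def)
      have S: "solution \<alpha> T a b (\<lambda>x t. F x (u m x t)) K (u (Suc m)) (u1 (Suc m)) (u2 (Suc m)) (ut (Suc m))" for m
        using N[OF Qs[of m]] by (simp add: P_def u_def u1_def u2_def ut_def s_def)
      \<comment> \<open>Contraction in the sup norm with weight exp(2 B t): a source bounded by B
        exp(2 B t) produces at most exp(2 B t) / 2, whose derivative it is. Each step therefore
        halves the distance on all of [0,T].\<close>
      have diff: "\<bar>u (Suc m) x t - u m x t\<bar> \<le> 2 * M * (1/2)^m * exp (2 * B * t)" if "t \<in> {0..T}" for m x t
        using that
      proof (induction m arbitrary: x t)
        case 0
        have "\<bar>u (Suc 0) x t - u 0 x t\<bar> \<le> 2 * M * 1" using um[OF 0, of "Suc 0" x] um[OF 0, of 0 x] by linarith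
        also have "\<dots> \<le> 2 * M * exp (2 * B * t)" using M B 0 by (intro mult_left_mono) auto
        finally show ?case by simp
      next
        case (Suc m)
        show ?case
        proof (rule solution_sup_bound[OF c \<kappa>(1) \<alpha>(1) solution_diff[OF S[of "Suc m"] S[of m]], where E' = "\<lambda>t. B * (2 * M * (1/2)^m * exp (2 * B * t))", OF _ _ _ Suc.prems])
          show "((\<lambda>t. 2 * M * (1/2)^(Suc m) * exp (2 * B * t)) has_real_derivative B * (2 * M * (1/2)^m * exp (2 * B * t))) (at t within {0..T})" for t
            by (auto intro!: derivative_eq_intros)
          show "0 \<le> 2 * M * (1/2)^(Suc m) * exp (2 * B * t)" for t using M by simp
          show "\<bar>F x (u (Suc m) x t) - F x (u m x t)\<bar> \<le> B * (2 * M * (1/2)^m * exp (2 * B * t))" if t: "t \<in> {0..T}" for x t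
            using F(2)[of x "u (Suc m) x t" x "u m x t"] mult_left_mono[OF Suc.IH[OF t, of x] B] by simp
        qed
      qed
      show ?thesis
      proof (rule reg_compact[of \<alpha> T K "\<lambda>m. u (Suc m)" "\<lambda>m. u1 (Suc m)" "\<lambda>m. u2 (Suc m)" "\<lambda>m. ut (Suc m)", OF R \<alpha>(1) T K], goal_cases)
        case (1 \<F> v v1 v2 vt)
        note \<F> = 1(1,2) and Rv = 1(3) and l0 = 1(4) and l1 = 1(5) and l2 = 1(6) and lt = 1(7)
        have "vt x t = a x \<bullet> v2 x t + b x \<bullet> v1 x t + F x (v x t)" if t: "t \<in> {0..T}" for x t
        proof -
          have "(\<lambda>m. 2 * M * (1/2)^m * exp (2 * B * t)) \<longlonglongrightarrow> 2 * M * 0 * exp (2 * B * t)"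
            by (intro tendsto_intros LIMSEQ_realpow_zero) auto
          then have z: "(\<lambda>m. 2 * M * (1/2)^m * exp (2 * B * t)) \<longlonglongrightarrow> 0" by simp
          have "(\<lambda>m. u (Suc m) x t - u m x t) \<longlonglongrightarrow> 0"
            by (rule Lim_null_comparison[OF always_eventually z]) (use diff[OF t, of _ x] in simp)
          from tendsto_diff[OF l0[OF t, of x] tendsto_mono[OF \<F>(2) this]] have "((\<lambda>m. u m x t) \<longlongrightarrow> v x t) \<F>" by simp
          then have "((\<lambda>m. B * \<bar>u m x t - v x t\<bar>) \<longlongrightarrow> B * \<bar>v x t - v x t\<bar>) \<F>" by (intro tendsto_intros)
          then have z': "((\<lambda>m. B * \<bar>u m x t - v x t\<bar>) \<longlongrightarrow> 0) \<F>" by simp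
          have "((\<lambda>m. F x (u m x t) - F x (v x t)) \<longlongrightarrow> 0) \<F>"
            by (rule Lim_null_comparison[OF always_eventually z']) (use F(2)[of x _ x "v x t"] in simp)
          from LIM_zero_cancel[OF this] have lF: "((\<lambda>m. F x (u m x t)) \<longlongrightarrow> F x (v x t)) \<F>" .
          have "((\<lambda>m. a x \<bullet> u2 (Suc m) x t + b x \<bullet> u1 (Suc m) x t + F x (u m x t))
             \<longlongrightarrow> a x \<bullet> v2 x t + b x \<bullet> v1 x t + F x (v x t)) \<F>"
            by (intro tendsto_intros l1[OF t] l2[OF t] lF)
          moreover have "ut (Suc m) x t = a x \<bullet> u2 (Suc m) x t + b x \<bullet> u1 (Suc m) x t + F x (u m x t)" for m
            using S[of m] t unfolding solution_def by blast
          ultimately have "((\<lambda>m. ut (Suc m) x t) \<longlongrightarrow> a x \<bullet> v2 x t + b x \<bullet> v1 x t + F x (v x t)) \<F>" by simp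
          from tendsto_unique[OF \<F>(1) lt[OF t] this] show ?thesis .
        qed
        then show ?thesis using Rv unfolding solution_def by blast
      qed
    qed
  qed
qed

section \<open>Cut-off functions and a penalised comparison on an annulus\<close>

lemma min_one_le_powr: "0 \<le> d \<Longrightarrow> 0 < \<alpha> \<Longrightarrow> \<alpha> \<le> 1 \<Longrightarrow> min 1 d \<le> d powr (\<alpha>::real)"
proof (cases "d \<le> 1")
  case True
  assume "0 \<le> d" "0 < \<alpha>" "\<alpha> \<le> 1"
  then show ?thesis using True powr_mono'[of \<alpha> 1 d] by simp
next
  case False
  assume "0 < \<alpha>"
  then show ?thesis using False ge_one_powr_ge_zero[of d \<alpha>] by simp
qed

text \<open>Nothing is known of \<open>g\<close> outside \<open>S\<close>. The splitting \<theta> x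
  (g x - g y) + (\<theta> x - \<theta> y) g y uses \<open>g\<close> at \<open>y\<close>, and at
  \<open>x\<close> only where \<theta> x does not vanish; if just \<open>x\<close> lies in
  \<open>S\<close> the two points are exchanged.\<close>

lemma cutoff_product:
  fixes g :: "'a::metric_space \<Rightarrow> 'b::real_normed_vector"
  assumes \<alpha>: "0 < \<alpha>" "\<alpha> \<le> 1" and \<theta>: "\<And>x. 0 \<le> \<theta> x" "\<And>x. \<theta> x \<le> 1" "\<And>x y. \<bar>\<theta> x - \<theta> y\<bar> \<le> L * min 1 (dist x y)" "\<And>x. x \<notin> S \<Longrightarrow> \<theta> x = 0"
    and g: "\<And>x. x \<in> S \<Longrightarrow> norm (g x) \<le> Q" "\<And>x y. x \<in> S \<Longrightarrow> y \<in> S \<Longrightarrow> norm (g x - g y) \<le> K * dist x y powr \<alpha>"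
    and pos: "0 \<le> L" "0 \<le> K" "0 \<le> Q"
  shows "norm (\<theta> x *\<^sub>R g x - \<theta> y *\<^sub>R g y) \<le> (K + L * Q) * dist x y powr \<alpha>"
proof -
  have *: "\<bar>\<theta> x - \<theta> y\<bar> * Q \<le> L * Q * dist x y powr \<alpha>" for x y
    using mult_right_mono[OF order_trans[OF \<theta>(3)[of x y] mult_left_mono[OF min_one_le_powr[OF zero_le_dist[of x y] \<alpha>] pos(1)]] pos(3)]
    by (simp add: mult_ac)
  have one: "norm (\<theta> x *\<^sub>R g x - \<theta> y *\<^sub>R g y) \<le> (K + L * Q) * dist x y powr \<alpha>" if "y \<in> S" for x y
  proof -
    have "\<theta> x *\<^sub>R g x - \<theta> y *\<^sub>R g y = \<theta> x *\<^sub>R (g x - g y) + (\<theta> x - \<theta> y) *\<^sub>R g y" by (simp add: algebra_simps)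
    then have "norm (\<theta> x *\<^sub>R g x - \<theta> y *\<^sub>R g y) \<le> norm (\<theta> x *\<^sub>R (g x - g y)) + norm ((\<theta> x - \<theta> y) *\<^sub>R g y)"
      using norm_triangle_ineq by metis
    moreover have "norm (\<theta> x *\<^sub>R (g x - g y)) \<le> 1 * (K * dist x y powr \<alpha>)"
    proof (cases "x \<in> S")
      case True
      then show ?thesis using g(2)[OF True \<open>y \<in> S\<close>] \<theta>(1,2)[of x] unfolding norm_scaleR by (intro mult_mono) auto
    qed (use \<theta>(4) pos in simp)
    moreover have "norm ((\<theta> x - \<theta> y) *\<^sub>R g y) \<le> L * Q * dist x y powr \<alpha>"
      using *[of x y] mult_left_mono[OF g(1)[OF that], of "\<bar>\<theta> x - \<theta> y\<bar>"] by simp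
    ultimately show ?thesis by (simp add: distrib_right)
  qed
  show ?thesis
  proof (cases "y \<in> S")
    case False
    show ?thesis
    proof (cases "x \<in> S")
      case True
      from one[OF True, of y] show ?thesis by (simp add: norm_minus_commute dist_commute)
    qed (use False \<theta>(4) pos in simp)
  qed (rule one)
qed

definition cutoff :: "real \<Rightarrow> real^'n \<Rightarrow> real" where
  "cutoff \<rho> x = max 0 (min 1 (\<rho> - norm x))"

lemma cutoff:
  shows "0 \<le> cutoff \<rho> x" "cutoff \<rho> x \<le> 1" "norm x \<le> \<rho> - 1 \<Longrightarrow> cutoff \<rho> x = 1" "\<rho> \<le> norm x \<Longrightarrow> cutoff \<rho> x = 0"
    "\<bar>cutoff \<rho> x - cutoff \<rho> y\<bar> \<le> min 1 (dist x y)"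
  using norm_triangle_ineq3[of x y] by (auto simp: cutoff_def dist_norm)

text \<open>An exponent of at least 2 smooths the kink at 0. The exponents 3 and 2 are used below,
  for a barrier that vanishes on a ball and is twice differentiable across its boundary.\<close>

lemma max_power_derivative:
  "((\<lambda>s::real. max 0 s ^ Suc (Suc n)) has_real_derivative real (Suc (Suc n)) * max 0 s ^ Suc n) (at s)"
proof (cases s "0::real" rule: linorder_cases)
  case less
  have "((\<lambda>s::real. 0) has_real_derivative real (Suc (Suc n)) * max 0 s ^ Suc n) (at s)" using less by simp
  then show ?thesis by (rule has_field_derivative_transform_within_open[of _ _ _ "{..<0}"]) (use less in auto)
next
  case equal
  show ?thesis unfolding CARAT_DERIV
  proof (intro exI[of _ "\<lambda>z. max 0 z ^ Suc n"] conjI allI)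
    show "isCont (\<lambda>z. max 0 z ^ Suc n) s" by (intro continuous_intros)
  qed (auto simp: equal max_def)
next
  case greater
  have "((\<lambda>s::real. s ^ Suc (Suc n)) has_real_derivative real (Suc (Suc n)) * max 0 s ^ Suc n) (at s)"
    using greater DERIV_pow[of "Suc (Suc n)" s] by simp
  then show ?thesis by (rule has_field_derivative_transform_within_open[of _ _ _ "{0<..}"]) (use greater in auto)
qed

lemma continuous_on_outer: "continuous_on S (outer :: real^'n \<Rightarrow> real^'n^'n)"
  unfolding outer_def by (intro continuous_on_vec_lambda continuous_intros)

lemma outer_mult: "outer x *v h = (x \<bullet> h) *\<^sub>R x"
  by (simp add: vec_eq_iff outer_def matrix_vector_mult_def inner_vec_def sum_distrib_left mult_ac)

text \<open>The barrier is \<delta> exp (\<Lambda> t) + M \<zeta> x, where \<zeta> vanishes for |x| \<le> r, equals 1 for |x| = r + 1 and is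
  twice differentiable; what the operator produces from \<zeta> is absorbed by the penalty N \<psi>.\<close>

lemma annulus_comparison:
  fixes A :: "real^'n \<Rightarrow> real^'n^'n"
  assumes A: "\<And>x. transpose (A x) = A x" "\<And>x v. 0 \<le> v \<bullet> (A x *v v)"
    and P: "\<And>x. x \<in> ball 0 (r+1) \<Longrightarrow> norm (A x) \<le> P" "\<And>x. x \<in> ball 0 (r+1) \<Longrightarrow> norm (B x) \<le> P"
    and r: "0 \<le> r" and \<Lambda>: "0 \<le> \<Lambda>" and M: "0 \<le> M" and \<eta>: "0 < \<eta>"
  obtains N\<^sub>0 where "0 \<le> N\<^sub>0" "\<And>N T' \<psi> v v1 v2 vt x t. N\<^sub>0 \<le> N \<Longrightarrow> T' \<le> T \<Longrightarrow> (\<And>x. 0 \<le> \<psi> x) \<Longrightarrow> (\<And>x. r \<le> norm x \<Longrightarrow> norm x \<le> r + 1 \<Longrightarrow> 1 \<le> \<psi> x) \<Longrightarrow>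
    continuous_on (cball 0 (r+1) \<times> {0..T'}) (\<lambda>(x,t). v x t) \<Longrightarrow> (\<And>x. x \<in> cball 0 (r+1) \<Longrightarrow> v x 0 \<le> 0) \<Longrightarrow>
    (\<And>x t. x \<in> sphere 0 (r+1) \<Longrightarrow> t \<in> {0..T'} \<Longrightarrow> v x t \<le> M) \<Longrightarrow> drv (ball 0 (r+1)) T' v v1 v2 vt \<Longrightarrow>
    (\<And>x t. x \<in> ball 0 (r+1) \<Longrightarrow> t \<in> {0<..T'} \<Longrightarrow> v x t > 0 \<Longrightarrow>
      vt x t \<le> A x \<bullet> v2 x t + B x \<bullet> v1 x t + \<Lambda> * v x t - N * \<psi> x * v x t) \<Longrightarrow>
    x \<in> cball 0 r \<Longrightarrow> t \<in> {0..T'} \<Longrightarrow> v x t \<le> \<eta>"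
proof -
  define q where "q = (r+1)\<^sup>2 - r\<^sup>2"
  have q: "0 < q" using r by (simp add: q_def power2_eq_square algebra_simps)
  \<comment> \<open>Normalises \<zeta> to 1 on the outer sphere, where |x|^2 - r^2 equals
    \<open>q\<close>.\<close>
  define k where "k = 1 / q ^ 3"
  have k: "0 < k" using q by (simp add: k_def)
  define p where "p x = max 0 (x \<bullet> x - r\<^sup>2)" for x :: "real^'n"
  define \<zeta> where "\<zeta> x = k * p x ^ 3" for x
  define \<zeta>1 where "\<zeta>1 x = (6 * k * p x ^ 2) *\<^sub>R x" for x
  define \<zeta>2 where "\<zeta>2 x = (6 * k * p x ^ 2) *\<^sub>R mat 1 + (24 * k * p x) *\<^sub>R outer x" for x
  have pc: "continuous_on S p" for S unfolding p_def[abs_def] by (intro continuous_intros)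
  have D: "((\<lambda>x. max 0 (x \<bullet> x - r\<^sup>2) ^ Suc (Suc n)) has_derivative (\<lambda>h. real (Suc (Suc n)) * max 0 (x \<bullet> x - r\<^sup>2) ^ Suc n * (2 * (x \<bullet> h)))) (at x)" for n and x :: "real^'n"
  proof -
    have "((\<lambda>x. x \<bullet> x - r\<^sup>2) has_derivative (\<lambda>h. 2 * (x \<bullet> h))) (at x)"
      by (auto intro!: derivative_eq_intros simp: inner_commute)
    from has_derivative_compose[OF this max_power_derivative[of n, unfolded has_field_derivative_def]] show ?thesis by simp
  qed
  have \<zeta>D: "(\<zeta> has_derivative (\<lambda>h. \<zeta>1 x \<bullet> h)) (at x)" for x
    unfolding \<zeta>_def[abs_def] \<zeta>1_def p_def
    by (rule has_derivative_eq_rhs[OF has_derivative_mult_right[OF D[of 1, unfolded One_nat_def, folded numeral_3_eq_3]]])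
      (simp add: fun_eq_iff numeral_2_eq_2 mult_ac)
  have \<zeta>1D: "(\<zeta>1 has_derivative (\<lambda>h. \<zeta>2 x *v h)) (at x)" for x
  proof -
    have "((\<lambda>x. p x ^ 2) has_derivative (\<lambda>h. 2 * p x * (2 * (x \<bullet> h)))) (at x)"
      using D[of 0 x] by (simp add: p_def numeral_2_eq_2)
    from has_derivative_scaleR[OF has_derivative_mult_right[OF this, of "6 * k"] has_derivative_ident]
    have "((\<lambda>x. (6 * k * p x ^ 2) *\<^sub>R x) has_derivative (\<lambda>h. (6 * k * p x ^ 2) *\<^sub>R h + (6 * k * (2 * p x * (2 * (x \<bullet> h)))) *\<^sub>R x)) (at x)" .
    moreover have "\<zeta>2 x *v h = (6 * k * p x ^ 2) *\<^sub>R h + (6 * k * (2 * p x * (2 * (x \<bullet> h)))) *\<^sub>R x" for h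
      unfolding \<zeta>2_def matrix_vector_mult_add_rdistrib by (simp add: outer_mult flip: scaleR_matrix_vector_assoc)
    ultimately show ?thesis unfolding \<zeta>1_def[abs_def] by simp
  qed
  have \<zeta>dr: "drv (ball 0 (r+1)) T' (\<lambda>x t. \<zeta> x) (\<lambda>x t. \<zeta>1 x) (\<lambda>x t. \<zeta>2 x) (\<lambda>x t. 0)" for T'
    unfolding drv_def using \<zeta>D \<zeta>1D by auto
  have bc: "\<exists>X. \<forall>x\<in>cball 0 (r+1). norm (g x) \<le> X" if "continuous_on (cball 0 (r+1)) g" for g :: "real^'n \<Rightarrow> 'z::real_normed_vector"
    using compact_imp_bounded[OF compact_continuous_image[OF that compact_cball]] unfolding bounded_iff by blast
  have "continuous_on (cball 0 (r+1)) \<zeta>" "continuous_on (cball 0 (r+1)) \<zeta>1" "continuous_on (cball 0 (r+1)) \<zeta>2"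
    unfolding \<zeta>_def[abs_def] \<zeta>1_def[abs_def] \<zeta>2_def[abs_def]
    by (auto intro!: continuous_intros pc continuous_on_outer)
  then obtain X0 X1 X2 where X: "\<And>x. x \<in> cball 0 (r+1) \<Longrightarrow> \<bar>\<zeta> x\<bar> \<le> X0" "\<And>x. x \<in> cball 0 (r+1) \<Longrightarrow> norm (\<zeta>1 x) \<le> X1"
    "\<And>x. x \<in> cball 0 (r+1) \<Longrightarrow> norm (\<zeta>2 x) \<le> X2" using bc[of \<zeta>] bc[of \<zeta>1] bc[of \<zeta>2] unfolding real_norm_def by blast
  have P0: "0 \<le> P" using order_trans[OF norm_ge_zero P(1)[of 0]] r by simp
  \<comment> \<open>Bounds what the operator and the zero-order term produce from \<zeta> on the
    ball.\<close>
  define Y where "Y = P * X2 + P * X1 + \<Lambda> * X0"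
  have Y: "A x \<bullet> \<zeta>2 x + B x \<bullet> \<zeta>1 x + \<Lambda> * \<zeta> x \<le> Y" if "x \<in> ball 0 (r+1)" for x
  proof -
    have x: "x \<in> cball 0 (r+1)" using that by auto
    have "A x \<bullet> \<zeta>2 x \<le> P * X2" by (rule order_trans[OF norm_cauchy_schwarz mult_mono[OF P(1)[OF that] X(3)[OF x] P0 norm_ge_zero]])
    moreover have "B x \<bullet> \<zeta>1 x \<le> P * X1" by (rule order_trans[OF norm_cauchy_schwarz mult_mono[OF P(2)[OF that] X(2)[OF x] P0 norm_ge_zero]])
    moreover have "\<Lambda> * \<zeta> x \<le> \<Lambda> * X0" using X(1)[OF x] \<Lambda> by (intro mult_left_mono) auto
    ultimately show ?thesis by (simp add: Y_def)
  qed
  \<comment> \<open>The growing part of the barrier starts at \<delta> and stays below \<eta> up to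
    time \<open>T\<close>.\<close>
  define \<delta> where "\<delta> = \<eta> * exp (- (\<Lambda> * T))"
  have \<delta>: "0 < \<delta>" using \<eta> by (simp add: \<delta>_def)
  define E where "E t = \<delta> * exp (\<Lambda> * t)" for t
  show thesis
  \<comment> \<open>Where \<open>v\<close> exceeds the barrier it is at least \<delta>, so on the
    annulus a penalty constant of this size outweighs M Y. The constant is fixed before
    \<open>v\<close> is given, as the functions compared later are constructed from it.\<close>
  proof (rule that[of "max 0 (M * Y / \<delta>)"])
    fix N T' :: real and \<psi> :: "real^'n \<Rightarrow> real" and v v1 v2 vt and x :: "real^'n" and t
    assume N: "max 0 (M * Y / \<delta>) \<le> N" and T': "T' \<le> T" and \<psi>: "\<And>x. 0 \<le> \<psi> x" "\<And>x. r \<le> norm x \<Longrightarrow> norm x \<le> r + 1 \<Longrightarrow> 1 \<le> \<psi> x"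
      and c: "continuous_on (cball 0 (r+1) \<times> {0..T'}) (\<lambda>(x,t). v x t)" and i: "\<And>x. x \<in> cball 0 (r+1) \<Longrightarrow> v x 0 \<le> 0"
      and b: "\<And>x t. x \<in> sphere 0 (r+1) \<Longrightarrow> t \<in> {0..T'} \<Longrightarrow> v x t \<le> M" and d: "drv (ball 0 (r+1)) T' v v1 v2 vt"
      and ineq: "\<And>x t. x \<in> ball 0 (r+1) \<Longrightarrow> t \<in> {0<..T'} \<Longrightarrow> v x t > 0 \<Longrightarrow>
        vt x t \<le> A x \<bullet> v2 x t + B x \<bullet> v1 x t + \<Lambda> * v x t - N * \<psi> x * v x t"
      and x: "x \<in> cball 0 r" and t: "t \<in> {0..T'}"
    have \<zeta>0: "0 \<le> \<zeta> x" for x using k by (simp add: \<zeta>_def p_def)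
    have inner: "p x = 0" if "norm x \<le> r" for x
      using power_mono[OF that, of 2] by (simp add: p_def power2_norm_eq_inner)
    have E': "(E has_real_derivative \<Lambda> * E t) (at t within {0..T'})" for t
      unfolding E_def[abs_def] by (auto intro!: derivative_eq_intros)
    have Ec: "continuous_on (cball 0 (r+1) \<times> {0..T'}) (\<lambda>(x::real^'n,t). E t)"
      unfolding E_def case_prod_beta by (intro continuous_intros)
    have \<zeta>c: "continuous_on (cball 0 (r+1) \<times> {0..T'}) (\<lambda>(x,t). \<zeta> x)"
      unfolding case_prod_beta \<zeta>_def by (intro continuous_intros continuous_on_compose2[OF pc[of UNIV]]) auto
    have "v x t - (E t + M * \<zeta> x) \<le> 0"
    proof (rule maximum_principle_compact[where w = "\<lambda>x t. v x t - (E t + M * \<zeta> x)" and K = \<Lambda> and a = A and b = B and z = 0 and r = "r+1",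
        OF _ _ _ drv_diff[OF d drv_add[OF drv_time[OF E'] drv_scale[OF \<zeta>dr, where c = M]]]])
      show "continuous_on (cball 0 (r+1) \<times> {0..T'}) (\<lambda>(x, t). v x t - (E t + M * \<zeta> x))"
        using c Ec \<zeta>c unfolding case_prod_beta by (intro continuous_intros)
      show "v x 0 - (E 0 + M * \<zeta> x) \<le> 0" if "x \<in> cball 0 (r+1)" for x
        using i[OF that] \<zeta>0[of x] M \<delta> by (simp add: E_def add_nonneg_nonneg order_trans[of _ 0])
      show "v x t - (E t + M * \<zeta> x) \<le> 0" if "x \<in> sphere 0 (r+1)" "t \<in> {0..T'}" for x t
      proof -
        have "x \<bullet> x = (r+1)\<^sup>2" using that(1) by (simp flip: power2_norm_eq_inner)
        then have "\<zeta> x = 1" using q by (simp add: \<zeta>_def p_def k_def flip: q_def)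
        then show ?thesis using b[OF that] \<delta> by (simp add: E_def add_increasing)
      qed
      show "vt x t - (\<Lambda> * E t + M * 0) \<le> A x \<bullet> (v2 x t - (0 + M *\<^sub>R \<zeta>2 x)) + B x \<bullet> (v1 x t - (0 + M *\<^sub>R \<zeta>1 x)) + \<Lambda> * (v x t - (E t + M * \<zeta> x))"
        if x: "x \<in> ball 0 (r+1)" and t: "t \<in> {0<..T'}" and w: "v x t - (E t + M * \<zeta> x) > 0" for x t
      proof -
        have vE: "E t < v x t" using w mult_nonneg_nonneg[OF M \<zeta>0[of x]] by linarith
        have E\<delta>: "\<delta> \<le> E t" unfolding E_def using mult_left_mono[of 1 "exp (\<Lambda> * t)" \<delta>] \<delta> \<Lambda> t by simp
        have "M * (A x \<bullet> \<zeta>2 x + B x \<bullet> \<zeta>1 x + \<Lambda> * \<zeta> x) \<le> N * \<psi> x * v x t"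
        \<comment> \<open>For |x| <= r, \<zeta> vanishes with its first and second derivatives, and
          the sign of the penalty is enough.\<close>
        proof (cases "norm x \<le> r")
          case True
          then show ?thesis using inner[OF True] \<psi>(1)[of x] N vE E\<delta> \<delta> by (simp add: \<zeta>_def \<zeta>1_def \<zeta>2_def)
        next
          case False
          have "M * (A x \<bullet> \<zeta>2 x + B x \<bullet> \<zeta>1 x + \<Lambda> * \<zeta> x) \<le> M * Y" by (rule mult_left_mono[OF Y[OF x] M])
          also have "\<dots> \<le> N * \<delta>" using N \<delta> by (simp add: pos_divide_le_eq)
          also have "\<dots> \<le> (N * \<psi> x) * v x t"
            using \<psi>(2)[of x] False x N vE E\<delta> \<delta> mult_left_mono[of 1 "\<psi> x" N] by (intro mult_mono) auto
          finally show ?thesis .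
        qed
        moreover have "vt x t \<le> A x \<bullet> v2 x t + B x \<bullet> v1 x t + \<Lambda> * v x t - N * \<psi> x * v x t"
          by (rule ineq[OF x t]) (use vE E\<delta> \<delta> in linarith)
        ultimately show ?thesis by (simp add: inner_diff_right algebra_simps)
      qed
    qed (use A x t in auto)
    moreover have "\<zeta> x = 0" using inner[of x] x by (simp add: \<zeta>_def)
    moreover have "E t \<le> \<eta>"
    proof -
      have "\<Lambda> * t \<le> \<Lambda> * T" using \<Lambda> t T' by (intro mult_left_mono) auto
      then have "E t \<le> \<delta> * exp (\<Lambda> * T)" unfolding E_def using \<delta> by simp
      also have "\<dots> = \<eta>" by (simp add: \<delta>_def flip: exp_add)
      finally show ?thesis .
    qed
    ultimately show "v x t \<le> \<eta>" by simp
  qed simp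
qed

section \<open>Comparison with the stationary solution\<close>

text \<open>Ellipticity is pointwise, the Hoelder constants are local and \<open>W\<close> may be
  unbounded; every quantitative statement therefore refers to a ball. The matrix \<open>A\<close>
  will be the symmetric part of the given coefficients.\<close>

locale stationary_problem =
  fixes \<alpha> :: real and A :: "real^'n \<Rightarrow> real^'n^'n" and B :: "real^'n \<Rightarrow> real^'n"
    and f :: "real^'n \<Rightarrow> real \<Rightarrow> real" and W :: "real^'n \<Rightarrow> real" and W1 :: "real^'n \<Rightarrow> real^'n" and W2 :: "real^'n \<Rightarrow> real^'n^'n"
  assumes \<alpha>: "0 < \<alpha>" "\<alpha> < 1"
    and symmetric: "transpose (A x) = A x" and elliptic: "v \<noteq> 0 \<Longrightarrow> 0 < v \<bullet> (A x *v v)"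
    and hoelder_A: "\<exists>K. \<forall>x y. norm x \<le> \<rho> \<longrightarrow> norm y \<le> \<rho> \<longrightarrow> norm (A x - A y) \<le> K * dist x y powr \<alpha>"
    and hoelder_B: "\<exists>K. \<forall>x y. norm x \<le> \<rho> \<longrightarrow> norm y \<le> \<rho> \<longrightarrow> norm (B x - B y) \<le> K * dist x y powr \<alpha>"
    and lipschitz: "loc_lip_f f" and f0: "f x 0 = 0"
    and W1: "(W has_derivative (\<lambda>h. W1 x \<bullet> h)) (at x)" and W2: "(W1 has_derivative (\<lambda>h. W2 x *v h)) (at x)"
    and stationary: "A x \<bullet> W2 x + B x \<bullet> W1 x + f x (W x) = 0" and W_nonneg: "0 \<le> W x"
begin

lemma psd: "0 \<le> v \<bullet> (A x *v v)"
  using elliptic[of v x] by (cases "v = 0") auto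

text \<open>The quadratic form attains a positive minimum on the compact product of the ball and the
  unit sphere. It is capped at 1 so that the identity matrix satisfies the same lower bound.\<close>

lemma local_coef:
  assumes \<rho>: "0 \<le> \<rho>"
  obtains \<kappa> \<Lambda> where "0 < \<kappa>" "\<kappa> \<le> 1" "1 \<le> \<Lambda>" "coef \<kappa> \<Lambda> \<alpha> (cball 0 \<rho>) A B"
proof -
  obtain K1 where K1: "norm x \<le> \<rho> \<Longrightarrow> norm y \<le> \<rho> \<Longrightarrow> norm (A x - A y) \<le> K1 * dist x y powr \<alpha>" for x y using hoelder_A by blast
  obtain K2 where K2: "norm x \<le> \<rho> \<Longrightarrow> norm y \<le> \<rho> \<Longrightarrow> norm (B x - B y) \<le> K2 * dist x y powr \<alpha>" for x y using hoelder_B by blast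
  define k where "k = max 0 (max K1 K2)"
  have kA: "norm (A x - A y) \<le> k * dist x y powr \<alpha>" and kB: "norm (B x - B y) \<le> k * dist x y powr \<alpha>" if "norm x \<le> \<rho>" "norm y \<le> \<rho>" for x y
    using K1[OF that] K2[OF that] by (auto simp: k_def intro: order_trans[OF _ mult_right_mono])
  define \<Lambda> where "\<Lambda> = 1 + k + k * \<rho> powr \<alpha> + norm (A 0) + norm (B 0)"
  have k: "0 \<le> k" by (simp add: k_def)
  have \<Lambda>: "1 \<le> \<Lambda>" "k \<le> \<Lambda>" using k by (auto simp: \<Lambda>_def add_increasing2)
  have bd: "k * dist x 0 powr \<alpha> \<le> k * \<rho> powr \<alpha>" if "norm x \<le> \<rho>" for x :: "real^'n"
    using that k \<alpha> by (intro mult_left_mono powr_mono2) auto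
  have bA: "norm (A x) \<le> \<Lambda>" and bB: "norm (B x) \<le> \<Lambda>" if "norm x \<le> \<rho>" for x
  proof -
    have "norm (A x) \<le> norm (A 0) + norm (A x - A 0)" "norm (B x) \<le> norm (B 0) + norm (B x - B 0)"
      using norm_triangle_sub[of "A x" "A 0"] norm_triangle_sub[of "B x" "B 0"] by auto
    moreover have "norm (0 :: real^'n) \<le> \<rho>" "0 \<le> norm (A 0)" "0 \<le> norm (B 0)" using \<rho> by auto
    ultimately show "norm (A x) \<le> \<Lambda>" "norm (B x) \<le> \<Lambda>"
      using kA[OF that \<open>norm 0 \<le> \<rho>\<close>] kB[OF that \<open>norm 0 \<le> \<rho>\<close>] bd[OF that] k unfolding \<Lambda>_def by linarith+
  qed
  have kA': "norm (A x - A y) \<le> \<Lambda> * dist x y powr \<alpha>" and kB': "norm (B x - B y) \<le> \<Lambda> * dist x y powr \<alpha>" if "norm x \<le> \<rho>" "norm y \<le> \<rho>" for x y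
    using kA[OF that] kB[OF that] mult_right_mono[OF \<Lambda>(2), of "dist x y powr \<alpha>"] by auto
  have "hol \<alpha> (cball 0 \<rho>) 0 \<Lambda> (\<lambda>x t. A x)"
    unfolding hol_def using bA kA' by auto
  from hol_continuous[OF this \<alpha>(1)] have "continuous_on (cball 0 \<rho>) (\<lambda>x. (\<lambda>(x,t). A x) (x, 0::real))"
    by (rule continuous_on_compose2) (auto intro!: continuous_intros)
  then have Ac: "continuous_on (cball 0 \<rho>) A" by simp
  let ?S = "cball 0 \<rho> \<times> sphere 0 1 :: ((real^'n) \<times> (real^'n)) set"
  have "continuous_on ?S (\<lambda>p. outer (snd p) \<bullet> A (fst p))"
    by (intro continuous_intros continuous_on_compose2[OF continuous_on_outer[of UNIV]] continuous_on_compose2[OF Ac]) auto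
  moreover have "compact ?S" by (intro compact_Times compact_cball compact_sphere)
  moreover have "(0, axis undefined 1) \<in> ?S" using \<rho> by simp
  then have "?S \<noteq> {}" by blast
  ultimately have "\<exists>p\<in>?S. \<forall>q\<in>?S. outer (snd p) \<bullet> A (fst p) \<le> outer (snd q) \<bullet> A (fst q)"
    using continuous_attains_inf by blast
  then obtain p where p: "p \<in> ?S" "\<And>q. q \<in> ?S \<Longrightarrow> outer (snd p) \<bullet> A (fst p) \<le> outer (snd q) \<bullet> A (fst q)" by blast
  define \<kappa> where "\<kappa> = min 1 (outer (snd p) \<bullet> A (fst p))"
  have \<kappa>: "0 < \<kappa>" "\<kappa> \<le> 1" using p(1) elliptic[of "snd p" "fst p"] by (force simp: \<kappa>_def inner_outer)+
  have quad: "\<kappa> * (h \<bullet> h) \<le> h \<bullet> (A x *v h)" if "norm x \<le> \<rho>" for x h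
  proof (cases "h = 0")
    case False
    let ?e = "(1 / norm h) *\<^sub>R h"
    have "\<kappa> \<le> outer ?e \<bullet> A x" unfolding \<kappa>_def using p(2)[of "(x, ?e)"] that False by auto
    also have "\<dots> = (h \<bullet> (A x *v h)) / (h \<bullet> h)"
      by (simp add: inner_outer matrix_vector_mult_scaleR power2_norm_eq_inner[symmetric] power2_eq_square)
    finally show ?thesis using False by (simp add: pos_le_divide_eq)
  qed simp
  show thesis
    by (rule that[OF \<kappa> \<Lambda>(1)])
      (use symmetric quad bA bB kA' kB' in \<open>auto simp: coef_def\<close>)
qed

text \<open>The radii are nested. The penalty is absent up to R and equals 1 from R + 1 to R + 3;
  the comparison with W takes place on the ball of radius R + 2, where the operator is still the
  original one; beyond R + 3 the operator is the Laplacian, and the whole source vanishes beyond R +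
  4. The barrier \<phi> exists only up to T', while the solution is wanted on the longer interval up
  to T.\<close>

lemma approximant:
  fixes \<phi> \<phi>' :: "real \<Rightarrow> real"
  assumes T: "0 \<le> T" "T' \<le> T" and R: "0 \<le> R" and \<eta>: "0 < \<eta>"
    and M: "0 \<le> M" "\<And>x. norm x \<le> R + 4 \<Longrightarrow> W x \<le> M" "\<And>x. f x M \<le> 0"
    and \<phi>: "\<phi> 0 = M" "\<And>t. t \<in> {0..T'} \<Longrightarrow> 0 \<le> \<phi> t" "\<And>t. t \<in> {0..T'} \<Longrightarrow> (\<phi> has_real_derivative \<phi>' t) (at t within {0..T'})"
      "\<And>x t v. t \<in> {0..T'} \<Longrightarrow> \<phi> t \<le> v \<Longrightarrow> f x v - f x (v - \<phi> t) \<le> \<phi>' t"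
  shows "\<exists>K u u1 u2 ut. reg \<alpha> UNIV T K u u1 u2 ut \<and> (\<forall>x\<in>ball 0 R. \<forall>t\<in>{0..T}. ut x t = A x \<bullet> u2 x t + B x \<bullet> u1 x t + f x (u x t)) \<and>
    (\<forall>x\<in>cball 0 R. \<forall>t\<in>{0..T}. 0 \<le> u x t \<and> u x t \<le> W x + \<eta>) \<and>
    (\<forall>x\<in>cball 0 R. \<forall>t\<in>{0..T'}. W x - \<phi> t - \<eta> \<le> u x t)"
proof -
  have R3: "0 \<le> R + 3" "0 \<le> R + 1" using R by auto
  define \<theta> where "\<theta> = (cutoff (R+3) :: real^'n \<Rightarrow> real)"
  define \<psi> where "\<psi> x = (1 - cutoff (R+1) x) * cutoff (R+4) x" for x :: "real^'n"
  have \<psi>01: "0 \<le> \<psi> x" "\<psi> x \<le> 1" for x using cutoff(1,2)[of _ x] by (auto simp: \<psi>_def intro: mult_le_one)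
  have \<psi>0: "\<psi> x = 0" if "norm x \<le> R \<or> R + 4 \<le> norm x" for x
    using that cutoff(3)[of x "R+1"] cutoff(4)[of "R+4" x] by (auto simp: \<psi>_def)
  have \<psi>1: "\<psi> x = 1" if "R + 1 \<le> norm x" "norm x \<le> R + 1 + 1" for x
    using that cutoff(3)[of x "R+4"] cutoff(4)[of "R+1" x] by (auto simp: \<psi>_def)
  have \<psi>L: "\<bar>\<psi> x - \<psi> y\<bar> \<le> 2 * min 1 (dist x y)" for x y
  proof -
    have "\<psi> x - \<psi> y = (1 - cutoff (R+1) x) * (cutoff (R+4) x - cutoff (R+4) y) + (cutoff (R+1) y - cutoff (R+1) x) * cutoff (R+4) y"
      by (simp add: \<psi>_def algebra_simps)
    also have "\<bar>\<dots>\<bar> \<le> \<bar>1 - cutoff (R+1) x\<bar> * \<bar>cutoff (R+4) x - cutoff (R+4) y\<bar> + \<bar>cutoff (R+1) y - cutoff (R+1) x\<bar> * \<bar>cutoff (R+4) y\<bar>"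
      by (rule order_trans[OF abs_triangle_ineq]) (simp add: abs_mult)
    also have "\<dots> \<le> 1 * min 1 (dist x y) + min 1 (dist y x) * 1"
      using cutoff(1,2)[of "R+1" x] cutoff(1,2)[of "R+4" y] cutoff(5)[of "R+4" x y] cutoff(5)[of "R+1" y x]
      by (intro add_mono mult_mono) auto
    finally show ?thesis by (simp add: dist_commute)
  qed
  obtain \<kappa> \<Lambda> where \<kappa>: "0 < \<kappa>" "\<kappa> \<le> 1" "1 \<le> \<Lambda>" and cf: "coef \<kappa> \<Lambda> \<alpha> (cball 0 (R+3)) A B" by (rule local_coef[OF R3(1)])
  have cfD: "norm (A x) \<le> \<Lambda>" "norm (B x) \<le> \<Lambda>" "\<kappa> * (h \<bullet> h) \<le> h \<bullet> (A x *v h)" if "x \<in> cball 0 (R+3)" for x h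
    using cf that unfolding coef_def by blast+
  have cfH: "norm (A x - A y) \<le> \<Lambda> * dist x y powr \<alpha>" "norm (B x - B y) \<le> \<Lambda> * dist x y powr \<alpha>" if "x \<in> cball 0 (R+3)" "y \<in> cball 0 (R+3)" for x y
    using cf that unfolding coef_def by blast+
  obtain L where L: "\<And>x y u v. norm x \<le> R + 4 + M \<Longrightarrow> norm y \<le> R + 4 + M \<Longrightarrow> 0 \<le> u \<Longrightarrow> u \<le> R + 4 + M \<Longrightarrow> 0 \<le> v \<Longrightarrow> v \<le> R + 4 + M \<Longrightarrow>
      \<bar>f x u - f y v\<bar> \<le> L * (dist x y + \<bar>u - v\<bar>)" using lipschitz unfolding loc_lip_f_def by blast
  define L' where "L' = max 0 L"
  have L': "0 \<le> L'" "\<And>x y u v. norm x \<le> R + 4 \<Longrightarrow> norm y \<le> R + 4 \<Longrightarrow> 0 \<le> u \<Longrightarrow> u \<le> M \<Longrightarrow> 0 \<le> v \<Longrightarrow> v \<le> M \<Longrightarrow>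
      \<bar>f x u - f y v\<bar> \<le> L' * (dist x y + \<bar>u - v\<bar>)"
  proof -
    fix x y :: "real^'n" and u v :: real assume "norm x \<le> R + 4" "norm y \<le> R + 4" "0 \<le> u" "u \<le> M" "0 \<le> v" "v \<le> M"
    then have "\<bar>f x u - f y v\<bar> \<le> L * (dist x y + \<bar>u - v\<bar>)" using R M(1) by (intro L) auto
    also have "\<dots> \<le> L' * (dist x y + \<bar>u - v\<bar>)" unfolding L'_def by (intro mult_right_mono) auto
    finally show "\<bar>f x u - f y v\<bar> \<le> L' * (dist x y + \<bar>u - v\<bar>)" .
  qed (simp add: L'_def)
  have Wd: "drv S T (\<lambda>x t. W x) (\<lambda>x t. W1 x) (\<lambda>x t. W2 x) (\<lambda>x t. 0)" for S T unfolding drv_def using W1 W2 by auto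
  have Wc: "continuous_on UNIV W" by (intro continuous_at_imp_continuous_on ballI has_derivative_continuous[OF W1])
  have W1c: "continuous_on UNIV W1" by (intro continuous_at_imp_continuous_on ballI has_derivative_continuous[OF W2])
  have small: "norm (A x) \<le> \<Lambda>" "norm (B x) \<le> \<Lambda>" if "x \<in> ball 0 (R+1+1)" for x using that cfD[of x] by auto
  show ?thesis
  proof (rule annulus_comparison[where A = A and B = B and r = "R+1" and P = \<Lambda> and \<Lambda> = L' and M = M and \<eta> = \<eta> and T = T, OF symmetric psd small R3(2) L'(1) M(1) \<eta>], goal_cases)
    case (3 N)
    note N = 3(1) and cmp = 3(2)
    \<comment> \<open>Clamping to [0,M] makes the source bounded and globally Lipschitz in
      \<open>u\<close>, as the existence result demands; the bounds \<open>pos\<close> and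
      \<open>upper\<close> show afterwards that it changes nothing.\<close>
    define cl where "cl u = max 0 (min M u)" for u
    have cl: "0 \<le> cl u" "cl u \<le> M" "\<bar>cl u - cl v\<bar> \<le> \<bar>u - v\<bar>" for u v using M(1) by (auto simp: cl_def)
    define F where "F x u = \<theta> x * f x (cl u) - \<psi> x * (N * (cl u - W x))" for x u
    define A' where "A' x = mat 1 + \<theta> x *\<^sub>R (A x - mat 1)" for x
    define B' where "B' x = \<theta> x *\<^sub>R B x" for x
    have \<theta>: "0 \<le> \<theta> x" "\<theta> x \<le> 1" "\<bar>\<theta> x - \<theta> y\<bar> \<le> 1 * min 1 (dist x y)" for x y using cutoff(1,2)[of "R+3" x] cutoff(5)[of "R+3" x y] by (auto simp: \<theta>_def)
    have \<theta>0: "\<theta> x = 0" if "x \<notin> cball 0 (R+3)" for x using that cutoff(4)[of "R+3" x] by (auto simp: \<theta>_def)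
    have \<theta>1: "\<theta> x = 1" if "norm x \<le> R+2" for x using that cutoff(3)[of x "R+3"] by (auto simp: \<theta>_def)
    define m where "m = norm (mat 1 :: real^'n^'n)"
    define \<Lambda>' where "\<Lambda>' = 2 * \<Lambda> + m"
    have m: "0 \<le> m" by (simp add: m_def)
    have \<Lambda>': "1 \<le> \<Lambda>'" using \<kappa> m by (auto simp: \<Lambda>'_def)
    have coef': "coef \<kappa> \<Lambda>' \<alpha> UNIV A' B'"
      unfolding coef_def
    proof (intro ballI conjI allI)
      fix x y :: "real^'n"
      have "transpose (A' x) = A' x \<and> (\<forall>h. \<kappa> * (h \<bullet> h) \<le> h \<bullet> (A' x *v h)) \<and> norm (A' x) \<le> \<Lambda>'"
      proof (cases "x \<in> cball 0 (R+3)")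
        case True
        show ?thesis using identity_interpolation[OF symmetric cfD(3)[OF True] \<kappa>(2) \<theta>(1,2)[of x]] cfD(1)[OF True] \<kappa>(3)
          unfolding A'_def \<Lambda>'_def m_def by auto
      next
        case False
        have "\<kappa> * (h \<bullet> h) \<le> h \<bullet> h" for h :: "real^'n" using mult_right_mono[OF \<kappa>(2), of "h \<bullet> h"] by simp
        then show ?thesis using \<theta>0[OF False] \<kappa>(3) by (simp add: A'_def \<Lambda>'_def m_def)
      qed
      then show "transpose (A' x) = A' x" "\<kappa> * (h \<bullet> h) \<le> h \<bullet> (A' x *v h)" "norm (A' x) \<le> \<Lambda>'" for h by blast+
      have Am: "norm (A x - mat 1) \<le> \<Lambda> + m" if "x \<in> cball 0 (R+3)" for x
        using norm_triangle_ineq4[of "A x" "mat 1"] cfD(1)[OF that] by (simp add: m_def)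
      show "norm (B' x) \<le> \<Lambda>'"
      proof (cases "x \<in> cball 0 (R+3)")
        case True
        have "norm (B' x) \<le> 1 * \<Lambda>" unfolding B'_def norm_scaleR using \<theta>(1,2)[of x] cfD(2)[OF True] by (intro mult_mono) auto
        then show ?thesis using \<kappa> m by (simp add: \<Lambda>'_def)
      qed (use \<theta>0[of x] \<Lambda>' in \<open>simp add: B'_def\<close>)
      have "norm (\<theta> x *\<^sub>R (A x - mat 1) - \<theta> y *\<^sub>R (A y - mat 1)) \<le> (\<Lambda> + 1 * (\<Lambda> + m)) * dist x y powr \<alpha>"
        by (rule cutoff_product[where S = "cball 0 (R+3)", OF \<alpha>(1) less_imp_le[OF \<alpha>(2)] \<theta> \<theta>0 Am]) (use cfH(1) m \<kappa> in auto)
      then show "norm (A' x - A' y) \<le> \<Lambda>' * dist x y powr \<alpha>" by (simp add: A'_def \<Lambda>'_def algebra_simps)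
      have "norm (B' x - B' y) \<le> (\<Lambda> + 1 * \<Lambda>) * dist x y powr \<alpha>"
        unfolding B'_def by (rule cutoff_product[where S = "cball 0 (R+3)", OF \<alpha>(1) less_imp_le[OF \<alpha>(2)] \<theta> \<theta>0 cfD(2) cfH(2)]) (use \<kappa> in auto)
      also have "\<dots> \<le> \<Lambda>' * dist x y powr \<alpha>" using m by (intro mult_right_mono) (auto simp: \<Lambda>'_def)
      finally show "norm (B' x - B' y) \<le> \<Lambda>' * dist x y powr \<alpha>" .
    qed
    define Q where "Q = L' * M"
    have Q: "0 \<le> Q" using L' M by (simp add: Q_def)
    have fQ: "\<bar>f x (cl u)\<bar> \<le> Q" if "norm x \<le> R + 4" for x u
    proof -
      have "\<bar>f x (cl u) - f x 0\<bar> \<le> L' * (dist x x + \<bar>cl u - 0\<bar>)" using that cl[of u] M(1) by (intro L') auto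
      also have "\<dots> \<le> L' * M" using cl(1,2)[of u] L'(1) by (intro mult_left_mono) auto
      finally show ?thesis using f0[of x] by (simp add: Q_def)
    qed
    \<comment> \<open>Lipschitz at small and bounded at large distances, hence \<alpha>-Hoelder with
      the sum of the constants.\<close>
    have loc: "\<bar>g x - g y\<bar> \<le> (l + 2 * q) * dist x y powr \<alpha>"
      if "\<bar>g x - g y\<bar> \<le> l * dist x y" "\<bar>g x\<bar> \<le> q" "\<bar>g y\<bar> \<le> q" "0 \<le> l" "0 \<le> q" for g :: "real^'n \<Rightarrow> real" and x y l q
    proof -
      have "\<bar>g x - g y\<bar> \<le> (l + 2 * q) * min 1 (dist x y)"
      proof (cases "dist x y \<le> 1")
        case True
        have "0 \<le> 2 * q * dist x y" using that by simp
        then show ?thesis using that(1) True unfolding distrib_right min_absorb2[OF True] by linarith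
      qed (use that in auto)
      also have "\<dots> \<le> (l + 2 * q) * dist x y powr \<alpha>"
        using that \<alpha> by (intro mult_left_mono min_one_le_powr) auto
      finally show ?thesis .
    qed
    obtain w where w: "\<And>x. x \<in> cball 0 (R+4) \<Longrightarrow> norm (W1 x) \<le> w"
      using compact_imp_bounded[OF compact_continuous_image[OF continuous_on_subset[OF W1c] compact_cball[of 0 "R+4"]]] unfolding bounded_iff by blast
    have w0: "0 \<le> w" using order_trans[OF norm_ge_zero w[of 0]] R by simp
    have WL: "\<bar>W x - W y\<bar> \<le> w * dist x y" if "norm x \<le> R+4" "norm y \<le> R+4" for x y
      using function_lipschitz[OF Wd[where S = "cball 0 (R+4)" and T = 0], of 0 w x y] w that by simp
    define h1 where "h1 = (L' + 2 * Q) + 1 * Q"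
    define h2 where "h2 = (N * w + 2 * (N * M)) + 2 * (N * M)"
    have F1: "\<bar>\<theta> x * f x (cl u) - \<theta> y * f y (cl u)\<bar> \<le> h1 * dist x y powr \<alpha>" for x y u
      unfolding h1_def
    proof (rule cutoff_product[where S = "cball 0 (R+3)", OF \<alpha>(1) less_imp_le[OF \<alpha>(2)] \<theta> \<theta>0, of "\<lambda>x. f x (cl u)", unfolded real_norm_def real_scaleR_def])
      show "\<bar>f x (cl u) - f y (cl u)\<bar> \<le> (L' + 2 * Q) * dist x y powr \<alpha>" if "x \<in> cball 0 (R+3)" "y \<in> cball 0 (R+3)" for x y
        using loc[of "\<lambda>x. f x (cl u)" x y L' Q] L'(2)[of x y "cl u" "cl u"] fQ[of x u] fQ[of y u] that cl[of u] L'(1) Q by auto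
    qed (use fQ L'(1) Q in auto)
    have WQ: "\<bar>N * (cl u - W x)\<bar> \<le> N * M" if "norm x \<le> R + 4" for x u
      unfolding abs_mult using N cl(1,2)[of u] M(2)[OF that] W_nonneg[of x] by (auto intro!: mult_left_mono)
    have F2: "\<bar>\<psi> x * (N * (cl u - W x)) - \<psi> y * (N * (cl u - W y))\<bar> \<le> h2 * dist x y powr \<alpha>" for x y u
      unfolding h2_def
    proof (rule cutoff_product[OF \<alpha>(1) less_imp_le[OF \<alpha>(2)] \<psi>01 \<psi>L, where S = "cball 0 (R+4)" and g = "\<lambda>x. N * (cl u - W x)", unfolded real_norm_def real_scaleR_def])
      show "\<bar>N * (cl u - W x) - N * (cl u - W y)\<bar> \<le> (N * w + 2 * (N * M)) * dist x y powr \<alpha>" if "x \<in> cball 0 (R+4)" "y \<in> cball 0 (R+4)" for x y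
      proof (rule loc)
        have "\<bar>N * (cl u - W x) - N * (cl u - W y)\<bar> = N * \<bar>W x - W y\<bar>" using N by (simp add: abs_mult abs_minus_commute flip: right_diff_distrib)
        also have "\<dots> \<le> N * (w * dist x y)" using WL[of x y] that N by (intro mult_left_mono) auto
        finally show "\<bar>N * (cl u - W x) - N * (cl u - W y)\<bar> \<le> N * w * dist x y" by simp
      qed (use WQ that N w0 M in auto)
    qed (use \<psi>0 WQ N M w0 in auto)
    define BB where "BB = max (Q + N * M) (max (h1 + h2) (L' + N))"
    have BB: "Q + N * M \<le> BB" "h1 + h2 \<le> BB" "L' + N \<le> BB" by (auto simp: BB_def)
    have \<theta>f: "\<bar>\<theta> x * f x (cl u)\<bar> \<le> Q" for x u
      using mult_mono[OF \<theta>(2)[of x] fQ[of x u] _ abs_ge_zero] \<theta>(1)[of x] \<theta>0[of x] Q by (cases "x \<in> cball 0 (R+3)") (auto simp: abs_mult)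
    have \<psi>W: "\<bar>\<psi> x * (N * (cl u - W x))\<bar> \<le> N * M" for x u
      using mult_mono[OF \<psi>01(2)[of x] WQ[of x u] _ abs_ge_zero] \<psi>01(1)[of x] \<psi>0[of x] N M(1) by (cases "norm x \<le> R+4") (auto simp: abs_mult)
    have FB: "\<bar>F x u\<bar> \<le> BB" for x u using \<theta>f[of x u] \<psi>W[of x u] BB(1) unfolding F_def by linarith
    have FH: "\<bar>F x u - F y v\<bar> \<le> BB * (dist x y powr \<alpha> + \<bar>u - v\<bar>)" for x y u v
    proof -
      have "\<bar>F x u - F y u\<bar> \<le> h1 * dist x y powr \<alpha> + h2 * dist x y powr \<alpha>" using F1[of x u y] F2[of x u y] unfolding F_def by linarith
      also have "\<dots> \<le> BB * dist x y powr \<alpha>" using BB(2) by (simp add: mult_right_mono flip: distrib_right)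
      finally have 1: "\<bar>F x u - F y u\<bar> \<le> BB * dist x y powr \<alpha>" .
      have "\<bar>\<theta> y * (f y (cl u) - f y (cl v))\<bar> \<le> L' * \<bar>u - v\<bar>"
      proof (cases "y \<in> cball 0 (R+3)")
        case True
        have "\<bar>\<theta> y * (f y (cl u) - f y (cl v))\<bar> \<le> 1 * \<bar>f y (cl u) - f y (cl v)\<bar>"
          unfolding abs_mult using \<theta>(1,2)[of y] by (intro mult_right_mono) auto
        also have "\<dots> \<le> L' * \<bar>cl u - cl v\<bar>" using L'(2)[of y y "cl u" "cl v"] True cl by auto
        also have "\<dots> \<le> L' * \<bar>u - v\<bar>" using cl(3) L'(1) by (intro mult_left_mono)
        finally show ?thesis .
      qed (use \<theta>0 L' in simp)
      moreover have "\<bar>\<psi> y * (N * (cl u - cl v))\<bar> \<le> N * \<bar>u - v\<bar>"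
        unfolding abs_mult using mult_mono[OF \<psi>01(2)[of y] mult_left_mono[OF cl(3)[of u v] N]] \<psi>01(1)[of y] N by auto
      moreover have "F y u - F y v = \<theta> y * (f y (cl u) - f y (cl v)) - \<psi> y * (N * (cl u - cl v))" by (simp add: F_def algebra_simps)
      moreover have "L' * \<bar>u - v\<bar> + N * \<bar>u - v\<bar> \<le> BB * \<bar>u - v\<bar>" using BB(3) by (simp add: mult_right_mono flip: distrib_right)
      ultimately have "\<bar>F y u - F y v\<bar> \<le> BB * \<bar>u - v\<bar>" by linarith
      with 1 show ?thesis unfolding distrib_left by linarith
    qed
    obtain l where l: "cball 0 (R+4) \<subseteq> cbox (- l) (l :: real^'n)" using bounded_subset_cbox_symmetric[OF bounded_cball] by blast
    have out: "R + 4 \<le> norm x" "x \<notin> cball 0 (R+3)" if "x \<notin> cbox (-l) l" for x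
    proof -
      have "x \<notin> cball 0 (R+4)" using that l by blast
      then show "R + 4 \<le> norm x" "x \<notin> cball 0 (R+3)" by auto
    qed
    have "solvable \<alpha> T (cbox (-l) l) A' B'"
      by (rule linear_solvable[OF \<alpha> \<kappa>(1,2) \<Lambda>' T(1) coef']) (use \<theta>0[OF out(2)] in \<open>auto simp: A'_def B'_def\<close>)
    moreover have "F x u = 0" if "x \<notin> cbox (-l) l" for x u using \<theta>0[OF out(2)[OF that]] \<psi>0[of x] out(1)[OF that] by (simp add: F_def)
    ultimately obtain K u u1 u2 ut where sol: "solution \<alpha> T A' B' (\<lambda>x t. F x (u x t)) K u u1 u2 ut"
      using nonlinear_solvable[OF \<alpha> \<kappa>(1,2) \<Lambda>' T(1) coef' _ FB FH] by blast
    then have rg: "reg \<alpha> UNIV T K u u1 u2 ut" and eq: "\<And>x t. t \<in> {0..T} \<Longrightarrow> ut x t = A' x \<bullet> u2 x t + B' x \<bullet> u1 x t + F x (u x t)"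
      unfolding solution_def by auto
    note dr = regD(1)[OF rg] and uc = hol_continuous[OF regD(4)[OF rg] \<alpha>(1)]
    have ub: "\<bar>u x t\<bar> \<le> K" if "t \<in> {0..T}" for x t using holD(1)[OF regD(4)[OF rg] UNIV_I that] by simp
    have u0: "u x 0 = 0" for x by (rule regD(2)[OF rg UNIV_I])
    have A'sym: "transpose (A' x) = A' x" and A'b: "norm (A' x) \<le> \<Lambda>'" and B'b: "norm (B' x) \<le> \<Lambda>'" for x using coef' unfolding coef_def by blast+
    have \<psi>WM: "0 \<le> \<psi> x * (N * (M - W x))" for x using \<psi>01(1)[of x] \<psi>0[of x] M(2)[of x] N by (cases "norm x \<le> R + 4") auto
    \<comment> \<open>0 is a subsolution: where u < 0 the clamped value is 0, so f contributes
      nothing and the penalty pushes up towards W >= 0. The sign is written as a factor to fit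
      \<open>drv_scale\<close>.\<close>
    have pos: "- 1 * u x t \<le> 0" if t: "t \<in> {0..T}" for x t
    proof (rule maximum_principle_space[where a = A' and b = B' and \<Lambda> = \<Lambda>' and K = 0 and B = K, OF _ _ _ drv_scale[OF dr] A'sym coef_psd[OF coef' \<kappa>(1)] A'b B'b _ _ t])
      show "continuous_on (UNIV \<times> {0..T}) (\<lambda>(x, t). - 1 * u x t)" using uc unfolding case_prod_beta by (intro continuous_intros)
      show "- 1 * ut x t \<le> A' x \<bullet> (- 1) *\<^sub>R u2 x t + B' x \<bullet> (- 1) *\<^sub>R u1 x t + 0 * (- 1 * u x t)" if t: "t \<in> {0<..T}" and n: "0 < - 1 * u x t" for x t
      proof -
        have "cl (u x t) = 0" using n by (simp add: cl_def)
        then have "0 \<le> F x (u x t)" using f0[of x] \<psi>01(1)[of x] N W_nonneg[of x] by (simp add: F_def)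
        then show ?thesis using eq[of t x] t by simp
      qed
      show "- 1 * u x t \<le> K" if "t \<in> {0..T}" for x t using ub[OF that, of x] by simp
    qed (use u0 in auto)
    \<comment> \<open>M is a supersolution, by f(x,M) <= 0 and because W <= M wherever the penalty
      acts.\<close>
    have upper: "u x t - M \<le> 0" if t: "t \<in> {0..T}" for x t
    proof (rule maximum_principle_space[where a = A' and b = B' and \<Lambda> = \<Lambda>' and K = 0 and B = "K",
          OF _ _ _ drv_diff[OF dr drv_time[of T "\<lambda>_. M" "\<lambda>_. 0"]] A'sym coef_psd[OF coef' \<kappa>(1)] A'b B'b _ _ t])
      show "continuous_on (UNIV \<times> {0..T}) (\<lambda>(x, t). u x t - M)" using uc unfolding case_prod_beta by (intro continuous_intros)
      show "ut x t - 0 \<le> A' x \<bullet> (u2 x t - 0) + B' x \<bullet> (u1 x t - 0) + 0 * (u x t - M)" if t: "t \<in> {0<..T}" and n: "0 < u x t - M" for x t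
      proof -
        have "cl (u x t) = M" using n M(1) by (simp add: cl_def)
        moreover have "\<theta> x * f x M \<le> 0" using \<theta>(1)[of x] M(3)[of x] by (simp add: mult_nonneg_nonpos)
        ultimately have "F x (u x t) \<le> 0" using \<psi>WM[of x] by (simp add: F_def)
        then show ?thesis using eq[of t x] t by simp
      qed
      show "u x t - M \<le> K" if "t \<in> {0..T}" for x t using ub[OF that, of x] M(1) by simp
    qed (use u0 M in auto)
    have clu: "cl (u x t) = u x t" if "t \<in> {0..T}" for x t using pos[OF that, of x] upper[OF that, of x] by (simp add: cl_def)
    have eq': "ut x t = A x \<bullet> u2 x t + B x \<bullet> u1 x t + f x (u x t) - \<psi> x * (N * (u x t - W x))" if "norm x \<le> R + 2" "t \<in> {0..T}" for x t
      using eq[OF that(2), of x] \<theta>1[OF that(1)] clu[OF that(2), of x] by (simp add: A'_def B'_def F_def)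
    have Wc': "continuous_on (cball 0 (R+1+1) \<times> {0..T}) (\<lambda>(x,t). W x)"
      unfolding case_prod_beta by (intro continuous_on_compose2[OF Wc] continuous_intros) auto
    have uc': "continuous_on (cball 0 (R+1+1) \<times> {0..T}) (\<lambda>(x,t). u x t)" by (rule continuous_on_subset[OF uc]) auto
    have uc'': "continuous_on (cball 0 (R+1+1) \<times> {0..T'}) (\<lambda>(x,t). u x t)" by (rule continuous_on_subset[OF uc]) (use T(2) in auto)
    have Wc'': "continuous_on (cball 0 (R+1+1) \<times> {0..T'}) (\<lambda>(x,t). W x)" by (rule continuous_on_subset[OF Wc']) (use T(2) in auto)
    have \<phi>c: "continuous_on (cball 0 (R+1+1) \<times> {0..T'}) (\<lambda>(x::real^'n,t). \<phi> t)"
      unfolding case_prod_beta by (rule continuous_on_compose2[OF DERIV_continuous_on[OF \<phi>(3)]]) (auto intro!: continuous_intros)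
    have \<psi>1': "1 \<le> \<psi> x" if "R + 1 \<le> norm x" "norm x \<le> R + 1 + 1" for x using \<psi>1[OF that] by simp
    \<comment> \<open>Where u > W the penalty has the sign required by \<open>cmp\<close>. Both
      values lie in [0,M], so the difference of the reaction terms is absorbed by the Lipschitz
      constant L'.\<close>
    have up: "u x t - W x \<le> \<eta>" if x: "x \<in> cball 0 (R+1)" and t: "t \<in> {0..T}" for x t
    proof (rule cmp[OF order_refl order_refl \<psi>01(1) \<psi>1' _ _ _ drv_subset[OF drv_diff[OF dr Wd] subset_UNIV] _ x t])
      show "continuous_on (cball 0 (R + 1 + 1) \<times> {0..T}) (\<lambda>(x, t). u x t - W x)"
        using uc' Wc' unfolding case_prod_beta by (intro continuous_intros)
      show "u x 0 - W x \<le> 0" for x using u0 W_nonneg[of x] by simp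
      show "u x t - W x \<le> M" if "t \<in> {0..T}" for x t using upper[OF that, of x] W_nonneg[of x] by simp
      show "ut x t - 0 \<le> A x \<bullet> (u2 x t - W2 x) + B x \<bullet> (u1 x t - W1 x) + L' * (u x t - W x) - N * \<psi> x * (u x t - W x)"
        if x: "x \<in> ball 0 (R + 1 + 1)" and t: "t \<in> {0<..T}" and g: "0 < u x t - W x" for x t
      proof -
        have tt: "t \<in> {0..T}" and xx: "norm x \<le> R + 2" using t x by auto
        have "f x (u x t) - f x (W x) \<le> L' * (u x t - W x)"
          using L'(2)[of x x "u x t" "W x"] g xx pos[OF tt, of x] upper[OF tt, of x] M(2)[of x] W_nonneg[of x] by auto
        then show ?thesis using eq'[OF xx tt] stationary[of x] by (simp add: inner_diff_right algebra_simps)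
      qed
    qed
    \<comment> \<open>Since u >= 0, positivity of W - \<phi> - u forces \<phi> < W, the range in
      which the hypothesis on f and \<phi> is available. The increment of f is split at the
      intermediate value W - \<phi>.\<close>
    have low: "W x - \<phi> t - u x t \<le> \<eta>" if x: "x \<in> cball 0 (R+1)" and t: "t \<in> {0..T'}" for x t
    proof (rule cmp[OF order_refl T(2) \<psi>01(1) \<psi>1' _ _ _ drv_subset[OF drv_diff[OF drv_diff[OF Wd drv_time[OF \<phi>(3)]] drv_time_mono[OF dr T(2)]] subset_UNIV] _ x t])
      show "continuous_on (cball 0 (R + 1 + 1) \<times> {0..T'}) (\<lambda>(x, t). W x - \<phi> t - u x t)"
        using uc'' Wc'' \<phi>c unfolding case_prod_beta by (intro continuous_intros)
      show "W x - \<phi> 0 - u x 0 \<le> 0" if "x \<in> cball 0 (R + 1 + 1)" for x using u0[of x] \<phi>(1) M(2)[of x] that by simp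
      show "W x - \<phi> t - u x t \<le> M" if "x \<in> sphere 0 (R + 1 + 1)" "t \<in> {0..T'}" for x t using pos[of t x] \<phi>(2)[OF that(2)] M(2)[of x] that T(2) by simp
      show "0 - \<phi>' t - ut x t \<le> A x \<bullet> (W2 x - 0 - u2 x t) + B x \<bullet> (W1 x - 0 - u1 x t) + L' * (W x - \<phi> t - u x t) - N * \<psi> x * (W x - \<phi> t - u x t)"
        if x: "x \<in> ball 0 (R + 1 + 1)" and t: "t \<in> {0<..T'}" and g: "0 < W x - \<phi> t - u x t" for x t
      proof -
        have tt': "t \<in> {0..T'}" and tt: "t \<in> {0..T}" and xx: "norm x \<le> R + 2" using t x T(2) by auto
        have 1: "f x (W x) - f x (W x - \<phi> t) \<le> \<phi>' t" using \<phi>(4)[OF tt', of "W x" x] g pos[OF tt, of x] by simp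
        have 2: "f x (W x - \<phi> t) - f x (u x t) \<le> L' * (W x - \<phi> t - u x t)"
          using L'(2)[of x x "W x - \<phi> t" "u x t"] g xx pos[OF tt, of x] upper[OF tt, of x] M(2)[of x] \<phi>(2)[OF tt'] by auto
        \<comment> \<open>The penalty is centred at W rather than at W - \<phi>; as \<phi> >= 0,
          this only strengthens it in the required direction.\<close>
        have "N * \<psi> x * (W x - \<phi> t - u x t) \<le> N * \<psi> x * (W x - u x t)" using N \<psi>01(1)[of x] \<phi>(2)[OF tt'] by (intro mult_left_mono) auto
        then show ?thesis using 1 2 eq'[OF xx tt] stationary[of x] by (simp add: inner_diff_right algebra_simps)
      qed
    qed
    show ?thesis
    proof (intro exI conjI ballI)
      show "reg \<alpha> UNIV T K u u1 u2 ut" by (rule rg)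
      show "ut x t = A x \<bullet> u2 x t + B x \<bullet> u1 x t + f x (u x t)" if "x \<in> ball 0 R" "t \<in> {0..T}" for x t
        using eq'[of x t] \<psi>0[of x] that by simp
      show "0 \<le> u x t" "u x t \<le> W x + \<eta>" if "x \<in> cball 0 R" "t \<in> {0..T}" for x t
        using pos[OF that(2), of x] up[of x t] that by auto
      show "W x - \<phi> t - \<eta> \<le> u x t" if "x \<in> cball 0 R" "t \<in> {0..T'}" for x t
        using low[of x t] that by auto
    qed
  qed
qed

end

text \<open>With Q s the integral of 1 / (- g) over [c', s], put \<phi> t = Q^{-1} (Q M - t) and \<tau> = sup Q - Q c.\<close>

lemma descending_barrier:
  fixes g :: "real \<Rightarrow> real"
  assumes c: "c' < c" and cont: "continuous_on {c'..} g" and neg: "\<And>s. c' \<le> s \<Longrightarrow> g s < 0"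
    and negU: "\<And>s. U \<le> s \<Longrightarrow> g s < 0" and int: "(\<lambda>s. 1 / - g s) integrable_on {U..}"
  obtains \<tau> where "0 \<le> \<tau>" "\<And>M0. \<exists>M\<ge>M0. \<exists>\<phi>. \<phi> 0 = M \<and> \<phi> \<tau> \<le> c \<and>
    (\<forall>t\<in>{0..\<tau>}. (\<phi> has_real_derivative g (\<phi> t)) (at t within {0..\<tau>}) \<and> c' < \<phi> t)"
proof -
  define k where "k s = 1 / - g s" for s
  have k0: "0 < k s" if "c' \<le> s" for s using neg[OF that] by (simp add: k_def divide_neg_neg)
  have kc: "continuous_on {c'..b} k" for b unfolding k_def[abs_def]
    by (intro continuous_intros continuous_on_subset[OF cont]) (use neg in \<open>auto simp: less_imp_neq\<close>)
  have ki: "k integrable_on {c'..b}" for b by (rule integrable_continuous_real[OF kc])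
  define Q where "Q s = integral {c'..s} k" for s
  have QD: "(Q has_real_derivative k s) (at s)" if "c' < s" for s
    using integral_has_real_derivative[OF kc[of "s+1"], of s] that at_within_Icc_at[of c' s "s+1"] unfolding Q_def[abs_def] by auto
  have Qc: "continuous_on {c'..b} Q" for b unfolding Q_def[abs_def] by (rule indefinite_integral_continuous_1[OF ki])
  have Qm: "Q s < Q s'" if "c' \<le> s" "s < s'" for s s'
  proof (rule DERIV_pos_imp_increasing_open[OF that(2)])
    show "\<exists>y. DERIV Q x :> y \<and> 0 < y" if "s < x" "x < s'" for x
      using QD[of x] k0[of x] that \<open>c' \<le> s\<close> by (intro exI[of _ "k x"]) auto
    show "continuous_on {s..s'} Q" by (rule continuous_on_subset[OF Qc[of s']]) (use that in auto)
  qed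
  have Q0: "Q c' = 0" by (simp add: Q_def)
  define V where "V = max U c'"
  \<comment> \<open>Convergence of the integral at infinity bounds \<open>Q\<close>; comparison
    takes place from the larger of \<open>U\<close> and \<open>c'\<close> on, where both integrals
    are defined.\<close>
  have Qb: "Q s \<le> Q V + integral {U..} k" if "c' \<le> s" for s
  proof (cases "s \<le> V")
    case True
    have "0 \<le> integral {U..} k" by (rule integral_nonneg) (use int negU in \<open>auto simp: k_def[abs_def] divide_nonneg_neg less_imp_le intro!: divide_nonneg_nonneg\<close>)
    moreover have "Q s \<le> Q V" using Qm[of s V] True that by (cases "s = V") auto
    ultimately show ?thesis by linarith
  next
    case False
    have "Q V + integral {V..s} k = Q s" unfolding Q_def
      by (rule Henstock_Kurzweil_Integration.integral_combine) (use False ki in \<open>auto simp: V_def\<close>)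
    moreover have "integral {V..s} k \<le> integral {U..} k"
    proof (rule integral_subset_le)
      show "k integrable_on {V..s}" by (rule integrable_continuous_real[OF continuous_on_subset[OF kc[of s]]]) (auto simp: V_def)
    qed (use int negU in \<open>auto simp: k_def[abs_def] V_def less_imp_le\<close>)
    ultimately show ?thesis by linarith
  qed
  define a where "a = (SUP s\<in>{c'..}. Q s)"
  have bdd: "bdd_above (Q ` {c'..})" using Qb by (auto intro!: bdd_aboveI2)
  have Qa: "Q s \<le> a" if "c' \<le> s" for s unfolding a_def by (rule cSUP_upper[OF _ bdd]) (use that in auto)
  show thesis
  \<comment> \<open>The descent from M to c takes the time Q M - Q c, which is at most a - Q c for
    every M.\<close>
  proof (rule that[of "a - Q c"])
    show "0 \<le> a - Q c" using Qa[of c] c by simp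
    fix M0
    have "a - Q c < a" using Qm[of c' c] c Q0 by simp
    then obtain s where s: "c' \<le> s" "a - Q c < Q s" unfolding a_def using less_cSUP_iff[OF _ bdd] by auto
    define M where "M = max (max M0 c) s"
    have M: "M0 \<le> M" "c \<le> M" "s \<le> M" by (auto simp: M_def)
    have QM: "a - Q c < Q M" using s Qm[of s M] M(3) by (cases "s = M") auto
    \<comment> \<open>The interval extends one unit beyond M, so that Q M is an interior point of
      the range and the inverse has a two-sided derivative there.\<close>
    define R where "R = inv_into {c'..M+1} Q"
    have img: "Q ` {c'..M+1} = {0..Q (M+1)}"
    proof (intro equalityI subsetI)
      fix y assume "y \<in> {0..Q (M+1)}"
      then obtain x where "c' \<le> x" "x \<le> M+1" "Q x = y" using IVT'[of Q c' y "M+1"] Q0 c M(2) Qc[of "M+1"] by auto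
      then show "y \<in> Q ` {c'..M+1}" by auto
    next
      fix y assume "y \<in> Q ` {c'..M+1}"
      then obtain x where x: "c' \<le> x" "x \<le> M+1" "y = Q x" by auto
      then show "y \<in> {0..Q (M+1)}" using Qm[of c' x] Qm[of x "M+1"] Q0 by (cases "c' = x"; cases "x = M+1") auto
    qed
    have inj: "inj_on Q {c'..M+1}"
    proof (rule inj_onI)
      fix x y assume "x \<in> {c'..M+1}" "y \<in> {c'..M+1}" "Q x = Q y"
      then show "x = y" using Qm[of x y] Qm[of y x] by (cases x y rule: linorder_cases) auto
    qed
    have QR: "Q (R y) = y" "R y \<in> {c'..M+1}" if "y \<in> {0..Q (M+1)}" for y
      using that f_inv_into_f[of y Q "{c'..M+1}"] inv_into_into[of y Q "{c'..M+1}"] unfolding R_def img by auto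
    have RQ: "R (Q x) = x" if "x \<in> {c'..M+1}" for x unfolding R_def by (rule inv_into_f_f[OF inj that])
    have Rc: "continuous_on {0..Q (M+1)} R"
      using continuous_on_inv[OF Qc[of "M+1"] compact_Icc, of R] RQ unfolding img by auto
    have RD: "(R has_real_derivative - g (R y)) (at y)" and Rpos: "c' < R y" if y: "0 < y" "y < Q (M+1)" for y
    proof -
      have yy: "y \<in> {0..Q (M+1)}" using y by auto
      show pos: "c' < R y" using QR[OF yy] y(1) Q0 by (cases "R y = c'") auto
      have "DERIV R y :> inverse (k (R y))"
      proof (rule DERIV_inverse_function[OF _ _ y])
        show "DERIV Q (R y) :> k (R y)" by (rule QD[OF pos])
        show "k (R y) \<noteq> 0" using k0[of "R y"] pos by simp
        show "Q (R z) = z" if "0 < z" "z < Q (M+1)" for z using QR(1)[of z] that by simp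
        show "isCont R y" by (rule continuous_on_interior[OF Rc]) (use y in simp)
      qed
      then show "(R has_real_derivative - g (R y)) (at y)" by (simp add: k_def)
    qed
    have QM1: "Q M < Q (M+1)" using Qm[of M "M+1"] c M by simp
    show "\<exists>M\<ge>M0. \<exists>\<phi>. \<phi> 0 = M \<and> \<phi> (a - Q c) \<le> c \<and>
      (\<forall>t\<in>{0..a - Q c}. (\<phi> has_real_derivative g (\<phi> t)) (at t within {0..a - Q c}) \<and> c' < \<phi> t)"
    proof (intro exI[of _ M] exI[of _ "\<lambda>t. R (Q M - t)"] conjI ballI)
      show "R (Q M - 0) = M" using RQ[of M] c M by simp
      show "R (Q M - (a - Q c)) \<le> c"
      proof (rule ccontr)
        assume "\<not> R (Q M - (a - Q c)) \<le> c"
        moreover have "Q (R (Q M - (a - Q c))) = Q M - (a - Q c)" using QR(1)[of "Q M - (a - Q c)"] QM QM1 Qa[of c] c by simp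
        ultimately show False using Qm[of c "R (Q M - (a - Q c))"] Qa[of M] c M by simp
      qed
      fix t assume t: "t \<in> {0..a - Q c}"
      have y: "0 < Q M - t" "Q M - t < Q (M+1)" using t QM QM1 by auto
      show "c' < R (Q M - t)" by (rule Rpos[OF y])
      have "((\<lambda>t. R (Q M - t)) has_real_derivative - g (R (Q M - t)) * (- 1)) (at t within {0..a - Q c})"
        by (rule DERIV_chain2[where g = "\<lambda>t. Q M - t", OF RD[OF y]]) (auto intro!: derivative_eq_intros)
      then show "((\<lambda>t. R (Q M - t)) has_real_derivative g (R (Q M - t))) (at t within {0..a - Q c})" by simp
    qed (rule M(1))
  qed
qed

section \<open>Local bounds for the approximations and passage to the limit\<close>

lemma hol_time_mono: "hol \<alpha> S T K g \<Longrightarrow> T' \<le> T \<Longrightarrow> hol \<alpha> S T' K g"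
  unfolding hol_def by auto

lemma reg_time_mono: "reg \<alpha> S T K u u1 u2 ut \<Longrightarrow> T' \<le> T \<Longrightarrow> reg \<alpha> S T' K u u1 u2 ut"
  unfolding reg_def by (auto intro: drv_time_mono hol_time_mono)

lemma coef_mono:
  assumes c: "coef \<kappa> \<Lambda> \<alpha> S a b" and \<Lambda>: "\<Lambda> \<le> \<Lambda>'" and S: "S' \<subseteq> S"
  shows "coef \<kappa> \<Lambda>' \<alpha> S' a b"
proof -
  have m: "\<Lambda> * dist x y powr \<alpha> \<le> \<Lambda>' * dist x y powr \<alpha>" for x y :: "real^'n" using \<Lambda> by (intro mult_right_mono) auto
  show ?thesis using c S order_trans[OF _ \<Lambda>] order_trans[OF _ m] unfolding coef_def by (meson subsetD)
qed

context stationary_problem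
begin

lemma W_locally_bounded: "\<exists>w. \<forall>x\<in>cball 0 \<rho>. \<bar>W x\<bar> \<le> w"
proof -
  have "continuous_on (cball 0 \<rho>) W" by (intro continuous_at_imp_continuous_on ballI has_derivative_continuous[OF W1])
  from compact_imp_bounded[OF compact_continuous_image[OF this compact_cball]] show ?thesis unfolding bounded_iff by simp
qed

text \<open>On the unit ball around \<open>z\<close> the bound 0 <= u <= W + 1 and the local data
  determine the interior estimate. \<open>K\<close> is chosen before the approximation: neither its
  radius nor its regularity constant K' on the whole space enters.\<close>

lemma local_estimate:
  assumes T: "0 \<le> T"
  shows "\<exists>K\<ge>0. \<forall>k u u1 u2 ut T' K'. norm z + 1 \<le> k \<longrightarrow> T \<le> T' \<longrightarrow> reg \<alpha> UNIV T' K' u u1 u2 ut \<longrightarrow>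
    (\<forall>x\<in>ball 0 k. \<forall>t\<in>{0..T'}. ut x t = A x \<bullet> u2 x t + B x \<bullet> u1 x t + f x (u x t)) \<longrightarrow>
    (\<forall>x\<in>cball 0 k. \<forall>t\<in>{0..T'}. 0 \<le> u x t \<and> u x t \<le> W x + 1) \<longrightarrow> reg \<alpha> (ball z (1/8)) T K u u1 u2 ut"
proof -
  define \<rho> where "\<rho> = norm z + 1"
  have \<rho>: "0 \<le> \<rho>" by (simp add: \<rho>_def)
  have sub: "ball z 1 \<subseteq> ball 0 \<rho>"
  proof
    fix x assume "x \<in> ball z 1"
    then show "x \<in> ball 0 \<rho>" using norm_triangle_sub[of x z] by (simp add: \<rho>_def dist_norm norm_minus_commute)
  qed
  obtain \<kappa> \<Lambda>\<^sub>0 where \<kappa>: "0 < \<kappa>" "\<kappa> \<le> 1" "1 \<le> \<Lambda>\<^sub>0" and c0: "coef \<kappa> \<Lambda>\<^sub>0 \<alpha> (cball 0 \<rho>) A B" by (rule local_coef[OF \<rho>])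
  obtain w where w: "\<And>x. x \<in> cball 0 \<rho> \<Longrightarrow> \<bar>W x\<bar> \<le> w"
    using W_locally_bounded by blast
  have w0: "0 \<le> w" using order_trans[OF abs_ge_zero w[of 0]] \<rho> by simp
  obtain L0 where L0: "\<And>x y u v. norm x \<le> \<rho> + w + 1 \<Longrightarrow> norm y \<le> \<rho> + w + 1 \<Longrightarrow> 0 \<le> u \<Longrightarrow> u \<le> \<rho> + w + 1 \<Longrightarrow> 0 \<le> v \<Longrightarrow> v \<le> \<rho> + w + 1 \<Longrightarrow>
      \<bar>f x u - f y v\<bar> \<le> L0 * (dist x y + \<bar>u - v\<bar>)" using lipschitz unfolding loc_lip_f_def by blast
  define \<Lambda> where "\<Lambda> = max \<Lambda>\<^sub>0 L0"
  have \<Lambda>: "1 \<le> \<Lambda>" "\<Lambda>\<^sub>0 \<le> \<Lambda>" "L0 \<le> \<Lambda>" using \<kappa> by (auto simp: \<Lambda>_def)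
  have L: "\<bar>f x u - f y v\<bar> \<le> \<Lambda> * (dist x y + \<bar>u - v\<bar>)" if "x \<in> ball z 1" "y \<in> ball z 1" "0 \<le> u" "u \<le> w + 1" "0 \<le> v" "v \<le> w + 1" for x y u v
  proof -
    have "norm x \<le> \<rho>" "norm y \<le> \<rho>" using sub that by (auto simp: subset_iff)
    then have "\<bar>f x u - f y v\<bar> \<le> L0 * (dist x y + \<bar>u - v\<bar>)" using that w0 \<rho> by (intro L0) auto
    also have "\<dots> \<le> \<Lambda> * (dist x y + \<bar>u - v\<bar>)" using \<Lambda>(3) by (intro mult_right_mono) auto
    finally show ?thesis .
  qed
  \<comment> \<open>The term 2 \<Lambda> turns the Lipschitz dependence of f on x into a Hoelder
    bound on a ball of diameter 2; \<Lambda> (w + 1) bounds f itself, by f(x,0) = 0.\<close>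
  define A0 where "A0 = 2 * \<Lambda> + \<Lambda> * (w + 1)"
  have A0: "0 \<le> A0" "2 * \<Lambda> \<le> A0" "\<Lambda> * (w+1) \<le> A0" using \<Lambda> w0 by (auto simp: A0_def)
  show ?thesis
  proof (rule interior_estimate[OF \<alpha> \<kappa>(1,2) \<Lambda>(1), where 'n = 'n], goal_cases)
    case (1 C)
    note C = 1(1) and ie = 1(2)
    show ?thesis
    proof (intro exI[of _ "C * (w + 1 + A0)"] conjI allI impI)
      show "0 \<le> C * (w + 1 + A0)" using C w0 A0 by simp
      fix k :: real and u u1 u2 ut T' K'
      assume k: "norm z + 1 \<le> k" and TT: "T \<le> T'" and r': "reg \<alpha> UNIV T' K' u u1 u2 ut"
        and eq: "\<forall>x\<in>ball 0 k. \<forall>t\<in>{0..T'}. ut x t = A x \<bullet> u2 x t + B x \<bullet> u1 x t + f x (u x t)"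
        and bd: "\<forall>x\<in>cball 0 k. \<forall>t\<in>{0..T'}. 0 \<le> u x t \<and> u x t \<le> W x + 1"
      have r: "reg \<alpha> (ball z 1) T K' u u1 u2 ut" by (rule reg_subset[OF reg_time_mono[OF r' TT]]) simp
      have k0: "norm x < k" "norm x \<le> \<rho>" if "x \<in> ball z 1" for x using sub that k by (auto simp: subset_iff \<rho>_def dest: order_less_le_trans)
      have u: "0 \<le> u x t" "u x t \<le> w + 1" if "x \<in> ball z 1" "t \<in> {0..T}" for x t
        using bd[rule_format, of x t] k0[OF that(1)] w[of x] that(2) TT by auto
      show "reg \<alpha> (ball z (1/8)) T (C * (w + 1 + A0)) u u1 u2 ut"
      proof (rule ie[where a = A and b = B and h = "\<lambda>x t. f x (u x t)" and M = "w + 1"])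
        show "prob \<alpha> \<kappa> \<Lambda> (ball z 1) T A B (\<lambda>x t. f x (u x t)) (w + 1) A0 u u1 u2 ut"
          unfolding prob_def
        proof (intro conjI ballI)
          show "coef \<kappa> \<Lambda> \<alpha> (ball z 1) A B" by (rule coef_mono[OF c0 \<Lambda>(2)]) (use sub ball_subset_cball in blast)
          show "\<bar>f x (u x t) - f y (u y t)\<bar> \<le> A0 * dist x y powr \<alpha> + \<Lambda> * \<bar>u x t - u y t\<bar>"
            if x: "x \<in> ball z 1" "y \<in> ball z 1" and t: "t \<in> {0..T}" for x y t
          proof -
            have "dist x y \<le> 2" using x dist_triangle_less_add[of x z 1 y 1] by (simp add: dist_commute)
            then have "dist x y \<le> 2 * min 1 (dist x y)" by (auto simp: min_def)
            also have "\<dots> \<le> 2 * dist x y powr \<alpha>" using \<alpha> min_one_le_powr[of "dist x y" \<alpha>] by simp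
            finally have "\<Lambda> * dist x y \<le> \<Lambda> * (2 * dist x y powr \<alpha>)" using \<Lambda> by (intro mult_left_mono) auto
            also have "\<dots> \<le> A0 * dist x y powr \<alpha>" using mult_right_mono[OF A0(2), of "dist x y powr \<alpha>"] by simp
            finally show ?thesis using L[OF x u[OF x(1) t] u[OF x(2) t]] unfolding distrib_left by linarith
          qed
          show "\<bar>u x t\<bar> \<le> w + 1" if "x \<in> ball z 1" "t \<in> {0..T}" for x t using u[OF that] by simp
          show "ut x t = A x \<bullet> u2 x t + B x \<bullet> u1 x t + f x (u x t)" if "x \<in> ball z 1" "t \<in> {0..T}" for x t
            using eq k0[OF that(1)] that(2) TT by auto
        qed (use regD(1,2)[OF r] hol_continuous[OF regD(4)[OF r] \<alpha>(1)] in auto)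
        show "hx \<alpha> (ball z 1) T K' u2" by (rule hol_hx[OF regD(6)[OF r]])
        show "transpose (u2 x t) = u2 x t" if "x \<in> ball z 1" "t \<in> {0..T}" for x t by (rule regD(3)[OF r that])
        show "\<bar>f x (u x t)\<bar> \<le> A0" if x: "x \<in> ball z 1" "t \<in> {0..T}" for x t
        proof -
          have "\<bar>f x (u x t) - f x 0\<bar> \<le> \<Lambda> * (dist x x + \<bar>u x t - 0\<bar>)" using x u[OF x] w0 by (intro L) auto
          also have "\<dots> \<le> \<Lambda> * (w + 1)" using u[OF x] \<Lambda> by (intro mult_left_mono) auto
          finally show ?thesis using f0[of x] A0(3) by linarith
        qed
        show "\<bar>f x (u x t) - f x (u x s)\<bar> \<le> A0 * \<bar>t - s\<bar> powr (\<alpha>/2) + \<Lambda> * \<bar>u x t - u x s\<bar>"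
          if x: "x \<in> ball z 1" "t \<in> {0..T}" "s \<in> {0..T}" for x t s
          using L[OF x(1,1) u[OF x(1,2)] u[OF x(1,3)]] A0(1) by (simp add: add_increasing)
      qed (use w0 A0 in auto)
    qed
  qed
qed

text \<open>The k-th approximation is used on the ball of radius k up to time \<tau> + k, so every
  point (x,t) with t >= 0 is covered by all large k, and the time \<tau> by every k. The limit
  function is obtained from pointwise bounds; its regularity and the equation then follow on each
  small ball separately.\<close>

lemma limit_solution:
  assumes \<tau>: "0 \<le> \<tau>"
    and barrier: "\<And>M0. \<exists>M\<ge>M0. (\<forall>x. f x M \<le> 0) \<and> (\<exists>\<phi> \<phi>'. \<phi> 0 = M \<and> \<phi> \<tau> \<le> c \<and>
      (\<forall>t\<in>{0..\<tau>}. 0 \<le> \<phi> t \<and> (\<phi> has_real_derivative \<phi>' t) (at t within {0..\<tau>}) \<and>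
        (\<forall>x v. \<phi> t \<le> v \<longrightarrow> f x v - f x (v - \<phi> t) \<le> \<phi>' t)))"
  shows "\<exists>v v1 v2 vt. (\<forall>z T. 0 \<le> T \<longrightarrow> (\<exists>K. reg \<alpha> (ball z (1/8)) T K v v1 v2 vt)) \<and>
    (\<forall>x t. 0 \<le> t \<longrightarrow> 0 \<le> v x t \<and> vt x t = A x \<bullet> v2 x t + B x \<bullet> v1 x t + f x (v x t)) \<and> (\<forall>x. W x - c \<le> v x \<tau>)"
proof -
  define P where "P k s \<longleftrightarrow> (\<exists>K. reg \<alpha> UNIV (\<tau> + real k) K (fst s) (fst (snd s)) (fst (snd (snd s))) (snd (snd (snd s)))) \<and>
      (\<forall>x\<in>ball 0 (real k). \<forall>t\<in>{0..\<tau> + real k}. snd (snd (snd s)) x t = A x \<bullet> fst (snd (snd s)) x t + B x \<bullet> fst (snd s) x t + f x (fst s x t)) \<and>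
      (\<forall>x\<in>cball 0 (real k). \<forall>t\<in>{0..\<tau> + real k}. 0 \<le> fst s x t \<and> fst s x t \<le> W x + 1) \<and>
      (\<forall>x\<in>cball 0 (real k). W x - c - 1 / real (Suc k) \<le> fst s x \<tau>)"
    for k and s :: "(real^'n \<Rightarrow> real \<Rightarrow> real) \<times> (real^'n \<Rightarrow> real \<Rightarrow> real^'n) \<times> (real^'n \<Rightarrow> real \<Rightarrow> real^'n^'n) \<times> (real^'n \<Rightarrow> real \<Rightarrow> real)"
  have "\<exists>s. P k s" for k
  proof -
    obtain w where w: "\<And>x. x \<in> cball 0 (real k + 4) \<Longrightarrow> \<bar>W x\<bar> \<le> w"
      using W_locally_bounded by blast
    obtain M \<phi> \<phi>' where M: "max 0 w \<le> M" "\<And>x. f x M \<le> 0" and \<phi>: "\<phi> 0 = M" "\<phi> \<tau> \<le> c"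
      "\<And>t. t \<in> {0..\<tau>} \<Longrightarrow> 0 \<le> \<phi> t" "\<And>t. t \<in> {0..\<tau>} \<Longrightarrow> (\<phi> has_real_derivative \<phi>' t) (at t within {0..\<tau>})"
      "\<And>t x v. t \<in> {0..\<tau>} \<Longrightarrow> \<phi> t \<le> v \<Longrightarrow> f x v - f x (v - \<phi> t) \<le> \<phi>' t" using barrier[of "max 0 w"] by blast
    have WM: "W x \<le> M" if "norm x \<le> real k + 4" for x using w[of x] that M(1) by auto
    have "\<exists>K u u1 u2 ut. reg \<alpha> UNIV (\<tau> + real k) K u u1 u2 ut \<and>
      (\<forall>x\<in>ball 0 (real k). \<forall>t\<in>{0..\<tau> + real k}. ut x t = A x \<bullet> u2 x t + B x \<bullet> u1 x t + f x (u x t)) \<and>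
      (\<forall>x\<in>cball 0 (real k). \<forall>t\<in>{0..\<tau> + real k}. 0 \<le> u x t \<and> u x t \<le> W x + 1 / real (Suc k)) \<and>
      (\<forall>x\<in>cball 0 (real k). \<forall>t\<in>{0..\<tau>}. W x - \<phi> t - 1 / real (Suc k) \<le> u x t)"
      \<comment> \<open>Applied with R = k, final time \<tau> + k, barrier time \<tau> and error
        1/(k+1).\<close>
      by (rule approximant[OF _ _ _ _ _ WM M(2) \<phi>(1,3,4,5)]) (use \<tau> M in auto)
    then obtain K u u1 u2 ut where s: "reg \<alpha> UNIV (\<tau> + real k) K u u1 u2 ut"
      "\<forall>x\<in>ball 0 (real k). \<forall>t\<in>{0..\<tau> + real k}. ut x t = A x \<bullet> u2 x t + B x \<bullet> u1 x t + f x (u x t)"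
      "\<forall>x\<in>cball 0 (real k). \<forall>t\<in>{0..\<tau> + real k}. 0 \<le> u x t \<and> u x t \<le> W x + 1 / real (Suc k)"
      "\<forall>x\<in>cball 0 (real k). \<forall>t\<in>{0..\<tau>}. W x - \<phi> t - 1 / real (Suc k) \<le> u x t" by blast
    have 1: "1 / real (Suc k) \<le> 1" by simp
    have "u x t \<le> W x + 1" if "x \<in> cball 0 (real k)" "t \<in> {0..\<tau> + real k}" for x t using s(3)[rule_format, OF that] 1 by linarith
    moreover have "W x - c - 1 / real (Suc k) \<le> u x \<tau>" if "x \<in> cball 0 (real k)" for x using s(4)[rule_format, OF that, of \<tau>] \<phi>(2) \<tau> by simp
    ultimately show ?thesis unfolding P_def using s(1,2,3) by (intro exI[of _ "(u,u1,u2,ut)"]) auto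
  qed
  then obtain s where s: "\<And>k. P k (s k)" by metis
  define u where "u k = fst (s k)" for k
  define u1 where "u1 k = fst (snd (s k))" for k
  define u2 where "u2 k = fst (snd (snd (s k)))" for k
  define ut where "ut k = snd (snd (snd (s k)))" for k
  have ur: "\<exists>K. reg \<alpha> UNIV (\<tau> + real k) K (u k) (u1 k) (u2 k) (ut k)"
    and ue: "\<forall>x\<in>ball 0 (real k). \<forall>t\<in>{0..\<tau> + real k}. ut k x t = A x \<bullet> u2 k x t + B x \<bullet> u1 k x t + f x (u k x t)"
    and ub: "\<forall>x\<in>cball 0 (real k). \<forall>t\<in>{0..\<tau> + real k}. 0 \<le> u k x t \<and> u k x t \<le> W x + 1"
    and ul: "\<forall>x\<in>cball 0 (real k). W x - c - 1 / real (Suc k) \<le> u k x \<tau>" for k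
    using s[of k] unfolding P_def u_def u1_def u2_def ut_def by auto
  have large: "\<forall>\<^sub>F k in sequentially. b \<le> real k" for b
    using eventually_ge_at_top[of "nat \<lceil>b\<rceil>"] by eventually_elim linarith
  have loc: "\<exists>K\<ge>0. \<forall>\<^sub>F k in sequentially. reg \<alpha> (ball z (1/8)) T K (u k) (u1 k) (u2 k) (ut k)" if T: "0 \<le> T" for z T
  proof -
    obtain K where K: "0 \<le> K" and e: "\<And>k u u1 u2 ut T' K'. norm z + 1 \<le> k \<Longrightarrow> T \<le> T' \<Longrightarrow> reg \<alpha> UNIV T' K' u u1 u2 ut \<Longrightarrow>
      (\<forall>x\<in>ball 0 k. \<forall>t\<in>{0..T'}. ut x t = A x \<bullet> u2 x t + B x \<bullet> u1 x t + f x (u x t)) \<Longrightarrow>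
      (\<forall>x\<in>cball 0 k. \<forall>t\<in>{0..T'}. 0 \<le> u x t \<and> u x t \<le> W x + 1) \<Longrightarrow> reg \<alpha> (ball z (1/8)) T K u u1 u2 ut"
      using local_estimate[OF T, of z] by blast
    have "\<forall>\<^sub>F k in sequentially. reg \<alpha> (ball z (1/8)) T K (u k) (u1 k) (u2 k) (ut k)"
      using large[of "norm z + 1 + T"]
    proof eventually_elim
      case (elim k)
      obtain K' where "reg \<alpha> UNIV (\<tau> + real k) K' (u k) (u1 k) (u2 k) (ut k)" using ur by blast
      from e[OF _ _ this ue ub] elim T \<tau> show ?case using norm_ge_zero[of z] by linarith
    qed
    then show ?thesis using K by blast
  qed
  show ?thesis
  proof (rule pointwise_compactness_quadruple[of "\<lambda>x t. 0 \<le> t" u u1 u2 ut], goal_cases)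
    case (1 x t)
    then obtain K where "\<forall>\<^sub>F k in sequentially. reg \<alpha> (ball x (1/8)) t K (u k) (u1 k) (u2 k) (ut k)" using loc by blast
    then have "\<forall>\<^sub>F k in sequentially. norm (u k x t) \<le> K \<and> norm (u1 k x t) \<le> K \<and> norm (u2 k x t) \<le> K \<and> norm (ut k x t) \<le> K"
    proof eventually_elim
      case (elim k)
      have p: "x \<in> ball x (1/8)" "t \<in> {0..t}" using 1 by auto
      show ?case using holD(1)[OF regD(4)[OF elim] p] holD(1)[OF regD(5)[OF elim] p] holD(1)[OF regD(6)[OF elim] p] holD(1)[OF regD(7)[OF elim] p] by blast
    qed
    then show ?case by blast
  next
    case (2 F v v1 v2 vt)
    note F = 2(1,2) and l0 = 2(3) and l1 = 2(4) and l2 = 2(5) and lt = 2(6)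
    have ev: "\<forall>\<^sub>F k in F. Q k" if "\<forall>\<^sub>F k in sequentially. Q k" for Q using filter_leD[OF F(2) that] .
    have bd: "\<forall>\<^sub>F k in F. 0 \<le> u k x t \<and> u k x t \<le> W x + 1 \<and> ut k x t = A x \<bullet> u2 k x t + B x \<bullet> u1 k x t + f x (u k x t)" if t: "0 \<le> t" for x t
      using ev[OF large[of "norm x + 1 + t"]]
    proof eventually_elim
      case (elim k)
      then have "x \<in> ball 0 (real k)" "x \<in> cball 0 (real k)" "t \<in> {0..\<tau> + real k}" using t \<tau> norm_ge_zero[of x] by (auto simp del: norm_ge_zero)
      then show ?case using ue[of k] ub[of k] by blast
    qed
    have v0: "0 \<le> v x t" "v x t \<le> W x + 1" if "0 \<le> t" for x t
      using tendsto_lowerbound[OF l0[OF that, of x] _ F(1), of 0] tendsto_upperbound[OF l0[OF that, of x] _ F(1), of "W x + 1"]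
        eventually_mono[OF bd[OF that, of x]] by auto
    have R: "\<exists>K. reg \<alpha> (ball z (1/8)) T K v v1 v2 vt" if T: "0 \<le> T" for z T
    proof -
      obtain K where K: "0 \<le> K" "\<forall>\<^sub>F k in sequentially. reg \<alpha> (ball z (1/8)) T K (u k) (u1 k) (u2 k) (ut k)" using loc[OF T] by blast
      have "reg \<alpha> (ball z (1/8)) T K v v1 v2 vt"
        by (rule reg_limit[OF F(1) open_ball \<alpha>(1) K(1) ev[OF K(2)] l0 l1 l2 lt T]) auto
      then show ?thesis by blast
    qed
    have E: "vt x t = A x \<bullet> v2 x t + B x \<bullet> v1 x t + f x (v x t)" if t: "0 \<le> t" for x t
    proof -
      let ?b = "norm x + W x + 1"
      \<comment> \<open>A box containing \<open>x\<close> and the values of both the approximations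
        and the limit at (x,t); on it f is Lipschitz, which carries the reaction term to the
        limit.\<close>
      obtain L where L: "\<And>x' y u v. norm x' \<le> ?b \<Longrightarrow> norm y \<le> ?b \<Longrightarrow> 0 \<le> u \<Longrightarrow> u \<le> ?b \<Longrightarrow> 0 \<le> v \<Longrightarrow> v \<le> ?b \<Longrightarrow>
        \<bar>f x' u - f y v\<bar> \<le> L * (dist x' y + \<bar>u - v\<bar>)" using lipschitz unfolding loc_lip_f_def by blast
      have "((\<lambda>k. L * \<bar>u k x t - v x t\<bar>) \<longlongrightarrow> L * \<bar>v x t - v x t\<bar>) F" by (intro tendsto_intros l0[OF t])
      then have z: "((\<lambda>k. L * \<bar>u k x t - v x t\<bar>) \<longlongrightarrow> 0) F" by simp
      have "((\<lambda>k. f x (u k x t) - f x (v x t)) \<longlongrightarrow> 0) F"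
      proof (rule Lim_null_comparison[OF _ z])
        show "\<forall>\<^sub>F k in F. norm (f x (u k x t) - f x (v x t)) \<le> L * \<bar>u k x t - v x t\<bar>"
          using bd[OF t, of x]
        proof eventually_elim
          case (elim k)
          then have "u k x t \<le> ?b" "v x t \<le> ?b" "norm x \<le> ?b" using v0(2)[OF t, of x] norm_ge_zero[of x] W_nonneg[of x] by linarith+
          then show ?case using L[of x x "u k x t" "v x t"] elim v0(1)[OF t, of x] by simp
        qed
      qed
      from LIM_zero_cancel[OF this] have lf: "((\<lambda>k. f x (u k x t)) \<longlongrightarrow> f x (v x t)) F" .
      have "((\<lambda>k. A x \<bullet> u2 k x t + B x \<bullet> u1 k x t + f x (u k x t)) \<longlongrightarrow> A x \<bullet> v2 x t + B x \<bullet> v1 x t + f x (v x t)) F"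
        by (intro tendsto_intros l1[OF t] l2[OF t] lf)
      moreover have "\<forall>\<^sub>F k in F. A x \<bullet> u2 k x t + B x \<bullet> u1 k x t + f x (u k x t) = ut k x t"
        using bd[OF t, of x] by eventually_elim simp
      ultimately have "((\<lambda>k. ut k x t) \<longlongrightarrow> A x \<bullet> v2 x t + B x \<bullet> v1 x t + f x (v x t)) F"
        by (rule Lim_transform_eventually)
      from tendsto_unique[OF F(1) lt[OF t] this] show ?thesis .
    qed
    have Wv: "W x - c \<le> v x \<tau>" for x
    proof (rule tendsto_le[OF F(1) l0[OF \<tau>]])
      have "(\<lambda>k. W x - c - 1 / real (Suc k)) \<longlonglongrightarrow> W x - c - 0"
        by (intro tendsto_diff tendsto_const LIMSEQ_Suc[OF lim_1_over_n])
      then show "((\<lambda>k. W x - c - 1 / real (Suc k)) \<longlongrightarrow> W x - c) F" using tendsto_mono[OF F(2)] by simp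
      show "\<forall>\<^sub>F k in F. W x - c - 1 / real (Suc k) \<le> u k x \<tau>"
        using ev[OF large[of "norm x"]] by eventually_elim (use ul in auto)
    qed
    show ?thesis using R E v0(1) Wv by blast
  qed
qed

end

section \<open>Partial derivatives and classical solutions\<close>

lemma pd_has_derivative:
  assumes "(g has_derivative (\<lambda>h. d \<bullet> h)) (at x)"
  shows "has_pd i g x" "pd i g x = d $ i"
proof -
  have "((\<lambda>s. g (x + s *\<^sub>R axis i 1)) has_vector_derivative d \<bullet> axis i 1) (at 0)"
    by (rule has_derivative_line) (use assms in simp)
  then have D: "((\<lambda>s. g (x + s *\<^sub>R axis i 1)) has_real_derivative d $ i) (at 0)"
    by (simp add: has_real_derivative_iff_has_vector_derivative inner_axis)
  from D show "has_pd i g x" unfolding has_pd_def real_differentiable_def by blast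
  from D show "pd i g x = d $ i" unfolding pd_def by (rule DERIV_imp_deriv)
qed

lemma pd_line_derivative:
  assumes "\<And>x. has_pd i g x"
  shows "((\<lambda>s. g (y + s *\<^sub>R axis i 1)) has_real_derivative pd i g (y + s *\<^sub>R axis i 1)) (at s)"
proof -
  have "((\<lambda>r. g ((y + s *\<^sub>R axis i 1) + r *\<^sub>R axis i 1)) has_real_derivative pd i g (y + s *\<^sub>R axis i 1)) (at 0)"
    using assms unfolding has_pd_def pd_def DERIV_deriv_iff_real_differentiable by blast
  then have "((\<lambda>r. g (y + (r + s) *\<^sub>R axis i 1)) has_real_derivative pd i g (y + s *\<^sub>R axis i 1)) (at 0)"
    by (simp add: algebra_simps)
  then show ?thesis using DERIV_shift[of "\<lambda>s. g (y + s *\<^sub>R axis i 1)" _ 0 s] by simp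
qed

text \<open>The coordinates are changed one at a time, by induction over the set of those already
  changed; each change costs at most e / n times the norm of the increment. It connects smoothness
  given by partial derivatives with the Frechet derivatives used so far.\<close>

lemma continuous_partials_has_derivative:
  fixes g :: "real^'n \<Rightarrow> real"
  assumes D: "\<And>i x. has_pd i g x" and C: "\<And>i. continuous_on UNIV (pd i g)"
  shows "(g has_derivative (\<lambda>h. (\<chi> i. pd i g x) \<bullet> h)) (at x)"
  unfolding has_derivative_at_alt
proof (intro conjI allI impI)
  show "bounded_linear (\<lambda>h. (\<chi> i. pd i g x) \<bullet> h)" by (rule bounded_linear_inner_right)
  fix e :: real assume e: "0 < e"
  define \<epsilon> where "\<epsilon> = e / real CARD('n)"
  have \<epsilon>: "0 < \<epsilon>" using e by (simp add: \<epsilon>_def)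
  have "\<exists>d>0. \<forall>z. dist z x < d \<longrightarrow> \<bar>pd i g z - pd i g x\<bar> < \<epsilon>" for i
    using C[of i] \<epsilon> unfolding continuous_on_iff dist_real_def by auto
  then obtain d where d: "\<And>i. 0 < d i" "\<And>i z. dist z x < d i \<Longrightarrow> \<bar>pd i g z - pd i g x\<bar> < \<epsilon>" by metis
  define \<delta> where "\<delta> = Min (range d)"
  have \<delta>: "0 < \<delta>" "\<delta> \<le> d i" for i using d(1) by (auto simp: \<delta>_def)
  have "\<bar>g y - g x - (\<chi> i. pd i g x) \<bullet> (y - x)\<bar> \<le> e * norm (y - x)" if y: "norm (y - x) < \<delta>" for y
  proof -
    define h where "h = y - x"
    define p where "p I = (\<chi> j. if j \<in> I then h $ j else 0)" for I
    have "\<bar>g (x + p I) - g x - (\<Sum>i\<in>I. pd i g x * h $ i)\<bar> \<le> real (card I) * (\<epsilon> * norm h)" for I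
    proof (induction I rule: finite_induct[OF finite])
      case 1
      have "p {} = 0" by (simp add: p_def vec_eq_iff)
      then show ?case by simp
    next
      case (2 i I)
      let ?l = "\<lambda>s. x + p I + s *\<^sub>R axis i 1"
      let ?S = "{- \<bar>h $ i\<bar>..\<bar>h $ i\<bar>}"
      have "norm ((g (?l (h $ i)) - h $ i * pd i g x) - (g (?l 0) - 0 * pd i g x)) \<le> \<epsilon> * norm (h $ i - 0)"
      proof (rule field_differentiable_bound[where S = ?S])
        show "((\<lambda>s. g (?l s) - s * pd i g x) has_real_derivative pd i g (?l s) - pd i g x) (at s within ?S)" for s
        proof (rule has_field_derivative_at_within)
          show "((\<lambda>s. g (?l s) - s * pd i g x) has_real_derivative pd i g (?l s) - pd i g x) (at s)"
            by (rule DERIV_diff[OF pd_line_derivative[OF D]]) (auto intro!: derivative_eq_intros)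
        qed
        show "norm (pd i g (?l s) - pd i g x) \<le> \<epsilon>" if "s \<in> ?S" for s
        proof -
          have "norm (p I + s *\<^sub>R axis i 1) \<le> norm h"
            by (rule norm_le_componentwise_cart) (use that 2 in \<open>auto simp: p_def axis_def\<close>)
          then have "dist (?l s) x < d i" using y \<delta>(2)[of i] by (simp add: dist_norm h_def add.assoc)
          from d(2)[OF this] show ?thesis by simp
        qed
      qed auto
      moreover have "x + p (insert i I) = ?l (h $ i)" using 2 by (auto simp: p_def vec_eq_iff axis_def)
      moreover have "\<epsilon> * \<bar>h $ i\<bar> \<le> \<epsilon> * norm h" using component_le_norm_cart[of h i] \<epsilon> by (intro mult_left_mono) auto
      moreover have "real (card (insert i I)) * (\<epsilon> * norm h) = real (card I) * (\<epsilon> * norm h) + \<epsilon> * norm h"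
        using 2 by (simp add: algebra_simps)
      ultimately show ?case using 2 by (simp add: algebra_simps)
    qed
    from this[of UNIV] have "\<bar>g (x + p UNIV) - g x - (\<Sum>i\<in>UNIV. pd i g x * h $ i)\<bar> \<le> e * norm h" by (simp add: \<epsilon>_def)
    moreover have "p UNIV = h" by (simp add: p_def vec_eq_iff)
    ultimately show ?thesis by (simp add: h_def inner_vec_def)
  qed
  then show "\<exists>\<delta>>0. \<forall>y. norm (y - x) < \<delta> \<longrightarrow> norm (g y - g x - (\<chi> i. pd i g x) \<bullet> (y - x)) \<le> e * norm (y - x)"
    using \<delta>(1) by (intro exI[of _ \<delta>]) auto
qed

text \<open>The symmetry of the Hessian is Schwarz's theorem: a second difference does not depend on
  the order of its two directions, and the mean value form evaluates it in either order at points
  close to \<open>x\<close>.\<close>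

lemma C2_derivatives:
  fixes W :: "real^'n \<Rightarrow> real"
  assumes "C2 W"
  shows "(W has_derivative (\<lambda>h. (\<chi> i. pd i W x) \<bullet> h)) (at x)"
    "((\<lambda>x. \<chi> i. pd i W x) has_derivative (\<lambda>h. (\<chi> i j. pd j (pd i W) x) *v h)) (at x)"
    "pd j (pd i W) x = pd i (pd j W) x"
proof -
  have c: "\<And>i x. has_pd i W x" "\<And>i. continuous_on UNIV (pd i W)" "\<And>i j x. has_pd j (pd i W) x" "\<And>i j. continuous_on UNIV (pd j (pd i W))"
    using assms unfolding C2_def by blast+
  show 1: "(W has_derivative (\<lambda>h. (\<chi> i. pd i W x) \<bullet> h)) (at x)" for x
    by (rule continuous_partials_has_derivative[OF c(1,2)])
  show 2: "((\<lambda>x. \<chi> i. pd i W x) has_derivative (\<lambda>h. (\<chi> i j. pd j (pd i W) x) *v h)) (at x)" for x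
  proof (rule has_derivative_vecI)
    show "((\<lambda>x. (\<chi> i. pd i W x) $ i) has_derivative (\<lambda>h. ((\<chi> i j. pd j (pd i W) x) *v h) $ i)) (at x)" for i
      using continuous_partials_has_derivative[OF c(3,4), of i x] by (simp add: matrix_vector_mult_def inner_vec_def)
  qed
  let ?H = "\<lambda>i j x. pd j (pd i W) x"
  have comp: "axis i 1 \<bullet> ((\<chi> i j. ?H i j x) *v axis j 1) = ?H i j x" for i j x
    by (simp add: matrix_vector_mult_basis column_def inner_axis' )
  have "\<bar>?H i j x - ?H j i x\<bar> \<le> 2 * e" if e: "0 < e" for e
  proof -
    obtain d where d: "0 < d" "\<And>z. dist z x < d \<Longrightarrow> \<bar>?H i j z - ?H i j x\<bar> < e"
      using c(4)[of j i] e unfolding continuous_on_iff dist_real_def by fastforce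
    obtain d' where d': "0 < d'" "\<And>z. dist z x < d' \<Longrightarrow> \<bar>?H j i z - ?H j i x\<bar> < e"
      using c(4)[of i j] e unfolding continuous_on_iff dist_real_def by fastforce
    \<comment> \<open>Points of the parallelogram with sides \<open>p\<close> and \<open>q\<close>
      lie within 2 s of \<open>x\<close>, hence inside both continuity radii.\<close>
    define s where "s = min d d' / 3"
    have s: "0 < s" "2 * s < d" "2 * s < d'" using d(1) d'(1) by (auto simp: s_def)
    define p q where "p = s *\<^sub>R (axis i 1 :: real^'n)" and "q = s *\<^sub>R (axis j 1 :: real^'n)"
    have near: "dist (x + r *\<^sub>R p' + r' *\<^sub>R q') x \<le> 2 * s" if "r \<in> {0..1}" "r' \<in> {0..1}" "norm p' = s" "norm q' = s" for r r' and p' q' :: "real^'n"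
    proof -
      have "dist (x + r *\<^sub>R p' + r' *\<^sub>R q') x \<le> r * s + r' * s"
        using norm_triangle_ineq[of "r *\<^sub>R p'" "r' *\<^sub>R q'"] that by (simp add: dist_norm add.assoc)
      also have "\<dots> \<le> 1 * s + 1 * s" using that s by (intro add_mono mult_right_mono) auto
      finally show ?thesis by simp
    qed
    have n: "norm p = s" "norm q = s" using s by (auto simp: p_def q_def)
    obtain r r' where r: "r \<in> {0..1}" "r' \<in> {0..1}"
      "W (x + p + q) - W (x + p) - W (x + q) + W x = p \<bullet> ((\<chi> i j. ?H i j (x + r *\<^sub>R p + r' *\<^sub>R q)) *v q)"
      by (rule second_difference_mvt[of UNIV W "\<lambda>x. \<chi> i. pd i W x" "\<lambda>x. \<chi> i j. ?H i j x" x p q, OF 1 2]) auto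
    obtain \<rho> \<rho>' where \<rho>: "\<rho> \<in> {0..1}" "\<rho>' \<in> {0..1}"
      "W (x + q + p) - W (x + q) - W (x + p) + W x = q \<bullet> ((\<chi> i j. ?H i j (x + \<rho> *\<^sub>R q + \<rho>' *\<^sub>R p)) *v p)"
      by (rule second_difference_mvt[of UNIV W "\<lambda>x. \<chi> i. pd i W x" "\<lambda>x. \<chi> i j. ?H i j x" x q p, OF 1 2]) auto
    have e: "W (x + q + p) - W (x + q) - W (x + p) + W x = W (x + p + q) - W (x + p) - W (x + q) + W x" by (simp add: add_ac)
    have "p \<bullet> ((\<chi> i j. ?H i j (x + r *\<^sub>R p + r' *\<^sub>R q)) *v q) = q \<bullet> ((\<chi> i j. ?H i j (x + \<rho> *\<^sub>R q + \<rho>' *\<^sub>R p)) *v p)"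
      unfolding r(3)[symmetric] \<rho>(3)[symmetric] e ..
    then have "s * (s * ?H i j (x + r *\<^sub>R p + r' *\<^sub>R q)) = s * (s * ?H j i (x + \<rho> *\<^sub>R q + \<rho>' *\<^sub>R p))"
      unfolding p_def q_def by (simp only: matrix_vector_mult_scaleR inner_scaleR_left inner_scaleR_right comp)
    then have "?H i j (x + r *\<^sub>R p + r' *\<^sub>R q) = ?H j i (x + \<rho> *\<^sub>R q + \<rho>' *\<^sub>R p)" using s by simp
    moreover have "\<bar>?H i j (x + r *\<^sub>R p + r' *\<^sub>R q) - ?H i j x\<bar> < e" by (rule d(2)) (use near[OF r(1,2) n] s in linarith)
    moreover have "\<bar>?H j i (x + \<rho> *\<^sub>R q + \<rho>' *\<^sub>R p) - ?H j i x\<bar> < e" by (rule d'(2)) (use near[OF \<rho>(1,2) n(2,1)] s in linarith)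
    ultimately show ?thesis by linarith
  qed
  from this[of "\<bar>?H i j x - ?H j i x\<bar> / 4"] show "?H i j x = ?H j i x" by (cases "?H i j x = ?H j i x") auto
qed

text \<open>The coefficients a_ij need not be symmetric, but a symmetric Hessian pairs only with
  their symmetric part; this reduces the operator to the form required by the maximum
  principle.\<close>

lemma Lop_eq_inner:
  assumes "\<And>i j. pd i (pd j w) x = H $ i $ j" "\<And>i j. H $ i $ j = H $ j $ i" "\<And>i. pd i w x = d $ i"
  shows "Lop a b w x = (\<chi> i j. (a i j x + a j i x) / 2) \<bullet> H + (\<chi> i. b i x) \<bullet> d"
proof -
  have "(\<Sum>i\<in>UNIV. \<Sum>j\<in>UNIV. a j i x * H $ i $ j) = (\<Sum>i\<in>UNIV. \<Sum>j\<in>UNIV. a i j x * H $ i $ j)"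
    by (subst sum.swap) (simp add: assms(2))
  moreover have "(\<Sum>i\<in>UNIV. \<Sum>j\<in>UNIV. a i j x * pd i (pd j w) x) = (\<Sum>i\<in>UNIV. \<Sum>j\<in>UNIV. a i j x * H $ i $ j)"
    by (intro sum.cong refl) (metis assms(1,2))
  ultimately show ?thesis
    unfolding Lop_def inner_vec_def by (simp add: assms(3) add_divide_distrib distrib_right sum.distrib flip: sum_divide_distrib)
qed

lemma locally_hoelder_continuous:
  fixes g :: "real^'n \<Rightarrow> real \<Rightarrow> 'b::real_normed_vector"
  assumes h: "\<And>z T. 0 \<le> T \<Longrightarrow> \<exists>K. hol \<alpha> (ball z (1/8)) T K g" and \<alpha>: "0 < \<alpha>"
  shows "continuous_on (UNIV \<times> {0..}) (\<lambda>(x,t). g x t)"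
  unfolding continuous_on_eq_continuous_within
proof
  fix p :: "(real^'n) \<times> real" assume p: "p \<in> UNIV \<times> {0..}"
  obtain x t where pt: "p = (x,t)" by (cases p)
  have t: "0 \<le> t" using p pt by simp
  obtain K where "hol \<alpha> (ball x (1/8)) (t+1) K g" using h[of "t+1" x] t by auto
  from hol_continuous[OF this \<alpha>] have "continuous (at p within ball x (1/8) \<times> {0..t+1}) (\<lambda>(x,t). g x t)"
    using t pt unfolding continuous_on_eq_continuous_within by auto
  moreover have "at p within ball x (1/8) \<times> {0..t+1} = at p within UNIV \<times> {0..}"
    by (rule at_within_nhd[where S = "ball x (1/8) \<times> {..<t+1}"]) (use t pt in \<open>auto intro: open_Times\<close>)
  ultimately show "continuous (at p within UNIV \<times> {0..}) (\<lambda>(x,t). g x t)" by simp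
qed

text \<open>Regularity on small balls and bounded time intervals translates into partial derivatives
  and joint continuity. Working up to time t + 1 makes \<open>t\<close> an interior point, so that
  one-sided time derivatives become ordinary ones.\<close>

lemma locally_regular:
  fixes v :: "real^'n \<Rightarrow> real \<Rightarrow> real"
  assumes R: "\<And>z T. 0 \<le> T \<Longrightarrow> \<exists>K. reg \<alpha> (ball z (1/8)) T K v v1 v2 vt" and \<alpha>: "0 < \<alpha>"
  shows "C21 v" and "v x 0 = 0" and "0 \<le> t \<Longrightarrow> v2 x t $ i $ j = v2 x t $ j $ i"
    and "0 < t \<Longrightarrow> deriv (v x) t = vt x t" and "0 < t \<Longrightarrow> pd i (\<lambda>y. v y t) x = v1 x t $ i"
    and "0 < t \<Longrightarrow> pd j (pd i (\<lambda>y. v y t)) x = v2 x t $ i $ j"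
proof -
  have r: "\<exists>K. reg \<alpha> (ball x (1/8)) T K v v1 v2 vt \<and> x \<in> ball x (1/8)" if "0 \<le> T" for x T using R[OF that, of x] by simp
  have d1: "((\<lambda>y. v y t) has_derivative (\<lambda>h. v1 x t \<bullet> h)) (at x)" and d2: "((\<lambda>y. v1 y t) has_derivative (\<lambda>h. v2 x t *v h)) (at x)"
    and sym: "transpose (v2 x t) = v2 x t" if t: "0 \<le> t" for x t
  proof -
    obtain K where K: "reg \<alpha> (ball x (1/8)) t K v v1 v2 vt" "x \<in> ball x (1/8)" "t \<in> {0..t}" using r[OF t, of x] t by auto
    show "((\<lambda>y. v y t) has_derivative (\<lambda>h. v1 x t \<bullet> h)) (at x)" "((\<lambda>y. v1 y t) has_derivative (\<lambda>h. v2 x t *v h)) (at x)"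
      "transpose (v2 x t) = v2 x t" using drvD(1,2)[OF regD(1)[OF K(1)] K(2,3)] regD(3)[OF K] by auto
  qed
  have dt: "(v x has_real_derivative vt x t) (at t)" if t: "0 < t" for x t
  proof -
    obtain K where K: "reg \<alpha> (ball x (1/8)) (t+1) K v v1 v2 vt" "x \<in> ball x (1/8)" using r[of "t+1" x] t by auto
    show ?thesis using drvD(3)[OF regD(1)[OF K(1)] K(2), of t] t at_within_Icc_at[of 0 t "t+1"] by simp
  qed
  show "v x 0 = 0" using r[of 0 x] regD(2) by blast
  show "0 \<le> t \<Longrightarrow> v2 x t $ i $ j = v2 x t $ j $ i" for t i j using sym[of t x] by (metis transpose_def vec_lambda_beta)
  show D: "deriv (v x) t = vt x t" if "0 < t" for x t by (rule DERIV_imp_deriv[OF dt[OF that]])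
  show P1: "pd i (\<lambda>y. v y t) x = v1 x t $ i" if "0 < t" for x t i using pd_has_derivative(2)[OF d1] that by simp
  have P1': "pd i (\<lambda>y. v y t) = (\<lambda>x. v1 x t $ i)" if "0 < t" for t i using P1[OF that] by auto
  have d2i: "((\<lambda>y. v1 y t $ i) has_derivative (\<lambda>h. (v2 x t $ i) \<bullet> h)) (at x)" if "0 \<le> t" for x t i
    using bounded_linear.has_derivative[OF bounded_linear_vec_nth d2[OF that], of i] by (simp add: matrix_vector_mult_def inner_vec_def)
  show P2: "pd j (pd i (\<lambda>y. v y t)) x = v2 x t $ i $ j" if "0 < t" for x t i j
    unfolding P1'[OF that] using pd_has_derivative(2)[OF d2i] that by simp
  have c: "continuous_on (UNIV \<times> {0..}) (\<lambda>(x,t). v x t)" "continuous_on (UNIV \<times> {0..}) (\<lambda>(x,t). v1 x t)"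
    "continuous_on (UNIV \<times> {0..}) (\<lambda>(x,t). v2 x t)" "continuous_on (UNIV \<times> {0..}) (\<lambda>(x,t). vt x t)"
    by (rule locally_hoelder_continuous[OF _ \<alpha>]; use R in \<open>blast dest: regD(4-7)\<close>)+
  have pos: "continuous_on (UNIV \<times> {0<..}) h" if "continuous_on (UNIV \<times> {0..}) h" for h :: "(real^'n) \<times> real \<Rightarrow> 'z::topological_space"
    by (rule continuous_on_subset[OF that]) auto
  show "C21 v"
    unfolding C21_def
  proof (intro conjI allI impI)
    show "continuous_on (UNIV \<times> {0..}) (\<lambda>(x,t). v x t)" by (rule c)
    show "v x differentiable at t" if "0 < t" for x t using dt[OF that] unfolding real_differentiable_def by blast
    show "continuous_on (UNIV \<times> {0<..}) (\<lambda>(x,t). deriv (v x) t)"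
      using pos[OF c(4)] by (rule continuous_on_cong[THEN iffD1, rotated -1]) (auto simp: D)
    show "has_pd i (\<lambda>y. v y t) x" if "0 < t" for i x t using pd_has_derivative(1)[OF d1] that by simp
    show "continuous_on (UNIV \<times> {0<..}) (\<lambda>(x,t). pd i (\<lambda>y. v y t) x)" for i
    proof -
      have "continuous_on (UNIV \<times> {0<..}) (\<lambda>p. (case p of (x,t) \<Rightarrow> v1 x t) $ i)" by (intro continuous_intros pos[OF c(2)])
      then show ?thesis by (rule continuous_on_cong[THEN iffD1, rotated -1]) (auto simp: P1)
    qed
    show "has_pd j (pd i (\<lambda>y. v y t)) x" if "0 < t" for i j x t unfolding P1'[OF that] using pd_has_derivative(1)[OF d2i] that by simp
    show "continuous_on (UNIV \<times> {0<..}) (\<lambda>(x,t). pd j (pd i (\<lambda>y. v y t)) x)" for i j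
    proof -
      have "continuous_on (UNIV \<times> {0<..}) (\<lambda>p. (case p of (x,t) \<Rightarrow> v2 x t) $ i $ j)" by (intro continuous_intros pos[OF c(3)])
      then show ?thesis by (rule continuous_on_cong[THEN iffD1, rotated -1]) (auto simp: P2)
    qed
  qed
qed

theorem theorem2:
  fixes a :: "'n::finite \<Rightarrow> 'n \<Rightarrow> real^'n \<Rightarrow> real"
    and b :: "'n \<Rightarrow> real^'n \<Rightarrow> real"
    and f :: "real^'n \<Rightarrow> real \<Rightarrow> real"
    and \<alpha> :: real
    and W :: "real^'n \<Rightarrow> real"
  assumes alpha: "0 < \<alpha>" "\<alpha> < 1"
    and holder_a: "\<forall>i j. loc_holder \<alpha> (a i j)"
    and holder_b: "\<forall>i. loc_holder \<alpha> (b i)"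
    and elliptic: "\<forall>x \<nu>. \<nu> \<noteq> 0 \<longrightarrow> (\<Sum>i\<in>UNIV. \<Sum>j\<in>UNIV. a i j x * \<nu>$i * \<nu>$j) > 0"
    and lip_f: "loc_lip_f f"
    and F1: "\<exists>M. \<forall>u>0. \<forall>x. f x u \<le> M"
    and F2: "\<exists>(m::nat) \<epsilon>. \<epsilon> > 0 \<and>
              filterlim (\<lambda>u. Fsup f u / (u * (\<Prod>i=1..m. iterlog i u)^2 * iterlog (m+1) u powr (2+\<epsilon>)))
                        at_bot at_top"
    and F3: "\<forall>x. f x 0 = 0" "loc_lip_half (Fsup f)"
    and F4a: "\<forall>u\<ge>0. Gsup f u < \<infinity>"
             "loc_lip_half (\<lambda>u. real_of_ereal (Gsup f u))"
             "\<exists>U. (\<forall>u\<ge>U. Gsup f u < 0) \<and> (\<lambda>u. 1 / - real_of_ereal (Gsup f u)) integrable_on {U..}"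
    and uniq: "\<forall>u. cauchy_sol a b f (\<lambda>x. 0) u \<longrightarrow> (\<forall>x t. t \<ge> 0 \<longrightarrow> u x t = 0)"
    and W: "stat_sol a b f W"
  shows "(\<forall>x. W x \<le> Sup {u. u \<ge> 0 \<and> Gsup f u = 0})
         \<and> ((\<forall>u>0. Gsup f u < 0) \<longrightarrow> (\<forall>x. W x = 0))"
proof -
  define A where "A x = (\<chi> i j. (a i j x + a j i x) / 2)" for x
  define B where "B x = (\<chi> i. b i x)" for x
  define W1 where "W1 x = (\<chi> i. pd i W x)" for x
  define W2 where "W2 x = (\<chi> i j. pd j (pd i W) x)" for x
  have C2: "C2 W" and W0: "\<And>x. 0 \<le> W x" and LW: "\<And>x. Lop a b W x + f x (W x) = 0" using W unfolding stat_sol_def by auto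
  interpret stationary_problem \<alpha> A B f W W1 W2
  proof
    show "transpose (A x) = A x" for x by (simp add: A_def transpose_def vec_eq_iff)
    show "0 < v \<bullet> (A x *v v)" if "v \<noteq> 0" for v x
    proof -
      let ?q = "\<lambda>i j. a i j x * v $ i * v $ j"
      have "v \<bullet> (A x *v v) = (\<Sum>i\<in>UNIV. \<Sum>j\<in>UNIV. (?q i j + ?q j i) / 2)"
        unfolding inner_vec_def matrix_vector_mult_def by (simp add: A_def sum_distrib_left algebra_simps)
      also have "\<dots> = ((\<Sum>i\<in>UNIV. \<Sum>j\<in>UNIV. ?q i j) + (\<Sum>i\<in>UNIV. \<Sum>j\<in>UNIV. ?q j i)) / 2"
        by (simp add: sum.distrib flip: sum_divide_distrib)
      also have "(\<Sum>i\<in>UNIV. \<Sum>j\<in>UNIV. ?q j i) = (\<Sum>i\<in>UNIV. \<Sum>j\<in>UNIV. ?q i j)" by (rule sum.swap)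
      finally show ?thesis using elliptic that by simp
    qed
    show "\<exists>K. \<forall>x y. norm x \<le> \<rho> \<longrightarrow> norm y \<le> \<rho> \<longrightarrow> norm (A x - A y) \<le> K * dist x y powr \<alpha>" for \<rho>
    proof -
      have "\<forall>i j. \<exists>K. \<forall>x y. norm x \<le> \<rho> \<and> norm y \<le> \<rho> \<longrightarrow> \<bar>a i j x - a i j y\<bar> \<le> K * dist x y powr \<alpha>"
        using holder_a unfolding loc_holder_def by blast
      then obtain K where K: "\<And>i j x y. norm x \<le> \<rho> \<and> norm y \<le> \<rho> \<Longrightarrow> \<bar>a i j x - a i j y\<bar> \<le> K i j * dist x y powr \<alpha>" by metis
      define k where "k = Max (range (\<lambda>(i,j). K i j))"
      have k: "K i j \<le> k" for i j unfolding k_def by (rule Max_ge) auto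
      have "norm (A x - A y) \<le> real CARD('n) * real CARD('n) * (k * dist x y powr \<alpha>)" if "norm x \<le> \<rho>" "norm y \<le> \<rho>" for x y
      proof (rule matrix_norm_le)
        fix i j
        have "\<bar>a i j x - a i j y\<bar> \<le> k * dist x y powr \<alpha>" for i j
          using K[of x y i j] that mult_right_mono[OF k[of i j], of "dist x y powr \<alpha>"] by simp
        from this[of i j] this[of j i] show "\<bar>(A x - A y) $ i $ j\<bar> \<le> k * dist x y powr \<alpha>" by (simp add: A_def abs_le_iff field_simps)
      qed
      then show ?thesis by (intro exI[of _ "real CARD('n) * real CARD('n) * k"]) (simp add: mult.assoc)
    qed
    show "\<exists>K. \<forall>x y. norm x \<le> \<rho> \<longrightarrow> norm y \<le> \<rho> \<longrightarrow> norm (B x - B y) \<le> K * dist x y powr \<alpha>" for \<rho>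
    proof -
      have "\<forall>i. \<exists>K. \<forall>x y. norm x \<le> \<rho> \<and> norm y \<le> \<rho> \<longrightarrow> \<bar>b i x - b i y\<bar> \<le> K * dist x y powr \<alpha>"
        using holder_b unfolding loc_holder_def by blast
      then obtain K where K: "\<And>i x y. norm x \<le> \<rho> \<and> norm y \<le> \<rho> \<Longrightarrow> \<bar>b i x - b i y\<bar> \<le> K i * dist x y powr \<alpha>" by metis
      define k where "k = Max (range K)"
      have k: "K i \<le> k" for i unfolding k_def by (rule Max_ge) auto
      have "norm (B x - B y) \<le> real CARD('n) * (k * dist x y powr \<alpha>)" if "norm x \<le> \<rho>" "norm y \<le> \<rho>" for x y
      proof (rule vector_norm_le)
        show "\<bar>(B x - B y) $ i\<bar> \<le> k * dist x y powr \<alpha>" for i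
          using K[of x y i] that mult_right_mono[OF k[of i], of "dist x y powr \<alpha>"] by (simp add: B_def)
      qed
      then show ?thesis by (intro exI[of _ "real CARD('n) * k"]) (simp add: mult.assoc)
    qed
    show "(W has_derivative (\<lambda>h. W1 x \<bullet> h)) (at x)" "(W1 has_derivative (\<lambda>h. W2 x *v h)) (at x)" for x
      using C2_derivatives(1,2)[OF C2, of x] unfolding W1_def[abs_def] W2_def by auto
    show "A x \<bullet> W2 x + B x \<bullet> W1 x + f x (W x) = 0" for x
    proof -
      have "Lop a b W x = A x \<bullet> W2 x + B x \<bullet> W1 x" unfolding A_def B_def
        by (rule Lop_eq_inner) (use C2_derivatives(3)[OF C2] in \<open>auto simp: W1_def W2_def\<close>)
      then show ?thesis using LW[of x] by simp
    qed
  qed (use alpha lip_f F3(1) W0 in auto)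
  define G where "G u = real_of_ereal (Gsup f u)" for u
  have Gge: "ereal (f x v - f x (v - u)) \<le> Gsup f u" if "u \<le> v" for u v x
    unfolding Gsup_def by (intro SUP_upper2[of x] SUP_upper2[of v]) (use that in auto)
  \<comment> \<open>The value minus infinity is excluded because each real difference quotient-free
    increment of f, for instance at v = u and x = 0, is a lower bound.\<close>
  have GG: "Gsup f u = ereal (G u)" if "0 \<le> u" for u
    using F4a(1) that Gge[of u u 0] unfolding G_def by (cases "Gsup f u") auto
  have fG: "f x v - f x (v - u) \<le> G u" if "0 \<le> u" "u \<le> v" for x u v
    using Gge[OF that(2), of x] unfolding GG[OF that(1)] by simp
  have G0: "Gsup f 0 = 0" by (simp add: Gsup_def)
  obtain U where U: "\<And>u. U \<le> u \<Longrightarrow> Gsup f u < 0" and int: "(\<lambda>u. 1 / - G u) integrable_on {U..}" using F4a(3) unfolding G_def by blast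
  have U0: "0 < U" using U[of 0] G0 by (cases "0 < U") auto
  have Gc: "continuous_on {0..} G"
    unfolding continuous_on_eq_continuous_within
  proof
    fix t :: real assume t: "t \<in> {0..}"
    obtain K where K: "\<And>u v. 0 \<le> u \<Longrightarrow> u \<le> t + 1 \<Longrightarrow> 0 \<le> v \<Longrightarrow> v \<le> t + 1 \<Longrightarrow> \<bar>G u - G v\<bar> \<le> K * \<bar>u - v\<bar>"
      using F4a(2) unfolding loc_lip_half_def G_def by blast
    have "continuous_on {0..t+1} G"
    proof (rule lipschitz_on_continuous_on[where L = "max 0 K"], rule lipschitz_onI)
      fix u v assume "u \<in> {0..t+1}" "v \<in> {0..t+1}"
      then have "\<bar>G u - G v\<bar> \<le> K * \<bar>u - v\<bar>" using K by auto
      also have "\<dots> \<le> max 0 K * \<bar>u - v\<bar>" by (intro mult_right_mono) auto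
      finally show "dist (G u) (G v) \<le> max 0 K * dist u v" by (simp add: dist_real_def)
    qed simp
    then have "continuous (at t within {0..t+1}) G" using t unfolding continuous_on_eq_continuous_within by simp
    moreover have "at t within {0..t+1} = at t within {0..}"
      by (rule at_within_nhd[where S = "{..<t+1}"]) auto
    ultimately show "continuous (at t within {0..}) G" by simp
  qed
  define c\<^sub>0 where "c\<^sub>0 = Sup {u. u \<ge> 0 \<and> Gsup f u = 0}"
  \<comment> \<open>Roots lie below \<open>U\<close>. The set is nonempty since 0 is always a root,
    which also makes its supremum nonnegative.\<close>
  have bdd: "bdd_above {u. u \<ge> 0 \<and> Gsup f u = 0}"
  proof (rule bdd_aboveI)
    show "u \<le> U" if "u \<in> {u. u \<ge> 0 \<and> Gsup f u = 0}" for u using U[of u] that by (cases "U \<le> u") auto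
  qed
  have c0: "u \<le> c\<^sub>0" if "0 \<le> u" "G u = 0" for u
    unfolding c\<^sub>0_def by (rule cSup_upper[OF _ bdd]) (use that GG[OF that(1)] in simp)
  have c00: "0 \<le> c\<^sub>0" by (rule c0) (simp_all add: G_def G0)
  \<comment> \<open>G is continuous and negative far out; a nonnegative value beyond the largest
    root would produce another root by the intermediate value theorem.\<close>
  have neg: "G u < 0" if u: "c\<^sub>0 < u" for u
  proof (rule ccontr)
    assume nn: "\<not> G u < 0"
    obtain m where m: "u \<le> m" "U \<le> m" using linear by blast
    have "G m < 0" using U[OF m(2)] GG[of m] U0 m by simp
    moreover have "continuous_on {u..m} G" by (rule continuous_on_subset[OF Gc]) (use u c00 in auto)
    ultimately obtain z where "u \<le> z" "G z = 0" using IVT2'[of G m 0 u] nn m by auto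
    then show False using c0[of z] u c00 by simp
  qed
  have le: "W x \<le> c" if c: "c\<^sub>0 < c" for c x
  proof -
    \<comment> \<open>Strictly between the largest root and \<open>c\<close>: on [c', infinity) the
      function G is negative, and the barrier can descend below c while remaining above c'.\<close>
    define c' where "c' = (c\<^sub>0 + c) / 2"
    have c': "c' < c" "c\<^sub>0 < c'" using c by (auto simp: c'_def field_simps)
    have "W x \<le> c"
    proof (rule descending_barrier[OF c'(1), of G U])
      show "continuous_on {c'..} G" by (rule continuous_on_subset[OF Gc]) (use c' c00 in auto)
      show "G s < 0" if "c' \<le> s" for s using neg that c' by simp
      show "G s < 0" if "U \<le> s" for s using U[OF that] GG[of s] U0 that by simp
      show "(\<lambda>s. 1 / - G s) integrable_on {U..}" by (rule int)
      fix \<tau> assume \<tau>: "0 \<le> \<tau>" and bar: "\<And>M0. \<exists>M\<ge>M0. \<exists>\<phi>. \<phi> 0 = M \<and> \<phi> \<tau> \<le> c \<and>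
        (\<forall>t\<in>{0..\<tau>}. (\<phi> has_real_derivative G (\<phi> t)) (at t within {0..\<tau>}) \<and> c' < \<phi> t)"
      have "\<exists>M\<ge>M0. (\<forall>x. f x M \<le> 0) \<and> (\<exists>\<phi> \<phi>'. \<phi> 0 = M \<and> \<phi> \<tau> \<le> c \<and>
        (\<forall>t\<in>{0..\<tau>}. 0 \<le> \<phi> t \<and> (\<phi> has_real_derivative \<phi>' t) (at t within {0..\<tau>}) \<and>
          (\<forall>x v. \<phi> t \<le> v \<longrightarrow> f x v - f x (v - \<phi> t) \<le> \<phi>' t)))" for M0
      proof -
        obtain M \<phi> where M: "max c' M0 \<le> M" and \<phi>: "\<phi> 0 = M" "\<phi> \<tau> \<le> c"
          "\<forall>t\<in>{0..\<tau>}. (\<phi> has_real_derivative G (\<phi> t)) (at t within {0..\<tau>}) \<and> c' < \<phi> t" using bar[of "max c' M0"] by blast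
        \<comment> \<open>The defining inequality of G with v = u = M, together with f(x,0) =
          0.\<close>
        have "f x M \<le> 0" for x using fG[of M M x] neg[of M] M c' c00 F3(1) by simp
        moreover have "0 \<le> \<phi> t" if "t \<in> {0..\<tau>}" for t using \<phi>(3) that c' c00 by fastforce
        ultimately show ?thesis using M \<phi> fG by (intro exI[of _ M] conjI exI[of _ \<phi>] exI[of _ "\<lambda>t. G (\<phi> t)"]) auto
      qed
      from limit_solution[OF \<tau> this] obtain v v1 v2 vt where
        R: "\<And>z T. 0 \<le> T \<Longrightarrow> \<exists>K. reg \<alpha> (ball z (1/8)) T K v v1 v2 vt" and
        E: "\<And>x t. 0 \<le> t \<Longrightarrow> 0 \<le> v x t \<and> vt x t = A x \<bullet> v2 x t + B x \<bullet> v1 x t + f x (v x t)" and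
        Wv: "\<And>x. W x - c \<le> v x \<tau>" by blast
      note lr = locally_regular[OF R alpha(1)]
      have "cauchy_sol a b f (\<lambda>x. 0) v"
        unfolding cauchy_sol_def
      proof (intro conjI allI impI)
        fix x and t :: real assume t: "0 < t"
        have "Lop a b (\<lambda>y. v y t) x = A x \<bullet> v2 x t + B x \<bullet> v1 x t" unfolding A_def B_def
        proof (rule Lop_eq_inner)
          show sym: "v2 x t $ i $ j = v2 x t $ j $ i" for i j by (rule lr(3)) (use t in auto)
          show "pd i (pd j (\<lambda>y. v y t)) x = v2 x t $ i $ j" for i j unfolding sym[of i j] by (rule lr(6)[OF _ t])
          show "pd i (\<lambda>y. v y t) x = v1 x t $ i" for i by (rule lr(5)[OF _ t])
        qed
        then show "deriv (v x) t = Lop a b (\<lambda>y. v y t) x + f x (v x t)" using lr(4)[OF _ t] E[of t x] t by simp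
      qed (use lr(1,2) E in auto)
      \<comment> \<open>The assumed uniqueness for zero initial values is applied at the single time
        \<tau>, at which W - c <= v.\<close>
      then have "v x \<tau> = 0" using uniq \<tau> by blast
      then show "W x \<le> c" using Wv[of x] by simp
    qed
    then show ?thesis .
  qed
  \<comment> \<open>The bound holds for every c above the largest root, hence for the root
    itself.\<close>
  have "W x \<le> c\<^sub>0" for x by (rule dense_ge) (rule le)
  moreover have "W x = 0" if "\<forall>u>0. Gsup f u < 0" for x
  proof -
    have "u \<ge> 0 \<and> Gsup f u = 0 \<longleftrightarrow> u = 0" for u using that[rule_format, of u] G0 by (cases "0 < u") auto
    then have "c\<^sub>0 = 0" by (simp add: c\<^sub>0_def)
    then show ?thesis using \<open>\<And>x. W x \<le> c\<^sub>0\<close>[of x] W0[of x] by simp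
  qed
  ultimately show ?thesis unfolding c\<^sub>0_def by blast
qed

end
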